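(* Let $\mathcal{C}$ be a triangulated category and let $\mathcal{P}=((\mathcal{S},\mathcal{T}),(\mathcal{U},\mathcal{V}))$ be a concentric twin cotorsion pair on $\mathcal{C}$. Put $\mathcal{Z}=\mathcal{T}\cap\mathcal{U}$ and $\mathcal{I}=\mathcal{S}\cap\mathcal{T}=\mathcal{U}\cap\mathcal{V}$. Then the ideal quotient $\mathcal{Z}/\mathcal{I}$, equipped with the functor $\Sigma$ and the class of distinguished right triangles, and with the functor $\Omega$ and the class of distinguished left triangles, is a pretriangulated category.
   Context: $\mathcal{C}$ is a triangulated category with shift $[1]$; $\mathrm{Ext}^1(X,Y)=\mathcal{C}(X,Y[1])$. For full subcategories $\mathcal{X},\mathcal{Y}\subseteq\mathcal{C}$, $\mathcal{X}\ast\mathcal{Y}$ is the full subcategory of objects $C$ admitting a distinguished triangle $X\to C\to Y\to X[1]$ with $X\in\mathcal{X},Y\in\mathcal{Y}$. A cotorsion pair on $\mathcal{C}$ is a pair $(\mathcal{U},\mathcal{V})$ of full additive subcategories closed under isomorphisms and direct summands with $\mathcal{C}=\mathcal{U}\ast\mathcal{V}[1]$ and $\mathrm{Ext}^1(\mathcal{U},\mathcal{V})=0$. A twin cotorsion pair (TCP) is a pair $((\mathcal{S},\mathcal{T}),(\mathcal{U},\mathcal{V}))$ of cotorsion pairs with $\mathrm{Ext}^1(\mathcal{S},\mathcal{V})=0$ (equivalently $\mathcal{S}\subseteq\mathcal{U}$, equivalently $\mathcal{V}\subseteq\mathcal{T}$). It is concentric if $\mathcal{S}\cap\mathcal{T}=\mathcal{U}\cap\mathcal{V}$;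 this subcategory is denoted $\mathcal{I}$, and $\mathcal{Z}=\mathcal{T}\cap\mathcal{U}$. For $\mathcal{I}\subseteq\mathcal{X}\subseteq\mathcal{C}$, $\mathcal{X}/\mathcal{I}$ is the ideal quotient (same objects; morphisms modulo those factoring through an object of $\mathcal{I}$); $\underline{f}$ is the class of $f$. Adjoints. The inclusion $\mathcal{Z}/\mathcal{I}\hookrightarrow\mathcal{U}/\mathcal{I}$ has a left adjoint $\sigma$ with unit $\eta$: for $U\in\mathcal{U}$, a triangle $S[-1]\to U\overset{z}{\to}Z\to S$ with $S\in\mathcal{S}$, $Z\in\mathcal{T}$ (then $Z\in\mathcal{Z}$) gives $\sigma(U)=Z$, $\eta_U=\underline{z}$. Dually $\mathcal{Z}/\mathcal{I}\hookrightarrow\mathcal{T}/\mathcal{I}$ has a right adjoint $\omega$ with counit $\varepsilon$: for $T\in\mathcal{T}$, a triangle $V\to Z\overset{z}{\to}T\to V[1]$ with $V\in\mathcal{V}$, $Z\in\mathcal{U}$ (then $Z\in\mathcal{Z}$) gives $\omega(T)=Z$, $\varepsilon_T=\underline{z}$. Shifts. For $Z\in\mathcal{Z}$ choose a triangle $Z\to I\to U\to Z[1]$ with $I\in\mathcal{I}$, $U\in\mathcal{U}$, and put $Z\langle1\rangle=U$; a morphism $\underline{z}$ in $\mathcal{Z}/\mathcal{I}$ is sent to $\underline{z}\langle 1\rangle=\underline{u}$, where $(z,i,u)$ is a morphism between the chosen triangles. This defines a functor $\langle1\rangle\colon\mathcal{Z}/\mathcal{I}\to\mathcal{U}/\mathcal{I}$,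 unique up to natural isomorphism. Dually, triangles $T\to I\to Z\to T[1]$ with $T\in\mathcal{T}$, $I\in\mathcal{I}$ define $\langle-1\rangle\colon\mathcal{Z}/\mathcal{I}\to\mathcal{T}/\mathcal{I}$, $Z\langle-1\rangle=T$. Put $\Sigma=\sigma\circ\langle1\rangle$ and $\Omega=\omega\circ\langle-1\rangle$, endofunctors of $\mathcal{Z}/\mathcal{I}$. There is an adjunction $\Sigma\dashv\Omega$, obtained by composing the adjunctions for $\sigma,\omega$ with the natural bijection $(\mathcal{U}/\mathcal{I})(Z\langle1\rangle,Z')\cong(\mathcal{T}/\mathcal{I})(Z,Z'\langle-1\rangle)$ given by $\underline{u}\leftrightarrow\underline{t}$ for morphisms of triangles $(t,i,u)$ from $Z\to I\to Z\langle1\rangle\to Z[1]$ to $Z'\langle-1\rangle\to I'\to Z'\to Z'\langle-1\rangle[1]$. Distinguished right triangles. Let $X\overset{f}{\to}Y\overset{a}{\to}U\overset{b}{\to}X[1]$ be a distinguished triangle in $\mathcal{C}$ with $X,Y\in\mathcal{Z}$, $U\in\mathcal{U}$ (a $\mathcal{U}$-conic triangle). Take a triangle $X\overset{\iota_X}{\to}I_X\overset{\wp_X}{\to}U_X\overset{\gamma_X}{\to}X[1]$ with $I_X\in\mathcal{I}$, $U_X\in\mathcal{U}$ (so $\Sigma X=\sigma(U_X)$) and a morphism of triangles $(\mathrm{id}_X,y,c)$ from the former to the latter. The associated standard right triangle is $X\overset{\underline{f}}{\to}Y\overset{\eta_U\circ\underline{a}}{\to}\sigma(U)\overset{\sigma(\underline{c})}{\to}\Sigma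 X$. A distinguished right triangle is a right triangle in $\mathcal{Z}/\mathcal{I}$ isomorphic to a standard one. Distinguished left triangles. Let $P[-1]\overset{k}{\to}T\overset{\ell}{\to}Z\overset{m}{\to}P$ be a distinguished triangle in $\mathcal{C}$ with $T\in\mathcal{T}$, $Z,P\in\mathcal{Z}$. Take a triangle $T_P\overset{\iota'_P}{\to}I'_P\overset{\wp'_P}{\to}P\overset{\gamma'_P}{\to}T_P[1]$ with $T_P\in\mathcal{T}$, $I'_P\in\mathcal{I}$ (so $\Omega P=\omega(T_P)$) and a morphism of triangles $(n,i,\mathrm{id}_P)$ from it to $T\overset{\ell}{\to}Z\overset{m}{\to}P\overset{-k[1]}{\to}T[1]$. The associated standard left triangle is $\Omega P\overset{\omega(\underline{n})}{\to}\omega(T)\overset{\underline{\ell}\circ\varepsilon_T}{\to}Z\overset{\underline{m}}{\to}P$. A distinguished left triangle is a left triangle isomorphic to a standard one. A right triangulated category is an additive category with an additive endofunctor $\Sigma$ and a class of right triangles $A\to B\to C\to\Sigma A$ satisfying all axioms of a triangulated category (closure under isomorphism, $A\overset{\mathrm{id}}{\to}A\to0\to\Sigma A$, completion of every morphism, rotation $A\overset{f}{\to}B\overset{g}{\to}C\overset{h}{\to}\Sigma A\ \Rightarrow\ B\overset{g}{\to}C\overset{h}{\to}\Sigma A\overset{-\Sigma f}{\to}\Sigma B$, completion of morphisms of triangles, octahedral axiom), except that $\Sigma$ need not be an equivalence (and rotation is only required in this direction). Left triangulated categories (with $\Omega$ and left triangles $\Omega C\to A\to B\to C$) are defined dually.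 A pretriangulated category (Beligiannis–Reiten) is an additive category with an adjoint pair $\Sigma\dashv\Omega$ of endofunctors, a right triangulation with respect to $\Sigma$ and a left triangulation with respect to $\Omega$, such that for every distinguished right triangle $A\overset{f}{\to}B\overset{g}{\to}C\overset{h}{\to}\Sigma A$ and distinguished left triangle $\Omega C'\overset{f'}{\to}A'\overset{g'}{\to}B'\overset{h'}{\to}C'$: (1) if $\alpha\colon A\to\Omega C'$, $\beta\colon B\to A'$ satisfy $\beta f=f'\alpha$, there is $\gamma\colon C\to B'$ with $\gamma g=g'\beta$ and $h'\gamma=\hat\alpha h$, where $\hat\alpha\colon\Sigma A\to C'$ is adjoint to $\alpha$; (2) if $\gamma\colon C\to B'$, $\delta\colon\Sigma A\to C'$ satisfy $h'\gamma=\delta h$, there is $\beta\colon B\to A'$ with $\beta f=f'\check\delta$ and $g'\beta=\gamma g$, where $\check\delta\colon A\to\Omega C'$ is adjoint to $\delta$.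
   Formalization: The adjunction Σ ⊣ Ω used is the negative of the one described in the setting (u corresponds to −t instead of t); with the sign −k[1] in the standard left triangles, conditions (1), (2) fail for u ↔ t, e.g. in D^b(ℤ) with S = V = 0. *)

theory Defs
  imports "HOL-Algebra.Group"
begin

section \<open>Categories\<close>

text \<open>Composition and addition are not indexed by objects; this is why the hom-sets of a category
  are required to be pairwise disjoint below.\<close>

record ('o, 'm) precategory =
  Ob :: "'o set"
  Hom :: "'o \<Rightarrow> 'o \<Rightarrow> 'm set"
  Id :: "'o \<Rightarrow> 'm"
  Comp :: "'m \<Rightarrow> 'm \<Rightarrow> 'm"  (infixr "\<cdot>\<index>" 75)
  Add :: "'m \<Rightarrow> 'm \<Rightarrow> 'm"  (infixl "\<boxplus>\<index>" 65)
  Zero :: "'o \<Rightarrow> 'o \<Rightarrow> 'm"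

locale category =
  fixes C :: "('o, 'm, 'z) precategory_scheme" (structure)
  assumes hom_disjoint:
      "\<lbrakk>A \<in> Ob C; B \<in> Ob C; A' \<in> Ob C; B' \<in> Ob C; f \<in> Hom C A B; f \<in> Hom C A' B'\<rbrakk>
        \<Longrightarrow> A = A' \<and> B = B'"
    and id_in_hom: "A \<in> Ob C \<Longrightarrow> Id C A \<in> Hom C A A"
    and comp_in_hom:
      "\<lbrakk>A \<in> Ob C; B \<in> Ob C; D \<in> Ob C; f \<in> Hom C A B; g \<in> Hom C B D\<rbrakk> \<Longrightarrow> g \<cdot> f \<in> Hom C A D"
    and comp_id_right: "\<lbrakk>A \<in> Ob C; B \<in> Ob C; f \<in> Hom C A B\<rbrakk> \<Longrightarrow> f \<cdot> Id C A = f"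
    and comp_id_left: "\<lbrakk>A \<in> Ob C; B \<in> Ob C; f \<in> Hom C A B\<rbrakk> \<Longrightarrow> Id C B \<cdot> f = f"
    and comp_assoc:
      "\<lbrakk>A \<in> Ob C; B \<in> Ob C; D \<in> Ob C; E \<in> Ob C; f \<in> Hom C A B; g \<in> Hom C B D; h \<in> Hom C D E\<rbrakk>
        \<Longrightarrow> (h \<cdot> g) \<cdot> f = h \<cdot> (g \<cdot> f)"

definition hom_group :: "('o, 'm, 'z) precategory_scheme \<Rightarrow> 'o \<Rightarrow> 'o \<Rightarrow> 'm monoid" where
  "hom_group C A B = \<lparr>carrier = Hom C A B, monoid.mult = Add C, one = Zero C A B\<rparr>"

definition neg :: "('o, 'm, 'z) precategory_scheme \<Rightarrow> 'o \<Rightarrow> 'o \<Rightarrow> 'm \<Rightarrow> 'm" where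
  "neg C A B f = inv\<^bsub>hom_group C A B\<^esub> f"

locale preadditive_category = category +
  assumes hom_comm_group: "\<lbrakk>A \<in> Ob C; B \<in> Ob C\<rbrakk> \<Longrightarrow> comm_group (hom_group C A B)"
    and comp_add_left:
      "\<lbrakk>A \<in> Ob C; B \<in> Ob C; D \<in> Ob C; f \<in> Hom C A B; g \<in> Hom C B D; g' \<in> Hom C B D\<rbrakk>
        \<Longrightarrow> (g \<boxplus> g') \<cdot> f = (g \<cdot> f) \<boxplus> (g' \<cdot> f)"
    and comp_add_right:
      "\<lbrakk>A \<in> Ob C; B \<in> Ob C; D \<in> Ob C; f \<in> Hom C A B; f' \<in> Hom C A B; g \<in> Hom C B D\<rbrakk>
        \<Longrightarrow> g \<cdot> (f \<boxplus> f') = (g \<cdot> f) \<boxplus> (g \<cdot> f')"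

definition zero_object :: "('o, 'm, 'z) precategory_scheme \<Rightarrow> 'o \<Rightarrow> bool" where
  "zero_object C N \<longleftrightarrow> N \<in> Ob C \<and>
     (\<forall>X\<in>Ob C. Hom C N X = {Zero C N X} \<and> Hom C X N = {Zero C X N})"

definition biproduct :: "('o, 'm, 'z) precategory_scheme \<Rightarrow> 'o \<Rightarrow> 'o \<Rightarrow> 'o \<Rightarrow> bool" where
  "biproduct C A B P \<longleftrightarrow> A \<in> Ob C \<and> B \<in> Ob C \<and> P \<in> Ob C \<and>
     (\<exists>i1\<in>Hom C A P. \<exists>i2\<in>Hom C B P. \<exists>p1\<in>Hom C P A. \<exists>p2\<in>Hom C P B.
        p1 \<cdot>\<^bsub>C\<^esub> i1 = Id C A \<and> p2 \<cdot>\<^bsub>C\<^esub> i2 = Id C B \<and>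
        p1 \<cdot>\<^bsub>C\<^esub> i2 = Zero C B A \<and> p2 \<cdot>\<^bsub>C\<^esub> i1 = Zero C A B \<and>
        (i1 \<cdot>\<^bsub>C\<^esub> p1) \<boxplus>\<^bsub>C\<^esub> (i2 \<cdot>\<^bsub>C\<^esub> p2) = Id C P)"

locale additive_category = preadditive_category +
  assumes ex_zero_object: "\<exists>N. zero_object C N"
    and ex_biproduct: "\<lbrakk>A \<in> Ob C; B \<in> Ob C\<rbrakk> \<Longrightarrow> \<exists>P. biproduct C A B P"

definition iso_in :: "('o, 'm, 'z) precategory_scheme \<Rightarrow> 'o \<Rightarrow> 'o \<Rightarrow> 'm \<Rightarrow> bool" where
  "iso_in C A B f \<longleftrightarrow> A \<in> Ob C \<and> B \<in> Ob C \<and> f \<in> Hom C A B \<and>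
     (\<exists>g\<in>Hom C B A. g \<cdot>\<^bsub>C\<^esub> f = Id C A \<and> f \<cdot>\<^bsub>C\<^esub> g = Id C B)"

definition op_cat :: "('o, 'm, 'z) precategory_scheme \<Rightarrow> ('o, 'm) precategory" where
  "op_cat C = \<lparr>Ob = Ob C, Hom = (\<lambda>A B. Hom C B A), Id = Id C,
     Comp = (\<lambda>g f. f \<cdot>\<^bsub>C\<^esub> g), Add = Add C, Zero = (\<lambda>A B. Zero C B A)\<rparr>"

record ('o, 'm, 'p, 'n) functor_data =
  on_ob :: "'o \<Rightarrow> 'p"
  on_hom :: "'m \<Rightarrow> 'n"

definition functor_comp ::
  "('p, 'n, 'q, 'k) functor_data \<Rightarrow> ('o, 'm, 'p, 'n) functor_data \<Rightarrow> ('o, 'm, 'q, 'k) functor_data"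
  where
  "functor_comp G F = \<lparr>on_ob = on_ob G \<circ> on_ob F, on_hom = on_hom G \<circ> on_hom F\<rparr>"

definition additive_functor ::
  "('o, 'm, 'z) precategory_scheme \<Rightarrow> ('p, 'n, 'y) precategory_scheme \<Rightarrow>
    ('o, 'm, 'p, 'n) functor_data \<Rightarrow> bool" where
  "additive_functor C D F \<longleftrightarrow>
     (\<forall>A\<in>Ob C. on_ob F A \<in> Ob D \<and> on_hom F (Id C A) = Id D (on_ob F A)) \<and>
     (\<forall>A\<in>Ob C. \<forall>B\<in>Ob C. \<forall>f\<in>Hom C A B. on_hom F f \<in> Hom D (on_ob F A) (on_ob F B)) \<and>
     (\<forall>A\<in>Ob C. \<forall>B\<in>Ob C. \<forall>f\<in>Hom C A B. \<forall>f'\<in>Hom C A B.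
        on_hom F (f \<boxplus>\<^bsub>C\<^esub> f') = on_hom F f \<boxplus>\<^bsub>D\<^esub> on_hom F f') \<and>
     (\<forall>A\<in>Ob C. \<forall>B\<in>Ob C. \<forall>E\<in>Ob C. \<forall>f\<in>Hom C A B. \<forall>g\<in>Hom C B E.
        on_hom F (g \<cdot>\<^bsub>C\<^esub> f) = on_hom F g \<cdot>\<^bsub>D\<^esub> on_hom F f)"

definition autoequivalence ::
  "('o, 'm, 'z) precategory_scheme \<Rightarrow> ('o, 'm, 'o, 'm) functor_data \<Rightarrow> bool" where
  "autoequivalence C F \<longleftrightarrow> additive_functor C C F \<and>
     (\<forall>A\<in>Ob C. \<forall>B\<in>Ob C. bij_betw (on_hom F) (Hom C A B) (Hom C (on_ob F A) (on_ob F B))) \<and>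
     (\<forall>B\<in>Ob C. \<exists>A\<in>Ob C. \<exists>f. iso_in C (on_ob F A) B f)"

definition adjunction ::
  "('o, 'm, 'z) precategory_scheme \<Rightarrow> ('o, 'm, 'o, 'm) functor_data \<Rightarrow>
    ('o, 'm, 'o, 'm) functor_data \<Rightarrow> ('o \<Rightarrow> 'o \<Rightarrow> 'm \<Rightarrow> 'm) \<Rightarrow> bool" where
  "adjunction D Sg Om \<phi> \<longleftrightarrow>
     (\<forall>A\<in>Ob D. \<forall>B\<in>Ob D. bij_betw (\<phi> A B) (Hom D (on_ob Sg A) B) (Hom D A (on_ob Om B))) \<and>
     (\<forall>A\<in>Ob D. \<forall>B\<in>Ob D. \<forall>A'\<in>Ob D. \<forall>B'\<in>Ob D.
        \<forall>x\<in>Hom D (on_ob Sg A) B. \<forall>f\<in>Hom D A' A. \<forall>k\<in>Hom D B B'.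
          \<phi> A' B' (k \<cdot>\<^bsub>D\<^esub> x \<cdot>\<^bsub>D\<^esub> on_hom Sg f) = on_hom Om k \<cdot>\<^bsub>D\<^esub> \<phi> A B x \<cdot>\<^bsub>D\<^esub> f)"

section \<open>Triangles; right, left and two-sided triangulations\<close>

text \<open>As a right triangle, \<open>(A, B, X, f, g, h)\<close> stands for
  \<open>A \<rightarrow>f B \<rightarrow>g X \<rightarrow>h \<Sigma>A\<close>; as a left triangle it stands for
  \<open>\<Omega>X \<rightarrow>f A \<rightarrow>g B \<rightarrow>h X\<close>.\<close>

type_synonym ('o, 'm) tri = "'o \<times> 'o \<times> 'o \<times> 'm \<times> 'm \<times> 'm"

definition right_triangle ::
  "('o, 'm, 'z) precategory_scheme \<Rightarrow> ('o, 'm, 'o, 'm) functor_data \<Rightarrow> ('o, 'm) tri \<Rightarrow> bool" where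
  "right_triangle C Sg t = (case t of (A, B, X, f, g, h) \<Rightarrow>
     A \<in> Ob C \<and> B \<in> Ob C \<and> X \<in> Ob C \<and>
     f \<in> Hom C A B \<and> g \<in> Hom C B X \<and> h \<in> Hom C X (on_ob Sg A))"

definition tri_mor ::
  "('o, 'm, 'z) precategory_scheme \<Rightarrow> ('o, 'm, 'o, 'm) functor_data \<Rightarrow>
    ('o, 'm) tri \<Rightarrow> ('o, 'm) tri \<Rightarrow> 'm \<Rightarrow> 'm \<Rightarrow> 'm \<Rightarrow> bool" where
  "tri_mor C Sg t t' a b c = (case (t, t') of ((A, B, X, f, g, h), (A', B', X', f', g', h')) \<Rightarrow>
     a \<in> Hom C A A' \<and> b \<in> Hom C B B' \<and> c \<in> Hom C X X' \<and>
     b \<cdot>\<^bsub>C\<^esub> f = f' \<cdot>\<^bsub>C\<^esub> a \<and> c \<cdot>\<^bsub>C\<^esub> g = g' \<cdot>\<^bsub>C\<^esub> b \<and> on_hom Sg a \<cdot>\<^bsub>C\<^esub> h = h' \<cdot>\<^bsub>C\<^esub> c)"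

definition tri_iso ::
  "('o, 'm, 'z) precategory_scheme \<Rightarrow> ('o, 'm, 'o, 'm) functor_data \<Rightarrow>
    ('o, 'm) tri \<Rightarrow> ('o, 'm) tri \<Rightarrow> bool" where
  "tri_iso C Sg t t' = (case (t, t') of ((A, B, X, f, g, h), (A', B', X', f', g', h')) \<Rightarrow>
     \<exists>a b c. tri_mor C Sg t t' a b c \<and> iso_in C A A' a \<and> iso_in C B B' b \<and> iso_in C X X' c)"

locale right_triangulated_category = additive_category C
  for C :: "('o, 'm, 'z) precategory_scheme" (structure) +
  fixes Sg :: "('o, 'm, 'o, 'm) functor_data"
    and R :: "('o, 'm) tri set"
  assumes suspension_additive: "additive_functor C C Sg"
    and dist_wf: "t \<in> R \<Longrightarrow> right_triangle C Sg t"
    and dist_iso: "\<lbrakk>t \<in> R; right_triangle C Sg t'; tri_iso C Sg t t'\<rbrakk> \<Longrightarrow> t' \<in> R"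
    and dist_id: "\<lbrakk>A \<in> Ob C; zero_object C N\<rbrakk>
        \<Longrightarrow> (A, A, N, Id C A, Zero C A N, Zero C N (on_ob Sg A)) \<in> R"
    and dist_complete: "\<lbrakk>A \<in> Ob C; B \<in> Ob C; f \<in> Hom C A B\<rbrakk> \<Longrightarrow> \<exists>X g h. (A, B, X, f, g, h) \<in> R"
    and dist_rotate: "(A, B, X, f, g, h) \<in> R
        \<Longrightarrow> (B, X, on_ob Sg A, g, h, neg C (on_ob Sg A) (on_ob Sg B) (on_hom Sg f)) \<in> R"
    and dist_mor: "\<lbrakk>(A, B, X, f, g, h) \<in> R; (A', B', X', f', g', h') \<in> R;
          a \<in> Hom C A A'; b \<in> Hom C B B'; b \<cdot> f = f' \<cdot> a\<rbrakk>
        \<Longrightarrow> \<exists>c. tri_mor C Sg (A, B, X, f, g, h) (A', B', X', f', g', h') a b c"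
    and dist_octahedral: "\<lbrakk>(X, Y, E, f, a, b) \<in> R; (Y, W, G, g, c, d) \<in> R; (X, W, F, g \<cdot> f, e, h) \<in> R\<rbrakk>
        \<Longrightarrow> \<exists>p q. (E, F, G, p, q, on_hom Sg a \<cdot> d) \<in> R \<and>
              tri_mor C Sg (X, Y, E, f, a, b) (X, W, F, g \<cdot> f, e, h) (Id C X) g p \<and>
              tri_mor C Sg (X, W, F, g \<cdot> f, e, h) (Y, W, G, g, c, d) f (Id C W) q"

text \<open>The left triangle \<open>\<Omega>X \<rightarrow> A \<rightarrow> B \<rightarrow> X\<close> is the right triangle \<open>X \<rightarrow> B \<rightarrow> A \<rightarrow> \<Omega>X\<close> of the opposite
  category.\<close>

definition op_tri :: "('o, 'm) tri \<Rightarrow> ('o, 'm) tri" where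
  "op_tri t = (case t of (A, B, X, f, g, h) \<Rightarrow> (X, B, A, h, g, f))"

definition left_triangle ::
  "('o, 'm, 'z) precategory_scheme \<Rightarrow> ('o, 'm, 'o, 'm) functor_data \<Rightarrow> ('o, 'm) tri \<Rightarrow> bool" where
  "left_triangle C Om t \<longleftrightarrow> right_triangle (op_cat C) Om (op_tri t)"

definition left_tri_iso ::
  "('o, 'm, 'z) precategory_scheme \<Rightarrow> ('o, 'm, 'o, 'm) functor_data \<Rightarrow>
    ('o, 'm) tri \<Rightarrow> ('o, 'm) tri \<Rightarrow> bool" where
  "left_tri_iso C Om t t' \<longleftrightarrow> tri_iso (op_cat C) Om (op_tri t) (op_tri t')"

definition left_triangulated_category ::
  "('o, 'm, 'z) precategory_scheme \<Rightarrow> ('o, 'm, 'o, 'm) functor_data \<Rightarrow> ('o, 'm) tri set \<Rightarrow> bool" where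
  "left_triangulated_category C Om L \<longleftrightarrow> right_triangulated_category (op_cat C) Om (op_tri ` L)"

definition pretriangulated_category ::
  "('o, 'm, 'z) precategory_scheme \<Rightarrow>
    ('o, 'm, 'o, 'm) functor_data \<Rightarrow> ('o, 'm) tri set \<Rightarrow>
    ('o, 'm, 'o, 'm) functor_data \<Rightarrow> ('o, 'm) tri set \<Rightarrow>
    ('o \<Rightarrow> 'o \<Rightarrow> 'm \<Rightarrow> 'm) \<Rightarrow> bool" where
  "pretriangulated_category D Sg R Om L \<phi> \<longleftrightarrow>
     right_triangulated_category D Sg R \<and>
     left_triangulated_category D Om L \<and>
     adjunction D Sg Om \<phi> \<and>
     (\<forall>A B X f g h A' B' X' f' g' h'.
        (A, B, X, f, g, h) \<in> R \<longrightarrow> (A', B', X', f', g', h') \<in> L \<longrightarrow>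
        (\<forall>\<alpha>\<in>Hom D A (on_ob Om X'). \<forall>\<beta>\<in>Hom D B A'.
           \<beta> \<cdot>\<^bsub>D\<^esub> f = f' \<cdot>\<^bsub>D\<^esub> \<alpha> \<longrightarrow>
           (\<exists>\<gamma>\<in>Hom D X B'. \<gamma> \<cdot>\<^bsub>D\<^esub> g = g' \<cdot>\<^bsub>D\<^esub> \<beta> \<and>
              h' \<cdot>\<^bsub>D\<^esub> \<gamma> = inv_into (Hom D (on_ob Sg A) X') (\<phi> A X') \<alpha> \<cdot>\<^bsub>D\<^esub> h)) \<and>
        (\<forall>\<gamma>\<in>Hom D X B'. \<forall>\<delta>\<in>Hom D (on_ob Sg A) X'.
           h' \<cdot>\<^bsub>D\<^esub> \<gamma> = \<delta> \<cdot>\<^bsub>D\<^esub> h \<longrightarrow>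
           (\<exists>\<beta>\<in>Hom D B A'. \<beta> \<cdot>\<^bsub>D\<^esub> f = f' \<cdot>\<^bsub>D\<^esub> \<phi> A X' \<delta> \<and> g' \<cdot>\<^bsub>D\<^esub> \<beta> = \<gamma> \<cdot>\<^bsub>D\<^esub> g)))"

record ('o, 'm) tricategory = "('o, 'm) precategory" +
  Shift :: "('o, 'm, 'o, 'm) functor_data"
  Tri :: "('o, 'm) tri set"

text \<open>The shift is only assumed to be an autoequivalence; strict automorphisms are a special case.\<close>

definition triangulated_category :: "('o, 'm, 'z) tricategory_scheme \<Rightarrow> bool" where
  "triangulated_category C \<longleftrightarrow>
     right_triangulated_category C (Shift C) (Tri C) \<and>
     autoequivalence C (Shift C) \<and>
     (\<forall>A B X f g h.
        right_triangle C (Shift C) (A, B, X, f, g, h) \<and>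
        (B, X, on_ob (Shift C) A, g, h,
           neg C (on_ob (Shift C) A) (on_ob (Shift C) B) (on_hom (Shift C) f)) \<in> Tri C
        \<longrightarrow> (A, B, X, f, g, h) \<in> Tri C)"

text \<open>A distinguished triangle \<open>P[-1] \<rightarrow>k X \<rightarrow>l Y \<rightarrow>m P\<close>.  Since the shift need not be
  bijective on objects, \<open>P[-1]\<close> is any object \<open>W\<close> together with an isomorphism \<open>\<kappa> : P \<rightarrow> W[1]\<close>
  (take \<open>\<kappa>\<close> to be the identity if the shift is an automorphism).\<close>

definition desusp_triangle ::
  "('o, 'm, 'z) tricategory_scheme \<Rightarrow> 'o \<Rightarrow> 'm \<Rightarrow> 'o \<Rightarrow> 'o \<Rightarrow> 'o \<Rightarrow> 'm \<Rightarrow> 'm \<Rightarrow> 'm \<Rightarrow> bool" where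
  "desusp_triangle C W \<kappa> X Y P k l m \<longleftrightarrow>
     W \<in> Ob C \<and> iso_in C P (on_ob (Shift C) W) \<kappa> \<and> m \<in> Hom C Y P \<and>
     (W, X, Y, k, l, \<kappa> \<cdot>\<^bsub>C\<^esub> m) \<in> Tri C"

section \<open>Cotorsion pairs\<close>

definition star :: "('o, 'm, 'z) tricategory_scheme \<Rightarrow> 'o set \<Rightarrow> 'o set \<Rightarrow> 'o set" where
  "star C \<X> \<Y> = {E \<in> Ob C. \<exists>X\<in>\<X>. \<exists>Y\<in>\<Y>. \<exists>f g h. (X, E, Y, f, g, h) \<in> Tri C}"

definition ext1_vanishes :: "('o, 'm, 'z) tricategory_scheme \<Rightarrow> 'o set \<Rightarrow> 'o set \<Rightarrow> bool" where
  "ext1_vanishes C \<X> \<Y> \<longleftrightarrow>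
     (\<forall>X\<in>\<X>. \<forall>Y\<in>\<Y>. Hom C X (on_ob (Shift C) Y) = {Zero C X (on_ob (Shift C) Y)})"

text \<open>Full additive subcategories closed under isomorphisms and direct summands.\<close>

definition additive_subcategory :: "('o, 'm, 'z) precategory_scheme \<Rightarrow> 'o set \<Rightarrow> bool" where
  "additive_subcategory C \<X> \<longleftrightarrow> \<X> \<subseteq> Ob C \<and>
     (\<exists>N\<in>\<X>. zero_object C N) \<and>
     (\<forall>A B P. biproduct C A B P \<longrightarrow> A \<in> \<X> \<longrightarrow> B \<in> \<X> \<longrightarrow> P \<in> \<X>) \<and>
     (\<forall>A B f. iso_in C A B f \<longrightarrow> A \<in> \<X> \<longrightarrow> B \<in> \<X>) \<and>
     (\<forall>A B P. biproduct C A B P \<longrightarrow> P \<in> \<X> \<longrightarrow> A \<in> \<X> \<and> B \<in> \<X>)"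

definition cotorsion_pair :: "('o, 'm, 'z) tricategory_scheme \<Rightarrow> 'o set \<Rightarrow> 'o set \<Rightarrow> bool" where
  "cotorsion_pair C \<U> \<V> \<longleftrightarrow>
     additive_subcategory C \<U> \<and> additive_subcategory C \<V> \<and>
     Ob C = star C \<U> (on_ob (Shift C) ` \<V>) \<and>
     ext1_vanishes C \<U> \<V>"

record 'o tcp =
  tcpS :: "'o set"
  tcpT :: "'o set"
  tcpU :: "'o set"
  tcpV :: "'o set"

definition twin_cotorsion_pair ::
  "('o, 'm, 'z) tricategory_scheme \<Rightarrow> ('o, 'y) tcp_scheme \<Rightarrow> bool" where
  "twin_cotorsion_pair C P \<longleftrightarrow>
     cotorsion_pair C (tcpS P) (tcpT P) \<and> cotorsion_pair C (tcpU P) (tcpV P) \<and>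
     ext1_vanishes C (tcpS P) (tcpV P)"

definition concentric_tcp ::
  "('o, 'm, 'z) tricategory_scheme \<Rightarrow> ('o, 'y) tcp_scheme \<Rightarrow> bool" where
  "concentric_tcp C P \<longleftrightarrow>
     twin_cotorsion_pair C P \<and> tcpS P \<inter> tcpT P = tcpU P \<inter> tcpV P"

definition tcpI :: "('o, 'y) tcp_scheme \<Rightarrow> 'o set" where
  "tcpI P = tcpS P \<inter> tcpT P"

definition tcpZ :: "('o, 'y) tcp_scheme \<Rightarrow> 'o set" where
  "tcpZ P = tcpT P \<inter> tcpU P"

section \<open>Ideal quotients\<close>

definition factors_through ::
  "('o, 'm, 'z) precategory_scheme \<Rightarrow> 'o set \<Rightarrow> 'o \<Rightarrow> 'o \<Rightarrow> 'm \<Rightarrow> bool" where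
  "factors_through C \<I> A B k \<longleftrightarrow> (\<exists>J\<in>\<I>. \<exists>p\<in>Hom C A J. \<exists>q\<in>Hom C J B. k = q \<cdot>\<^bsub>C\<^esub> p)"

definition cls :: "('o, 'm, 'z) precategory_scheme \<Rightarrow> 'o set \<Rightarrow> 'm \<Rightarrow> 'm set" where
  "cls C \<I> f = {g. \<exists>A\<in>Ob C. \<exists>B\<in>Ob C. f \<in> Hom C A B \<and>
     (\<exists>k. factors_through C \<I> A B k \<and> g = f \<boxplus>\<^bsub>C\<^esub> k)}"

definition ideal_quotient ::
  "('o, 'm, 'z) precategory_scheme \<Rightarrow> 'o set \<Rightarrow> 'o set \<Rightarrow> ('o, 'm set) precategory" where
  "ideal_quotient C \<X> \<I> = \<lparr>Ob = \<X>,
     Hom = (\<lambda>A B. cls C \<I> ` Hom C A B),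
     Id = (\<lambda>A. cls C \<I> (Id C A)),
     Comp = (\<lambda>G F. \<Union>g\<in>G. \<Union>f\<in>F. cls C \<I> (g \<cdot>\<^bsub>C\<^esub> f)),
     Add = (\<lambda>F G. \<Union>f\<in>F. \<Union>g\<in>G. cls C \<I> (f \<boxplus>\<^bsub>C\<^esub> g)),
     Zero = (\<lambda>A B. cls C \<I> (Zero C A B))\<rparr>"

section \<open>The functors \<open>\<Sigma>\<close> and \<open>\<Omega>\<close>\<close>

text \<open>The choices entering the construction, for \<open>X\<close> in \<open>\<Z>\<close>, \<open>U\<close> in \<open>\<U>\<close>, \<open>T\<close> in \<open>\<T>\<close>:
  \<open>X \<rightarrow> su_I X \<rightarrow> su X \<rightarrow> X[1]\<close> defines \<open>X\<langle>1\<rangle> = su X\<close>;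
  \<open>de X \<rightarrow> de_I X \<rightarrow> X \<rightarrow> (de X)[1]\<close> defines \<open>X\<langle>-1\<rangle> = de X\<close>;
  \<open>eta U : U \<rightarrow> sig U\<close> represents the unit at \<open>U\<close> and
  \<open>eps T : ome T \<rightarrow> T\<close> the counit at \<open>T\<close>.\<close>

record ('o, 'm) tcp_choices = "'o tcp" +
  su_I :: "'o \<Rightarrow> 'o"
  su :: "'o \<Rightarrow> 'o"
  su_iota :: "'o \<Rightarrow> 'm"
  su_wp :: "'o \<Rightarrow> 'm"
  su_gamma :: "'o \<Rightarrow> 'm"
  de :: "'o \<Rightarrow> 'o"
  de_I :: "'o \<Rightarrow> 'o"
  de_iota :: "'o \<Rightarrow> 'm"
  de_wp :: "'o \<Rightarrow> 'm"
  de_gamma :: "'o \<Rightarrow> 'm"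
  sig :: "'o \<Rightarrow> 'o"
  eta :: "'o \<Rightarrow> 'm"
  ome :: "'o \<Rightarrow> 'o"
  eps :: "'o \<Rightarrow> 'm"

definition su_tri :: "('o, 'm, 'y) tcp_choices_scheme \<Rightarrow> 'o \<Rightarrow> ('o, 'm) tri" where
  "su_tri P X = (X, su_I P X, su P X, su_iota P X, su_wp P X, su_gamma P X)"

definition de_tri :: "('o, 'm, 'y) tcp_choices_scheme \<Rightarrow> 'o \<Rightarrow> ('o, 'm) tri" where
  "de_tri P X = (de P X, de_I P X, X, de_iota P X, de_wp P X, de_gamma P X)"

definition valid_choices ::
  "('o, 'm, 'z) tricategory_scheme \<Rightarrow> ('o, 'm, 'y) tcp_choices_scheme \<Rightarrow> bool" where
  "valid_choices C P \<longleftrightarrow>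
     (\<forall>X\<in>tcpZ P. su_I P X \<in> tcpI P \<and> su P X \<in> tcpU P \<and> su_tri P X \<in> Tri C) \<and>
     (\<forall>X\<in>tcpZ P. de_I P X \<in> tcpI P \<and> de P X \<in> tcpT P \<and> de_tri P X \<in> Tri C) \<and>
     (\<forall>U\<in>tcpU P. sig P U \<in> tcpT P \<and>
        (\<exists>S\<in>tcpS P. \<exists>W \<kappa> w s. desusp_triangle C W \<kappa> U (sig P U) S w (eta P U) s)) \<and>
     (\<forall>T\<in>tcpT P. ome P T \<in> tcpU P \<and>
        (\<exists>V\<in>tcpV P. \<exists>v w. (V, ome P T, T, v, eps P T, w) \<in> Tri C))"

abbreviation cl ::
  "('o, 'm, 'z) tricategory_scheme \<Rightarrow> ('o, 'm, 'y) tcp_choices_scheme \<Rightarrow> 'm \<Rightarrow> 'm set" where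
  "cl C P \<equiv> cls C (tcpI P)"

definition ZI ::
  "('o, 'm, 'z) tricategory_scheme \<Rightarrow> ('o, 'm, 'y) tcp_choices_scheme \<Rightarrow> ('o, 'm set) precategory" where
  "ZI C P = ideal_quotient C (tcpZ P) (tcpI P)"

definition UI ::
  "('o, 'm, 'z) tricategory_scheme \<Rightarrow> ('o, 'm, 'y) tcp_choices_scheme \<Rightarrow> ('o, 'm set) precategory" where
  "UI C P = ideal_quotient C (tcpU P) (tcpI P)"

definition TI ::
  "('o, 'm, 'z) tricategory_scheme \<Rightarrow> ('o, 'm, 'y) tcp_choices_scheme \<Rightarrow> ('o, 'm set) precategory" where
  "TI C P = ideal_quotient C (tcpT P) (tcpI P)"

definition shift1 ::
  "('o, 'm, 'z) tricategory_scheme \<Rightarrow> ('o, 'm, 'y) tcp_choices_scheme \<Rightarrow>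
    ('o, 'm set, 'o, 'm set) functor_data" where
  "shift1 C P = \<lparr>on_ob = su P,
     on_hom = (\<lambda>F. THE G. \<exists>A\<in>tcpZ P. \<exists>B\<in>tcpZ P. \<exists>z i u.
        tri_mor C (Shift C) (su_tri P A) (su_tri P B) z i u \<and> F = cl C P z \<and> G = cl C P u)\<rparr>"

definition shift_minus1 ::
  "('o, 'm, 'z) tricategory_scheme \<Rightarrow> ('o, 'm, 'y) tcp_choices_scheme \<Rightarrow>
    ('o, 'm set, 'o, 'm set) functor_data" where
  "shift_minus1 C P = \<lparr>on_ob = de P,
     on_hom = (\<lambda>F. THE G. \<exists>A\<in>tcpZ P. \<exists>B\<in>tcpZ P. \<exists>t i z.
        tri_mor C (Shift C) (de_tri P A) (de_tri P B) t i z \<and> F = cl C P z \<and> G = cl C P t)\<rparr>"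

text \<open>The adjoints act on morphisms by naturality of the unit and of the counit.\<close>

definition sigma ::
  "('o, 'm, 'z) tricategory_scheme \<Rightarrow> ('o, 'm, 'y) tcp_choices_scheme \<Rightarrow>
    ('o, 'm set, 'o, 'm set) functor_data" where
  "sigma C P = \<lparr>on_ob = sig P,
     on_hom = (\<lambda>F. THE G. \<exists>A\<in>tcpU P. \<exists>B\<in>tcpU P.
        F \<in> Hom (UI C P) A B \<and> G \<in> Hom (ZI C P) (sig P A) (sig P B) \<and>
        G \<cdot>\<^bsub>UI C P\<^esub> cl C P (eta P A) = cl C P (eta P B) \<cdot>\<^bsub>UI C P\<^esub> F)\<rparr>"

definition omega ::
  "('o, 'm, 'z) tricategory_scheme \<Rightarrow> ('o, 'm, 'y) tcp_choices_scheme \<Rightarrow>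
    ('o, 'm set, 'o, 'm set) functor_data" where
  "omega C P = \<lparr>on_ob = ome P,
     on_hom = (\<lambda>F. THE G. \<exists>A\<in>tcpT P. \<exists>B\<in>tcpT P.
        F \<in> Hom (TI C P) A B \<and> G \<in> Hom (ZI C P) (ome P A) (ome P B) \<and>
        cl C P (eps P B) \<cdot>\<^bsub>TI C P\<^esub> G = F \<cdot>\<^bsub>TI C P\<^esub> cl C P (eps P A))\<rparr>"

definition Sigma_Z ::
  "('o, 'm, 'z) tricategory_scheme \<Rightarrow> ('o, 'm, 'y) tcp_choices_scheme \<Rightarrow>
    ('o, 'm set, 'o, 'm set) functor_data" where
  "Sigma_Z C P = functor_comp (sigma C P) (shift1 C P)"

definition Omega_Z ::
  "('o, 'm, 'z) tricategory_scheme \<Rightarrow> ('o, 'm, 'y) tcp_choices_scheme \<Rightarrow>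
    ('o, 'm set, 'o, 'm set) functor_data" where
  "Omega_Z C P = functor_comp (omega C P) (shift_minus1 C P)"

text \<open>The bijections
  \<open>(\<Z>/\<I>)(\<sigma>(X\<langle>1\<rangle>), Y) \<cong> (\<U>/\<I>)(X\<langle>1\<rangle>, Y) \<cong> (\<T>/\<I>)(X, Y\<langle>-1\<rangle>) \<cong> (\<Z>/\<I>)(X, \<omega>(Y\<langle>-1\<rangle>))\<close>
  and their composite.\<close>

definition adj_sigma ::
  "('o, 'm, 'z) tricategory_scheme \<Rightarrow> ('o, 'm, 'y) tcp_choices_scheme \<Rightarrow> 'o \<Rightarrow> 'm set \<Rightarrow> 'm set" where
  "adj_sigma C P U F = F \<cdot>\<^bsub>UI C P\<^esub> cl C P (eta P U)"

definition adj_shift ::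
  "('o, 'm, 'z) tricategory_scheme \<Rightarrow> ('o, 'm, 'y) tcp_choices_scheme \<Rightarrow>
    'o \<Rightarrow> 'o \<Rightarrow> 'm set \<Rightarrow> 'm set" where
  "adj_shift C P X Y F = (THE G. \<exists>t i u.
     tri_mor C (Shift C) (su_tri P X) (de_tri P Y) t i u \<and> F = cl C P u \<and> G = cl C P t)"

definition adj_omega ::
  "('o, 'm, 'z) tricategory_scheme \<Rightarrow> ('o, 'm, 'y) tcp_choices_scheme \<Rightarrow>
    'o \<Rightarrow> 'o \<Rightarrow> 'm set \<Rightarrow> 'm set" where
  "adj_omega C P X T F = (THE G. G \<in> Hom (ZI C P) X (ome P T) \<and>
     cl C P (eps P T) \<cdot>\<^bsub>TI C P\<^esub> G = F)"

definition adj ::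
  "('o, 'm, 'z) tricategory_scheme \<Rightarrow> ('o, 'm, 'y) tcp_choices_scheme \<Rightarrow>
    'o \<Rightarrow> 'o \<Rightarrow> 'm set \<Rightarrow> 'm set" where
  "adj C P X Y F = adj_omega C P X (de P Y) (adj_shift C P X Y (adj_sigma C P (su P X) F))"

text \<open>The bijection \<open>adj\<close> matches the class of \<open>u\<close> with that of \<open>t\<close>.  The standard right and left
  triangles defined below are compatible for its negative, which matches \<open>u\<close> with \<open>-t\<close>, and in
  general not for \<open>adj\<close> itself: the sign is forced by the one in \<open>-k[1]\<close>.  Take
  \<open>\<S> = \<V> = 0\<close> and \<open>\<T> = \<U> = \<C>\<close>, so that \<open>\<Z>/\<I> = \<C>\<close>, and choose the triangles with \<open>\<gamma> = id\<close>,
  \<open>\<gamma>' = id\<close>.  Then the right triangles are the distinguished triangles, the left triangles are the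
  \<open>(-k, l, m)\<close> with \<open>(k, l, m)\<close> distinguished, and \<open>adj\<close> sends \<open>u\<close> to \<open>u[-1]\<close>.  For the triangle
  \<open>\<int> \<rightarrow> \<int> \<rightarrow> \<int>/3 \<rightarrow> \<int>[1]\<close> given by multiplication by \<open>3\<close> in the derived category of \<open>\<int>\<close>, and for
  identities \<open>\<gamma>\<close>, \<open>\<delta>\<close>, compatibility with \<open>adj\<close> would require \<open>\<beta> : \<int> \<rightarrow> \<int>\<close> with \<open>\<beta> 3 = -3\<close> and
  \<open>\<beta>\<close> congruent to \<open>1\<close> modulo \<open>3\<close>.\<close>

definition Sigma_Omega_adj ::
  "('o, 'm, 'z) tricategory_scheme \<Rightarrow> ('o, 'm, 'y) tcp_choices_scheme \<Rightarrow>
    'o \<Rightarrow> 'o \<Rightarrow> 'm set \<Rightarrow> 'm set" where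
  "Sigma_Omega_adj C P X Y F = neg (ZI C P) X (on_ob (Omega_Z C P) Y) (adj C P X Y F)"

section \<open>Distinguished right and left triangles in \<open>\<Z>/\<I>\<close>\<close>

definition standard_right ::
  "('o, 'm, 'z) tricategory_scheme \<Rightarrow> ('o, 'm, 'y) tcp_choices_scheme \<Rightarrow> ('o, 'm set) tri set" where
  "standard_right C P =
     {(X, Y, sig P U, cl C P f, cl C P (eta P U) \<cdot>\<^bsub>UI C P\<^esub> cl C P a, on_hom (sigma C P) (cl C P c))
      | X Y U f a b y c.
        X \<in> tcpZ P \<and> Y \<in> tcpZ P \<and> U \<in> tcpU P \<and> (X, Y, U, f, a, b) \<in> Tri C \<and>
        tri_mor C (Shift C) (X, Y, U, f, a, b) (su_tri P X) (Id C X) y c}"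

definition distinguished_right ::
  "('o, 'm, 'z) tricategory_scheme \<Rightarrow> ('o, 'm, 'y) tcp_choices_scheme \<Rightarrow> ('o, 'm set) tri set" where
  "distinguished_right C P = {t. right_triangle (ZI C P) (Sigma_Z C P) t \<and>
     (\<exists>s\<in>standard_right C P. tri_iso (ZI C P) (Sigma_Z C P) s t)}"

text \<open>Here \<open>W\<close> is \<open>Q[-1]\<close>, and \<open>-k[1] \<cdot> \<kappa>\<close> is the last morphism of the rotation
  \<open>T \<rightarrow>l Z \<rightarrow>m Q \<rightarrow> T[1]\<close> of \<open>Q[-1] \<rightarrow>k T \<rightarrow>l Z \<rightarrow>m Q\<close>.\<close>

definition standard_left ::
  "('o, 'm, 'z) tricategory_scheme \<Rightarrow> ('o, 'm, 'y) tcp_choices_scheme \<Rightarrow> ('o, 'm set) tri set" where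
  "standard_left C P =
     {(ome P T, Z, Q, on_hom (omega C P) (cl C P n), cl C P l \<cdot>\<^bsub>TI C P\<^esub> cl C P (eps P T), cl C P m)
      | T Z Q W \<kappa> k l m n i.
        T \<in> tcpT P \<and> Z \<in> tcpZ P \<and> Q \<in> tcpZ P \<and> desusp_triangle C W \<kappa> T Z Q k l m \<and>
        tri_mor C (Shift C) (de_tri P Q)
          (T, Z, Q, l, m,
            neg C (on_ob (Shift C) W) (on_ob (Shift C) T) (on_hom (Shift C) k) \<cdot>\<^bsub>C\<^esub> \<kappa>)
          n i (Id C Q)}"

definition distinguished_left ::
  "('o, 'm, 'z) tricategory_scheme \<Rightarrow> ('o, 'm, 'y) tcp_choices_scheme \<Rightarrow> ('o, 'm set) tri set" where
  "distinguished_left C P = {t. left_triangle (ZI C P) (Omega_Z C P) t \<and>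
     (\<exists>s\<in>standard_left C P. left_tri_iso (ZI C P) (Omega_Z C P) s t)}"

end

theory Submission
  imports Defs
begin

text \<open>Replace the triangles of \<open>\<C>\<close> by conflations \<open>X \<rightarrow> Y \<rightarrow> Z\<close> realizing extensions
  \<open>e : Z \<rightarrow> X[1]\<close>, which are pushed forward along morphisms out of \<open>X\<close> and pulled back along
  morphisms into \<open>Z\<close>.  The properties of conflations that are needed are self-dual, so the left
  triangulation is the right triangulation of the opposite category.

  A morphism \<open>f : X \<rightarrow> Y\<close> in \<open>\<Z>\<close> has a model triangle, obtained by applying \<open>\<sigma>\<close> to the pushout
  \<open>Y \<rightarrow> W \<rightarrow> X\<langle>1\<rangle>\<close> of \<open>X \<rightarrow> I \<rightarrow> X\<langle>1\<rangle>\<close> along \<open>f\<close>, and the distinguished right triangles are those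
  isomorphic to a model.  A conflation with all terms in \<open>\<U>\<close> becomes a distinguished right triangle
  under \<open>\<sigma>\<close>; applied to \<open>Y \<rightarrow> W \<rightarrow> X\<langle>1\<rangle>\<close> this is the rotation axiom, and applied to the conflation
  between the cones of two composable inflations it is the octahedral axiom, up to an endomorphism of
  the third vertex, which is invertible because it differs from the identity by a square-zero one.

  The adjunction holds because, modulo \<open>\<I>\<close>, both morphisms \<open>X\<langle>1\<rangle> \<rightarrow> Y\<close> and morphisms
  \<open>X \<rightarrow> Y\<langle>-1\<rangle>\<close> are extensions of \<open>X\<langle>1\<rangle>\<close> by \<open>Y\<langle>-1\<rangle>\<close>; under it, both compatibility conditions are
  the completion of a morphism of extensions to one of conflations.\<close>

text \<open>The obstacle is that squares in \<Z>/\<I> commute only modulo \<I>, while completions in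
  \<C> need strictly commuting data. Extensions remove it: the push of an extension of an object of
  \<U>, or the pull of an extension by an object of \<T>, depends only on the class of the morphism,
  so a square commuting modulo \<I> becomes an honest morphism of extensions. A standard triangle
  needs a first map with cone in \<U>, which a morphism has only after replacement by an isomorphic
  one; the model uses just the push along the given representative, and so responds to squares
  directly. Duality cannot be applied to the triangles themselves, because the shift is only an
  autoequivalence and has no canonical inverse. The signs have a common origin: in a pushout or
  pullback of two conflations the induced extensions agree only up to sign. This puts a minus on the
  third map of a model, and that minus becomes the one required by rotation. One copy is left over
  when a model on one side is compared with a standard triangle on the other, and the adjunction
  absorbs it.\<close>

definition arrs :: "('o, 'm, 'z) precategory_scheme \<Rightarrow> 'm set" where
  "arrs C = {f. \<exists>A\<in>Ob C. \<exists>B\<in>Ob C. f \<in> Hom C A B}"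

text \<open>Hom-sets are pairwise disjoint, so an arrow determines its ends. Recovering them turns
  typing side conditions into equations between ends that rewriting can discharge.\<close>

definition src :: "('o, 'm, 'z) precategory_scheme \<Rightarrow> 'm \<Rightarrow> 'o" where
  "src C f = (THE A. A \<in> Ob C \<and> (\<exists>B\<in>Ob C. f \<in> Hom C A B))"

definition tgt :: "('o, 'm, 'z) precategory_scheme \<Rightarrow> 'm \<Rightarrow> 'o" where
  "tgt C f = (THE B. B \<in> Ob C \<and> (\<exists>A\<in>Ob C. f \<in> Hom C A B))"

abbreviation mor :: "('o, 'm, 'z) precategory_scheme \<Rightarrow> 'm \<Rightarrow> 'o \<Rightarrow> 'o \<Rightarrow> bool" where
  "mor C f A B \<equiv> f \<in> arrs C \<and> src C f = A \<and> tgt C f = B \<and> A \<in> Ob C \<and> B \<in> Ob C"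

text \<open>With the objects recovered from the arrow, negation is a unary operation that rewriting
  can move through composites.\<close>

definition mn :: "('o, 'm, 'z) precategory_scheme \<Rightarrow> 'm \<Rightarrow> 'm" where
  "mn C f = neg C (src C f) (tgt C f) f"

section \<open>Composition and isomorphisms of typed arrows\<close>

context category
begin

lemma src_tgt_eq:
  assumes "A \<in> Ob C" "B \<in> Ob C" "f \<in> Hom C A B"
  shows "src C f = A" "tgt C f = B"
proof -
  have u: "A' = A \<and> B' = B" if "A' \<in> Ob C" "B' \<in> Ob C" "f \<in> Hom C A' B'" for A' B'
    using hom_disjoint[of A' B' A B f] that assms by simp
  show "src C f = A" unfolding src_def
    by (rule the_equality) (use u assms in blast)+
  show "tgt C f = B" unfolding tgt_def
    by (rule the_equality) (use u assms in blast)+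
qed

lemma hom_iff_mor: "\<lbrakk>A \<in> Ob C; B \<in> Ob C\<rbrakk> \<Longrightarrow> f \<in> Hom C A B \<longleftrightarrow> mor C f A B"
proof
  assume "A \<in> Ob C" "B \<in> Ob C" "f \<in> Hom C A B"
  then show "mor C f A B" using src_tgt_eq unfolding arrs_def by blast
next
  assume "mor C f A B"
  then show "f \<in> Hom C A B" using src_tgt_eq unfolding arrs_def by blast
qed

lemma src_ob [simp]: "f \<in> arrs C \<Longrightarrow> src C f \<in> Ob C"
  and tgt_ob [simp]: "f \<in> arrs C \<Longrightarrow> tgt C f \<in> Ob C"
  unfolding arrs_def using src_tgt_eq by blast+

lemma mor_hom: "mor C f A B \<Longrightarrow> f \<in> Hom C A B"
  using hom_iff_mor by blast

lemma arrs_hom: "f \<in> arrs C \<Longrightarrow> f \<in> Hom C (src C f) (tgt C f)"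
  by (simp add: mor_hom)

lemma mor_comp:
  assumes "f \<in> arrs C" "g \<in> arrs C" "src C g = tgt C f"
  shows "mor C (g \<cdot> f) (src C f) (tgt C g)"
proof -
  have "g \<cdot> f \<in> Hom C (src C f) (tgt C g)"
    using comp_in_hom[of "src C f" "tgt C f" "tgt C g" f g] arrs_hom[of f] arrs_hom[of g] assms by simp
  then show ?thesis using assms hom_iff_mor[of "src C f" "tgt C g"] by simp
qed

lemma comp_simps [simp]:
  assumes "f \<in> arrs C" "g \<in> arrs C" "src C g = tgt C f"
  shows "g \<cdot> f \<in> arrs C" "src C (g \<cdot> f) = src C f" "tgt C (g \<cdot> f) = tgt C g"
  using mor_comp[OF assms] by auto

lemma id_simps [simp]:
  assumes "A \<in> Ob C"
  shows "Id C A \<in> arrs C" "src C (Id C A) = A" "tgt C (Id C A) = A"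
  using id_in_hom[OF assms] assms hom_iff_mor[of A A] by simp_all

lemma comp_assoc' [simp]:
  assumes "f \<in> arrs C" "g \<in> arrs C" "h \<in> arrs C" "src C g = tgt C f" "src C h = tgt C g"
  shows "(h \<cdot> g) \<cdot> f = h \<cdot> (g \<cdot> f)"
  by (rule comp_assoc[of "src C f" "tgt C f" "tgt C g" "tgt C h"])
     (use assms in \<open>simp_all add: hom_iff_mor\<close>)

lemma comp_id [simp]:
  assumes "f \<in> arrs C"
  shows "src C f = A \<Longrightarrow> f \<cdot> Id C A = f" "tgt C f = B \<Longrightarrow> Id C B \<cdot> f = f"
  using comp_id_right[OF src_ob tgt_ob arrs_hom, of f] comp_id_left[OF src_ob tgt_ob arrs_hom, of f] assms by auto

text \<open>Rewriting associates composites to the right, which hides a known product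
  \<open>g \<cdot> f\<close> inside a longer composite. Instantiated with that product, the rule
  reaches it there.\<close>

lemma comp_reassoc:
  assumes "g \<cdot> f = k" "f \<in> arrs C" "g \<in> arrs C" "src C g = tgt C f"
    "h \<in> arrs C" "tgt C h = src C f"
  shows "g \<cdot> (f \<cdot> h) = k \<cdot> h"
  using assms by auto

lemma iso_in_mor: "iso_in C A B f \<longleftrightarrow> mor C f A B \<and> (\<exists>g. mor C g B A \<and> g \<cdot> f = Id C A \<and> f \<cdot> g = Id C B)"
  unfolding iso_in_def Bex_def by (simp add: hom_iff_mor conj_ac cong: conj_cong)

lemma iso_inE:
  assumes "iso_in C A B f"
  obtains g where "mor C f A B" "mor C g B A" "g \<cdot> f = Id C A" "f \<cdot> g = Id C B"
  using assms unfolding iso_in_mor by blast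

lemma iso_inI:
  assumes "mor C f A B" "mor C g B A" "g \<cdot> f = Id C A" "f \<cdot> g = Id C B"
  shows "iso_in C A B f"
  using assms unfolding iso_in_mor by blast

lemma iso_in_id: "A \<in> Ob C \<Longrightarrow> iso_in C A A (Id C A)"
  by (rule iso_inI[where g = "Id C A"]) simp_all

lemma iso_in_comp:
  assumes "iso_in C A B f" "iso_in C B D g"
  shows "iso_in C A D (g \<cdot> f)"
proof -
  obtain f' where f: "mor C f A B" "mor C f' B A" "f' \<cdot> f = Id C A" "f \<cdot> f' = Id C B"
    using assms(1) by (rule iso_inE)
  obtain g' where g: "mor C g B D" "mor C g' D B" "g' \<cdot> g = Id C B" "g \<cdot> g' = Id C D"
    using assms(2) by (rule iso_inE)
  have "g' \<cdot> (g \<cdot> f) = f" "f \<cdot> (f' \<cdot> g') = g'"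
    using f g by (simp_all add: comp_reassoc[of g' g] comp_reassoc[of f f'])
  then show ?thesis using f g by (intro iso_inI[where g = "f' \<cdot> g'"]) simp_all
qed

text \<open>The left inverse \<open>r \<cdot> g\<close> and the right inverse
  \<open>g \<cdot> s\<close> of \<open>f\<close> coincide by the usual sandwich argument.\<close>

lemma iso_in_of_left_right_inverse:
  assumes "mor C f A B" "iso_in C A A (g \<cdot> f)" "iso_in C B B (f \<cdot> g)" "mor C g B A"
  shows "iso_in C A B f"
proof -
  obtain r where r: "mor C r A A" "r \<cdot> (g \<cdot> f) = Id C A" using assms(2) by (rule iso_inE)
  obtain s where s: "mor C s B B" "(f \<cdot> g) \<cdot> s = Id C B" using assms(3) by (rule iso_inE)
  have "r \<cdot> g = (r \<cdot> g) \<cdot> ((f \<cdot> g) \<cdot> s)" using assms r s by simp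
  also have "\<dots> = ((r \<cdot> (g \<cdot> f)) \<cdot> g) \<cdot> s" using assms r(1) s(1) by simp
  also have "\<dots> = g \<cdot> s" using assms r s by simp
  finally have "f \<cdot> (r \<cdot> g) = Id C B" using assms(1,4) s by simp
  then show ?thesis using assms(1,4) r by (intro iso_inI[where g = "r \<cdot> g"]) simp_all
qed

end

section \<open>Sums and negatives of arrows\<close>

context preadditive_category
begin

lemma hom_group_simps [simp]:
  "carrier (hom_group C A B) = Hom C A B"
  "x \<otimes>\<^bsub>hom_group C A B\<^esub> y = x \<boxplus> y"
  "\<one>\<^bsub>hom_group C A B\<^esub> = Zero C A B"
  by (simp_all add: hom_group_def)

lemma zero_simps [simp]:
  assumes "A \<in> Ob C" "B \<in> Ob C"
  shows "Zero C A B \<in> arrs C" "src C (Zero C A B) = A" "tgt C (Zero C A B) = B"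
proof -
  interpret G: comm_group "hom_group C A B" using hom_comm_group assms by auto
  have "Zero C A B \<in> Hom C A B" using G.one_closed by simp
  then show "Zero C A B \<in> arrs C" "src C (Zero C A B) = A" "tgt C (Zero C A B) = B"
    using assms hom_iff_mor by blast+
qed

lemma mor_add:
  assumes "f \<in> arrs C" "g \<in> arrs C" "src C g = src C f" "tgt C g = tgt C f"
  shows "mor C (f \<boxplus> g) (src C f) (tgt C f)"
proof -
  interpret G: comm_group "hom_group C (src C f) (tgt C f)" using hom_comm_group assms by auto
  have "f \<boxplus> g \<in> Hom C (src C f) (tgt C f)"
    using G.m_closed[of f g] assms by (simp add: hom_iff_mor)
  then show ?thesis using assms by (simp add: hom_iff_mor)
qed

lemma mor_mn:
  assumes "f \<in> arrs C"
  shows "mor C (mn C f) (src C f) (tgt C f)"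
proof -
  interpret G: comm_group "hom_group C (src C f) (tgt C f)" using hom_comm_group assms by auto
  have "mn C f \<in> Hom C (src C f) (tgt C f)"
    using G.inv_closed[of f] assms hom_iff_mor by (simp add: mn_def neg_def)
  then show ?thesis using assms by (simp add: hom_iff_mor)
qed

lemma add_simps [simp]:
  assumes "f \<in> arrs C" "g \<in> arrs C" "src C g = src C f" "tgt C g = tgt C f"
  shows "f \<boxplus> g \<in> arrs C" "src C (f \<boxplus> g) = src C f" "tgt C (f \<boxplus> g) = tgt C f"
  using mor_add[OF assms] by auto

lemma mn_simps [simp]:
  assumes "f \<in> arrs C"
  shows "mn C f \<in> arrs C" "src C (mn C f) = src C f" "tgt C (mn C f) = tgt C f"
  using mor_mn[OF assms] by auto

lemma neg_mn: "mor C f A B \<Longrightarrow> neg C A B f = mn C f"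
  by (auto simp: mn_def)

lemma add_assoc:
  assumes "f \<in> arrs C" "g \<in> arrs C" "h \<in> arrs C" "src C g = src C f" "tgt C g = tgt C f"
    "src C h = src C f" "tgt C h = tgt C f"
  shows "(f \<boxplus> g) \<boxplus> h = f \<boxplus> (g \<boxplus> h)"
proof -
  interpret G: comm_group "hom_group C (src C f) (tgt C f)" using hom_comm_group assms by auto
  show ?thesis using G.m_assoc[of f g h] assms by (simp add: hom_iff_mor)
qed

lemma add_comm:
  assumes "f \<in> arrs C" "g \<in> arrs C" "src C g = src C f" "tgt C g = tgt C f"
  shows "f \<boxplus> g = g \<boxplus> f"
proof -
  interpret G: comm_group "hom_group C (src C f) (tgt C f)" using hom_comm_group assms by auto
  show ?thesis using G.m_comm[of f g] assms by (simp add: hom_iff_mor)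
qed

lemma add_left_comm:
  assumes "f \<in> arrs C" "g \<in> arrs C" "h \<in> arrs C" "src C g = src C f" "tgt C g = tgt C f"
    "src C h = src C f" "tgt C h = tgt C f"
  shows "f \<boxplus> (g \<boxplus> h) = g \<boxplus> (f \<boxplus> h)"
proof -
  have "f \<boxplus> (g \<boxplus> h) = (f \<boxplus> g) \<boxplus> h" by (rule add_assoc[symmetric]) (use assms in simp_all)
  also have "\<dots> = (g \<boxplus> f) \<boxplus> h" using add_comm[of f g] assms by simp
  also have "\<dots> = g \<boxplus> (f \<boxplus> h)" by (rule add_assoc) (use assms in simp_all)
  finally show ?thesis .
qed

lemmas add_ac = add_assoc add_comm add_left_comm

lemma add_zero [simp]:
  assumes "f \<in> arrs C" "src C f = A" "tgt C f = B"
  shows "f \<boxplus> Zero C A B = f" "Zero C A B \<boxplus> f = f"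
proof -
  have o: "A \<in> Ob C" "B \<in> Ob C" using assms by auto
  interpret G: comm_group "hom_group C A B" using hom_comm_group o by auto
  show "f \<boxplus> Zero C A B = f" "Zero C A B \<boxplus> f = f"
    using G.r_one[of f] G.l_one[of f] assms o by (simp_all add: hom_iff_mor)
qed

lemma add_mn [simp]:
  assumes "f \<in> arrs C"
  shows "f \<boxplus> mn C f = Zero C (src C f) (tgt C f)" "mn C f \<boxplus> f = Zero C (src C f) (tgt C f)"
proof -
  interpret G: comm_group "hom_group C (src C f) (tgt C f)" using hom_comm_group assms by auto
  show "f \<boxplus> mn C f = Zero C (src C f) (tgt C f)" "mn C f \<boxplus> f = Zero C (src C f) (tgt C f)"
    using G.r_inv[of f] G.l_inv[of f] assms hom_iff_mor by (simp_all add: mn_def neg_def)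
qed

lemma add_left_cancel:
  assumes "f \<boxplus> g = f \<boxplus> h" "f \<in> arrs C" "g \<in> arrs C" "h \<in> arrs C"
    "src C g = src C f" "tgt C g = tgt C f" "src C h = src C f" "tgt C h = tgt C f"
  shows "g = h"
proof -
  interpret G: comm_group "hom_group C (src C f) (tgt C f)" using hom_comm_group assms by auto
  show ?thesis using G.Units_l_cancel[of f g h] assms by (simp add: hom_iff_mor G.Units_eq)
qed

lemma mn_unique:
  assumes "f \<boxplus> g = Zero C A B" "mor C f A B" "mor C g A B"
  shows "mn C f = g"
  by (rule add_left_cancel[of f]) (use assms in auto)

lemma mn_mn [simp]: "f \<in> arrs C \<Longrightarrow> mn C (mn C f) = f"
  by (rule mn_unique[where A = "src C f" and B = "tgt C f"]) simp_all

text \<open>A substitute for subtraction: a second parallel morphism is the first plus a correction,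
  the shape in which cosets of the ideal are described.\<close>

lemma difference:
  assumes "mor C f A B" "mor C g A B"
  obtains d where "mor C d A B" "g = f \<boxplus> d"
proof (rule that[of "mn C f \<boxplus> g"])
  show "g = f \<boxplus> (mn C f \<boxplus> g)" using assms by (simp add: add_assoc[symmetric])
qed (use assms in simp)

lemma distribs [simp]:
  assumes "f \<in> arrs C" "f' \<in> arrs C" "g \<in> arrs C" "src C f = src C f'" "tgt C f = tgt C f'"
  shows "src C g = tgt C f \<Longrightarrow> g \<cdot> (f \<boxplus> f') = (g \<cdot> f) \<boxplus> (g \<cdot> f')"
    and "tgt C g = src C f \<Longrightarrow> (f \<boxplus> f') \<cdot> g = (f \<cdot> g) \<boxplus> (f' \<cdot> g)"
proof -
  show "g \<cdot> (f \<boxplus> f') = (g \<cdot> f) \<boxplus> (g \<cdot> f')" if "src C g = tgt C f"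
    by (rule comp_add_right[of "src C f" "tgt C f" "tgt C g"]) (use assms that in \<open>auto simp: hom_iff_mor\<close>)
  show "(f \<boxplus> f') \<cdot> g = (f \<cdot> g) \<boxplus> (f' \<cdot> g)" if "tgt C g = src C f"
    by (rule comp_add_left[of "src C g" "tgt C g" "tgt C f"]) (use assms that in \<open>auto simp: hom_iff_mor\<close>)
qed

lemma comp_zero [simp]:
  assumes "g \<in> arrs C" "A \<in> Ob C" "B \<in> Ob C"
  shows "src C g = B \<Longrightarrow> g \<cdot> Zero C A B = Zero C A (tgt C g)"
    and "tgt C g = A \<Longrightarrow> Zero C A B \<cdot> g = Zero C (src C g) B"
proof -
  show "g \<cdot> Zero C A B = Zero C A (tgt C g)" if "src C g = B"
  proof (rule add_left_cancel[of "g \<cdot> Zero C A B"])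
    have "(g \<cdot> Zero C A B) \<boxplus> (g \<cdot> Zero C A B) = g \<cdot> (Zero C A B \<boxplus> Zero C A B)"
      by (rule distribs(1)[symmetric]) (use assms that in auto)
    then show "(g \<cdot> Zero C A B) \<boxplus> (g \<cdot> Zero C A B) = (g \<cdot> Zero C A B) \<boxplus> Zero C A (tgt C g)"
      using assms that by simp
  qed (use assms that in auto)
  show "Zero C A B \<cdot> g = Zero C (src C g) B" if "tgt C g = A"
  proof (rule add_left_cancel[of "Zero C A B \<cdot> g"])
    have "(Zero C A B \<cdot> g) \<boxplus> (Zero C A B \<cdot> g) = (Zero C A B \<boxplus> Zero C A B) \<cdot> g"
      by (rule distribs(2)[symmetric]) (use assms that in auto)
    then show "(Zero C A B \<cdot> g) \<boxplus> (Zero C A B \<cdot> g) = (Zero C A B \<cdot> g) \<boxplus> Zero C (src C g) B"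
      using assms that by simp
  qed (use assms that in auto)
qed

lemma comp_mn [simp]:
  assumes "f \<in> arrs C" "g \<in> arrs C" "src C g = tgt C f"
  shows "g \<cdot> mn C f = mn C (g \<cdot> f)" "mn C g \<cdot> f = mn C (g \<cdot> f)"
proof -
  have "(g \<cdot> f) \<boxplus> (g \<cdot> mn C f) = g \<cdot> (f \<boxplus> mn C f)"
    by (rule distribs(1)[symmetric]) (use assms in auto)
  then show "g \<cdot> mn C f = mn C (g \<cdot> f)"
    using assms by (intro mn_unique[symmetric, where A = "src C f" and B = "tgt C g"]) auto
  have "(g \<cdot> f) \<boxplus> (mn C g \<cdot> f) = (g \<boxplus> mn C g) \<cdot> f"
    by (rule distribs(2)[symmetric]) (use assms in auto)
  then show "mn C g \<cdot> f = mn C (g \<cdot> f)"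
    using assms by (intro mn_unique[symmetric, where A = "src C f" and B = "tgt C g"]) auto
qed

lemma mn_zero [simp]: "A \<in> Ob C \<Longrightarrow> B \<in> Ob C \<Longrightarrow> mn C (Zero C A B) = Zero C A B"
  by (rule mn_unique[where A = A and B = B]) simp_all

lemma biproduct_mor:
  "biproduct C A B P \<longleftrightarrow> A \<in> Ob C \<and> B \<in> Ob C \<and> P \<in> Ob C \<and>
     (\<exists>i1 i2 p1 p2. mor C i1 A P \<and> mor C i2 B P \<and> mor C p1 P A \<and> mor C p2 P B \<and>
        p1 \<cdot> i1 = Id C A \<and> p2 \<cdot> i2 = Id C B \<and> p1 \<cdot> i2 = Zero C B A \<and> p2 \<cdot> i1 = Zero C A B \<and>
        (i1 \<cdot> p1) \<boxplus> (i2 \<cdot> p2) = Id C P)"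
  (is "?l = ?r")
proof
  assume ?l
  then obtain i1 i2 p1 p2 where "A \<in> Ob C" "B \<in> Ob C" "P \<in> Ob C"
    "i1 \<in> Hom C A P" "i2 \<in> Hom C B P" "p1 \<in> Hom C P A" "p2 \<in> Hom C P B"
    "p1 \<cdot> i1 = Id C A" "p2 \<cdot> i2 = Id C B" "p1 \<cdot> i2 = Zero C B A" "p2 \<cdot> i1 = Zero C A B"
    "(i1 \<cdot> p1) \<boxplus> (i2 \<cdot> p2) = Id C P"
    unfolding biproduct_def by blast
  then show ?r by (simp add: hom_iff_mor) blast
next
  assume ?r
  then obtain i1 i2 p1 p2 where "A \<in> Ob C" "B \<in> Ob C" "P \<in> Ob C"
    "mor C i1 A P" "mor C i2 B P" "mor C p1 P A" "mor C p2 P B"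
    and e: "p1 \<cdot> i1 = Id C A" "p2 \<cdot> i2 = Id C B" "p1 \<cdot> i2 = Zero C B A" "p2 \<cdot> i1 = Zero C A B"
    "(i1 \<cdot> p1) \<boxplus> (i2 \<cdot> p2) = Id C P"
    by blast
  then have "A \<in> Ob C" "B \<in> Ob C" "P \<in> Ob C"
    "i1 \<in> Hom C A P" "i2 \<in> Hom C B P" "p1 \<in> Hom C P A" "p2 \<in> Hom C P B"
    by (simp_all add: hom_iff_mor)
  with e show ?l unfolding biproduct_def by blast
qed

end

section \<open>Opposite categories\<close>

lemma op_cat_simps [simp]:
  "Ob (op_cat C) = Ob C" "Hom (op_cat C) A B = Hom C B A" "Id (op_cat C) = Id C"
  "g \<cdot>\<^bsub>op_cat C\<^esub> f = f \<cdot>\<^bsub>C\<^esub> g" "Add (op_cat C) = Add C"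
  "Zero (op_cat C) A B = Zero C B A"
  by (simp_all add: op_cat_def)

lemma op_cat_src [simp]: "src (op_cat C) f = tgt C f" "tgt (op_cat C) f = src C f"
  "arrs (op_cat C) = arrs C"
  by (auto simp: src_def tgt_def arrs_def)

lemma op_cat_neg [simp]: "hom_group (op_cat C) A B = hom_group C B A"
   "neg (op_cat C) A B f = neg C B A f" "mn (op_cat C) f = mn C f"
  by (simp_all add: hom_group_def neg_def mn_def)

lemma op_cat_additive:
  assumes "additive_category C"
  shows "additive_category (op_cat C)"
proof -
  interpret additive_category C by fact
  show ?thesis
  proof (intro additive_category.intro preadditive_category.intro category.intro
      preadditive_category_axioms.intro additive_category_axioms.intro)
    show "\<exists>N. zero_object (op_cat C) N"
      using ex_zero_object by (auto simp: zero_object_def)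
    fix A B assume "A \<in> Ob (op_cat C)" "B \<in> Ob (op_cat C)"
    then obtain P where "biproduct C A B P" using ex_biproduct by auto
    then show "\<exists>P. biproduct (op_cat C) A B P" unfolding biproduct_def by (intro exI[of _ P]) auto
  next
    fix A B A' B' f
    assume "A \<in> Ob (op_cat C)" "B \<in> Ob (op_cat C)" "A' \<in> Ob (op_cat C)" "B' \<in> Ob (op_cat C)"
      "f \<in> Hom (op_cat C) A B" "f \<in> Hom (op_cat C) A' B'"
    then show "A = A' \<and> B = B'" using hom_disjoint[of B A B' A' f] by simp
  next
    fix A B D E f g h
    assume "A \<in> Ob (op_cat C)" "B \<in> Ob (op_cat C)" "D \<in> Ob (op_cat C)" "E \<in> Ob (op_cat C)"
      "f \<in> Hom (op_cat C) A B" "g \<in> Hom (op_cat C) B D" "h \<in> Hom (op_cat C) D E"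
    then show "(h \<cdot>\<^bsub>op_cat C\<^esub> g) \<cdot>\<^bsub>op_cat C\<^esub> f = h \<cdot>\<^bsub>op_cat C\<^esub> (g \<cdot>\<^bsub>op_cat C\<^esub> f)"
      using comp_assoc[of E D B A h g f] by simp
  next
    fix A B D f g g'
    assume "A \<in> Ob (op_cat C)" "B \<in> Ob (op_cat C)" "D \<in> Ob (op_cat C)"
      "f \<in> Hom (op_cat C) A B" "g \<in> Hom (op_cat C) B D" "g' \<in> Hom (op_cat C) B D"
    then show "(g \<boxplus>\<^bsub>op_cat C\<^esub> g') \<cdot>\<^bsub>op_cat C\<^esub> f = (g \<cdot>\<^bsub>op_cat C\<^esub> f) \<boxplus>\<^bsub>op_cat C\<^esub> (g' \<cdot>\<^bsub>op_cat C\<^esub> f)"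
      using comp_add_right[of D B A g g' f] by simp
  next
    fix A B D f f' g
    assume "A \<in> Ob (op_cat C)" "B \<in> Ob (op_cat C)" "D \<in> Ob (op_cat C)"
      "f \<in> Hom (op_cat C) A B" "f' \<in> Hom (op_cat C) A B" "g \<in> Hom (op_cat C) B D"
    then show "g \<cdot>\<^bsub>op_cat C\<^esub> (f \<boxplus>\<^bsub>op_cat C\<^esub> f') = (g \<cdot>\<^bsub>op_cat C\<^esub> f) \<boxplus>\<^bsub>op_cat C\<^esub> (g \<cdot>\<^bsub>op_cat C\<^esub> f')"
      using comp_add_left[of D B A g f f'] by simp
  next
    fix A B D f g
    assume "A \<in> Ob (op_cat C)" "B \<in> Ob (op_cat C)" "D \<in> Ob (op_cat C)"
      "f \<in> Hom (op_cat C) A B" "g \<in> Hom (op_cat C) B D"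
    then show "g \<cdot>\<^bsub>op_cat C\<^esub> f \<in> Hom (op_cat C) A D"
      using comp_in_hom[of D B A g f] by simp
  next
    fix A B assume "A \<in> Ob (op_cat C)" "B \<in> Ob (op_cat C)"
    then show "comm_group (hom_group (op_cat C) A B)" using hom_comm_group by simp
  qed (simp_all add: id_in_hom comp_id_right comp_id_left)
qed

section \<open>Ideal quotients\<close>

lemma ideal_quotient_simps [simp]:
  "Ob (ideal_quotient C X I) = X" "Hom (ideal_quotient C X I) A B = cls C I ` Hom C A B"
  "Id (ideal_quotient C X I) A = cls C I (Id C A)"
  "Zero (ideal_quotient C X I) A B = cls C I (Zero C A B)"
  by (simp_all add: ideal_quotient_def)

text \<open>In contrast to \<open>factors_through\<close>, the end objects are not parameters, so
  that membership in the ideal is a property of the arrow alone.\<close>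

definition null :: "('o, 'm, 'z) precategory_scheme \<Rightarrow> 'o set \<Rightarrow> 'm \<Rightarrow> bool" where
  "null C I k \<longleftrightarrow> (\<exists>p q. p \<in> arrs C \<and> q \<in> arrs C \<and> tgt C p \<in> I \<and> src C q = tgt C p \<and> k = q \<cdot>\<^bsub>C\<^esub> p)"

section \<open>The ideal of morphisms factoring through \<open>I\<close>, and its cosets\<close>

locale ideal_category = additive_category C
  for C :: "('o, 'm, 'z) precategory_scheme" (structure) +
  fixes I :: "'o set"
  assumes I_ob: "I \<subseteq> Ob C"
    and I_zero: "\<exists>N\<in>I. zero_object C N"
    and I_biproduct: "\<lbrakk>biproduct C A B J; A \<in> I; B \<in> I\<rbrakk> \<Longrightarrow> J \<in> I"
begin

lemma null_arr: "null C I k \<Longrightarrow> k \<in> arrs C"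
  unfolding null_def by auto

lemma nullE:
  assumes "null C I k"
  obtains p q where "p \<in> arrs C" "q \<in> arrs C" "tgt C p \<in> I" "src C q = tgt C p" "k = q \<cdot> p"
  using assms unfolding null_def by blast

lemma nullI: "\<lbrakk>mor C p A J; mor C q J B; J \<in> I\<rbrakk> \<Longrightarrow> null C I (q \<cdot> p)"
  unfolding null_def by metis

lemma null_comp_left: "\<lbrakk>null C I k; g \<in> arrs C; src C g = tgt C k\<rbrakk> \<Longrightarrow> null C I (g \<cdot> k)"
proof -
  assume h: "null C I k" "g \<in> arrs C" "src C g = tgt C k"
  obtain p q where k: "p \<in> arrs C" "q \<in> arrs C" "tgt C p \<in> I" "src C q = tgt C p" "k = q \<cdot> p"
    using h(1) by (rule nullE)
  then show ?thesis using h nullI[of p "src C p" "tgt C p" "g \<cdot> q" "tgt C g"] by simp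
qed

lemma null_comp_right: "\<lbrakk>null C I k; g \<in> arrs C; tgt C g = src C k\<rbrakk> \<Longrightarrow> null C I (k \<cdot> g)"
proof -
  assume h: "null C I k" "g \<in> arrs C" "tgt C g = src C k"
  obtain p q where k: "p \<in> arrs C" "q \<in> arrs C" "tgt C p \<in> I" "src C q = tgt C p" "k = q \<cdot> p"
    using h(1) by (rule nullE)
  then show ?thesis using h nullI[of "p \<cdot> g" "src C g" "tgt C p" q "tgt C q"] by simp
qed

lemma null_zero:
  assumes "A \<in> Ob C" "B \<in> Ob C"
  shows "null C I (Zero C A B)"
proof -
  obtain N where "N \<in> I" using I_zero by auto
  then show ?thesis using nullI[of "Zero C A N" A N "Zero C N B" B] assms I_ob by auto
qed

text \<open>The two intermediate objects are merged into their biproduct, through which the sum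
  factors as a row after a column.\<close>

lemma null_add:
  assumes "null C I k" "null C I k'" "src C k' = src C k" "tgt C k' = tgt C k"
  shows "null C I (k \<boxplus> k')"
proof -
  obtain p q where k: "p \<in> arrs C" "q \<in> arrs C" "tgt C p \<in> I" "src C q = tgt C p" "k = q \<cdot> p"
    using assms(1) by (rule nullE)
  obtain p' q' where k': "p' \<in> arrs C" "q' \<in> arrs C" "tgt C p' \<in> I" "src C q' = tgt C p'" "k' = q' \<cdot> p'"
    using assms(2) by (rule nullE)
  have e: "src C p' = src C p" "tgt C q' = tgt C q" using assms(3,4) k k' by simp_all
  obtain K where K: "biproduct C (tgt C p) (tgt C p') K" using ex_biproduct k k' tgt_ob by blast
  then obtain i1 i2 p1 p2 where b: "mor C i1 (tgt C p) K" "mor C i2 (tgt C p') K" "mor C p1 K (tgt C p)" "mor C p2 K (tgt C p')"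
    "p1 \<cdot> i1 = Id C (tgt C p)" "p2 \<cdot> i2 = Id C (tgt C p')" "p1 \<cdot> i2 = Zero C (tgt C p') (tgt C p)"
    "p2 \<cdot> i1 = Zero C (tgt C p) (tgt C p')"
    unfolding biproduct_mor by blast
  define a where "a = (i1 \<cdot> p) \<boxplus> (i2 \<cdot> p')"
  define c where "c = (q \<cdot> p1) \<boxplus> (q' \<cdot> p2)"
  have a: "mor C a (src C p) K" "mor C c K (tgt C q)" using k k' b e unfolding a_def c_def by simp_all
  have "p1 \<cdot> a = p" "p2 \<cdot> a = p'" unfolding a_def using k k' b e
    by (simp_all add: comp_reassoc[OF b(5)] comp_reassoc[OF b(6)] comp_reassoc[OF b(7)] comp_reassoc[OF b(8)])
  then have "c \<cdot> a = k \<boxplus> k'" unfolding c_def using a(1) k k' b e by simp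
  moreover have "K \<in> I" using K k k' I_biproduct by blast
  ultimately show ?thesis using nullI[OF a] by simp
qed

lemma null_mn: "null C I k \<Longrightarrow> null C I (mn C k)"
proof -
  assume h: "null C I k"
  obtain p q where k: "p \<in> arrs C" "q \<in> arrs C" "tgt C p \<in> I" "src C q = tgt C p" "k = q \<cdot> p"
    using h by (rule nullE)
  have "mn C k = mn C q \<cdot> p" using k by simp
  then show ?thesis using nullI[of p "src C p" "tgt C p" "mn C q" "tgt C q"] k by simp
qed

lemma factors_through_null:
  assumes "A \<in> Ob C" "B \<in> Ob C"
  shows "factors_through C I A B k \<longleftrightarrow> mor C k A B \<and> null C I k"
proof
  assume "factors_through C I A B k"
  then obtain J p q where "J \<in> I" "J \<in> Ob C" "p \<in> Hom C A J" "q \<in> Hom C J B" "k = q \<cdot> p"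
    unfolding factors_through_def using I_ob by blast
  then show "mor C k A B \<and> null C I k" using assms nullI[of p A J q B] by (simp add: hom_iff_mor)
next
  assume h: "mor C k A B \<and> null C I k"
  then have "null C I k" by blast
  then obtain p q where k: "p \<in> arrs C" "q \<in> arrs C" "tgt C p \<in> I" "src C q = tgt C p" "k = q \<cdot> p"
    by (rule nullE)
  then have "p \<in> Hom C A (tgt C p)" "q \<in> Hom C (tgt C p) B" using h by (auto intro!: mor_hom)
  then show "factors_through C I A B k" unfolding factors_through_def using k by blast
qed

lemma cls_iff: "g \<in> cls C I f \<longleftrightarrow>
   f \<in> arrs C \<and> (\<exists>k. null C I k \<and> src C k = src C f \<and> tgt C k = tgt C f \<and> g = f \<boxplus> k)"
proof
  assume "g \<in> cls C I f"
  then obtain A B k where h: "A \<in> Ob C" "B \<in> Ob C" "f \<in> Hom C A B" "factors_through C I A B k" "g = f \<boxplus> k"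
    unfolding cls_def by blast
  then show "f \<in> arrs C \<and> (\<exists>k. null C I k \<and> src C k = src C f \<and> tgt C k = tgt C f \<and> g = f \<boxplus> k)"
    using factors_through_null[of A B k] by (auto simp: hom_iff_mor)
next
  assume "f \<in> arrs C \<and> (\<exists>k. null C I k \<and> src C k = src C f \<and> tgt C k = tgt C f \<and> g = f \<boxplus> k)"
  then show "g \<in> cls C I f"
    unfolding cls_def using factors_through_null[of "src C f" "tgt C f"] arrs_hom null_arr
    by (intro CollectI bexI[of _ "src C f"] bexI[of _ "tgt C f"]) auto
qed

lemma cls_self: "f \<in> arrs C \<Longrightarrow> f \<in> cls C I f"
  unfolding cls_iff using null_zero[of "src C f" "tgt C f"] by (intro conjI exI[of _ "Zero C (src C f) (tgt C f)"]) auto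

lemma cls_mem: "\<lbrakk>g \<in> cls C I f; f \<in> arrs C\<rbrakk> \<Longrightarrow> mor C g (src C f) (tgt C f)"
  unfolding cls_iff using null_arr by auto

lemma cls_eqI:
  assumes "null C I k" "f \<in> arrs C" "src C k = src C f" "tgt C k = tgt C f"
  shows "cls C I (f \<boxplus> k) = cls C I f"
proof -
  have k: "k \<in> arrs C" using assms null_arr by blast
  have "g \<in> cls C I f" if g: "g \<in> cls C I (f \<boxplus> k)" for g
  proof -
    obtain l where l: "null C I l" "src C l = src C f" "tgt C l = tgt C f" "g = (f \<boxplus> k) \<boxplus> l"
      using g assms k unfolding cls_iff by auto
    then have "g = f \<boxplus> (k \<boxplus> l)" using assms k null_arr[OF l(1)] by (simp add: add_assoc)
    then show ?thesis unfolding cls_iff using assms k l null_add[of k l] null_arr[OF l(1)]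
      by (intro conjI exI[of _ "k \<boxplus> l"]) auto
  qed
  moreover have "g \<in> cls C I (f \<boxplus> k)" if g: "g \<in> cls C I f" for g
  proof -
    obtain l where l: "null C I l" "src C l = src C f" "tgt C l = tgt C f" "g = f \<boxplus> l"
      using g unfolding cls_iff by blast
    have "g = (f \<boxplus> k) \<boxplus> (mn C k \<boxplus> l)"
    proof -
      have "k \<boxplus> (mn C k \<boxplus> l) = l"
        using k null_arr[OF l(1)] l assms by (simp add: add_assoc[symmetric])
      then show ?thesis using k null_arr[OF l(1)] l assms by (simp add: add_assoc)
    qed
    then show ?thesis unfolding cls_iff using assms k l null_add[of "mn C k" l] null_mn null_arr[OF l(1)]
      by (intro conjI exI[of _ "mn C k \<boxplus> l"]) auto
  qed
  ultimately show ?thesis by blast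
qed

lemma cls_eq_iff:
  assumes "f \<in> arrs C"
  shows "cls C I f = cls C I g \<longleftrightarrow>
    (\<exists>k. null C I k \<and> src C k = src C f \<and> tgt C k = tgt C f \<and> g = f \<boxplus> k)"
proof
  assume e: "cls C I f = cls C I g"
  have "f \<in> cls C I g" using e cls_self[OF assms] by simp
  then have "g \<in> arrs C" unfolding cls_iff by blast
  then have "g \<in> cls C I f" using e cls_self by blast
  then show "\<exists>k. null C I k \<and> src C k = src C f \<and> tgt C k = tgt C f \<and> g = f \<boxplus> k"
    unfolding cls_iff by blast
qed (use assms cls_eqI in auto)

lemma cls_eqE:
  assumes "cls C I f = cls C I g" "f \<in> arrs C"
  obtains k where "null C I k" "src C k = src C f" "tgt C k = tgt C f" "k \<in> arrs C" "g = f \<boxplus> k"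
  using assms cls_eq_iff null_arr by blast

lemma cls_of_mem: "g \<in> cls C I f \<Longrightarrow> cls C I g = cls C I f"
  using cls_eqI unfolding cls_iff by auto

text \<open>Expanding the composite of two perturbed representatives leaves, besides
  \<open>g \<cdot> f\<close>, only terms with a null factor.\<close>

lemma cls_comp_cong:
  assumes "cls C I f = cls C I f'" "cls C I g = cls C I g'" "f \<in> arrs C" "g \<in> arrs C" "src C g = tgt C f"
  shows "cls C I (g \<cdot> f) = cls C I (g' \<cdot> f')"
proof -
  obtain k where k: "null C I k" "src C k = src C f" "tgt C k = tgt C f" "k \<in> arrs C" "f' = f \<boxplus> k"
    using assms(1,3) by (rule cls_eqE)
  obtain l where l: "null C I l" "src C l = src C g" "tgt C l = tgt C g" "l \<in> arrs C" "g' = g \<boxplus> l"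
    using assms(2,4) by (rule cls_eqE)
  have "cls C I (g' \<cdot> f') = cls C I ((g' \<cdot> f) \<boxplus> (g' \<cdot> k))" using k l assms by simp
  also have "\<dots> = cls C I (g' \<cdot> f)"
    by (rule cls_eqI) (use k l assms null_comp_left[of k g'] in simp_all)
  also have "\<dots> = cls C I ((g \<cdot> f) \<boxplus> (l \<cdot> f))" using k l assms by simp
  also have "\<dots> = cls C I (g \<cdot> f)"
    by (rule cls_eqI) (use k l assms null_comp_right[of l f] in simp_all)
  finally show ?thesis ..
qed

lemma cls_add_cong:
  assumes "cls C I f = cls C I f'" "cls C I g = cls C I g'" "f \<in> arrs C" "g \<in> arrs C"
    "src C g = src C f" "tgt C g = tgt C f"
  shows "cls C I (f \<boxplus> g) = cls C I (f' \<boxplus> g')"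
proof -
  obtain k where k: "null C I k" "src C k = src C f" "tgt C k = tgt C f" "k \<in> arrs C" "f' = f \<boxplus> k"
    using assms(1,3) by (rule cls_eqE)
  obtain l where l: "null C I l" "src C l = src C g" "tgt C l = tgt C g" "l \<in> arrs C" "g' = g \<boxplus> l"
    using assms(2,4) by (rule cls_eqE)
  have "f' \<boxplus> g' = (f \<boxplus> g) \<boxplus> (k \<boxplus> l)" using k l assms by (simp add: add_ac)
  moreover have "cls C I ((f \<boxplus> g) \<boxplus> (k \<boxplus> l)) = cls C I (f \<boxplus> g)"
    by (rule cls_eqI) (use k l assms null_add in auto)
  ultimately show ?thesis by simp
qed

section \<open>The structure of the quotient category\<close>

abbreviation Q where "Q \<equiv> ideal_quotient C (Ob C) I"

text \<open>The union that defines composition ranges over all pairs of representatives. By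
  congruence its members are one and the same class, and it is not empty because each arrow lies in
  its own class.\<close>

lemma quotient_comp:
  assumes "f \<in> arrs C" "g \<in> arrs C" "src C g = tgt C f"
  shows "Comp (ideal_quotient C X I) (cls C I g) (cls C I f) = cls C I (g \<cdot> f)"
proof -
  have "Comp (ideal_quotient C X I) (cls C I g) (cls C I f) =
     (\<Union>g'\<in>cls C I g. \<Union>f'\<in>cls C I f. cls C I (g' \<cdot> f'))"
    by (simp add: ideal_quotient_def)
  also have "\<dots> = (\<Union>g'\<in>cls C I g. \<Union>f'\<in>cls C I f. cls C I (g \<cdot> f))"
    using assms by (intro SUP_cong refl cls_comp_cong cls_of_mem) (simp_all add: cls_mem)
  also have "\<dots> = cls C I (g \<cdot> f)" using cls_self assms by auto
  finally show ?thesis .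
qed

lemma quotient_add:
  assumes "f \<in> arrs C" "g \<in> arrs C" "src C g = src C f" "tgt C g = tgt C f"
  shows "Add (ideal_quotient C X I) (cls C I f) (cls C I g) = cls C I (f \<boxplus> g)"
proof -
  have "Add (ideal_quotient C X I) (cls C I f) (cls C I g) =
     (\<Union>f'\<in>cls C I f. \<Union>g'\<in>cls C I g. cls C I (f' \<boxplus> g'))"
    by (simp add: ideal_quotient_def)
  also have "\<dots> = (\<Union>f'\<in>cls C I f. \<Union>g'\<in>cls C I g. cls C I (f \<boxplus> g))"
    using assms by (intro SUP_cong refl cls_add_cong cls_of_mem) (simp_all add: cls_mem)
  also have "\<dots> = cls C I (f \<boxplus> g)" using cls_self assms by auto
  finally show ?thesis .
qed

lemma quotient_preadditive:
  assumes X: "X \<subseteq> Ob C"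
  shows "preadditive_category (ideal_quotient C X I)"
proof (intro preadditive_category.intro category.intro preadditive_category_axioms.intro, goal_cases)
  case (1 A B A' B' F)
  then obtain f f' where "f \<in> Hom C A B" "f' \<in> Hom C A' B'" "F = cls C I f" "F = cls C I f'" by auto
  moreover have "A \<in> Ob C" "B \<in> Ob C" "A' \<in> Ob C" "B' \<in> Ob C" using 1 X by auto
  ultimately have "mor C f A B" "mor C f' A' B'" "f \<in> cls C I f'"
    using cls_self[of f] by (auto simp: hom_iff_mor)
  then show ?case using cls_mem[of f f'] by auto
next
  case (2 A) then show ?case using X id_in_hom by auto
next
  case (3 A B D F G)
  then obtain f g where "f \<in> Hom C A B" "F = cls C I f" "g \<in> Hom C B D" "G = cls C I g" by auto
  then show ?case using 3 X comp_in_hom by (auto simp: quotient_comp hom_iff_mor subset_iff)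
next
  case (4 A B F)
  then obtain f where "f \<in> Hom C A B" "F = cls C I f" by auto
  then show ?case using 4 X by (auto simp: quotient_comp hom_iff_mor subset_iff)
next
  case (5 A B F)
  then obtain f where "f \<in> Hom C A B" "F = cls C I f" by auto
  then show ?case using 5 X by (auto simp: quotient_comp hom_iff_mor subset_iff)
next
  case (6 A B D E F G H)
  then obtain f g h where "f \<in> Hom C A B" "F = cls C I f" "g \<in> Hom C B D" "G = cls C I g"
    "h \<in> Hom C D E" "H = cls C I h" by auto
  then show ?case using 6 X by (auto simp: quotient_comp hom_iff_mor subset_iff)
next
  case (7 A B)
  then have o: "A \<in> Ob C" "B \<in> Ob C" using X by auto
  let ?Q = "ideal_quotient C X I"
  have q: "\<exists>f. mor C f A B \<and> F = cls C I f" if "F \<in> carrier (hom_group ?Q A B)" for F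
    using that o by (auto simp: hom_iff_mor hom_group_def)
  have c: "cls C I f \<in> carrier (hom_group ?Q A B)" if "mor C f A B" for f
    using that o by (simp add: hom_iff_mor hom_group_def)
  have m: "x \<otimes>\<^bsub>hom_group ?Q A B\<^esub> y = Add ?Q x y" for x y by (simp add: hom_group_def)
  have z: "\<one>\<^bsub>hom_group ?Q A B\<^esub> = cls C I (Zero C A B)" by (simp add: hom_group_def)
  show ?case
  proof (rule comm_groupI; (unfold m z)?)
    show "cls C I (Zero C A B) \<in> carrier (hom_group ?Q A B)" using o by (intro c) simp
  next
    fix F assume "F \<in> carrier (hom_group ?Q A B)"
    then obtain f where f: "mor C f A B" "F = cls C I f" using q by blast
    then show "\<exists>y\<in>carrier (hom_group ?Q A B). Add ?Q y F = cls C I (Zero C A B)"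
      by (intro bexI[of _ "cls C I (mn C f)"] c) (simp_all add: quotient_add)
    show "Add ?Q (cls C I (Zero C A B)) F = F" using f by (simp add: quotient_add)
  next
    fix F G assume "F \<in> carrier (hom_group ?Q A B)" "G \<in> carrier (hom_group ?Q A B)"
    then obtain f g where f: "mor C f A B" "F = cls C I f" and g: "mor C g A B" "G = cls C I g" using q by blast
    show "Add ?Q F G = Add ?Q G F" using f g by (simp add: quotient_add add_comm)
    have "cls C I (f \<boxplus> g) \<in> carrier (hom_group ?Q A B)" using f g by (intro c) simp
    then show "Add ?Q F G \<in> carrier (hom_group ?Q A B)" using f g by (simp add: quotient_add)
    fix H assume "H \<in> carrier (hom_group ?Q A B)"
    then obtain h where h: "mor C h A B" "H = cls C I h" using q by blast
    show "Add ?Q (Add ?Q F G) H = Add ?Q F (Add ?Q G H)" using f g h by (simp add: quotient_add add_assoc)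
  qed
next
  case (8 A B D F G G')
  then obtain f g g' where "f \<in> Hom C A B" "F = cls C I f" "g \<in> Hom C B D" "G = cls C I g"
    "g' \<in> Hom C B D" "G' = cls C I g'" by auto
  then show ?case using 8 X by (auto simp: quotient_comp quotient_add hom_iff_mor subset_iff)
next
  case (9 A B D F F' G)
  then obtain f g f' where "f \<in> Hom C A B" "F = cls C I f" "g \<in> Hom C B D" "G = cls C I g"
    "f' \<in> Hom C A B" "F' = cls C I f'" by auto
  then show ?case using 9 X by (auto simp: quotient_comp quotient_add hom_iff_mor subset_iff)
qed

lemma quotient_arr:
  assumes X: "X \<subseteq> Ob C"
  shows "mor (ideal_quotient C X I) F A B \<longleftrightarrow> A \<in> X \<and> B \<in> X \<and> (\<exists>f. mor C f A B \<and> F = cls C I f)"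
proof -
  interpret D: preadditive_category "ideal_quotient C X I" using quotient_preadditive[OF X] .
  have "mor (ideal_quotient C X I) F A B \<longleftrightarrow> A \<in> X \<and> B \<in> X \<and> F \<in> cls C I ` Hom C A B"
    using D.hom_iff_mor[of A B F] by auto
  also have "\<dots> \<longleftrightarrow> A \<in> X \<and> B \<in> X \<and> (\<exists>f. mor C f A B \<and> F = cls C I f)"
    using X by (auto simp: hom_iff_mor subset_iff)
  finally show ?thesis .
qed

lemma quotient_cls:
  assumes X: "X \<subseteq> Ob C" and "f \<in> arrs C" "src C f \<in> X" "tgt C f \<in> X"
  shows "cls C I f \<in> arrs (ideal_quotient C X I)"
    "src (ideal_quotient C X I) (cls C I f) = src C f"
    "tgt (ideal_quotient C X I) (cls C I f) = tgt C f"
  using quotient_arr[OF X, of "cls C I f" "src C f" "tgt C f"] assms(2-) by auto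

lemma quotient_mn:
  assumes X: "X \<subseteq> Ob C" and "f \<in> arrs C" "src C f \<in> X" "tgt C f \<in> X"
  shows "mn (ideal_quotient C X I) (cls C I f) = cls C I (mn C f)"
proof -
  interpret D: preadditive_category "ideal_quotient C X I" using quotient_preadditive[OF X] .
  show ?thesis
    by (rule D.mn_unique[where A = "src C f" and B = "tgt C f"])
       (use assms in \<open>simp_all add: quotient_cls quotient_add\<close>)
qed

lemma quotient_iso:
  assumes X: "X \<subseteq> Ob C" and "mor C f A B" "mor C g B A" "A \<in> X" "B \<in> X"
    "cls C I (g \<cdot> f) = cls C I (Id C A)" "cls C I (f \<cdot> g) = cls C I (Id C B)"
  shows "iso_in (ideal_quotient C X I) A B (cls C I f)"
proof -
  interpret D: preadditive_category "ideal_quotient C X I" using quotient_preadditive[OF X] .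
  show ?thesis
    by (rule D.iso_inI[where g = "cls C I g"])
       (use assms in \<open>simp_all add: quotient_cls quotient_comp\<close>)
qed

text \<open>Composites and sums are computed on representatives, so the equations of a biproduct in
  \<C> survive in the quotient; the zero object is taken from \<open>I\<close>.\<close>

lemma quotient_additive:
  assumes X: "X \<subseteq> Ob C" and IX: "I \<subseteq> X"
    and b: "\<And>A B P. \<lbrakk>biproduct C A B P; A \<in> X; B \<in> X\<rbrakk> \<Longrightarrow> P \<in> X"
  shows "additive_category (ideal_quotient C X I)"
proof -
  interpret D: preadditive_category "ideal_quotient C X I" using quotient_preadditive[OF X] .
  show ?thesis
  proof
    obtain N where N: "N \<in> I" "zero_object C N" using I_zero by blast
    then have "zero_object (ideal_quotient C X I) N"
      using X IX unfolding zero_object_def by auto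
    then show "\<exists>N. zero_object (ideal_quotient C X I) N" ..
  next
    fix A B assume h: "A \<in> Ob (ideal_quotient C X I)" "B \<in> Ob (ideal_quotient C X I)"
    then have "A \<in> Ob C" "B \<in> Ob C" using X by auto
    then obtain P where P: "biproduct C A B P" using ex_biproduct by blast
    have AX: "A \<in> X" "B \<in> X" "P \<in> X" using h b[OF P] by auto
    obtain i1 i2 p1 p2 where m: "mor C i1 A P" "mor C i2 B P" "mor C p1 P A" "mor C p2 P B"
      and e: "p1 \<cdot> i1 = Id C A" "p2 \<cdot> i2 = Id C B" "p1 \<cdot> i2 = Zero C B A" "p2 \<cdot> i1 = Zero C A B"
        "(i1 \<cdot> p1) \<boxplus> (i2 \<cdot> p2) = Id C P"
      using P unfolding biproduct_mor by blast
    have "biproduct (ideal_quotient C X I) A B P"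
      unfolding D.biproduct_mor
      by (intro conjI exI[of _ "cls C I i1"] exI[of _ "cls C I i2"] exI[of _ "cls C I p1"] exI[of _ "cls C I p2"])
         (use m e AX X in \<open>simp_all add: quotient_cls quotient_comp quotient_add\<close>)
    then show "\<exists>P. biproduct (ideal_quotient C X I) A B P" ..
  qed
qed

end

section \<open>Quotients and subcategories under passage to the opposite category\<close>

lemma op_cls: "category C \<Longrightarrow> cls (op_cat C) I f = cls C I f"
proof -
  have "factors_through (op_cat C) I A B k \<longleftrightarrow> factors_through C I B A k" for A B k
    unfolding factors_through_def by auto
  then show ?thesis unfolding cls_def by auto
qed

text \<open>This is an equality of records rather than an isomorphism, so results about the quotient
  of the opposite category carry over to the opposite of the quotient by mere rewriting.\<close>

lemma op_ideal_quotient: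
  assumes "category C"
  shows "op_cat (ideal_quotient C X I) = ideal_quotient (op_cat C) X I"
proof -
  have "(\<lambda>G F. \<Union>g\<in>F. \<Union>f\<in>G. cls C I (g \<cdot>\<^bsub>C\<^esub> f)) = (\<lambda>G F. \<Union>g\<in>G. \<Union>f\<in>F. cls C I (f \<cdot>\<^bsub>C\<^esub> g))"
    by (intro ext) auto
  then show ?thesis
    using assms by (subst op_cat_def) (simp add: ideal_quotient_def op_cls)
qed

lemma op_biproduct: "biproduct (op_cat C) A B P \<longleftrightarrow> biproduct C A B P"
  unfolding biproduct_def by auto

lemma op_iso: "iso_in (op_cat C) A B f \<longleftrightarrow> iso_in C B A f"
  unfolding iso_in_def by auto

text \<open>Only closure under isomorphisms changes direction, and passing to inverse isomorphisms
  restores it.\<close>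

lemma op_additive_subcategory: 
  assumes "category C"
  shows "additive_subcategory (op_cat C) X \<longleftrightarrow> additive_subcategory C X"
proof -
  have "(\<forall>A B f. iso_in C B A f \<longrightarrow> A \<in> X \<longrightarrow> B \<in> X) \<longleftrightarrow> (\<forall>A B f. iso_in C A B f \<longrightarrow> A \<in> X \<longrightarrow> B \<in> X)"
    unfolding iso_in_def by blast
  moreover have "zero_object (op_cat C) N \<longleftrightarrow> zero_object C N" for N
    unfolding zero_object_def by auto
  ultimately show ?thesis
    unfolding additive_subcategory_def op_biproduct op_iso by simp
qed

section \<open>Right triangulations presented by model triangles\<close>

lemma additive_functor_simps:
  assumes F: "additive_functor C D F" and "preadditive_category C" "preadditive_category D"
  shows "A \<in> Ob C \<Longrightarrow> on_ob F A \<in> Ob D"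
    and "A \<in> Ob C \<Longrightarrow> on_hom F (Id C A) = Id D (on_ob F A)"
    and "f \<in> arrs C \<Longrightarrow> on_hom F f \<in> arrs D"
    and "f \<in> arrs C \<Longrightarrow> src D (on_hom F f) = on_ob F (src C f)"
    and "f \<in> arrs C \<Longrightarrow> tgt D (on_hom F f) = on_ob F (tgt C f)"
    and "\<lbrakk>f \<in> arrs C; g \<in> arrs C; src C g = tgt C f\<rbrakk> \<Longrightarrow> on_hom F (g \<cdot>\<^bsub>C\<^esub> f) = on_hom F g \<cdot>\<^bsub>D\<^esub> on_hom F f"
    and "\<lbrakk>f \<in> arrs C; g \<in> arrs C; src C g = src C f; tgt C g = tgt C f\<rbrakk> \<Longrightarrow>
      on_hom F (f \<boxplus>\<^bsub>C\<^esub> g) = on_hom F f \<boxplus>\<^bsub>D\<^esub> on_hom F g"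
    and "f \<in> arrs C \<Longrightarrow> on_hom F (mn C f) = mn D (on_hom F f)"
    and "\<lbrakk>A \<in> Ob C; B \<in> Ob C\<rbrakk> \<Longrightarrow> on_hom F (Zero C A B) = Zero D (on_ob F A) (on_ob F B)"
proof -
  interpret C: preadditive_category C by fact
  interpret D: preadditive_category D by fact
  note d = F[unfolded additive_functor_def]
  show ob: "on_ob F A \<in> Ob D" if "A \<in> Ob C" for A using d that by blast
  show "on_hom F (Id C A) = Id D (on_ob F A)" if "A \<in> Ob C" for A using d that by blast
  have m: "mor D (on_hom F f) (on_ob F (src C f)) (on_ob F (tgt C f))" if "f \<in> arrs C" for f
  proof -
    have "on_hom F f \<in> Hom D (on_ob F (src C f)) (on_ob F (tgt C f))"
      using d C.arrs_hom[OF that] that C.src_ob C.tgt_ob by blast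
    then show ?thesis using D.hom_iff_mor ob that by simp
  qed
  show "f \<in> arrs C \<Longrightarrow> on_hom F f \<in> arrs D"
    "f \<in> arrs C \<Longrightarrow> src D (on_hom F f) = on_ob F (src C f)"
    "f \<in> arrs C \<Longrightarrow> tgt D (on_hom F f) = on_ob F (tgt C f)" for f using m by auto
  show "on_hom F (g \<cdot>\<^bsub>C\<^esub> f) = on_hom F g \<cdot>\<^bsub>D\<^esub> on_hom F f"
    if "f \<in> arrs C" "g \<in> arrs C" "src C g = tgt C f" for f g
    using d C.arrs_hom[OF that(1)] C.arrs_hom[OF that(2)] C.src_ob[OF that(1)] C.tgt_ob[OF that(1)] C.tgt_ob[OF that(2)]
    unfolding that(3) by blast
  show add: "on_hom F (f \<boxplus>\<^bsub>C\<^esub> g) = on_hom F f \<boxplus>\<^bsub>D\<^esub> on_hom F g"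
    if "f \<in> arrs C" "g \<in> arrs C" "src C g = src C f" "tgt C g = tgt C f" for f g
    using d C.arrs_hom[OF that(1)] C.arrs_hom[OF that(2)] C.src_ob[OF that(1)] C.tgt_ob[OF that(1)]
    unfolding that(3,4) by blast
  \<comment> \<open>The image of zero is its own double, and in the target group only zero has this
    property.\<close>
  show z: "on_hom F (Zero C A B) = Zero D (on_ob F A) (on_ob F B)" if "A \<in> Ob C" "B \<in> Ob C" for A B
  proof (rule D.add_left_cancel[of "on_hom F (Zero C A B)"])
    show "on_hom F (Zero C A B) \<boxplus>\<^bsub>D\<^esub> on_hom F (Zero C A B) =
        on_hom F (Zero C A B) \<boxplus>\<^bsub>D\<^esub> Zero D (on_ob F A) (on_ob F B)"
      using add[of "Zero C A B" "Zero C A B"] m[of "Zero C A B"] that by simp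
  qed (use m[of "Zero C A B"] that in auto)
  show "on_hom F (mn C f) = mn D (on_hom F f)" if "f \<in> arrs C" for f
    by (rule D.mn_unique[symmetric, where A = "on_ob F (src C f)" and B = "on_ob F (tgt C f)"])
       (use add[of f "mn C f"] z[of "src C f" "tgt C f"] m[of f] m[of "mn C f"] that in auto)
qed

section \<open>Triangles over an additive endofunctor\<close>

locale suspended_category = additive_category C
  for C :: "('o, 'm, 'z) precategory_scheme" (structure) +
  fixes Sg :: "('o, 'm, 'o, 'm) functor_data"
  assumes Sg_additive: "additive_functor C C Sg"
begin

lemmas Sg_simps [simp] =
  additive_functor_simps[OF Sg_additive preadditive_category_axioms preadditive_category_axioms]

lemma right_triangle_iff:
  "right_triangle C Sg (A, B, X, f, g, h) \<longleftrightarrow> mor C f A B \<and> mor C g B X \<and> mor C h X (on_ob Sg A)"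
  unfolding right_triangle_def using hom_iff_mor[of A B f] hom_iff_mor[of B X g] hom_iff_mor[of X "on_ob Sg A" h]
  by auto

lemma tri_mor_iff:
  assumes "right_triangle C Sg (A, B, X, f, g, h)" "right_triangle C Sg (A', B', X', f', g', h')"
  shows "tri_mor C Sg (A, B, X, f, g, h) (A', B', X', f', g', h') a b c \<longleftrightarrow>
    mor C a A A' \<and> mor C b B B' \<and> mor C c X X' \<and>
    b \<cdot> f = f' \<cdot> a \<and> c \<cdot> g = g' \<cdot> b \<and> on_hom Sg a \<cdot> h = h' \<cdot> c"
  using assms hom_iff_mor[of A A' a] hom_iff_mor[of B B' b] hom_iff_mor[of X X' c]
  unfolding tri_mor_def right_triangle_iff by auto

lemma tri_mor_comp:
  assumes "right_triangle C Sg t" "right_triangle C Sg t'" "right_triangle C Sg t''"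
    and "tri_mor C Sg t t' a b c" "tri_mor C Sg t' t'' a' b' c'"
  shows "tri_mor C Sg t t'' (a' \<cdot> a) (b' \<cdot> b) (c' \<cdot> c)"
proof -
  obtain A B X f g h where t: "t = (A, B, X, f, g, h)" by (cases t)
  obtain A' B' X' f' g' h' where t': "t' = (A', B', X', f', g', h')" by (cases t')
  obtain A'' B'' X'' f'' g'' h'' where t'': "t'' = (A'', B'', X'', f'', g'', h'')" by (cases t'')
  note w = assms(1-3)[unfolded t t' t'']
  note m = assms(4,5)[unfolded t t' t'' tri_mor_iff[OF w(1,2)] tri_mor_iff[OF w(2,3)]]
  note w' = w[unfolded right_triangle_iff]
  have "(b' \<cdot> b) \<cdot> f = b' \<cdot> (f' \<cdot> a)" using m w' by simp
  also have "\<dots> = (b' \<cdot> f') \<cdot> a" using m w' by (intro comp_assoc'[symmetric]) auto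
  finally have 1: "(b' \<cdot> b) \<cdot> f = f'' \<cdot> (a' \<cdot> a)" using m w' by simp
  have "(c' \<cdot> c) \<cdot> g = c' \<cdot> (g' \<cdot> b)" using m w' by simp
  also have "\<dots> = (c' \<cdot> g') \<cdot> b" using m w' by (intro comp_assoc'[symmetric]) auto
  finally have 2: "(c' \<cdot> c) \<cdot> g = g'' \<cdot> (b' \<cdot> b)" using m w' by simp
  have "on_hom Sg (a' \<cdot> a) \<cdot> h = on_hom Sg a' \<cdot> (h' \<cdot> c)" using m w' by simp
  also have "\<dots> = (on_hom Sg a' \<cdot> h') \<cdot> c" using m w' by (intro comp_assoc'[symmetric]) auto
  finally have 3: "on_hom Sg (a' \<cdot> a) \<cdot> h = h'' \<cdot> (c' \<cdot> c)" using m w' by simp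
  show ?thesis unfolding t t'' tri_mor_iff[OF w(1,3)] using m w' 1 2 3 by simp
qed

text \<open>The inverse components again form a morphism of triangles: each square is conjugated by
  the isomorphisms at its corners.\<close>

lemma tri_isoE:
  assumes "tri_iso C Sg (A, B, X, f, g, h) (A', B', X', f', g', h')"
    "right_triangle C Sg (A, B, X, f, g, h)" "right_triangle C Sg (A', B', X', f', g', h')"
  obtains a b c a' b' c' where
    "tri_mor C Sg (A, B, X, f, g, h) (A', B', X', f', g', h') a b c"
    "tri_mor C Sg (A', B', X', f', g', h') (A, B, X, f, g, h) a' b' c'"
    "mor C a A A'" "mor C a' A' A" "a' \<cdot> a = Id C A" "a \<cdot> a' = Id C A'"
    "mor C b B B'" "mor C b' B' B" "b' \<cdot> b = Id C B" "b \<cdot> b' = Id C B'"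
    "mor C c X X'" "mor C c' X' X" "c' \<cdot> c = Id C X" "c \<cdot> c' = Id C X'"
proof -
  obtain a b c where t: "tri_mor C Sg (A, B, X, f, g, h) (A', B', X', f', g', h') a b c"
    and i: "iso_in C A A' a" "iso_in C B B' b" "iso_in C X X' c"
    using assms(1) unfolding tri_iso_def by auto
  obtain a' where a: "mor C a A A'" "mor C a' A' A" "a' \<cdot> a = Id C A" "a \<cdot> a' = Id C A'"
    using i(1) by (rule iso_inE)
  obtain b' where b: "mor C b B B'" "mor C b' B' B" "b' \<cdot> b = Id C B" "b \<cdot> b' = Id C B'"
    using i(2) by (rule iso_inE)
  obtain c' where c: "mor C c X X'" "mor C c' X' X" "c' \<cdot> c = Id C X" "c \<cdot> c' = Id C X'"
    using i(3) by (rule iso_inE)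
  note m = t[unfolded tri_mor_iff[OF assms(2,3)]]
  note w = assms(2,3)[unfolded right_triangle_iff]
  have s: "on_hom Sg a' \<cdot> on_hom Sg a = Id C (on_ob Sg A)"
    using arg_cong[OF a(3), of "on_hom Sg"] a(1,2) by simp
  have 1: "b' \<cdot> f' = f \<cdot> a'"
  proof -
    have "b' \<cdot> f' = b' \<cdot> ((f' \<cdot> a) \<cdot> a')" using a b w by simp
    also have "\<dots> = b' \<cdot> ((b \<cdot> f) \<cdot> a')" using m by simp
    also have "\<dots> = (b' \<cdot> b) \<cdot> (f \<cdot> a')" using a(1,2) b(1,2) w by simp
    finally show ?thesis using a b w by simp
  qed
  have 2: "c' \<cdot> g' = g \<cdot> b'"
  proof -
    have "c' \<cdot> g' = c' \<cdot> ((g' \<cdot> b) \<cdot> b')" using b c w by simp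
    also have "\<dots> = c' \<cdot> ((c \<cdot> g) \<cdot> b')" using m by simp
    also have "\<dots> = (c' \<cdot> c) \<cdot> (g \<cdot> b')" using c(1,2) b(1,2) w by simp
    finally show ?thesis using c b w by simp
  qed
  have 3: "on_hom Sg a' \<cdot> h' = h \<cdot> c'"
  proof -
    have "on_hom Sg a' \<cdot> h' = on_hom Sg a' \<cdot> ((h' \<cdot> c) \<cdot> c')" using c a w by simp
    also have "\<dots> = on_hom Sg a' \<cdot> ((on_hom Sg a \<cdot> h) \<cdot> c')" using m by simp
    also have "\<dots> = (on_hom Sg a' \<cdot> on_hom Sg a) \<cdot> (h \<cdot> c')" using a(1,2) c(1,2) w by simp
    finally show ?thesis unfolding s using c w by simp
  qed
  have "tri_mor C Sg (A', B', X', f', g', h') (A, B, X, f, g, h) a' b' c'"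
    unfolding tri_mor_iff[OF assms(3,2)] using a b c 1 2 3 by simp
  with t a b c show ?thesis using that by blast
qed

lemma tri_isoI:
  assumes "tri_mor C Sg (A, B, X, f, g, h) (A', B', X', f', g', h') a b c"
    "iso_in C A A' a" "iso_in C B B' b" "iso_in C X X' c"
  shows "tri_iso C Sg (A, B, X, f, g, h) (A', B', X', f', g', h')"
  using assms unfolding tri_iso_def by auto

lemma tri_iso_sym:
  assumes "tri_iso C Sg t t'" "right_triangle C Sg t" "right_triangle C Sg t'"
  shows "tri_iso C Sg t' t"
proof -
  obtain A B X f g h where t: "t = (A, B, X, f, g, h)" by (cases t)
  obtain A' B' X' f' g' h' where t': "t' = (A', B', X', f', g', h')" by (cases t')
  obtain a b c a' b' c' where "tri_mor C Sg t' t a' b' c'" and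
    "mor C a A A'" "mor C a' A' A" "a' \<cdot> a = Id C A" "a \<cdot> a' = Id C A'"
    "mor C b B B'" "mor C b' B' B" "b' \<cdot> b = Id C B" "b \<cdot> b' = Id C B'"
    "mor C c X X'" "mor C c' X' X" "c' \<cdot> c = Id C X" "c \<cdot> c' = Id C X'"
    using assms unfolding t t' by (rule tri_isoE)
  then show ?thesis unfolding t t' by (intro tri_isoI[of _ _ _ _ _ _ _ _ _ _ _ _ a' b' c']) (blast intro: iso_inI)+
qed

lemma tri_iso_trans:
  assumes "tri_iso C Sg t t'" "tri_iso C Sg t' t''"
    "right_triangle C Sg t" "right_triangle C Sg t'" "right_triangle C Sg t''"
  shows "tri_iso C Sg t t''"
proof -
  obtain A B X f g h where t: "t = (A, B, X, f, g, h)" by (cases t)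
  obtain A' B' X' f' g' h' where t': "t' = (A', B', X', f', g', h')" by (cases t')
  obtain A'' B'' X'' f'' g'' h'' where t'': "t'' = (A'', B'', X'', f'', g'', h'')" by (cases t'')
  obtain a b c where 1: "tri_mor C Sg t t' a b c" "iso_in C A A' a" "iso_in C B B' b" "iso_in C X X' c"
    using assms(1) unfolding t t' tri_iso_def by auto
  obtain a' b' c' where 2: "tri_mor C Sg t' t'' a' b' c'" "iso_in C A' A'' a'" "iso_in C B' B'' b'" "iso_in C X' X'' c'"
    using assms(2) unfolding t' t'' tri_iso_def by auto
  have "tri_mor C Sg t t'' (a' \<cdot> a) (b' \<cdot> b) (c' \<cdot> c)"
    using tri_mor_comp[OF assms(3-5) 1(1) 2(1)] .
  then show ?thesis unfolding t t''
    by (rule tri_isoI) (use 1 2 iso_in_comp in auto)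
qed

end

text \<open>The models are asked only for what can be checked on representatives: consecutive maps
  compose to zero, the second map is a weak cokernel of the first, squares can be filled in. All of
  this passes to \<open>R\<close> along isomorphisms. The octahedron is asked only for some
  isomorphic replacement of the given composable pair, since the given morphisms need not be
  inflations with suitable cones.\<close>

locale model_triangulation = suspended_category +
  fixes R M :: "('a, 'b) tri set"
  assumes R_wf: "t \<in> R \<Longrightarrow> right_triangle C Sg t"
    and R_iso: "\<lbrakk>t \<in> R; right_triangle C Sg t'; tri_iso C Sg t t'\<rbrakk> \<Longrightarrow> t' \<in> R"
    and M_wf: "m \<in> M \<Longrightarrow> right_triangle C Sg m"
    and R_model: "t \<in> R \<Longrightarrow> \<exists>m\<in>M. tri_iso C Sg m t"
    and M_mor: "\<lbrakk>(A, B, X, f, g, h) \<in> M; (A', B', X', f', g', h') \<in> M;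
          mor C a A A'; mor C b B B'; b \<cdot> f = f' \<cdot> a\<rbrakk>
        \<Longrightarrow> \<exists>c. tri_mor C Sg (A, B, X, f, g, h) (A', B', X', f', g', h') a b c"
    and M_zero: "(A, B, X, f, g, h) \<in> M \<Longrightarrow> g \<cdot> f = Zero C A X"
    and M_cokernel: "\<lbrakk>(A, B, X, f, g, h) \<in> M; mor C k B K; k \<cdot> f = Zero C A K\<rbrakk>
        \<Longrightarrow> \<exists>k'. mor C k' X K \<and> k = k' \<cdot> g"
    and M_rotate: "(A, B, X, f, g, h) \<in> M
        \<Longrightarrow> (B, X, on_ob Sg A, g, h, mn C (on_hom Sg f)) \<in> R"
    and R_complete: "mor C f A B \<Longrightarrow> \<exists>X g h. (A, B, X, f, g, h) \<in> R"
    and R_octahedral: "\<lbrakk>mor C f X Y; mor C g Y W\<rbrakk> \<Longrightarrow>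
        \<exists>Y' W' y w f' g' E F G a b c d e h p q. iso_in C Y Y' y \<and> iso_in C W W' w \<and>
          f' = y \<cdot> f \<and> mor C g' Y' W' \<and> w \<cdot> g = g' \<cdot> y \<and>
          (X, Y', E, f', a, b) \<in> R \<and> (Y', W', G, g', c, d) \<in> R \<and> (X, W', F, g' \<cdot> f', e, h) \<in> R \<and>
          (E, F, G, p, q, on_hom Sg a \<cdot> d) \<in> R \<and>
          tri_mor C Sg (X, Y', E, f', a, b) (X, W', F, g' \<cdot> f', e, h) (Id C X) g' p \<and>
          tri_mor C Sg (X, W', F, g' \<cdot> f', e, h) (Y', W', G, g', c, d) f' (Id C W') q"
begin

lemma R_modelE:
  assumes "(A, B, X, f, g, h) \<in> R"
  obtains A0 B0 X0 f0 g0 h0 a b c a' b' c' where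
    "(A0, B0, X0, f0, g0, h0) \<in> M"
    "tri_mor C Sg (A0, B0, X0, f0, g0, h0) (A, B, X, f, g, h) a b c"
    "tri_mor C Sg (A, B, X, f, g, h) (A0, B0, X0, f0, g0, h0) a' b' c'"
    "mor C a A0 A" "mor C a' A A0" "a' \<cdot> a = Id C A0" "a \<cdot> a' = Id C A"
    "mor C b B0 B" "mor C b' B B0" "b' \<cdot> b = Id C B0" "b \<cdot> b' = Id C B"
    "mor C c X0 X" "mor C c' X X0" "c' \<cdot> c = Id C X0" "c \<cdot> c' = Id C X"
    "tri_iso C Sg (A0, B0, X0, f0, g0, h0) (A, B, X, f, g, h)"
proof -
  obtain m where m: "m \<in> M" "tri_iso C Sg m (A, B, X, f, g, h)" using R_model assms by blast
  obtain A0 B0 X0 f0 g0 h0 where m': "m = (A0, B0, X0, f0, g0, h0)" by (cases m)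
  show ?thesis
    by (rule tri_isoE[OF m(2)[unfolded m'] M_wf[OF m(1), unfolded m'] R_wf[OF assms]])
       (rule that; (use m m' in blast)?)
qed

lemma R_zero:
  assumes "(A, B, X, f, g, h) \<in> R"
  shows "g \<cdot> f = Zero C A X"
proof -
  obtain A0 B0 X0 f0 g0 h0 a b c a' b' c' where m: "(A0, B0, X0, f0, g0, h0) \<in> M"
    and t: "tri_mor C Sg (A0, B0, X0, f0, g0, h0) (A, B, X, f, g, h) a b c"
    and i: "mor C a A0 A" "mor C a' A A0" "a \<cdot> a' = Id C A" "mor C b B0 B" "mor C c X0 X"
    using assms by (rule R_modelE)
  note w = M_wf[OF m, unfolded right_triangle_iff] R_wf[OF assms, unfolded right_triangle_iff]
  note e = t[unfolded tri_mor_iff[OF M_wf[OF m] R_wf[OF assms]]]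
  have "g \<cdot> f = g \<cdot> ((f \<cdot> a) \<cdot> a')" using w i by simp
  also have "\<dots> = g \<cdot> ((b \<cdot> f0) \<cdot> a')" using e by simp
  also have "\<dots> = (g \<cdot> b) \<cdot> (f0 \<cdot> a')" using w i by simp
  also have "\<dots> = (c \<cdot> g0) \<cdot> (f0 \<cdot> a')" using e by simp
  also have "\<dots> = c \<cdot> ((g0 \<cdot> f0) \<cdot> a')" using w i by simp
  also have "\<dots> = Zero C A X" using M_zero[OF m] w i by simp
  finally show ?thesis .
qed

lemma R_cokernel:
  assumes "(A, B, X, f, g, h) \<in> R" "mor C k B K" "k \<cdot> f = Zero C A K"
  shows "\<exists>k'. mor C k' X K \<and> k = k' \<cdot> g"
proof -
  obtain A0 B0 X0 f0 g0 h0 a b c a' b' c' where m: "(A0, B0, X0, f0, g0, h0) \<in> M"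
    and t: "tri_mor C Sg (A0, B0, X0, f0, g0, h0) (A, B, X, f, g, h) a b c"
    and t': "tri_mor C Sg (A, B, X, f, g, h) (A0, B0, X0, f0, g0, h0) a' b' c'"
    and i: "mor C a A0 A" "mor C a' A A0" "mor C b B0 B" "mor C b' B B0" "b \<cdot> b' = Id C B" "mor C c X0 X" "mor C c' X X0"
    using assms(1) by (rule R_modelE)
  note w = M_wf[OF m, unfolded right_triangle_iff] R_wf[OF assms(1), unfolded right_triangle_iff]
  note e = t[unfolded tri_mor_iff[OF M_wf[OF m] R_wf[OF assms(1)]]]
  note e' = t'[unfolded tri_mor_iff[OF R_wf[OF assms(1)] M_wf[OF m]]]
  have "(k \<cdot> b) \<cdot> f0 = k \<cdot> (f \<cdot> a)" using w i e assms by simp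
  also have "\<dots> = (k \<cdot> f) \<cdot> a" using w i assms(2) by simp
  finally have "(k \<cdot> b) \<cdot> f0 = Zero C A0 K" using w i assms by simp
  then obtain k' where k': "mor C k' X0 K" "k \<cdot> b = k' \<cdot> g0"
    using M_cokernel[OF m, of "k \<cdot> b" K] i assms by auto
  have "k = (k \<cdot> b) \<cdot> b'" using i assms by simp
  also have "\<dots> = k' \<cdot> (g0 \<cdot> b')" using k' w i by simp
  also have "\<dots> = k' \<cdot> (c' \<cdot> g)" using e' by simp
  also have "\<dots> = (k' \<cdot> c') \<cdot> g" using k' w i by simp
  finally show ?thesis using k' i by (intro exI[of _ "k' \<cdot> c'"]) simp
qed

text \<open>An isomorphism of triangles rotates to one whose third component is the suspension of
  its first.\<close>

lemma R_rotate:
  assumes "(A, B, X, f, g, h) \<in> R"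
  shows "(B, X, on_ob Sg A, g, h, mn C (on_hom Sg f)) \<in> R"
proof -
  obtain A0 B0 X0 f0 g0 h0 a b c a' b' c' where m: "(A0, B0, X0, f0, g0, h0) \<in> M"
    and t: "tri_mor C Sg (A0, B0, X0, f0, g0, h0) (A, B, X, f, g, h) a b c"
    and i: "mor C a A0 A" "mor C a' A A0" "a' \<cdot> a = Id C A0" "a \<cdot> a' = Id C A"
    "mor C b B0 B" "mor C b' B B0" "b' \<cdot> b = Id C B0" "b \<cdot> b' = Id C B"
    "mor C c X0 X" "mor C c' X X0" "c' \<cdot> c = Id C X0" "c \<cdot> c' = Id C X"
    using assms by (rule R_modelE)
  note w = M_wf[OF m, unfolded right_triangle_iff] R_wf[OF assms, unfolded right_triangle_iff]
  note e = t[unfolded tri_mor_iff[OF M_wf[OF m] R_wf[OF assms]]]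
  have s: "on_hom Sg a' \<cdot> on_hom Sg a = Id C (on_ob Sg A0)" "on_hom Sg a \<cdot> on_hom Sg a' = Id C (on_ob Sg A)"
    using arg_cong[OF i(3), of "on_hom Sg"] arg_cong[OF i(4), of "on_hom Sg"] i(1,2) by simp_all
  have r: "right_triangle C Sg (B0, X0, on_ob Sg A0, g0, h0, mn C (on_hom Sg f0))"
    and r': "right_triangle C Sg (B, X, on_ob Sg A, g, h, mn C (on_hom Sg f))"
    unfolding right_triangle_iff using w by simp_all
  have f: "on_hom Sg b \<cdot> on_hom Sg f0 = on_hom Sg f \<cdot> on_hom Sg a"
  proof -
    have "on_hom Sg (b \<cdot> f0) = on_hom Sg (f \<cdot> a)" using e by simp
    then show ?thesis using w i(1,5) by simp
  qed
  have "tri_mor C Sg (B0, X0, on_ob Sg A0, g0, h0, mn C (on_hom Sg f0))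
     (B, X, on_ob Sg A, g, h, mn C (on_hom Sg f)) b c (on_hom Sg a)"
    unfolding tri_mor_iff[OF r r'] using e f w i by simp
  moreover have "iso_in C (on_ob Sg A0) (on_ob Sg A) (on_hom Sg a)"
    by (rule iso_inI[where g = "on_hom Sg a'"]) (use i s in simp_all)
  moreover have "iso_in C B0 B b" "iso_in C X0 X c" using i iso_inI by blast+
  ultimately have "tri_iso C Sg (B0, X0, on_ob Sg A0, g0, h0, mn C (on_hom Sg f0))
     (B, X, on_ob Sg A, g, h, mn C (on_hom Sg f))" by (intro tri_isoI)
  then show ?thesis using R_iso[OF M_rotate[OF m] r'] by blast
qed

lemma R_mor:
  assumes t: "(A, B, X, f, g, h) \<in> R" and t': "(A', B', X', f', g', h') \<in> R"
    and m: "mor C a A A'" "mor C b B B'" "b \<cdot> f = f' \<cdot> a"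
  shows "\<exists>c. tri_mor C Sg (A, B, X, f, g, h) (A', B', X', f', g', h') a b c"
proof -
  obtain A0 B0 X0 f0 g0 h0 a0 b0 c0 a1 b1 c1 where m0: "(A0, B0, X0, f0, g0, h0) \<in> M"
    and t0: "tri_mor C Sg (A0, B0, X0, f0, g0, h0) (A, B, X, f, g, h) a0 b0 c0"
    and t1: "tri_mor C Sg (A, B, X, f, g, h) (A0, B0, X0, f0, g0, h0) a1 b1 c1"
    and i0: "mor C a0 A0 A" "mor C a1 A A0" "a0 \<cdot> a1 = Id C A" "mor C b0 B0 B" "mor C b1 B B0" "b0 \<cdot> b1 = Id C B"
    using t by (rule R_modelE)
  obtain A2 B2 X2 f2 g2 h2 a2 b2 c2 a3 b3 c3 where m2: "(A2, B2, X2, f2, g2, h2) \<in> M"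
    and t2: "tri_mor C Sg (A2, B2, X2, f2, g2, h2) (A', B', X', f', g', h') a2 b2 c2"
    and t3: "tri_mor C Sg (A', B', X', f', g', h') (A2, B2, X2, f2, g2, h2) a3 b3 c3"
    and i2: "mor C a2 A2 A'" "mor C a3 A' A2" "a2 \<cdot> a3 = Id C A'" "mor C b2 B2 B'" "mor C b3 B' B2" "b2 \<cdot> b3 = Id C B'"
    using t' by (rule R_modelE)
  note w = M_wf[OF m0] M_wf[OF m2] R_wf[OF t] R_wf[OF t']
  note v = w[unfolded right_triangle_iff]
  note e0 = t0[unfolded tri_mor_iff[OF w(1) w(3)]] and e3 = t3[unfolded tri_mor_iff[OF w(4) w(2)]]
  \<comment> \<open>The given pair is conjugated into the two models, where the square can be
    completed; indices 0 and 1 belong to the source triangle, 2 and 3 to the target.\<close>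
  have "(b3 \<cdot> (b \<cdot> b0)) \<cdot> f0 = b3 \<cdot> (b \<cdot> (f \<cdot> a0))" using e0 i0 i2 m v by simp
  also have "\<dots> = b3 \<cdot> ((b \<cdot> f) \<cdot> a0)" using i0 i2 m(1,2) v by simp
  also have "\<dots> = (b3 \<cdot> f') \<cdot> (a \<cdot> a0)" using i0 i2 m v by simp
  also have "\<dots> = f2 \<cdot> (a3 \<cdot> (a \<cdot> a0))" using e3 i0 i2 m v by simp
  finally obtain c where c: "tri_mor C Sg (A0, B0, X0, f0, g0, h0) (A2, B2, X2, f2, g2, h2) (a3 \<cdot> (a \<cdot> a0)) (b3 \<cdot> (b \<cdot> b0)) c"
    using M_mor[OF m0 m2, of "a3 \<cdot> (a \<cdot> a0)" "b3 \<cdot> (b \<cdot> b0)"] i0 i2 m by auto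
  have 1: "tri_mor C Sg (A, B, X, f, g, h) (A', B', X', f', g', h') (a2 \<cdot> ((a3 \<cdot> (a \<cdot> a0)) \<cdot> a1)) (b2 \<cdot> ((b3 \<cdot> (b \<cdot> b0)) \<cdot> b1)) (c2 \<cdot> (c \<cdot> c1))"
    using tri_mor_comp[OF w(3) w(2) w(4) tri_mor_comp[OF w(3) w(1) w(2) t1 c] t2] .
  have "a2 \<cdot> ((a3 \<cdot> (a \<cdot> a0)) \<cdot> a1) = (a2 \<cdot> a3) \<cdot> (a \<cdot> (a0 \<cdot> a1))"
    "b2 \<cdot> ((b3 \<cdot> (b \<cdot> b0)) \<cdot> b1) = (b2 \<cdot> b3) \<cdot> (b \<cdot> (b0 \<cdot> b1))"
    using i0(1,2,4,5) i2(1,2,4,5) m by simp_all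
  then show ?thesis using 1 i0 i2 m by auto
qed

text \<open>An endomorphism \<open>n\<close> of the third vertex over the identities differs from the identity by some
  \<open>k \<cdot> h\<close> with \<open>h \<cdot> k \<cdot> h = 0\<close>, so that \<open>n - 1\<close> squares to zero.\<close>

lemma endo_iso:
  assumes t: "(A, B, X, f, g, h) \<in> R"
    and n: "tri_mor C Sg (A, B, X, f, g, h) (A, B, X, f, g, h) (Id C A) (Id C B) n"
  shows "iso_in C X X n"
proof -
  note w = R_wf[OF t]
  note v = w[unfolded right_triangle_iff]
  have m: "mor C n X X" "n \<cdot> g = g" "h \<cdot> n = h" using n[unfolded tri_mor_iff[OF w w]] v by auto
  obtain d where d: "mor C d X X" "n = Id C X \<boxplus> d" by (rule difference[of "Id C X" X X n]) (use m v in auto)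
  have "g \<boxplus> (d \<cdot> g) = g \<boxplus> Zero C B X" using m(2) d v by simp
  then have "d \<cdot> g = Zero C B X" by (rule add_left_cancel) (use d v in auto)
  moreover have "h \<boxplus> (h \<cdot> d) = h \<boxplus> Zero C X (on_ob Sg A)" using m(3) d v by simp
  then have hd: "h \<cdot> d = Zero C X (on_ob Sg A)" by (rule add_left_cancel) (use d v in auto)
  \<comment> \<open>In the rotated triangle \<open>h\<close> is a weak cokernel of \<open>g\<close>,
    and \<open>d\<close> kills \<open>g\<close>.\<close>
  ultimately obtain k where k: "mor C k (on_ob Sg A) X" "d = k \<cdot> h"
    using R_cokernel[OF R_rotate[OF t], of d X] d v by auto
  have "d \<cdot> d = k \<cdot> (h \<cdot> d)" using k v d by simp
  then have dd: "d \<cdot> d = Zero C X X" unfolding hd using k v by simp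
  show ?thesis
    by (rule iso_inI[where g = "Id C X \<boxplus> mn C d"])
       (use d v dd in \<open>simp_all add: add_assoc\<close>)
qed

text \<open>Fill-ins in the two directions compose to endomorphisms over identities. These are
  invertible although they need not be identities, which is enough for each fill-in to be an
  isomorphism.\<close>

lemma R_iso_extend:
  assumes t: "(A, B, X, f, g, h) \<in> R" and t': "(A', B', X', f', g', h') \<in> R"
    and a: "iso_in C A A' a" and b: "iso_in C B B' b" and e: "b \<cdot> f = f' \<cdot> a"
  obtains c where "tri_mor C Sg (A, B, X, f, g, h) (A', B', X', f', g', h') a b c" "iso_in C X X' c"
proof -
  obtain a' where a: "mor C a A A'" "mor C a' A' A" "a' \<cdot> a = Id C A" "a \<cdot> a' = Id C A'"
    using a by (rule iso_inE)
  obtain b' where b: "mor C b B B'" "mor C b' B' B" "b' \<cdot> b = Id C B" "b \<cdot> b' = Id C B'"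
    using b by (rule iso_inE)
  note w = R_wf[OF t] R_wf[OF t']
  note v = w[unfolded right_triangle_iff]
  obtain c where c: "tri_mor C Sg (A, B, X, f, g, h) (A', B', X', f', g', h') a b c"
    using R_mor[OF t t'] a b e by blast
  have "b' \<cdot> f' = b' \<cdot> ((f' \<cdot> a) \<cdot> a')" using a b v by simp
  also have "\<dots> = b' \<cdot> ((b \<cdot> f) \<cdot> a')" using e by simp
  also have "\<dots> = (b' \<cdot> b) \<cdot> (f \<cdot> a')" using a(1,2) b(1,2) v by simp
  finally have "b' \<cdot> f' = f \<cdot> a'" using a b v by simp
  then obtain c' where c': "tri_mor C Sg (A', B', X', f', g', h') (A, B, X, f, g, h) a' b' c'"
    using R_mor[OF t' t] a b by blast
  have "iso_in C X X (c' \<cdot> c)"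
    using endo_iso[OF t] tri_mor_comp[OF w(1) w(2) w(1) c c'] a b by simp
  moreover have "iso_in C X' X' (c \<cdot> c')"
    using endo_iso[OF t'] tri_mor_comp[OF w(2) w(1) w(2) c' c] a b by simp
  ultimately have "iso_in C X X' c"
    using iso_in_of_left_right_inverse c c' unfolding tri_mor_iff[OF w] tri_mor_iff[OF w(2) w(1)] by blast
  with c show ?thesis using that by blast
qed

text \<open>The triangle completing an identity has a vanishing third vertex: both of its remaining
  maps are zero, and the identity of that vertex factors through \<open>h\<close> because
  \<open>h\<close> is a weak cokernel of \<open>g\<close>.\<close>

lemma R_id:
  assumes "A \<in> Ob C" "zero_object C N"
  shows "(A, A, N, Id C A, Zero C A N, Zero C N (on_ob Sg A)) \<in> R"
proof -
  have N: "N \<in> Ob C" "f = Zero C N K" if "mor C f N K" for f K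
    using assms(2) that mor_hom[OF that] unfolding zero_object_def by auto
  have NO: "N \<in> Ob C" using assms(2) unfolding zero_object_def by blast
  obtain X g h where t: "(A, A, X, Id C A, g, h) \<in> R" using R_complete[of "Id C A" A A] assms by auto
  note v = R_wf[OF t, unfolded right_triangle_iff]
  have g: "g = Zero C A X" using R_zero[OF t] v by simp
  \<comment> \<open>After two rotations the first two maps are \<open>h\<close> and minus an
    identity, so the vanishing of their composite gives the vanishing of \<open>h\<close>.\<close>
  have "mn C (on_hom Sg (Id C A)) \<cdot> h = Zero C X (on_ob Sg A)" using R_zero[OF R_rotate[OF R_rotate[OF t]]] by simp
  then have "mn C (mn C h) = mn C (Zero C X (on_ob Sg A))" using v by simp
  then have h: "h = Zero C X (on_ob Sg A)" using v by simp
  obtain k where k: "mor C k (on_ob Sg A) X" "Id C X = k \<cdot> h"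
    using R_cokernel[OF R_rotate[OF t], of "Id C X" X] v g assms by auto
  have X: "Id C X = Zero C X X" using k h v by simp
  have i: "iso_in C X N (Zero C X N)"
    by (rule iso_inI[where g = "Zero C N X"]) (use v NO X N(2)[of "Id C N" N] in simp_all)
  have w: "right_triangle C Sg (A, A, N, Id C A, Zero C A N, Zero C N (on_ob Sg A))"
    unfolding right_triangle_iff using assms NO by simp
  have "tri_mor C Sg (A, A, X, Id C A, g, h) (A, A, N, Id C A, Zero C A N, Zero C N (on_ob Sg A)) (Id C A) (Id C A) (Zero C X N)"
    unfolding tri_mor_iff[OF R_wf[OF t] w] using v NO g h by simp
  then show ?thesis using R_iso[OF t w] i iso_in_id assms tri_isoI by blast
qed

text \<open>An octahedron is at hand for a replaced pair. The replacement induces isomorphisms of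
  the three third vertices, along which the octahedron is conjugated back.\<close>

lemma R_octahedron:
  assumes t1: "(X, Y, E, f, a, b) \<in> R" and t2: "(Y, W, G, g, c, d) \<in> R" and t3: "(X, W, F, g \<cdot> f, e, h) \<in> R"
  shows "\<exists>p q. (E, F, G, p, q, on_hom Sg a \<cdot> d) \<in> R \<and>
              tri_mor C Sg (X, Y, E, f, a, b) (X, W, F, g \<cdot> f, e, h) (Id C X) g p \<and>
              tri_mor C Sg (X, W, F, g \<cdot> f, e, h) (Y, W, G, g, c, d) f (Id C W) q"
proof -
  note w = R_wf[OF t1] R_wf[OF t2] R_wf[OF t3]
  note v = w[unfolded right_triangle_iff]
  obtain Y' W' y z f' g' E' F' G' a' b' c' d' e' h' p q where
      i: "iso_in C Y Y' y" "iso_in C W W' z" and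
      e: "f' = y \<cdot> f" "mor C g' Y' W'" "z \<cdot> g = g' \<cdot> y" and
      s: "(X, Y', E', f', a', b') \<in> R" "(Y', W', G', g', c', d') \<in> R" "(X, W', F', g' \<cdot> f', e', h') \<in> R" and
      o: "(E', F', G', p, q, on_hom Sg a' \<cdot> d') \<in> R" and
      m: "tri_mor C Sg (X, Y', E', f', a', b') (X, W', F', g' \<cdot> f', e', h') (Id C X) g' p"
         "tri_mor C Sg (X, W', F', g' \<cdot> f', e', h') (Y', W', G', g', c', d') f' (Id C W') q"
    using R_octahedral[of f X Y g W] v by blast
  note w' = R_wf[OF s(1)] R_wf[OF s(2)] R_wf[OF s(3)] R_wf[OF o]
  note v' = w'[unfolded right_triangle_iff]
  obtain y' where y: "mor C y Y Y'" "mor C y' Y' Y" "y' \<cdot> y = Id C Y" "y \<cdot> y' = Id C Y'"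
    using i(1) by (rule iso_inE)
  obtain z' where z: "mor C z W W'" "mor C z' W' W" "z' \<cdot> z = Id C W" "z \<cdot> z' = Id C W'"
    using i(2) by (rule iso_inE)
  have X: "iso_in C X X (Id C X)" using iso_in_id v by blast
  \<comment> \<open>\<open>\<epsilon>\<close>, \<open>\<gamma>\<close> and \<open>\<phi>\<close>
    compare the third vertices over the given isomorphisms of the first two; any choice of
    completion serves.\<close>
  obtain \<epsilon> where \<epsilon>: "tri_mor C Sg (X, Y, E, f, a, b) (X, Y', E', f', a', b') (Id C X) y \<epsilon>" "iso_in C E E' \<epsilon>"
    by (rule R_iso_extend[OF t1 s(1) X i(1)]) (use e v v' in auto)
  obtain \<gamma> where \<gamma>: "tri_mor C Sg (Y, W, G, g, c, d) (Y', W', G', g', c', d') y z \<gamma>" "iso_in C G G' \<gamma>"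
    by (rule R_iso_extend[OF t2 s(2) i(1) i(2)]) (use e v v' in auto)
  have zgf: "z \<cdot> (g \<cdot> f) = g' \<cdot> (y \<cdot> f)"
  proof -
    have "z \<cdot> (g \<cdot> f) = (z \<cdot> g) \<cdot> f" using z(1) v by simp
    also have "\<dots> = g' \<cdot> (y \<cdot> f)" unfolding e(3) using y(1) v v' by simp
    finally show ?thesis .
  qed
  obtain \<phi> where \<phi>: "tri_mor C Sg (X, W, F, g \<cdot> f, e, h) (X, W', F', g' \<cdot> f', e', h') (Id C X) z \<phi>" "iso_in C F F' \<phi>"
    by (rule R_iso_extend[OF t3 s(3) X i(2)]) (use e v v' zgf y in auto)
  obtain \<phi>' where \<phi>': "mor C \<phi> F F'" "mor C \<phi>' F' F" "\<phi>' \<cdot> \<phi> = Id C F" "\<phi> \<cdot> \<phi>' = Id C F'"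
    using \<phi>(2) by (rule iso_inE)
  obtain \<gamma>' where \<gamma>': "mor C \<gamma> G G'" "mor C \<gamma>' G' G" "\<gamma>' \<cdot> \<gamma> = Id C G" "\<gamma> \<cdot> \<gamma>' = Id C G'"
    using \<gamma>(2) by (rule iso_inE)
  have \<phi>t: "tri_mor C Sg (X, W', F', g' \<cdot> f', e', h') (X, W, F, g \<cdot> f, e, h) (Id C X) z' \<phi>'"
  proof -
    note x = \<phi>(1)[unfolded tri_mor_iff[OF w(3) w'(3)]]
    have "z' \<cdot> (g' \<cdot> f') = (z' \<cdot> z) \<cdot> (g \<cdot> f)" using x z(1,2) v v' by simp
    then have 1: "z' \<cdot> (g' \<cdot> f') = g \<cdot> f" using z v v' by simp
    have "\<phi>' \<cdot> e' = \<phi>' \<cdot> ((e' \<cdot> z) \<cdot> z')" using z v v' by simp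
    also have "\<dots> = \<phi>' \<cdot> ((\<phi> \<cdot> e) \<cdot> z')" using x by simp
    also have "\<dots> = (\<phi>' \<cdot> \<phi>) \<cdot> (e \<cdot> z')" using z(1,2) \<phi>'(1,2) v v' by simp
    finally have 2: "\<phi>' \<cdot> e' = e \<cdot> z'" using \<phi>' z v by simp
    have "h \<cdot> \<phi>' = (h' \<cdot> \<phi>) \<cdot> \<phi>'" using x v v' \<phi>'(1,2) by simp
    then have 3: "h \<cdot> \<phi>' = h'" using v v' \<phi>' by simp
    show ?thesis unfolding tri_mor_iff[OF w'(3) w(3)] using 1 2 3 v v' z \<phi>' by simp
  qed
  have \<gamma>t: "tri_mor C Sg (Y', W', G', g', c', d') (Y, W, G, g, c, d) y' z' \<gamma>'"
  proof -
    note x = \<gamma>(1)[unfolded tri_mor_iff[OF w(2) w'(2)]]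
    have "z' \<cdot> g' = z' \<cdot> ((g' \<cdot> y) \<cdot> y')" using y z v v' by simp
    also have "\<dots> = z' \<cdot> ((z \<cdot> g) \<cdot> y')" using x by simp
    also have "\<dots> = (z' \<cdot> z) \<cdot> (g \<cdot> y')" using y(1,2) z(1,2) v v' by simp
    finally have 1: "z' \<cdot> g' = g \<cdot> y'" using y z v v' by simp
    have "\<gamma>' \<cdot> c' = \<gamma>' \<cdot> ((c' \<cdot> z) \<cdot> z')" using z \<gamma>' v v' by simp
    also have "\<dots> = \<gamma>' \<cdot> ((\<gamma> \<cdot> c) \<cdot> z')" using x by simp
    also have "\<dots> = (\<gamma>' \<cdot> \<gamma>) \<cdot> (c \<cdot> z')" using z(1,2) \<gamma>'(1,2) v v' by simp
    finally have 2: "\<gamma>' \<cdot> c' = c \<cdot> z'" using z \<gamma>' v v' by simp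
    have sy: "on_hom Sg y' \<cdot> on_hom Sg y = Id C (on_ob Sg Y)"
      using arg_cong[OF y(3), of "on_hom Sg"] y(1,2) by simp
    have "on_hom Sg y' \<cdot> d' = on_hom Sg y' \<cdot> ((d' \<cdot> \<gamma>) \<cdot> \<gamma>')" using y \<gamma>' v v' by simp
    also have "\<dots> = on_hom Sg y' \<cdot> ((on_hom Sg y \<cdot> d) \<cdot> \<gamma>')" using x by simp
    also have "\<dots> = (on_hom Sg y' \<cdot> on_hom Sg y) \<cdot> (d \<cdot> \<gamma>')" using y(1,2) \<gamma>'(1,2) v v' by simp
    finally have 3: "on_hom Sg y' \<cdot> d' = d \<cdot> \<gamma>'" unfolding sy using \<gamma>' v v' by simp
    show ?thesis unfolding tri_mor_iff[OF w'(2) w(2)] using 1 2 3 v v' y z \<gamma>' by simp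
  qed
  let ?p = "\<phi>' \<cdot> (p \<cdot> \<epsilon>)" and ?q = "\<gamma>' \<cdot> (q \<cdot> \<phi>)"
  note ee = \<epsilon>(1)[unfolded tri_mor_iff[OF w(1) w'(1)]]
  have P: "tri_mor C Sg (X, Y, E, f, a, b) (X, W, F, g \<cdot> f, e, h) (Id C X) g ?p"
  proof -
    have "tri_mor C Sg (X, Y, E, f, a, b) (X, W, F, g \<cdot> f, e, h) (Id C X \<cdot> (Id C X \<cdot> Id C X)) (z' \<cdot> (g' \<cdot> y)) ?p"
      using tri_mor_comp[OF w(1) w'(3) w(3) tri_mor_comp[OF w(1) w'(1) w'(3) \<epsilon>(1) m(1)] \<phi>t] by simp
    moreover have "z' \<cdot> (g' \<cdot> y) = g"
    proof -
      have "z' \<cdot> (g' \<cdot> y) = (z' \<cdot> z) \<cdot> g" unfolding e(3)[symmetric] using z(1,2) v by simp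
      then show ?thesis using z v by simp
    qed
    ultimately show ?thesis using v by simp
  qed
  have Q: "tri_mor C Sg (X, W, F, g \<cdot> f, e, h) (Y, W, G, g, c, d) f (Id C W) ?q"
  proof -
    have "tri_mor C Sg (X, W, F, g \<cdot> f, e, h) (Y, W, G, g, c, d) (y' \<cdot> (f' \<cdot> Id C X)) (z' \<cdot> (Id C W' \<cdot> z)) ?q"
      using tri_mor_comp[OF w(3) w'(2) w(2) tri_mor_comp[OF w(3) w'(3) w'(2) \<phi>(1) m(2)] \<gamma>t] by simp
    moreover have "y' \<cdot> (f' \<cdot> Id C X) = f"
    proof -
      have "y' \<cdot> (f' \<cdot> Id C X) = (y' \<cdot> y) \<cdot> f" unfolding e(1) using y(1,2) v by simp
      then show ?thesis using y v by simp
    qed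
    ultimately show ?thesis using z v by simp
  qed
  have wo: "right_triangle C Sg (E, F, G, ?p, ?q, on_hom Sg a \<cdot> d)"
    unfolding right_triangle_iff using v v' \<phi>' \<gamma>' ee by simp
  obtain \<epsilon>' where \<epsilon>': "mor C \<epsilon> E E'" "mor C \<epsilon>' E' E" "\<epsilon>' \<cdot> \<epsilon> = Id C E" "\<epsilon> \<cdot> \<epsilon>' = Id C E'"
    using \<epsilon>(2) by (rule iso_inE)
  have 1: "\<phi> \<cdot> ?p = p \<cdot> \<epsilon>" "\<gamma> \<cdot> ?q = q \<cdot> \<phi>"
    using \<phi>' \<gamma>' v' \<epsilon>' by (simp_all add: comp_reassoc[of \<phi> \<phi>'] comp_reassoc[of \<gamma> \<gamma>'])
  \<comment> \<open>The connecting map of the octahedron contains \<open>on_hom Sg a\<close>, so its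
    square combines the middle square of \<open>\<epsilon>\<close> under \<open>Sg\<close> with the
    last square of \<open>\<gamma>\<close>.\<close>
  have 2: "on_hom Sg \<epsilon> \<cdot> (on_hom Sg a \<cdot> d) = (on_hom Sg a' \<cdot> d') \<cdot> \<gamma>"
  proof -
    note x = \<gamma>(1)[unfolded tri_mor_iff[OF w(2) w'(2)]]
    have "on_hom Sg \<epsilon> \<cdot> (on_hom Sg a \<cdot> d) = on_hom Sg (\<epsilon> \<cdot> a) \<cdot> d" using v \<epsilon>' by simp
    also have "\<dots> = on_hom Sg (a' \<cdot> y) \<cdot> d" using ee by simp
    also have "\<dots> = on_hom Sg a' \<cdot> (on_hom Sg y \<cdot> d)" using v v' y by simp
    also have "\<dots> = (on_hom Sg a' \<cdot> d') \<cdot> \<gamma>" using x v v' \<gamma>' by simp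
    finally show ?thesis .
  qed
  have "tri_mor C Sg (E, F, G, ?p, ?q, on_hom Sg a \<cdot> d) (E', F', G', p, q, on_hom Sg a' \<cdot> d') \<epsilon> \<phi> \<gamma>"
    unfolding tri_mor_iff[OF wo w'(4)] using 1 2 \<epsilon>' \<phi>' \<gamma>' by blast
  then have "tri_iso C Sg (E, F, G, ?p, ?q, on_hom Sg a \<cdot> d) (E', F', G', p, q, on_hom Sg a' \<cdot> d')"
    using \<epsilon>(2) \<phi>(2) \<gamma>(2) by (rule tri_isoI)
  then have "(E, F, G, ?p, ?q, on_hom Sg a \<cdot> d) \<in> R"
    using R_iso[OF o wo] tri_iso_sym wo w'(4) by blast
  with P Q show ?thesis by blast
qed

theorem right_triangulated: "right_triangulated_category C Sg R"
proof
  show "additive_functor C C Sg" by (rule Sg_additive)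
  show "t \<in> R \<Longrightarrow> right_triangle C Sg t" for t by (rule R_wf)
  show "\<lbrakk>t \<in> R; right_triangle C Sg t'; tri_iso C Sg t t'\<rbrakk> \<Longrightarrow> t' \<in> R" for t t' by (rule R_iso)
  show "\<exists>X g h. (A, B, X, f, g, h) \<in> R" if "A \<in> Ob C" "B \<in> Ob C" "f \<in> Hom C A B" for A B f
    using R_complete that hom_iff_mor by blast
  show "(B, X, on_ob Sg A, g, h, neg C (on_ob Sg A) (on_ob Sg B) (on_hom Sg f)) \<in> R"
    if t: "(A, B, X, f, g, h) \<in> R" for A B X f g h
    using R_rotate[OF t] R_wf[OF t, unfolded right_triangle_iff] neg_mn[of "on_hom Sg f"] by simp
  show "\<exists>c. tri_mor C Sg (A, B, X, f, g, h) (A', B', X', f', g', h') a b c"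
    if "(A, B, X, f, g, h) \<in> R" "(A', B', X', f', g', h') \<in> R" "a \<in> Hom C A A'" "b \<in> Hom C B B'" "b \<cdot> f = f' \<cdot> a"
    for A B X f g h A' B' X' f' g' h' a b
    using R_mor[OF that(1,2)] R_wf[OF that(1)] R_wf[OF that(2)] that(3-5) hom_iff_mor
    unfolding right_triangle_iff by blast
qed (use R_id R_octahedron in auto)

end

section \<open>Extensions and conflations\<close>

text \<open>This expresses that the group of extensions of \<open>X\<close> by \<open>Y\<close>
  vanishes. It is phrased as having at most one element because the extension data carry neither a
  zero nor an addition.\<close>

definition triv :: "'e set \<Rightarrow> ('e \<Rightarrow> 'o) \<Rightarrow> ('e \<Rightarrow> 'o) \<Rightarrow> 'o \<Rightarrow> 'o \<Rightarrow> bool" where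
  "triv EE eC eA X Y \<longleftrightarrow>
     (\<forall>e\<in>EE. \<forall>e'\<in>EE. eC e = X \<longrightarrow> eC e' = X \<longrightarrow> eA e = Y \<longrightarrow> eA e' = Y \<longrightarrow> e = e')"

lemma triv_swap: "triv EE eA eC Y X \<longleftrightarrow> triv EE eC eA X Y"
  unfolding triv_def by blast

text \<open>In a triangulated category an extension \<open>e\<close> is a morphism \<open>eC e \<rightarrow> (eA e)[1]\<close> together with its
  two objects, and \<open>cf f g e\<close> says that \<open>(f, g, e)\<close> is a distinguished triangle.  The assumptions
  are in the style of the extriangulated categories of Nakaoka and Palu; the list is invariant under
  passage to the opposite category, which is what allows the shift to be eliminated.\<close>

locale extension_category = additive_category C
  for C :: "('o, 'm, 'z) precategory_scheme" (structure) +
  fixes EE :: "'e set" and eC eA :: "'e \<Rightarrow> 'o" and push pull :: "'m \<Rightarrow> 'e \<Rightarrow> 'e"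
    and cf :: "'m \<Rightarrow> 'm \<Rightarrow> 'e \<Rightarrow> bool"
  assumes ext_ob: "e \<in> EE \<Longrightarrow> eC e \<in> Ob C \<and> eA e \<in> Ob C"
    and push_ext: "\<lbrakk>e \<in> EE; a \<in> arrs C; src C a = eA e\<rbrakk>
      \<Longrightarrow> push a e \<in> EE \<and> eC (push a e) = eC e \<and> eA (push a e) = tgt C a"
    and pull_ext: "\<lbrakk>e \<in> EE; c \<in> arrs C; tgt C c = eC e\<rbrakk>
      \<Longrightarrow> pull c e \<in> EE \<and> eA (pull c e) = eA e \<and> eC (pull c e) = src C c"
    and push_id: "e \<in> EE \<Longrightarrow> push (Id C (eA e)) e = e"
    and pull_id: "e \<in> EE \<Longrightarrow> pull (Id C (eC e)) e = e"
    and push_comp: "\<lbrakk>e \<in> EE; a \<in> arrs C; b \<in> arrs C; src C a = eA e; src C b = tgt C a\<rbrakk>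
      \<Longrightarrow> push (b \<cdot> a) e = push b (push a e)"
    and pull_comp: "\<lbrakk>e \<in> EE; a \<in> arrs C; b \<in> arrs C; tgt C a = eC e; tgt C b = src C a\<rbrakk>
      \<Longrightarrow> pull (a \<cdot> b) e = pull b (pull a e)"
    and push_pull: "\<lbrakk>e \<in> EE; a \<in> arrs C; c \<in> arrs C; src C a = eA e; tgt C c = eC e\<rbrakk>
      \<Longrightarrow> push a (pull c e) = pull c (push a e)"
    and ext_add: "\<lbrakk>e \<in> EE; e' \<in> EE; z \<in> arrs C; z' \<in> arrs C; u \<in> arrs C; u' \<in> arrs C;
        src C z = eA e'; src C z' = eA e'; tgt C z = eA e; tgt C z' = eA e;
        tgt C u = eC e; tgt C u' = eC e; src C u = eC e'; src C u' = eC e';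
        push z e' = pull u e; push z' e' = pull u' e\<rbrakk>
      \<Longrightarrow> push (z \<boxplus> z') e' = pull (u \<boxplus> u') e"
    and ext_neg: "\<lbrakk>e \<in> EE; e' \<in> EE; z \<in> arrs C; u \<in> arrs C; src C z = eA e'; tgt C z = eA e;
        tgt C u = eC e; src C u = eC e'; push z e' = pull u e\<rbrakk>
      \<Longrightarrow> push (mn C z) e' = pull (mn C u) e"
    and cf_wf: "cf f g e \<Longrightarrow> f \<in> arrs C \<and> g \<in> arrs C \<and> e \<in> EE \<and> src C g = tgt C f \<and>
        eA e = src C f \<and> eC e = tgt C g \<and> g \<cdot> f = Zero C (src C f) (tgt C g)"
    and cf_realize: "e \<in> EE \<Longrightarrow> \<exists>f g. cf f g e"
    and cf_mor: "\<lbrakk>cf f g e; cf f' g' e'; a \<in> arrs C; c \<in> arrs C; src C a = src C f; tgt C a = src C f';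
        src C c = tgt C g; tgt C c = tgt C g'; push a e = pull c e'\<rbrakk>
      \<Longrightarrow> \<exists>b. b \<in> arrs C \<and> src C b = tgt C f \<and> tgt C b = tgt C f' \<and> b \<cdot> f = f' \<cdot> a \<and> c \<cdot> g = g' \<cdot> b"
    and push_eq: "\<lbrakk>cf f g e; k \<in> arrs C; k' \<in> arrs C; src C k = src C f; src C k' = src C f; tgt C k' = tgt C k\<rbrakk>
      \<Longrightarrow> push k e = push k' e \<longleftrightarrow>
        (\<exists>m. m \<in> arrs C \<and> src C m = tgt C f \<and> tgt C m = tgt C k \<and> k \<boxplus> (m \<cdot> f) = k')"
    and pull_eq: "\<lbrakk>cf g f e; k \<in> arrs C; k' \<in> arrs C; tgt C k = tgt C f; tgt C k' = tgt C f; src C k' = src C k\<rbrakk>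
      \<Longrightarrow> pull k e = pull k' e \<longleftrightarrow>
        (\<exists>m. m \<in> arrs C \<and> tgt C m = src C f \<and> src C m = src C k \<and> k \<boxplus> (f \<cdot> m) = k')"
    and cf_cokernel: "\<lbrakk>cf f g e; k \<in> arrs C; src C k = tgt C f; k \<cdot> f = Zero C (src C f) (tgt C k)\<rbrakk>
      \<Longrightarrow> \<exists>m. m \<in> arrs C \<and> src C m = tgt C g \<and> tgt C m = tgt C k \<and> m \<cdot> g = k"
    and cf_kernel: "\<lbrakk>cf g f e; k \<in> arrs C; tgt C k = src C f; f \<cdot> k = Zero C (src C k) (tgt C f)\<rbrakk>
      \<Longrightarrow> \<exists>m. m \<in> arrs C \<and> tgt C m = src C g \<and> src C m = src C k \<and> g \<cdot> m = k"
    and push_exact: "\<lbrakk>cf f g e; x \<in> EE; eA x = src C f; push f x = push (Zero C (src C f) (tgt C f)) x\<rbrakk>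
      \<Longrightarrow> \<exists>c. c \<in> arrs C \<and> src C c = eC x \<and> tgt C c = tgt C g \<and> pull c e = x"
    and pull_exact: "\<lbrakk>cf g f e; x \<in> EE; eC x = tgt C f; pull f x = pull (Zero C (src C f) (tgt C f)) x\<rbrakk>
      \<Longrightarrow> \<exists>c. c \<in> arrs C \<and> tgt C c = eA x \<and> src C c = src C g \<and> push c e = x"
    and triv_mid_C: "\<lbrakk>cf f g e; X \<in> Ob C; triv EE eC eA (src C f) X; triv EE eC eA (tgt C g) X\<rbrakk>
      \<Longrightarrow> triv EE eC eA (tgt C f) X"
    and triv_mid_A: "\<lbrakk>cf g f e; X \<in> Ob C; triv EE eC eA X (tgt C f); triv EE eC eA X (src C g)\<rbrakk>
      \<Longrightarrow> triv EE eC eA X (src C f)"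
    and inflation_comp: "\<lbrakk>cf f a e1; cf g c e2; src C g = tgt C f\<rbrakk>
      \<Longrightarrow> \<exists>h e3 p q. cf (g \<cdot> f) h e3 \<and> cf p q (push a e2) \<and> tgt C p = tgt C h \<and>
         p \<cdot> a = h \<cdot> g \<and> q \<cdot> h = c \<and> pull p e3 = e1 \<and> pull q e2 = push f e3"
    and deflation_comp: "\<lbrakk>cf a f e1; cf c g e2; tgt C g = src C f\<rbrakk>
      \<Longrightarrow> \<exists>h e3 p q. cf h (f \<cdot> g) e3 \<and> cf q p (pull a e2) \<and> src C p = src C h \<and>
         a \<cdot> p = g \<cdot> h \<and> h \<cdot> q = c \<and> push p e3 = e1 \<and> push q e2 = pull f e3"
    and pushout: "\<lbrakk>cf f1 g1 e1; cf f2 g2 e2; src C f2 = src C f1\<rbrakk>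
      \<Longrightarrow> \<exists>x y d e. cf x y (push f1 e2) \<and> cf d e (push f2 e1) \<and> tgt C d = tgt C x \<and>
         x \<cdot> f1 = d \<cdot> f2 \<and> y \<cdot> d = g2 \<and> e \<cdot> x = g1 \<and> pull e e1 = pull (mn C y) e2"
    and pullback: "\<lbrakk>cf g1 f1 e1; cf g2 f2 e2; tgt C f2 = tgt C f1\<rbrakk>
      \<Longrightarrow> \<exists>x y d e. cf y x (pull f1 e2) \<and> cf e d (pull f2 e1) \<and> src C d = src C x \<and>
         f1 \<cdot> x = f2 \<cdot> d \<and> d \<cdot> y = g2 \<and> x \<cdot> e = g1 \<and> push e e1 = push (mn C y) e2"

text \<open>Every assumption is either self-dual or one of a pair of mirror images, so each
  obligation is the mirror assumption with its variables rearranged.\<close>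

lemma extension_category_op:
  assumes "extension_category C EE eC eA push pull cf"
  shows "extension_category (op_cat C) EE eA eC pull push (\<lambda>f g e. cf g f e)"
proof -
  interpret extension_category C EE eC eA push pull cf by fact
  interpret op: additive_category "op_cat C" by (rule op_cat_additive) unfold_locales
  show ?thesis
  proof (unfold_locales, goal_cases)
    case 1 then show ?case using ext_ob by simp
  next case 2 then show ?case using pull_ext by simp
  next case 3 then show ?case using push_ext by simp
  next case 4 then show ?case using pull_id by simp
  next case 5 then show ?case using push_id by simp
  next case 6 then show ?case using pull_comp by simp
  next case 7 then show ?case using push_comp by simp
  next case 8 then show ?case using push_pull by simp
  \<comment> \<open>Interchanging \<open>push\<close> and \<open>pull\<close> turns the equation
    around, so the two extensions, and with them the two pairs of morphisms, trade places.\<close>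
  next case (9 e e' z z' u u') then show ?case using ext_add[of e' e u u' z z'] by simp
  next case (10 e e' z u) then show ?case using ext_neg[of e' e u z] by simp
  next case (11 f g e) then show ?case using cf_wf[of g f e] by simp
  next case 12 then show ?case using cf_realize by blast
  next case (13 f g e f' g' e' a c)
    then obtain b where "b \<in> arrs C" "src C b = tgt C g'" "tgt C b = tgt C g" "b \<cdot>\<^bsub>C\<^esub> g' = g \<cdot>\<^bsub>C\<^esub> c" "a \<cdot>\<^bsub>C\<^esub> f' = f \<cdot>\<^bsub>C\<^esub> b"
      using cf_mor[of g' f' e' g f e c a] by auto
    with 13 show ?case using cf_wf[of g f e] cf_wf[of g' f' e'] by (intro exI[of _ b]) simp
  next case (14 f g e k k') then show ?case using pull_eq[of g f e k k'] by simp
  next case (15 g f e k k') then show ?case using push_eq[of f g e k k'] by simp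
  next case (16 f g e k) then show ?case using cf_kernel[of g f e k] by simp
  next case (17 g f e k) then show ?case using cf_cokernel[of f g e k] by simp
  next case (18 f g e x) then show ?case using pull_exact[of g f e x] by simp
  next case (19 g f e x) then show ?case using push_exact[of f g e x] by simp
  next case (20 f g e X) then show ?case using triv_mid_A[of g f e X] by (simp add: triv_swap[of EE eA eC])
  next case (21 g f e X) then show ?case using triv_mid_C[of f g e X] by (simp add: triv_swap[of EE eA eC])
  next case (22 f a e1 g c e2) then show ?case using deflation_comp[of a f e1 c g e2] by simp
  next case (23 a f e1 c g e2) then show ?case using inflation_comp[of f a e1 g c e2] by simp
  next case (24 f1 g1 e1 f2 g2 e2) then show ?case using pullback[of g1 f1 e1 g2 f2 e2] by simp
  next case (25 g1 f1 e1 g2 f2 e2) then show ?case using pushout[of f1 g1 e1 f2 g2 e2] by simp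
  qed
qed

section \<open>Extending, lifting and splitting\<close>

context extension_category
begin

lemma push_simps [simp]:
  assumes "e \<in> EE" "a \<in> arrs C" "src C a = eA e"
  shows "push a e \<in> EE" "eC (push a e) = eC e" "eA (push a e) = tgt C a"
  using push_ext[OF assms] by auto

lemma pull_simps [simp]:
  assumes "e \<in> EE" "c \<in> arrs C" "tgt C c = eC e"
  shows "pull c e \<in> EE" "eA (pull c e) = eA e" "eC (pull c e) = src C c"
  using pull_ext[OF assms] by auto

lemma ext_id [simp]:
  assumes "e \<in> EE"
  shows "eA e = A \<Longrightarrow> push (Id C A) e = e" "eC e = B \<Longrightarrow> pull (Id C B) e = e"
  using push_id pull_id assms by auto

lemma triv_eq: "\<lbrakk>triv EE eC eA X Y; e \<in> EE; e' \<in> EE; eC e = X; eC e' = X; eA e = Y; eA e' = Y\<rbrakk> \<Longrightarrow> e = e'"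
  unfolding triv_def by blast

text \<open>The obstruction to extending \<open>k\<close> along \<open>f\<close> is
  \<open>push k e\<close>, which lies in a vanishing group and therefore equals the push along
  zero.\<close>

lemma extend:
  assumes "cf f g e" "mor C k (src C f) X" "triv EE eC eA (tgt C g) X"
  obtains m where "mor C m (tgt C f) X" "m \<cdot> f = k"
proof -
  note w = cf_wf[OF assms(1)]
  have "push (Zero C (src C f) X) e = push k e"
    by (rule triv_eq[OF assms(3)]) (use w assms in simp_all)
  then obtain m where "mor C m (tgt C f) X" "Zero C (src C f) X \<boxplus> (m \<cdot> f) = k"
    using push_eq[OF assms(1), of "Zero C (src C f) X" k] assms w by auto
  then show ?thesis using that[of m] w by simp
qed

text \<open>The obstruction to lifting \<open>k\<close> along \<open>g\<close> is
  \<open>pull k e\<close>, which again lies in a vanishing group.\<close>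

lemma lift:
  assumes "cf f g e" "mor C k X (tgt C g)" "triv EE eC eA X (src C f)"
  obtains m where "mor C m X (tgt C f)" "g \<cdot> m = k"
proof -
  note w = cf_wf[OF assms(1)]
  have "pull (Zero C X (tgt C g)) e = pull k e"
    by (rule triv_eq[OF assms(3)]) (use w assms in simp_all)
  then obtain m where "mor C m X (tgt C f)" "Zero C X (tgt C g) \<boxplus> (g \<cdot> m) = k"
    using pull_eq[OF assms(1), of "Zero C X (tgt C g)" k] assms w by auto
  then show ?thesis using that[of m] w by simp
qed

text \<open>Vanishing provides a retraction \<open>r\<close> of \<open>f\<close> and a section
  \<open>s\<close> of \<open>g\<close>, but these are found independently and need not be
  complementary; the section has to be corrected.\<close>

lemma split_biproduct:
  assumes cf: "cf f g e" and t: "triv EE eC eA (tgt C g) (src C f)"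
  shows "biproduct C (src C f) (tgt C g) (tgt C f)"
proof -
  define A B X where "A = src C f" and "B = tgt C f" and "X = tgt C g"
  have w: "mor C f A B" "mor C g B X" "g \<cdot> f = Zero C A X"
    using cf_wf[OF cf] unfolding A_def B_def X_def by auto
  note t = t[folded A_def X_def]
  obtain r where r: "mor C r B A" "r \<cdot> f = Id C A"
    by (rule extend[OF cf, of "Id C A" A, folded A_def B_def X_def]; (rule that; assumption)?) (use w t in simp_all)
  obtain s where s: "mor C s X B" "g \<cdot> s = Id C X"
    by (rule lift[OF cf, of "Id C X" X, folded A_def B_def X_def]; (rule that; assumption)?) (use w t in simp_all)
  \<comment> \<open>The idempotent complementary to \<open>f \<cdot> r\<close>. It kills
    \<open>f\<close>, hence factors through \<open>g\<close>, and its second factor \<open>i\<close>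
    is the corrected section.\<close>
  define k where "k = Id C B \<boxplus> mn C (f \<cdot> r)"
  have k: "mor C k B B" unfolding k_def using w r by simp
  have "k \<cdot> f = Zero C A B" unfolding k_def using w r by simp
  then obtain i where i: "mor C i X B" "i \<cdot> g = k"
    using cf_cokernel[OF cf, of k] k w unfolding A_def B_def X_def by auto
  have gk: "g \<cdot> k = g" unfolding k_def using w r by (simp add: comp_reassoc[of g f])
  \<comment> \<open>The old section serves to test equations after composing with \<open>g\<close>
    on the right.\<close>
  have "g \<cdot> i = (g \<cdot> i) \<cdot> (g \<cdot> s)" using i(1) w s(2) by simp
  also have "\<dots> = (g \<cdot> (i \<cdot> g)) \<cdot> s" using i(1) w s(1) by simp
  also have "\<dots> = Id C X" using gk i(2) s(2) by simp
  finally have gi: "g \<cdot> i = Id C X" .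
  have rk: "r \<cdot> k = Zero C B A" unfolding k_def using w r by (simp add: comp_reassoc[OF r(2)])
  have "r \<cdot> i = (r \<cdot> i) \<cdot> (g \<cdot> s)" using r(1) i(1) w s(2) by simp
  also have "\<dots> = (r \<cdot> (i \<cdot> g)) \<cdot> s" using r(1) i(1) w s(1) by simp
  also have "\<dots> = Zero C X A" unfolding i(2) rk using s w by simp
  finally have ri: "r \<cdot> i = Zero C X A" .
  have "(f \<cdot> r) \<boxplus> (i \<cdot> g) = Id C B" unfolding i(2) k_def using w r(1)
    by (simp add: add_left_comm)
  then have "biproduct C A X B" unfolding biproduct_mor using w r i(1) ri gi
    by (intro conjI exI[of _ f] exI[of _ i] exI[of _ r] exI[of _ g]) simp_all
  then show ?thesis unfolding A_def B_def X_def .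
qed

end

section \<open>Concentric twin cotorsion pairs\<close>

lemma additive_subcategoryD:
  assumes "additive_subcategory C X"
  shows "A \<in> X \<Longrightarrow> A \<in> Ob C" "\<exists>N\<in>X. zero_object C N"
    "\<lbrakk>biproduct C A B P; A \<in> X; B \<in> X\<rbrakk> \<Longrightarrow> P \<in> X"
    "\<lbrakk>iso_in C A B f; A \<in> X\<rbrakk> \<Longrightarrow> B \<in> X"
    "\<lbrakk>biproduct C A B P; P \<in> X\<rbrakk> \<Longrightarrow> A \<in> X" "\<lbrakk>biproduct C A B P; P \<in> X\<rbrakk> \<Longrightarrow> B \<in> X"
  using assms unfolding additive_subcategory_def by (elim conjE; blast)+

text \<open>The decomposition of \<C> given by a cotorsion pair becomes two approximations, one
  ending and one starting at the given object, because there is no shift here to pass from one to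
  the other.\<close>

locale concentric = extension_category +
  fixes S T U V
  assumes sub: "additive_subcategory C S" "additive_subcategory C T"
      "additive_subcategory C U" "additive_subcategory C V"
    and S_T: "\<lbrakk>X \<in> S; Y \<in> T\<rbrakk> \<Longrightarrow> triv EE eC eA X Y"
    and U_V: "\<lbrakk>X \<in> U; Y \<in> V\<rbrakk> \<Longrightarrow> triv EE eC eA X Y"
    and S_V: "\<lbrakk>X \<in> S; Y \<in> V\<rbrakk> \<Longrightarrow> triv EE eC eA X Y"
    and ST_left: "X \<in> Ob C \<Longrightarrow> \<exists>f g e. cf f g e \<and> tgt C g = X \<and> src C f \<in> T \<and> tgt C f \<in> S"
    and ST_right: "X \<in> Ob C \<Longrightarrow> \<exists>f g e. cf f g e \<and> src C f = X \<and> tgt C f \<in> T \<and> tgt C g \<in> S"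
    and UV_left: "X \<in> Ob C \<Longrightarrow> \<exists>f g e. cf f g e \<and> tgt C g = X \<and> src C f \<in> V \<and> tgt C f \<in> U"
    and UV_right: "X \<in> Ob C \<Longrightarrow> \<exists>f g e. cf f g e \<and> src C f = X \<and> tgt C f \<in> V \<and> tgt C g \<in> U"
    and concentric: "S \<inter> T = U \<inter> V"

text \<open>Duality interchanges the two cotorsion pairs and the two members of each. The
  subcategory \<Z> is unchanged, and so is \<I>, by concentricity.\<close>

lemma concentric_op:
  assumes "concentric C EE eC eA push pull cf S T U V"
  shows "concentric (op_cat C) EE eA eC pull push (\<lambda>f g e. cf g f e) V U T S"
proof -
  interpret concentric C EE eC eA push pull cf S T U V by fact
  interpret op: extension_category "op_cat C" EE eA eC pull push "\<lambda>f g e. cf g f e"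
    by (rule extension_category_op) unfold_locales
  note sw = triv_swap[of EE eA eC]
  have m: "src C g = tgt C f" if "cf f g e" for f g e using cf_wf[OF that] by blast
  show ?thesis
  proof (unfold_locales, goal_cases)
    case (8 X)
    then obtain f g e where "cf f g e" "src C f = X" "tgt C f \<in> V" "tgt C g \<in> U" using UV_right[of X] by auto
    then show ?case using m[of f g e] by (rule_tac exI[of _ g], rule_tac exI[of _ f], rule_tac exI[of _ e]) simp
  next
    case (9 X)
    then obtain f g e where "cf f g e" "tgt C g = X" "src C f \<in> V" "tgt C f \<in> U" using UV_left[of X] by auto
    then show ?case using m[of f g e] by (rule_tac exI[of _ g], rule_tac exI[of _ f], rule_tac exI[of _ e]) simp
  next
    case (10 X)
    then obtain f g e where "cf f g e" "src C f = X" "tgt C f \<in> T" "tgt C g \<in> S" using ST_right[of X] by auto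
    then show ?case using m[of f g e] by (rule_tac exI[of _ g], rule_tac exI[of _ f], rule_tac exI[of _ e]) simp
  next
    case (11 X)
    then obtain f g e where "cf f g e" "tgt C g = X" "src C f \<in> T" "tgt C f \<in> S" using ST_left[of X] by auto
    then show ?case using m[of f g e] by (rule_tac exI[of _ g], rule_tac exI[of _ f], rule_tac exI[of _ e]) simp
  qed (use sub S_T U_V S_V concentric in \<open>simp_all add: op_additive_subcategory[OF category_axioms] sw Int_commute[of V U] Int_commute[of T S]\<close>)
qed

section \<open>Orthogonality and closure properties of the four classes\<close>

context concentric
begin

abbreviation I where "I \<equiv> S \<inter> T"
abbreviation Zc where "Zc \<equiv> T \<inter> U"

lemma sub_ob: "X \<in> S \<Longrightarrow> X \<in> Ob C" "X \<in> T \<Longrightarrow> X \<in> Ob C" "X \<in> U \<Longrightarrow> X \<in> Ob C" "X \<in> V \<Longrightarrow> X \<in> Ob C"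
  using sub[THEN additive_subcategoryD(1)] by auto

text \<open>If \<open>X\<close> has no extensions by \<T>, its approximation by an object of \<S>
  with kernel in \<T> splits, so \<open>X\<close> is a summand of an object of \<S>. The other three
  classes are treated in the same way.\<close>

lemma S_iff: "X \<in> S \<longleftrightarrow> X \<in> Ob C \<and> (\<forall>Y\<in>T. triv EE eC eA X Y)"
proof
  assume h: "X \<in> Ob C \<and> (\<forall>Y\<in>T. triv EE eC eA X Y)"
  then obtain f g e where f: "cf f g e" "tgt C g = X" "src C f \<in> T" "tgt C f \<in> S" using ST_left by blast
  then show "X \<in> S" using additive_subcategoryD(6)[OF sub(1) split_biproduct[OF f(1)]] h by auto
qed (use S_T sub_ob in auto)

lemma U_iff: "X \<in> U \<longleftrightarrow> X \<in> Ob C \<and> (\<forall>Y\<in>V. triv EE eC eA X Y)"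
proof
  assume h: "X \<in> Ob C \<and> (\<forall>Y\<in>V. triv EE eC eA X Y)"
  then obtain f g e where f: "cf f g e" "tgt C g = X" "src C f \<in> V" "tgt C f \<in> U" using UV_left by blast
  then show "X \<in> U" using additive_subcategoryD(6)[OF sub(3) split_biproduct[OF f(1)]] h by auto
qed (use U_V sub_ob in auto)

lemma T_iff: "X \<in> T \<longleftrightarrow> X \<in> Ob C \<and> (\<forall>Y\<in>S. triv EE eC eA Y X)"
proof
  assume h: "X \<in> Ob C \<and> (\<forall>Y\<in>S. triv EE eC eA Y X)"
  then obtain f g e where f: "cf f g e" "src C f = X" "tgt C f \<in> T" "tgt C g \<in> S" using ST_right by blast
  then show "X \<in> T" using additive_subcategoryD(5)[OF sub(2) split_biproduct[OF f(1)]] h by auto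
qed (use S_T sub_ob in auto)

lemma V_iff: "X \<in> V \<longleftrightarrow> X \<in> Ob C \<and> (\<forall>Y\<in>U. triv EE eC eA Y X)"
proof
  assume h: "X \<in> Ob C \<and> (\<forall>Y\<in>U. triv EE eC eA Y X)"
  then obtain f g e where f: "cf f g e" "src C f = X" "tgt C f \<in> V" "tgt C g \<in> U" using UV_right by blast
  then show "X \<in> V" using additive_subcategoryD(5)[OF sub(4) split_biproduct[OF f(1)]] h by auto
qed (use U_V sub_ob in auto)

lemma S_U: "X \<in> S \<Longrightarrow> X \<in> U" using S_V sub_ob by (auto simp: U_iff)
text \<open>Each class is the full orthogonal of its partner, and vanishing of extensions passes
  from the outer terms of a conflation to the middle one.\<close>

lemma extension_closed:
  assumes "cf f g e"
  shows "\<lbrakk>src C f \<in> S; tgt C g \<in> S\<rbrakk> \<Longrightarrow> tgt C f \<in> S"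
    and "\<lbrakk>src C f \<in> T; tgt C g \<in> T\<rbrakk> \<Longrightarrow> tgt C f \<in> T"
    and "\<lbrakk>src C f \<in> U; tgt C g \<in> U\<rbrakk> \<Longrightarrow> tgt C f \<in> U"
    and "\<lbrakk>src C f \<in> V; tgt C g \<in> V\<rbrakk> \<Longrightarrow> tgt C f \<in> V"
proof -
  have o: "tgt C f \<in> Ob C" using cf_wf[OF assms] by simp
  show "\<lbrakk>src C f \<in> S; tgt C g \<in> S\<rbrakk> \<Longrightarrow> tgt C f \<in> S"
    using triv_mid_C[OF assms] o sub_ob(2) S_T unfolding S_iff[of "tgt C f"] by blast
  show "\<lbrakk>src C f \<in> U; tgt C g \<in> U\<rbrakk> \<Longrightarrow> tgt C f \<in> U"
    using triv_mid_C[OF assms] o sub_ob(4) U_V unfolding U_iff[of "tgt C f"] by blast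
  have gf: "src C g = tgt C f" using cf_wf[OF assms] by simp
  show "\<lbrakk>src C f \<in> T; tgt C g \<in> T\<rbrakk> \<Longrightarrow> tgt C f \<in> T"
    using triv_mid_A[OF assms] o sub_ob(1) S_T unfolding T_iff[of "tgt C f"] gf by blast
  show "\<lbrakk>src C f \<in> V; tgt C g \<in> V\<rbrakk> \<Longrightarrow> tgt C f \<in> V"
    using triv_mid_A[OF assms] o sub_ob(3) U_V unfolding V_iff[of "tgt C f"] gf by blast
qed

lemma I_sub: "J \<in> I \<Longrightarrow> J \<in> S \<and> J \<in> T \<and> J \<in> U \<and> J \<in> V \<and> J \<in> Ob C"
  using concentric sub_ob by blast

lemma Z_ob: "Zc \<subseteq> Ob C" using sub_ob by blast

lemma Z_I: "I \<subseteq> Zc" using S_U by blast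

lemma Z_biproduct: "\<lbrakk>biproduct C A B P; A \<in> Zc; B \<in> Zc\<rbrakk> \<Longrightarrow> P \<in> Zc"
  using additive_subcategoryD(3)[OF sub(2)] additive_subcategoryD(3)[OF sub(3)] by auto

end

sublocale concentric \<subseteq> ideal_category C "S \<inter> T"
proof
  show "S \<inter> T \<subseteq> Ob C" using sub_ob by blast
  obtain N where "N \<in> S" "zero_object C N" using additive_subcategoryD(2)[OF sub(1)] by blast
  moreover obtain N' where "N' \<in> T" "zero_object C N'" using additive_subcategoryD(2)[OF sub(2)] by blast
  \<comment> \<open>The zero objects supplied by \<S> and \<T> may differ, but they are isomorphic
    and \<S> is closed under isomorphisms.\<close>
  moreover have "N' \<in> S"
  proof -
    have o: "N \<in> Ob C" "N' \<in> Ob C" using calculation unfolding zero_object_def by auto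
    have u: "f = Zero C N N" if "f \<in> Hom C N N" for f
      using calculation(2) that o unfolding zero_object_def by blast
    have u': "f = Zero C N' N'" if "f \<in> Hom C N' N'" for f
      using calculation(4) that o unfolding zero_object_def by blast
    have "Id C N = Zero C N N" "Id C N' = Zero C N' N'" using u u' id_in_hom o by auto
    then have "iso_in C N N' (Zero C N N')"
      by (intro iso_inI[where g = "Zero C N' N"]) (use o in simp_all)
    then show ?thesis using additive_subcategoryD(4)[OF sub(1)] calculation by blast
  qed
  ultimately show "\<exists>N\<in>S \<inter> T. zero_object C N" by blast
  show "\<lbrakk>biproduct C A B J; A \<in> S \<inter> T; B \<in> S \<inter> T\<rbrakk> \<Longrightarrow> J \<in> S \<inter> T" for A B J
    using additive_subcategoryD(3)[OF sub(1)] additive_subcategoryD(3)[OF sub(2)] by auto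
qed

section \<open>Extensions and morphisms modulo the ideal\<close>

context concentric
begin

lemma null_factor:
  assumes "null C I k"
  obtains J p q where "J \<in> I" "mor C p (src C k) J" "mor C q J (tgt C k)" "q \<cdot> p = k"
proof -
  obtain p q where "p \<in> arrs C" "q \<in> arrs C" "tgt C p \<in> I" "src C q = tgt C p" "k = q \<cdot> p"
    using assms by (rule nullE)
  then show ?thesis by (intro that[of "tgt C p" p q]) simp_all
qed

text \<open>Embed \<open>X\<close> into an object of \<T> with cokernel in \<S>. The middle term is
  then in \<S> too, hence in \<I>, and \<open>r\<close> extends to it because its target is in
  \<T>.\<close>

lemma ST_null:
  assumes "mor C r X Y" "X \<in> S" "Y \<in> T"
  shows "null C I r"
proof -
  obtain f g e where f: "cf f g e" "src C f = X" "tgt C f \<in> T" "tgt C g \<in> S"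
    using ST_right assms by blast
  then have J: "tgt C f \<in> I" using extension_closed(1)[OF f(1)] assms by auto
  obtain m where m: "mor C m (tgt C f) Y" "m \<cdot> f = r"
    by (rule extend[OF f(1), of r Y]; (rule that; assumption)?) (use f assms S_T in simp_all)
  then show ?thesis using nullI[OF _ m(1) J, of f X] cf_wf[OF f(1)] f assms by simp
qed

text \<open>A morphism into an object of \<I> extends along the inflation of \<open>e\<close>, since
  \<I> lies in \<V> and the cokernel in \<U>; so a null perturbation does not change the push. This
  is what makes squares that commute modulo \<I> act on extensions.\<close>

lemma push_cls:
  assumes "e \<in> EE" "eC e \<in> U" "z \<in> arrs C" "src C z = eA e" "cls C I z = cls C I z'"
  shows "push z e = push z' e"
proof -
  obtain f g where cf: "cf f g e" using cf_realize assms by blast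
  note w = cf_wf[OF cf]
  obtain k where k: "null C I k" "src C k = src C z" "tgt C k = tgt C z" "k \<in> arrs C" "z' = z \<boxplus> k"
    using assms(5,3) by (rule cls_eqE)
  obtain J p q where n: "J \<in> I" "mor C p (src C k) J" "mor C q J (tgt C k)" "q \<cdot> p = k"
    using k(1) by (rule null_factor)
  obtain m where m: "mor C m (tgt C f) J" "m \<cdot> f = p"
    by (rule extend[OF cf, of p J]; (rule that; assumption)?) (use w n k(2-4) assms U_V[OF assms(2)] I_sub[OF n(1)] in simp_all)
  have "(q \<cdot> m) \<cdot> f = k" using n m w by simp
  then show ?thesis
    using push_eq[OF cf, of z z'] k w n(1,3) m(1) assms by (auto intro!: exI[of _ "q \<cdot> m"])
qed

text \<open>Here \<I> is used as a part of \<S>: morphisms out of its objects lift along the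
  deflation of \<open>e\<close>, whose kernel is in \<T>.\<close>

lemma pull_cls:
  assumes "e \<in> EE" "eA e \<in> T" "z \<in> arrs C" "tgt C z = eC e" "cls C I z = cls C I z'"
  shows "pull z e = pull z' e"
proof -
  obtain f g where cf: "cf f g e" using cf_realize assms by blast
  note w = cf_wf[OF cf]
  obtain k where k: "null C I k" "src C k = src C z" "tgt C k = tgt C z" "k \<in> arrs C" "z' = z \<boxplus> k"
    using assms(5,3) by (rule cls_eqE)
  obtain J p q where n: "J \<in> I" "mor C p (src C k) J" "mor C q J (tgt C k)" "q \<cdot> p = k"
    using k(1) by (rule null_factor)
  obtain m where m: "mor C m J (tgt C f)" "g \<cdot> m = q"
    by (rule lift[OF cf, of q J]; (rule that; assumption)?) (use w n k(2-4) assms S_T[OF _ assms(2)] I_sub[OF n(1)] in simp_all)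
  have "g \<cdot> (m \<cdot> p) = (g \<cdot> m) \<cdot> p" using n(2) m(1) w by simp
  then have "g \<cdot> (m \<cdot> p) = k" using n m by simp
  then show ?thesis
    using pull_eq[OF cf, of z z'] k w n(1,2) m(1) assms by (auto intro!: exI[of _ "m \<cdot> p"])
qed

text \<open>For a conflation \<open>X \<rightarrow> J \<rightarrow> Y\<close> with \<open>J\<close> in \<open>\<I>\<close>, extensions by \<open>X\<close> of objects of \<open>\<U>\<close>
  are the same as morphisms to \<open>Y\<close> modulo \<open>\<I>\<close>, and dually.\<close>

lemma pull_inj:
  assumes cf: "cf i p c" and "tgt C i \<in> I" "mor C u X (tgt C p)" "mor C u' X (tgt C p)" "pull u c = pull u' c"
  shows "cls C I u = cls C I u'"
proof -
  note w = cf_wf[OF cf]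
  obtain m where m: "mor C m X (tgt C i)" "u \<boxplus> (p \<cdot> m) = u'"
    using pull_eq[OF cf, of u u'] assms w by auto
  then show ?thesis
    using cls_eqI[of "p \<cdot> m" u] nullI[of m X "tgt C i" p "tgt C p"] assms w by simp
qed

lemma push_inj:
  assumes cf: "cf i p c" and "tgt C i \<in> I" "mor C u (src C i) X" "mor C u' (src C i) X" "push u c = push u' c"
  shows "cls C I u = cls C I u'"
proof -
  note w = cf_wf[OF cf]
  obtain m where m: "mor C m (tgt C i) X" "u \<boxplus> (m \<cdot> i) = u'"
    using push_eq[OF cf, of u u'] assms w by auto
  then show ?thesis
    using cls_eqI[of "m \<cdot> i" u] nullI[of i "src C i" "tgt C i" m X] assms w by simp
qed

text \<open>The middle term of the conflation lies in \<V> and the cokernel of \<open>x\<close> in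
  \<U>, so \<open>x\<close> becomes trivial when pushed along \<open>i\<close>; by exactness it is a
  pull of \<open>c\<close>.\<close>

lemma pull_surj:
  assumes cf: "cf i p c" and "tgt C i \<in> I" "x \<in> EE" "eA x = src C i" "eC x \<in> U"
  obtains u where "mor C u (eC x) (tgt C p)" "pull u c = x"
proof -
  note w = cf_wf[OF cf]
  have "push i x = push (Zero C (src C i) (tgt C i)) x"
    by (rule triv_eq[OF U_V[OF assms(5), of "tgt C i"]]) (use w assms I_sub[OF assms(2)] in simp_all)
  then obtain u where "u \<in> arrs C" "src C u = eC x" "tgt C u = tgt C p" "pull u c = x"
    using push_exact[OF cf assms(3,4)] by blast
  then show ?thesis by (intro that[of u]) (use ext_ob[OF assms(3)] w in simp_all)
qed

text \<open>The middle term, now as an object of \<S>, has no extensions by \<open>eA x\<close> in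
  \<T>, so \<open>x\<close> becomes trivial when pulled along \<open>p\<close>.\<close>

lemma push_surj:
  assumes cf: "cf i p c" and "tgt C i \<in> I" "x \<in> EE" "eC x = tgt C p" "eA x \<in> T"
  obtains u where "mor C u (src C i) (eA x)" "push u c = x"
proof -
  note w = cf_wf[OF cf]
  have "pull p x = pull (Zero C (src C p) (tgt C p)) x"
    by (rule triv_eq[OF S_T[OF _ assms(5), of "tgt C i"]]) (use w assms I_sub[OF assms(2)] in simp_all)
  then obtain u where "u \<in> arrs C" "tgt C u = eA x" "src C u = src C i" "push u c = x"
    using pull_exact[OF cf assms(3,4)] by blast
  then show ?thesis by (intro that[of u]) (use ext_ob[OF assms(3)] w in simp_all)
qed

text \<open>Inflations with cokernel in \<S> are the morphisms that the reflection inverts. This is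
  the existence half of that fact; the next lemma is uniqueness modulo \<I>.\<close>

lemma S_cone_extend:
  assumes cf: "cf h s e" and "tgt C s \<in> S" "mor C k (src C h) Y" "Y \<in> T"
  obtains G where "mor C G (tgt C h) Y" "G \<cdot> h = k"
  by (rule extend[OF cf assms(3)]; (rule that; assumption)?) (use assms S_T in simp_all)

text \<open>The difference of \<open>G\<close> and \<open>G'\<close> is null on the source of
  \<open>h\<close>. Extending its factorization along \<open>h\<close> gives a null correction,
  after which the difference kills \<open>h\<close> strictly and factors through an object of
  \<S>.\<close>

lemma S_cone_cancel:
  assumes cf: "cf h s e" and "tgt C s \<in> S" "mor C G (tgt C h) Y" "mor C G' (tgt C h) Y" "Y \<in> T"
    "cls C I (G \<cdot> h) = cls C I (G' \<cdot> h)"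
  shows "cls C I G = cls C I G'"
proof -
  define A B where "A = src C h" and "B = tgt C h"
  have w: "mor C h A B" "mor C s B (tgt C s)" using cf_wf[OF cf] unfolding A_def B_def by auto
  have G: "mor C G B Y" "mor C G' B Y" using assms unfolding B_def by auto
  have Gh: "G \<cdot> h \<in> arrs C" using w G by simp
  obtain k where "null C I k" "src C k = src C (G \<cdot> h)" "tgt C k = tgt C (G \<cdot> h)" "k \<in> arrs C" "G' \<cdot> h = (G \<cdot> h) \<boxplus> k"
    using assms(6) Gh by (rule cls_eqE)
  then have k: "null C I k" "mor C k A Y" "G' \<cdot> h = (G \<cdot> h) \<boxplus> k" using w G by auto
  obtain J p q where n: "J \<in> I" "mor C p A J" "mor C q J Y" "q \<cdot> p = k"
    using null_factor[OF k(1)] k(2) by metis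
  obtain p' where p': "mor C p' B J" "p' \<cdot> h = p"
    by (rule S_cone_extend[OF cf assms(2), of p J, folded A_def B_def]; (rule that; assumption)?) (use n I_sub[OF n(1)] in simp_all)
  define n' where "n' = q \<cdot> p'"
  have n': "null C I n'" "mor C n' B Y" unfolding n'_def
    using nullI[OF p'(1) n(3,1)] n(3) p' by auto
  obtain d where d: "mor C d B Y" "G' = G \<boxplus> d"
    by (rule difference[of G B Y G']) (use G in auto)
  obtain d' where d': "mor C d' B Y" "d = n' \<boxplus> d'"
    by (rule difference[of n' B Y d]) (use d n' in auto)
  have nh: "n' \<cdot> h = k" unfolding n'_def using p' n w by simp
  have "(G \<cdot> h) \<boxplus> (d \<cdot> h) = (G \<cdot> h) \<boxplus> k" using k(3) d w G by simp
  then have "d \<cdot> h = k" by (rule add_left_cancel) (use w G d(1) k(2) in auto)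
  then have "k \<boxplus> (d' \<cdot> h) = k \<boxplus> Zero C A Y" using d' n' w nh k(2) by simp
  then have "d' \<cdot> h = Zero C A Y" by (rule add_left_cancel) (use w G d'(1) k(2) in auto)
  then obtain r where r: "mor C r (tgt C s) Y" "r \<cdot> s = d'"
    using cf_cokernel[OF cf, of d'] d' k w unfolding A_def B_def by auto
  \<comment> \<open>What remains passes through a morphism from \<S> to \<T>, and these are all
    null.\<close>
  have "null C I (r \<cdot> s)" by (rule null_comp_right[OF ST_null]) (use r(1) assms w in auto)
  then have "null C I d" unfolding d'(2) r(2) using null_add[OF n'(1)] d' n' by auto
  then show ?thesis unfolding d(2) using cls_eqI[of d G] d(1) G by simp
qed

end

section \<open>The suspension functor\<close>

text \<open>Of the triangle chosen for \<open>X\<close> only the extension \<open>sg X\<close> is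
  kept as data; its inflation and deflation are asserted to exist, as the suspension and its
  triangles are determined by the extension.\<close>

locale suspension_choice = concentric +
  fixes su sig :: "'a \<Rightarrow> 'a" and sg :: "'a \<Rightarrow> 'd" and eta :: "'a \<Rightarrow> 'b"
  assumes su_choice: "X \<in> T \<inter> U \<Longrightarrow>
      su X \<in> U \<and> (\<exists>i p. cf i p (sg X) \<and> src C i = X \<and> tgt C i \<in> S \<inter> T \<and> tgt C p = su X)"
    and sig_choice: "A \<in> U \<Longrightarrow>
      sig A \<in> T \<and> (\<exists>s e. cf (eta A) s e \<and> src C (eta A) = A \<and> tgt C (eta A) = sig A \<and> tgt C s \<in> S)"
begin

abbreviation D where "D \<equiv> ideal_quotient C (T \<inter> U) (S \<inter> T)"

lemma cong_left: "\<lbrakk>cls C I f = cls C I f'; f \<in> arrs C; g \<in> arrs C; src C g = tgt C f\<rbrakk>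
    \<Longrightarrow> cls C I (g \<cdot> f) = cls C I (g \<cdot> f')"
  by (rule cls_comp_cong) simp_all

lemma cong_right: "\<lbrakk>cls C I g = cls C I g'; f \<in> arrs C; g \<in> arrs C; src C g = tgt C f\<rbrakk>
    \<Longrightarrow> cls C I (g \<cdot> f) = cls C I (g' \<cdot> f)"
  by (rule cls_comp_cong) simp_all

lemma cong_mn: "\<lbrakk>cls C I f = cls C I f'; f \<in> arrs C; f' \<in> arrs C\<rbrakk> \<Longrightarrow> cls C I (mn C f) = cls C I (mn C f')"
proof -
  assume h: "cls C I f = cls C I f'" "f \<in> arrs C" "f' \<in> arrs C"
  have "src C f' = src C f" "tgt C f' = tgt C f"
    using cls_mem[of f' f] cls_self[OF h(3)] h by auto
  then show ?thesis using cong_right[OF h(1), of "mn C (Id C (src C f))"] h by simp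
qed

lemma Zc_ob: "X \<in> T \<inter> U \<Longrightarrow> X \<in> Ob C \<and> X \<in> T \<and> X \<in> U"
  using sub_ob by blast

lemma su_U: "X \<in> T \<inter> U \<Longrightarrow> su X \<in> U \<and> su X \<in> Ob C"
  using su_choice sub_ob by blast

lemma suE:
  assumes "X \<in> T \<inter> U"
  obtains i p J where "cf i p (sg X)" "mor C i X J" "J \<in> I" "mor C p J (su X)"
proof -
  obtain i p where h: "cf i p (sg X)" "src C i = X" "tgt C i \<in> I" "tgt C p = su X"
    using su_choice[OF assms] by blast
  show ?thesis by (rule that[OF h(1), of "tgt C i"]) (use h cf_wf[OF h(1)] Zc_ob[OF assms] su_U[OF assms] in simp_all)
qed

lemma sg_ext: "X \<in> T \<inter> U \<Longrightarrow> sg X \<in> EE \<and> eA (sg X) = X \<and> eC (sg X) = su X"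
  by (elim suE) (use cf_wf in metis)

lemma sigE:
  assumes "A \<in> U"
  obtains s e where "cf (eta A) s e" "tgt C s \<in> S" "mor C s (sig A) (tgt C s)"
proof -
  obtain s e where h: "cf (eta A) s e" "tgt C (eta A) = sig A" "tgt C s \<in> S" using sig_choice[OF assms] by blast
  then show ?thesis using that[OF h(1)] cf_wf[OF h(1)] tgt_ob[of "eta A"] by simp
qed

lemma eta_mor: "A \<in> U \<Longrightarrow> mor C (eta A) A (sig A)"
  using sig_choice[of A] cf_wf sub_ob by metis

text \<open>\<open>sig A\<close> is an extension of an object of \<S>, hence of \<U>, by
  \<open>A\<close>.\<close>

lemma sig_Zc: "A \<in> U \<Longrightarrow> sig A \<in> T \<inter> U"
proof -
  assume A: "A \<in> U"
  then obtain s e where h: "cf (eta A) s e" "tgt C s \<in> S" by (elim sigE)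
  then show ?thesis using extension_closed(3)[OF h(1)] S_U sig_choice[OF A] eta_mor[OF A] A by auto
qed

lemma sig_ob: "A \<in> U \<Longrightarrow> sig A \<in> Ob C \<and> sig A \<in> T \<and> sig A \<in> U"
  using sig_Zc Zc_ob by blast

text \<open>Together with the next lemma this is the universal property of the unit. Factorizations
  exist strictly in \<C> and are unique only modulo \<I>.\<close>

lemma sig_extend:
  assumes "A \<in> U" "mor C k A Y" "Y \<in> T"
  obtains G where "mor C G (sig A) Y" "G \<cdot> eta A = k"
proof -
  obtain s e where h: "cf (eta A) s e" "tgt C s \<in> S" using assms(1) by (rule sigE)
  show ?thesis
    by (rule S_cone_extend[OF h, of k Y]; (rule that)?) (use eta_mor[OF assms(1)] assms in simp_all)
qed

lemma sig_cancel:
  assumes "A \<in> U" "mor C G (sig A) Y" "mor C G' (sig A) Y" "Y \<in> T" "cls C I (G \<cdot> eta A) = cls C I (G' \<cdot> eta A)"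
  shows "cls C I G = cls C I G'"
proof -
  obtain s e where h: "cf (eta A) s e" "tgt C s \<in> S" using assms(1) by (rule sigE)
  show ?thesis by (rule S_cone_cancel[OF h, of _ Y]) (use eta_mor[OF assms(1)] assms in simp_all)
qed

section \<open>Isomorphisms of the quotient coming from the reflection and from objects of
  \<I>\<close>

lemma D_iso:
  assumes "mor C f A B" "mor C g B A" "A \<in> T \<inter> U" "B \<in> T \<inter> U"
    "cls C I (g \<cdot> f) = cls C I (Id C A)" "cls C I (f \<cdot> g) = cls C I (Id C B)"
  shows "iso_in D A B (cls C I f)"
  by (rule quotient_iso[OF Z_ob assms(1,2)]) (use assms in simp_all)

text \<open>The reflection preserves isomorphisms modulo \<I>. The argument cancels units, because
  no functor is at hand here that could be applied.\<close>

lemma sig_iso: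
  assumes "mor C f A B" "mor C g B A" "A \<in> U" "B \<in> U"
    "cls C I (g \<cdot> f) = cls C I (Id C A)" "cls C I (f \<cdot> g) = cls C I (Id C B)"
    "mor C t (sig A) (sig B)" "cls C I (t \<cdot> eta A) = cls C I (eta B \<cdot> f)"
  shows "iso_in D (sig A) (sig B) (cls C I t)"
proof -
  note ab = eta_mor[OF assms(3)] eta_mor[OF assms(4)] sig_ob[OF assms(3)] sig_ob[OF assms(4)]
  obtain t' where t': "mor C t' (sig B) (sig A)" "t' \<cdot> eta B = eta A \<cdot> g"
    by (rule sig_extend[OF assms(4), of "eta A \<cdot> g" "sig A"]; (rule that; assumption)?) (use ab assms(1,2) in simp_all)
  have "cls C I ((t' \<cdot> t) \<cdot> eta A) = cls C I (t' \<cdot> (eta B \<cdot> f))"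
    using cong_left[OF assms(8), of t'] ab t'(1) assms(1,7) by simp
  also have "\<dots> = cls C I ((eta A \<cdot> g) \<cdot> f)" unfolding t'(2)[symmetric] using ab t'(1) assms(1) by simp
  also have "\<dots> = cls C I (Id C (sig A) \<cdot> eta A)" using cong_left[OF assms(5), of "eta A"] ab assms(1,2) by simp
  finally have 1: "cls C I (t' \<cdot> t) = cls C I (Id C (sig A))"
    by (rule sig_cancel[where Y = "sig A", OF assms(3), rotated 3]) (use ab t' assms(7) in simp_all)
  have "cls C I ((t \<cdot> t') \<cdot> eta B) = cls C I ((t \<cdot> eta A) \<cdot> g)"
    using ab t' assms(1,2,7) by simp
  also have "\<dots> = cls C I ((eta B \<cdot> f) \<cdot> g)" by (rule cong_right[OF assms(8)]) (use ab assms(1,2,7) in simp_all)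
  also have "\<dots> = cls C I (Id C (sig B) \<cdot> eta B)" using cong_left[OF assms(6), of "eta B"] ab assms(1,2) by simp
  finally have 2: "cls C I (t \<cdot> t') = cls C I (Id C (sig B))"
    by (rule sig_cancel[where Y = "sig B", OF assms(4), rotated 3]) (use ab t' assms(7) in simp_all)
  show ?thesis by (rule D_iso[OF assms(7) t'(1) _ _ 1 2]) (use sig_Zc assms in auto)
qed

text \<open>An inflation with cokernel in \<S> becomes invertible under the reflection. There is no
  inverse of \<open>h\<close> to reflect; the inverse comes from extending \<open>eta A\<close>
  along \<open>h\<close>.\<close>

lemma sig_iso_S_cone:
  assumes cf: "cf h s e" and "tgt C s \<in> S" "mor C h A B" "A \<in> U" "B \<in> U"
    "mor C t (sig A) (sig B)" "cls C I (t \<cdot> eta A) = cls C I (eta B \<cdot> h)"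
  shows "iso_in D (sig A) (sig B) (cls C I t)"
proof -
  note ab = eta_mor[OF assms(4)] eta_mor[OF assms(5)] sig_ob[OF assms(4)] sig_ob[OF assms(5)]
  obtain k where k: "mor C k B (sig A)" "k \<cdot> h = eta A"
    by (rule S_cone_extend[OF cf assms(2), of "eta A" "sig A"]; (rule that)?) (use ab assms(3) in simp_all)
  obtain t' where t': "mor C t' (sig B) (sig A)" "t' \<cdot> eta B = k"
    by (rule sig_extend[OF assms(5), of k "sig A"]; (rule that; assumption)?) (use ab k(1) in simp_all)
  have "cls C I ((t' \<cdot> t) \<cdot> eta A) = cls C I (t' \<cdot> (eta B \<cdot> h))"
    using cong_left[OF assms(7), of t'] ab t'(1) assms(3,6) by simp
  also have "t' \<cdot> (eta B \<cdot> h) = eta A"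
    using k t' ab assms(3) by (simp add: comp_reassoc[OF t'(2)])
  finally have "cls C I ((t' \<cdot> t) \<cdot> eta A) = cls C I (Id C (sig A) \<cdot> eta A)" using ab by simp
  then have 1: "cls C I (t' \<cdot> t) = cls C I (Id C (sig A))"
    by (rule sig_cancel[where Y = "sig A", OF assms(4), rotated 3]) (use ab t' assms(6) in simp_all)
  \<comment> \<open>Neither \<open>h\<close> nor \<open>eta B\<close> need be epic in \<C>, but both
    can be cancelled modulo \<I> when the target is in \<T>.\<close>
  have "((t \<cdot> t') \<cdot> eta B) \<cdot> h = t \<cdot> eta A" using k t' ab assms(3,6) by simp
  then have "cls C I (((t \<cdot> t') \<cdot> eta B) \<cdot> h) = cls C I (eta B \<cdot> h)" using assms(7) by simp
  then have "cls C I ((t \<cdot> t') \<cdot> eta B) = cls C I (eta B)"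
    by (rule S_cone_cancel[where Y = "sig B", OF cf assms(2), rotated 3]) (use ab t'(1) assms(3,6) in simp_all)
  then have "cls C I ((t \<cdot> t') \<cdot> eta B) = cls C I (Id C (sig B) \<cdot> eta B)" using ab by simp
  then have 2: "cls C I (t \<cdot> t') = cls C I (Id C (sig B))"
    by (rule sig_cancel[where Y = "sig B", OF assms(5), rotated 3]) (use ab t' assms(6) in simp_all)
  show ?thesis by (rule D_iso[OF assms(6) t'(1) _ _ 1 2]) (use sig_Zc assms in auto)
qed

text \<open>An object of \<Z> is its own reflection: its identity extends along the unit, and the
  resulting one-sided inverse is two-sided after cancelling the unit.\<close>

lemma eta_iso:
  assumes "Y \<in> T \<inter> U"
  shows "iso_in D Y (sig Y) (cls C I (eta Y))"
proof -
  have Y: "Y \<in> U" "Y \<in> T" "Y \<in> Ob C" using Zc_ob[OF assms] by auto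
  note e = eta_mor[OF Y(1)] sig_ob[OF Y(1)]
  obtain r where r: "mor C r (sig Y) Y" "r \<cdot> eta Y = Id C Y"
    by (rule sig_extend[OF Y(1), of "Id C Y" Y]; (rule that; assumption)?) (use Y in simp_all)
  have "cls C I ((eta Y \<cdot> r) \<cdot> eta Y) = cls C I (Id C (sig Y) \<cdot> eta Y)" using e r by simp
  then have 1: "cls C I (eta Y \<cdot> r) = cls C I (Id C (sig Y))"
    by (rule sig_cancel[where Y = "sig Y", OF Y(1), rotated 3]) (use e r(1) in simp_all)
  show ?thesis by (rule D_iso[OF e(1) r(1) assms sig_Zc[OF Y(1)] _ 1]) (use r in simp)
qed

text \<open>The kernel of \<open>e\<close> is in \<V> and \<open>A\<close> in \<U>, so
  \<open>e\<close> has a section. The difference of \<open>s \<cdot> e\<close> and the identity is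
  killed by \<open>e\<close>, hence factors through \<open>d\<close> and an object of \<I>.\<close>

lemma sub_I_iso:
  assumes cf: "cf d e x" and "src C d \<in> I" "mor C e B A" "A \<in> U"
  obtains s where "mor C s A B" "e \<cdot> s = Id C A" "cls C I (s \<cdot> e) = cls C I (Id C B)"
proof -
  note w = cf_wf[OF cf]
  obtain s where s: "mor C s A B" "e \<cdot> s = Id C A"
    by (rule lift[OF cf, of "Id C A" A]; (rule that)?) (use w assms U_V[OF assms(4)] I_sub[OF assms(2)] in simp_all)
  have es: "e \<cdot> (s \<cdot> e) = e" using s assms(3) by (simp add: comp_reassoc[OF s(2)])
  obtain k where k: "mor C k B B" "s \<cdot> e = Id C B \<boxplus> k"
    by (rule difference[of "Id C B" B B "s \<cdot> e"]) (use s(1) assms(3) in simp_all)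
  have "e \<boxplus> (e \<cdot> k) = e \<cdot> (Id C B \<boxplus> k)" using k(1) assms(3) by simp
  also have "\<dots> = e \<boxplus> Zero C B A" unfolding k(2)[symmetric] es using assms(3) by simp
  finally have "e \<cdot> k = Zero C B A" by (rule add_left_cancel) (use k(1) assms(3) in simp_all)
  then obtain m where m: "mor C m B (src C d)" "d \<cdot> m = k"
    using cf_kernel[OF cf, of k] k(1) assms(3) w by auto
  then have "null C I k" using nullI[OF m(1), of d B] w assms by auto
  then have "cls C I (s \<cdot> e) = cls C I (Id C B)" unfolding k(2) using k(1) by (intro cls_eqI) simp_all
  with s show ?thesis by (rule that)
qed

text \<open>The dual argument: with the cokernel in \<S> and \<open>A\<close> in \<T> the inflation
  has a retraction, and the error factors through the cokernel.\<close>

lemma quotient_I_iso: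
  assumes cf: "cf d e x" and "tgt C e \<in> I" "mor C d A B" "A \<in> T"
  obtains r where "mor C r B A" "r \<cdot> d = Id C A" "cls C I (d \<cdot> r) = cls C I (Id C B)"
proof -
  note w = cf_wf[OF cf]
  obtain r where r: "mor C r B A" "r \<cdot> d = Id C A"
    by (rule extend[OF cf, of "Id C A" A]; (rule that)?) (use w assms S_T[OF _ assms(4)] I_sub[OF assms(2)] in simp_all)
  obtain k where k: "mor C k B B" "d \<cdot> r = Id C B \<boxplus> k"
    by (rule difference[of "Id C B" B B "d \<cdot> r"]) (use r(1) assms(3) in simp_all)
  have "d \<boxplus> (k \<cdot> d) = (Id C B \<boxplus> k) \<cdot> d" using k(1) assms(3) by simp
  also have "\<dots> = d \<boxplus> Zero C A B" unfolding k(2)[symmetric] using assms(3) r by simp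
  finally have "k \<cdot> d = Zero C A B" by (rule add_left_cancel) (use k(1) assms(3) in simp_all)
  then obtain m where m: "mor C m (tgt C e) B" "m \<cdot> e = k"
    using cf_cokernel[OF cf, of k] k(1) assms(3) w by auto
  then have "null C I k" using nullI[OF _ m(1), of e B] w assms by auto
  then have "cls C I (d \<cdot> r) = cls C I (Id C B)" unfolding k(2) using k(1) by (intro cls_eqI) simp_all
  with r show ?thesis by (rule that)
qed

text \<open>The graph of the suspension functor on representatives. It is a relation because the
  intermediate \<open>u\<close> and the result \<open>v\<close> are determined only modulo
  \<I>.\<close>

definition susp :: "'b \<Rightarrow> 'b \<Rightarrow> bool" where
  "susp z v \<longleftrightarrow> (\<exists>X Y u. X \<in> T \<inter> U \<and> Y \<in> T \<inter> U \<and> mor C z X Y \<and> mor C u (su X) (su Y) \<and>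
     pull u (sg Y) = push z (sg X) \<and> mor C v (sig (su X)) (sig (su Y)) \<and>
     cls C I (v \<cdot> eta (su X)) = cls C I (eta (su Y) \<cdot> u))"

text \<open>With the next lemma: modulo \<I>, morphisms from an object of \<U> to
  \<open>su X\<close> are the same as its extensions by \<open>X\<close>.\<close>

lemma su_arrow_exists:
  assumes "X \<in> T \<inter> U" "A \<in> U" "e \<in> EE" "eC e = A" "eA e = X"
  obtains u where "mor C u A (su X)" "pull u (sg X) = e"
proof -
  obtain i p J where i: "cf i p (sg X)" "mor C i X J" "J \<in> I" "mor C p J (su X)" using assms(1) by (rule suE)
  show ?thesis by (rule pull_surj[OF i(1), of e]; (rule that)?) (use i assms su_U in auto)
qed

lemma su_arrow_unique:
  assumes "X \<in> T \<inter> U" "mor C u A (su X)" "mor C u' A (su X)" "pull u (sg X) = pull u' (sg X)"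
  shows "cls C I u = cls C I u'"
proof -
  obtain i p J where i: "cf i p (sg X)" "mor C i X J" "J \<in> I" "mor C p J (su X)" using assms(1) by (rule suE)
  show ?thesis by (rule pull_inj[OF i(1), of _ A]) (use i assms in auto)
qed

lemma sig_arrow_exists:
  assumes "A \<in> U" "B \<in> U" "mor C u A B"
  obtains v where "mor C v (sig A) (sig B)" "v \<cdot> eta A = eta B \<cdot> u"
  by (rule sig_extend[OF assms(1), of "eta B \<cdot> u" "sig B"]; (rule that)?)
     (use eta_mor[OF assms(2)] sig_ob[OF assms(2)] assms in simp_all)

lemma susp_exists:
  assumes "X \<in> T \<inter> U" "Y \<in> T \<inter> U" "mor C z X Y"
  obtains u v where "mor C u (su X) (su Y)" "pull u (sg Y) = push z (sg X)"
    "mor C v (sig (su X)) (sig (su Y))" "v \<cdot> eta (su X) = eta (su Y) \<cdot> u" "susp z v"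
proof -
  note s = su_U[OF assms(1)] su_U[OF assms(2)] sg_ext[OF assms(1)] sg_ext[OF assms(2)]
  obtain u where u: "mor C u (su X) (su Y)" "pull u (sg Y) = push z (sg X)"
    by (rule su_arrow_exists[OF assms(2), of "su X" "push z (sg X)"]; (rule that)?) (use s assms in simp_all)
  obtain v where v: "mor C v (sig (su X)) (sig (su Y))" "v \<cdot> eta (su X) = eta (su Y) \<cdot> u"
    by (rule sig_arrow_exists[of "su X" "su Y" u]; (rule that)?) (use s u in simp_all)
  show ?thesis by (rule that[OF u v]) (use susp_def u v assms in auto)
qed

lemma susp_id:
  assumes X: "X \<in> T \<inter> U"
  shows "susp (Id C X) (Id C (sig (su X)))"
proof -
  note s = su_U[OF X] sg_ext[OF X] Zc_ob[OF X]
  note e = eta_mor[of "su X"] sig_ob[of "su X"]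
  show ?thesis unfolding susp_def
    by (rule exI[of _ X], rule exI[of _ X], rule exI[of _ "Id C (su X)"]) (use X s e in simp)
qed

lemma susp_comp:
  assumes "susp z v" "susp z' v'" "src C z' = tgt C z"
  shows "susp (z' \<cdot> z) (v' \<cdot> v)"
proof -
  obtain X Y u where h: "X \<in> T \<inter> U" "Y \<in> T \<inter> U" "mor C z X Y" "mor C u (su X) (su Y)"
     "pull u (sg Y) = push z (sg X)" "mor C v (sig (su X)) (sig (su Y))"
     "cls C I (v \<cdot> eta (su X)) = cls C I (eta (su Y) \<cdot> u)"
    using assms(1) unfolding susp_def by blast
  obtain W u' where h': "W \<in> T \<inter> U" "mor C z' Y W" "mor C u' (su Y) (su W)"
     "pull u' (sg W) = push z' (sg Y)" "mor C v' (sig (su Y)) (sig (su W))"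
     "cls C I (v' \<cdot> eta (su Y)) = cls C I (eta (su W) \<cdot> u')"
    using assms(2,3) h(3) unfolding susp_def by auto
  note s = su_U[OF h(1)] su_U[OF h(2)] sg_ext[OF h(1)] sg_ext[OF h(2)] su_U[OF h'(1)] sg_ext[OF h'(1)]
    eta_mor[of "su X"] eta_mor[of "su Y"] eta_mor[of "su W"]
  have "pull (u' \<cdot> u) (sg W) = pull u (push z' (sg Y))" using s h h' pull_comp[of "sg W" u' u] by simp
  also have "\<dots> = push z' (push z (sg X))" using s h h' push_pull[of "sg Y" z' u] by simp
  also have "\<dots> = push (z' \<cdot> z) (sg X)" using s h(3) h'(2) push_comp[of "sg X" z z'] by simp
  finally have 1: "pull (u' \<cdot> u) (sg W) = push (z' \<cdot> z) (sg X)" .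
  have "cls C I ((v' \<cdot> v) \<cdot> eta (su X)) = cls C I (v' \<cdot> (eta (su Y) \<cdot> u))"
    using cong_left[OF h(7), of v'] s h(6) h'(5) by simp
  also have "\<dots> = cls C I ((eta (su W) \<cdot> u') \<cdot> u)"
    using cong_right[OF h'(6), of u] s h(4) h'(5) by simp
  finally have "cls C I ((v' \<cdot> v) \<cdot> eta (su X)) = cls C I (eta (su W) \<cdot> (u' \<cdot> u))" using s h(4) h'(3) by simp
  with 1 show ?thesis unfolding susp_def
    by (intro exI[of _ X] exI[of _ W] exI[of _ "u' \<cdot> u"]) (use h h' in simp)
qed

lemma susp_add:
  assumes "susp z v" "susp z' v'" "src C z' = src C z" "tgt C z' = tgt C z"
  shows "susp (z \<boxplus> z') (v \<boxplus> v')"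
proof -
  obtain X Y u where h: "X \<in> T \<inter> U" "Y \<in> T \<inter> U" "mor C z X Y" "mor C u (su X) (su Y)"
     "pull u (sg Y) = push z (sg X)" "mor C v (sig (su X)) (sig (su Y))"
     "cls C I (v \<cdot> eta (su X)) = cls C I (eta (su Y) \<cdot> u)"
    using assms(1) unfolding susp_def by blast
  obtain u' where h': "mor C z' X Y" "mor C u' (su X) (su Y)"
     "pull u' (sg Y) = push z' (sg X)" "mor C v' (sig (su X)) (sig (su Y))"
     "cls C I (v' \<cdot> eta (su X)) = cls C I (eta (su Y) \<cdot> u')"
    using assms(2,3,4) h(3) unfolding susp_def by auto
  note s = su_U[OF h(1)] su_U[OF h(2)] sg_ext[OF h(1)] sg_ext[OF h(2)] eta_mor[of "su X"] eta_mor[of "su Y"]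
  \<comment> \<open>Extensions have no addition of their own here; what can be added are two
    morphisms between the same extensions.\<close>
  have 1: "pull (u \<boxplus> u') (sg Y) = push (z \<boxplus> z') (sg X)"
    by (rule ext_add[symmetric]) (use s h(3,4,5) h'(1,2,3) in simp_all)
  have "cls C I ((v \<boxplus> v') \<cdot> eta (su X)) = cls C I ((v \<cdot> eta (su X)) \<boxplus> (v' \<cdot> eta (su X)))"
    using s h(6) h'(4) by simp
  also have "\<dots> = cls C I ((eta (su Y) \<cdot> u) \<boxplus> (eta (su Y) \<cdot> u'))"
    by (rule cls_add_cong[OF h(7) h'(5)]) (use s h(6) h'(4) in simp_all)
  also have "\<dots> = cls C I (eta (su Y) \<cdot> (u \<boxplus> u'))" using s h(4) h'(2) by simp
  finally show ?thesis unfolding susp_def using 1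
    by (intro exI[of _ X] exI[of _ Y] exI[of _ "u \<boxplus> u'"]) (use h h' in simp)
qed

end

sublocale suspension_choice \<subseteq> D: additive_category "ideal_quotient C (T \<inter> U) (S \<inter> T)"
  by (rule quotient_additive[OF Z_ob Z_I Z_biproduct])

context suspension_choice
begin

lemma D_mor: "mor D F A B \<longleftrightarrow> A \<in> T \<inter> U \<and> B \<in> T \<inter> U \<and> (\<exists>f. mor C f A B \<and> F = cls C I f)"
  by (rule quotient_arr[OF Z_ob])

lemma D_cls [simp]:
  assumes "f \<in> arrs C" "src C f \<in> T" "src C f \<in> U" "tgt C f \<in> T" "tgt C f \<in> U"
  shows "cls C I f \<in> arrs D" "src D (cls C I f) = src C f" "tgt D (cls C I f) = tgt C f"
  using quotient_cls[OF Z_ob] assms by auto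

lemma D_mn: "\<lbrakk>f \<in> arrs C; src C f \<in> T \<inter> U; tgt C f \<in> T \<inter> U\<rbrakk> \<Longrightarrow> mn D (cls C I f) = cls C I (mn C f)"
  by (rule quotient_mn[OF Z_ob])

end

text \<open>The functor is a parameter constrained only by its values on classes of representatives.
  The functors of the main statement are given by definite descriptions and have to be evaluated
  before they fit.\<close>

locale suspension = suspension_choice +
  fixes Sg :: "('a, 'b set, 'a, 'b set) functor_data"
  assumes Sg_ob: "X \<in> T \<inter> U \<Longrightarrow> on_ob Sg X = sig (su X)"
    and Sg_hom: "susp z v \<Longrightarrow> on_hom Sg (cls C (S \<inter> T) z) = cls C (S \<inter> T) v"
begin

lemma Sg_additive: "additive_functor D D Sg"
  unfolding additive_functor_def
proof (intro conjI ballI)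
  fix X assume X: "X \<in> Ob D"
  then show "on_ob Sg X \<in> Ob D" using Sg_ob[of X] sig_Zc su_U by simp
  show "on_hom Sg (Id D X) = Id D (on_ob Sg X)" using X Sg_ob[of X] Sg_hom[OF susp_id[of X]] by simp
next
  fix A B F assume h: "A \<in> Ob D" "B \<in> Ob D" "F \<in> Hom D A B"
  then obtain f where f: "mor C f A B" "F = cls C I f" using D.hom_iff_mor D_mor by metis
  obtain u v where v: "mor C v (sig (su A)) (sig (su B))" "susp f v"
    by (rule susp_exists[of A B f]) (use h f in auto)
  then have "mor D (cls C I v) (on_ob Sg A) (on_ob Sg B)"
    using h Sg_ob sig_Zc su_U by auto
  then show "on_hom Sg F \<in> Hom D (on_ob Sg A) (on_ob Sg B)" unfolding f Sg_hom[OF v(2)] by (rule D.mor_hom)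
next
  fix A B F F' assume h: "A \<in> Ob D" "B \<in> Ob D" "F \<in> Hom D A B" "F' \<in> Hom D A B"
  then obtain f f' where f: "mor C f A B" "F = cls C I f" "mor C f' A B" "F' = cls C I f'"
    using D.hom_iff_mor D_mor by metis
  obtain u v where v: "mor C v (sig (su A)) (sig (su B))" "susp f v"
    by (rule susp_exists[of A B f]) (use h f in auto)
  obtain u' v' where v': "mor C v' (sig (su A)) (sig (su B))" "susp f' v'"
    by (rule susp_exists[of A B f']) (use h f in auto)
  have "susp (f \<boxplus> f') (v \<boxplus> v')" using v v' f by (intro susp_add) simp_all
  then show "on_hom Sg (F \<boxplus>\<^bsub>D\<^esub> F') = on_hom Sg F \<boxplus>\<^bsub>D\<^esub> on_hom Sg F'"
    using f v v' by (simp add: quotient_add Sg_hom)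
next
  fix A B E F G assume h: "A \<in> Ob D" "B \<in> Ob D" "E \<in> Ob D" "F \<in> Hom D A B" "G \<in> Hom D B E"
  then obtain f g where f: "mor C f A B" "F = cls C I f" "mor C g B E" "G = cls C I g"
    using D.hom_iff_mor D_mor by metis
  obtain u v where v: "mor C v (sig (su A)) (sig (su B))" "susp f v"
    by (rule susp_exists[of A B f]) (use h f in auto)
  obtain u' v' where v': "mor C v' (sig (su B)) (sig (su E))" "susp g v'"
    by (rule susp_exists[of B E g]) (use h f in auto)
  have "susp (g \<cdot> f) (v' \<cdot> v)" using v v' f by (intro susp_comp) simp_all
  then show "on_hom Sg (G \<cdot>\<^bsub>D\<^esub> F) = on_hom Sg G \<cdot>\<^bsub>D\<^esub> on_hom Sg F"
    using f v v' by (simp add: quotient_comp Sg_hom)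
qed

end

sublocale suspension \<subseteq> D: suspended_category "ideal_quotient C (T \<inter> U) (S \<inter> T)" Sg
  by unfold_locales (rule Sg_additive)

section \<open>Distinguished right triangles\<close>

context suspension
begin

text \<open>The comparison with the chosen triangle is encoded by its effect on extensions,
  \<open>pull c (sg X) = b\<close>, from which its middle component can be recovered. The morphism
  \<open>v\<close> represents the image of \<open>c\<close> under the reflection.\<close>

definition std :: "('a, 'b set) tri set" where
  "std = {(X, Y, sig A, cls C I f, cls C I (eta A \<cdot> a), cls C I v) | X Y A f a b c v.
     X \<in> T \<inter> U \<and> Y \<in> T \<inter> U \<and> A \<in> U \<and> cf f a b \<and> mor C f X Y \<and> mor C a Y A \<and>
     mor C c A (su X) \<and> pull c (sg X) = b \<and>
     mor C v (sig A) (sig (su X)) \<and> cls C I (v \<cdot> eta A) = cls C I (eta (su X) \<cdot> c)}"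

definition dist :: "('a, 'b set) tri set" where
  "dist = {t. right_triangle D Sg t \<and> (\<exists>s\<in>std. tri_iso D Sg s t)}"

text \<open>The model triangle of \<open>f\<close> is built from the pushout \<open>Y \<rightarrow> W \<rightarrow> X\<langle>1\<rangle>\<close> of
  \<open>X \<rightarrow> I \<rightarrow> X\<langle>1\<rangle>\<close> along \<open>f\<close>, so that, unlike a standard triangle, it exists for every \<open>f\<close>.\<close>

definition models :: "('a, 'b set) tri set" where
  "models = {(X, Y, sig W, cls C I f, cls C I (eta W \<cdot> y), cls C I v) | X Y W f y w v.
     X \<in> T \<inter> U \<and> Y \<in> T \<inter> U \<and> mor C f X Y \<and> cf y w (push f (sg X)) \<and>
     mor C y Y W \<and> mor C w W (su X) \<and>
     mor C v (sig W) (sig (su X)) \<and> cls C I (v \<cdot> eta W) = cls C I (eta (su X) \<cdot> mn C w)}"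

lemma modelsE:
  assumes "(X, Y, Z, F, G, H) \<in> models"
  obtains W f y w v where "Z = sig W" "F = cls C I f" "G = cls C I (eta W \<cdot> y)" "H = cls C I v"
    "X \<in> T \<inter> U" "Y \<in> T \<inter> U" "W \<in> U" "mor C f X Y" "cf y w (push f (sg X))"
    "mor C y Y W" "mor C w W (su X)"
    "mor C v (sig W) (sig (su X))" "cls C I (v \<cdot> eta W) = cls C I (eta (su X) \<cdot> mn C w)"
proof -
  obtain W f y w v where h: "Z = sig W" "F = cls C I f" "G = cls C I (eta W \<cdot> y)" "H = cls C I v"
    "X \<in> T \<inter> U" "Y \<in> T \<inter> U" "mor C f X Y" "cf y w (push f (sg X))"
    "mor C y Y W" "mor C w W (su X)"
    "mor C v (sig W) (sig (su X))" "cls C I (v \<cdot> eta W) = cls C I (eta (su X) \<cdot> mn C w)"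
    using assms unfolding models_def by blast
  have "W \<in> U" using extension_closed(3)[OF h(8)] h(6,9,10) su_U[OF h(5)] by auto
  with h show ?thesis by (intro that)
qed

section \<open>Standard triangles and models compared\<close>

lemma std_wf: "t \<in> std \<Longrightarrow> right_triangle D Sg t"
proof -
  assume "t \<in> std"
  then obtain X Y A f a b c v where h: "t = (X, Y, sig A, cls C I f, cls C I (eta A \<cdot> a), cls C I v)"
    "X \<in> T \<inter> U" "Y \<in> T \<inter> U" "A \<in> U" "mor C f X Y" "mor C a Y A" "mor C v (sig A) (sig (su X))"
    unfolding std_def by blast
  note s = Zc_ob[OF h(2)] Zc_ob[OF h(3)] sig_ob[OF h(4)] eta_mor[OF h(4)] su_U[OF h(2)]
  note s' = s sig_ob[of "su X"]
  show ?thesis unfolding h(1) D.right_triangle_iff using h(5-) s' Sg_ob[OF h(2)] by simp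
qed

lemma models_wf: "t \<in> models \<Longrightarrow> right_triangle D Sg t"
proof -
  assume t: "t \<in> models"
  obtain X Y Z F G H where t': "t = (X, Y, Z, F, G, H)" by (cases t)
  obtain W f y w v where h: "Z = sig W" "F = cls C I f" "G = cls C I (eta W \<cdot> y)" "H = cls C I v"
    "X \<in> T \<inter> U" "Y \<in> T \<inter> U" "W \<in> U" "mor C f X Y" "mor C y Y W" "mor C v (sig W) (sig (su X))"
    using t unfolding t' by (elim modelsE)
  note s = Zc_ob[OF h(5)] Zc_ob[OF h(6)] sig_ob[OF h(7)] eta_mor[OF h(7)] su_U[OF h(5)]
  note s' = s sig_ob[of "su X"]
  show ?thesis unfolding t' h(1-4) D.right_triangle_iff using h(8-) s' Sg_ob[OF h(5)] by simp
qed

lemma dist_wf: "t \<in> dist \<Longrightarrow> right_triangle D Sg t"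
  unfolding dist_def by blast

lemma dist_iso: "\<lbrakk>t \<in> dist; right_triangle D Sg t'; tri_iso D Sg t t'\<rbrakk> \<Longrightarrow> t' \<in> dist"
  unfolding dist_def using D.tri_iso_trans std_wf by blast

lemma std_dist: "t \<in> std \<Longrightarrow> t \<in> dist"
proof -
  assume t: "t \<in> std"
  obtain X Y Z F G H where t': "t = (X, Y, Z, F, G, H)" by (cases t)
  note w = std_wf[OF t, unfolded t']
  note v = w[unfolded D.right_triangle_iff]
  have "tri_mor D Sg t t (Id D X) (Id D Y) (Id D Z)" unfolding t' D.tri_mor_iff[OF w w] using v D.id_simps
    by (simp del: ideal_quotient_simps)
  then have "tri_iso D Sg t t" unfolding t' by (rule D.tri_isoI) (use v D.iso_in_id in auto)
  then show ?thesis unfolding dist_def using t std_wf by blast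
qed

text \<open>The strict equation for \<open>v\<close> is part of the conclusion because membership in
  \<open>std\<close> retains it only modulo \<I>.\<close>

lemma std_exists:
  assumes "cf f a b" "mor C f X Y" "mor C a Y A" "X \<in> T \<inter> U" "Y \<in> T \<inter> U" "A \<in> U"
  obtains c v where "mor C c A (su X)" "pull c (sg X) = b" "mor C v (sig A) (sig (su X))"
    "v \<cdot> eta A = eta (su X) \<cdot> c" "(X, Y, sig A, cls C I f, cls C I (eta A \<cdot> a), cls C I v) \<in> std"
proof -
  obtain c where c: "mor C c A (su X)" "pull c (sg X) = b"
    by (rule su_arrow_exists[OF assms(4,6), of b]; (rule that)?) (use cf_wf[OF assms(1)] assms in simp_all)
  obtain v where v: "mor C v (sig A) (sig (su X))" "v \<cdot> eta A = eta (su X) \<cdot> c"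
    by (rule sig_arrow_exists[of A "su X" c]; (rule that)?) (use c su_U[OF assms(4)] assms in simp_all)
  have "(X, Y, sig A, cls C I f, cls C I (eta A \<cdot> a), cls C I v) \<in> std"
    unfolding std_def using assms c v(1) arg_cong[OF v(2), of "cls C I"] by blast
  with c v show ?thesis by (rule that)
qed

text \<open>The pushout \<open>W\<close> of \<open>f\<close> and of the inflation
  \<open>X \<rightarrow> J\<close> sits in two conflations:
  \<open>Y \<rightarrow> W \<rightarrow> su X\<close>, which gives the model, and
  \<open>J \<rightarrow> W \<rightarrow> A\<close>, whose deflation is invertible modulo \<I>. The
  reflection of this deflation compares the two triangles.\<close>

lemma std_model:
  assumes "t \<in> std"
  shows "\<exists>m\<in>models. tri_iso D Sg m t"
proof -
  obtain X Y A f a b c v where h: "t = (X, Y, sig A, cls C I f, cls C I (eta A \<cdot> a), cls C I v)"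
     "X \<in> T \<inter> U" "Y \<in> T \<inter> U" "A \<in> U" "cf f a b" "mor C f X Y" "mor C a Y A"
     "mor C c A (su X)" "pull c (sg X) = b"
     "mor C v (sig A) (sig (su X))" "cls C I (v \<cdot> eta A) = cls C I (eta (su X) \<cdot> c)"
    using assms unfolding std_def by blast
  obtain i p J where i: "cf i p (sg X)" "mor C i X J" "J \<in> I" "mor C p J (su X)" using h(2) by (rule suE)
  obtain y w d e where po: "cf y w (push f (sg X))" "cf d e (push i b)" "tgt C d = tgt C y"
      "e \<cdot> y = a" "pull e b = pull (mn C w) (sg X)"
    using pushout[OF h(5) i(1)] i(2) h(6) by auto
  note sX = sg_ext[OF h(2)] su_U[OF h(2)] eta_mor[of "su X"] sig_ob[of "su X"]
  note b = cf_wf[OF h(5)]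
  define W where "W = tgt C y"
  have m: "mor C y Y W" "mor C w W (su X)" "mor C d J W" "mor C e W A"
    using cf_wf[OF po(1)] cf_wf[OF po(2)] po(3) b h(6,7) i(2) sX unfolding W_def by auto
  have WU: "W \<in> U" using extension_closed(3)[OF po(1)] m Zc_ob[OF h(3)] sX by simp
  note sW = eta_mor[OF WU] sig_ob[OF WU] eta_mor[OF h(4)] sig_ob[OF h(4)]
  obtain v0 where v0: "mor C v0 (sig W) (sig (su X))" "v0 \<cdot> eta W = eta (su X) \<cdot> mn C w"
    by (rule sig_arrow_exists[of W "su X" "mn C w"]; (rule that)?) (use m WU sX in simp_all)
  have M: "(X, Y, sig W, cls C I f, cls C I (eta W \<cdot> y), cls C I v0) \<in> models"
    unfolding models_def using h(2,3,6) po(1) m v0(1) arg_cong[OF v0(2), of "cls C I"] by blast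
  obtain t' where t': "mor C t' (sig W) (sig A)" "t' \<cdot> eta W = eta A \<cdot> e"
    by (rule sig_arrow_exists[of W A e]; (rule that)?) (use m WU h(4) in simp_all)
  obtain r where r: "mor C r A W" "e \<cdot> r = Id C A" "cls C I (r \<cdot> e) = cls C I (Id C W)"
    by (rule sub_I_iso[OF po(2), of W A]; (rule that)?) (use m i h(4) in simp_all)
  have iso: "iso_in D (sig W) (sig A) (cls C I t')"
    by (rule sig_iso[OF m(4) r(1) WU h(4) r(3) _ t'(1)]) (use r(2) t'(2) in simp_all)
  have 1: "t' \<cdot> (eta W \<cdot> y) = eta A \<cdot> a"
    using t' m sW po(4) by (simp add: comp_reassoc[OF t'(2)])
  \<comment> \<open>Both sides classify the same extension of \<open>W\<close> by \<open>X\<close>,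
    by the sign rule of the pushout. The minus in the definition of the models is chosen for this
    equation.\<close>
  have ce: "cls C I (c \<cdot> e) = cls C I (mn C w)"
    by (rule su_arrow_unique[OF h(2), of _ W]) (use m h(8,9) po(5) sX pull_comp[of "sg X" c e] in simp_all)
  have "cls C I ((v \<cdot> t') \<cdot> eta W) = cls C I ((v \<cdot> eta A) \<cdot> e)" using t' m sW h(10) by simp
  also have "\<dots> = cls C I ((eta (su X) \<cdot> c) \<cdot> e)" by (rule cong_right[OF h(11)]) (use m sW h(10) in simp_all)
  also have "\<dots> = cls C I (eta (su X) \<cdot> mn C w)" using cong_left[OF ce, of "eta (su X)"] m h(8) sX by simp
  finally have "cls C I ((v \<cdot> t') \<cdot> eta W) = cls C I (v0 \<cdot> eta W)" using v0(2) by simp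
  then have 2: "cls C I (v \<cdot> t') = cls C I v0"
    by (rule sig_cancel[where Y = "sig (su X)", OF WU, rotated 3]) (use t'(1) v0(1) h(10) sX in simp_all)
  note w = models_wf[OF M] std_wf[OF assms, unfolded h(1)]
  note XY = Zc_ob[OF h(2)] Zc_ob[OF h(3)]
  have "tri_mor D Sg (X, Y, sig W, cls C I f, cls C I (eta W \<cdot> y), cls C I v0) (X, Y, sig A, cls C I f, cls C I (eta A \<cdot> a), cls C I v)
    (cls C I (Id C X)) (cls C I (Id C Y)) (cls C I t')"
    unfolding D.tri_mor_iff[OF w]
    using XY h(6,7,10) m sW t'(1) v0(1) sX 1 2 Sg_hom[OF susp_id[OF h(2)]]
    by (simp add: quotient_comp)
  then have "tri_iso D Sg (X, Y, sig W, cls C I f, cls C I (eta W \<cdot> y), cls C I v0) t"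
    unfolding h(1) by (rule D.tri_isoI) (use iso D.iso_in_id[of X] D.iso_in_id[of Y] h(2,3) in simp_all)
  with M show ?thesis by blast
qed

lemma dist_model: "t \<in> dist \<Longrightarrow> \<exists>m\<in>models. tri_iso D Sg m t"
proof -
  assume t: "t \<in> dist"
  then obtain s where s: "s \<in> std" "tri_iso D Sg s t" unfolding dist_def by blast
  then obtain m where m: "m \<in> models" "tri_iso D Sg m s" using std_model by blast
  show ?thesis using D.tri_iso_trans[OF m(2) s(2)] models_wf[OF m(1)] std_wf[OF s(1)] dist_wf[OF t] m(1) by blast
qed

text \<open>The square commutes only in the quotient, yet it yields a strict morphism between the
  two pushed extensions, with components \<open>b\<close> and \<open>u\<close>. A completion
  \<open>k\<close> of it, reflected, is the required third component.\<close>

lemma models_mor: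
  assumes M: "(X, Y, Z, F, G, H) \<in> models" "(X', Y', Z', F', G', H') \<in> models"
    and ab: "mor D \<alpha> X X'" "mor D \<beta> Y Y'" "\<beta> \<cdot>\<^bsub>D\<^esub> F = F' \<cdot>\<^bsub>D\<^esub> \<alpha>"
  shows "\<exists>\<gamma>. tri_mor D Sg (X, Y, Z, F, G, H) (X', Y', Z', F', G', H') \<alpha> \<beta> \<gamma>"
proof -
  obtain W f y w v where h: "Z = sig W" "F = cls C I f" "G = cls C I (eta W \<cdot> y)" "H = cls C I v"
    "X \<in> T \<inter> U" "Y \<in> T \<inter> U" "W \<in> U" "mor C f X Y" "cf y w (push f (sg X))" "mor C y Y W" "mor C w W (su X)"
    "mor C v (sig W) (sig (su X))" "cls C I (v \<cdot> eta W) = cls C I (eta (su X) \<cdot> mn C w)"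
    using M(1) by (rule modelsE)
  obtain W' f' y' w' v' where h': "Z' = sig W'" "F' = cls C I f'" "G' = cls C I (eta W' \<cdot> y')" "H' = cls C I v'"
    "X' \<in> T \<inter> U" "Y' \<in> T \<inter> U" "W' \<in> U" "mor C f' X' Y'" "cf y' w' (push f' (sg X'))" "mor C y' Y' W'" "mor C w' W' (su X')"
    "mor C v' (sig W') (sig (su X'))" "cls C I (v' \<cdot> eta W') = cls C I (eta (su X') \<cdot> mn C w')"
    using M(2) by (rule modelsE)
  obtain a b where a: "mor C a X X'" "\<alpha> = cls C I a" and b: "mor C b Y Y'" "\<beta> = cls C I b" using ab D_mor by metis
  note s = sg_ext[OF h(5)] su_U[OF h(5)] sg_ext[OF h'(5)] su_U[OF h'(5)] eta_mor[OF h(7)] eta_mor[OF h'(7)]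
    sig_ob[OF h(7)] sig_ob[OF h'(7)]
  note s' = s eta_mor[of "su X"] sig_ob[of "su X"] eta_mor[of "su X'"] sig_ob[of "su X'"]
  have bf: "cls C I (b \<cdot> f) = cls C I (f' \<cdot> a)" using ab(3) a b h(2,8) h'(2,8) by (simp add: quotient_comp)
  obtain u t where u: "mor C u (su X) (su X')" "pull u (sg X') = push a (sg X)"
    "mor C t (sig (su X)) (sig (su X'))" "t \<cdot> eta (su X) = eta (su X') \<cdot> u" "susp a t"
    using h(5) h'(5) a(1) by (rule susp_exists)
  have "push b (push f (sg X)) = push (b \<cdot> f) (sg X)" using push_comp[of "sg X" f b] h(8) b(1) s by simp
  also have "\<dots> = push (f' \<cdot> a) (sg X)" by (rule push_cls) (use s b(1) h(8) bf in simp_all)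
  also have "\<dots> = push f' (pull u (sg X'))" using push_comp[of "sg X" a f'] h'(8) a(1) s u(2) by simp
  also have "\<dots> = pull u (push f' (sg X'))" using push_pull[of "sg X'" f' u] h'(8) u(1) s by simp
  finally obtain k where k: "mor C k W W'" "k \<cdot> y = y' \<cdot> b" "u \<cdot> w = w' \<cdot> k"
    using cf_mor[OF h(9) h'(9), of b u] h(10,11) h'(10,11) b(1) u(1) by auto
  obtain q where q: "mor C q (sig W) (sig W')" "q \<cdot> eta W = eta W' \<cdot> k"
    by (rule sig_arrow_exists[of W W' k]; (rule that)?) (use h(7) h'(7) k in simp_all)
  have 1: "q \<cdot> (eta W \<cdot> y) = (eta W' \<cdot> y') \<cdot> b"
    using q h(10) h'(10) k s b(1) by (simp add: comp_reassoc[OF q(2)])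
  have "cls C I ((t \<cdot> v) \<cdot> eta W) = cls C I (t \<cdot> (eta (su X) \<cdot> mn C w))"
    using cong_left[OF h(13), of t] s' h(12) u(3) by simp
  also have "t \<cdot> (eta (su X) \<cdot> mn C w) = mn C (eta (su X') \<cdot> (w' \<cdot> k))"
    using u s' h(11) k(3)[symmetric] by (simp add: comp_reassoc[OF u(4)])
  also have "\<dots> = (eta (su X') \<cdot> mn C w') \<cdot> k" using s' h'(11) k(1) by simp
  also have "cls C I \<dots> = cls C I ((v' \<cdot> eta W') \<cdot> k)"
    by (rule cong_right[OF h'(13)[symmetric]]) (use s' h'(11) k(1) in simp_all)
  also have "\<dots> = cls C I ((v' \<cdot> q) \<cdot> eta W)" using q k(1) s' h'(12) by simp
  finally have 2: "cls C I (t \<cdot> v) = cls C I (v' \<cdot> q)"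
    by (rule sig_cancel[where Y = "sig (su X')", OF h(7), rotated 3]) (use s' u(3) h(12) h'(12) q(1) in simp_all)
  note w = models_wf[OF M(1)] models_wf[OF M(2)]
  note XY = Zc_ob[OF h(5)] Zc_ob[OF h(6)] Zc_ob[OF h'(5)] Zc_ob[OF h'(6)]
  have "tri_mor D Sg (X, Y, Z, F, G, H) (X', Y', Z', F', G', H') \<alpha> \<beta> (cls C I q)"
    unfolding D.tri_mor_iff[OF w]
    using ab XY s' q(1) h(10,12) h'(10,12) u(3) b(1) Sg_hom[OF u(5)] 1 2
    by (simp add: h(1-4) h'(1-4) quotient_comp a(2) b(2))
  then show ?thesis ..
qed

text \<open>An extension becomes trivial when pushed along its own inflation. Hence
  \<open>y \<cdot> f\<close> pushes \<open>sg X\<close> to the trivial extension, and injectivity of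
  classification makes it null.\<close>

lemma models_zero:
  assumes "(X, Y, Z, F, G, H) \<in> models"
  shows "G \<cdot>\<^bsub>D\<^esub> F = Zero D X Z"
proof -
  obtain W f y w v where h: "Z = sig W" "F = cls C I f" "G = cls C I (eta W \<cdot> y)" "H = cls C I v"
    "X \<in> T \<inter> U" "Y \<in> T \<inter> U" "W \<in> U" "mor C f X Y" "cf y w (push f (sg X))" "mor C y Y W"
    using assms by (rule modelsE)
  note s = sg_ext[OF h(5)] su_U[OF h(5)] eta_mor[OF h(7)] sig_ob[OF h(7)]
  obtain i p J where i: "cf i p (sg X)" "mor C i X J" "J \<in> I" "mor C p J (su X)" using h(5) by (rule suE)
  \<comment> \<open>The correcting morphism is the negative of the identity of
    \<open>W\<close>.\<close>
  have "push y (push f (sg X)) = push (Zero C Y W) (push f (sg X))"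
    by (subst push_eq[OF h(9)]) (use h(10) in \<open>auto intro!: exI[of _ "mn C (Id C W)"]\<close>)
  then have "push (y \<cdot> f) (sg X) = push (Zero C X W) (sg X)"
    using push_comp[of "sg X" f y] push_comp[of "sg X" f "Zero C Y W"] h(8,10) s by simp
  then have "cls C I (y \<cdot> f) = cls C I (Zero C X W)"
    by (intro push_inj[OF i(1), of _ W]) (use i(2,3) h(8,10) in simp_all)
  then have "cls C I (eta W \<cdot> (y \<cdot> f)) = cls C I (Zero C X (sig W))"
    using cong_left[of "y \<cdot> f" "Zero C X W" "eta W"] h(8,10) s by simp
  then show ?thesis unfolding h(1-3) using h(8,10) s by (simp add: quotient_comp)
qed

text \<open>A null \<open>k \<cdot> f\<close> pushes \<open>sg X\<close> to the trivial extension,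
  so \<open>k\<close> extends strictly along \<open>y\<close>, and then along the unit because its
  target is in \<T>.\<close>

lemma models_cokernel:
  assumes "(X, Y, Z, F, G, H) \<in> models" "mor D K Y B" "K \<cdot>\<^bsub>D\<^esub> F = Zero D X B"
  shows "\<exists>K'. mor D K' Z B \<and> K = K' \<cdot>\<^bsub>D\<^esub> G"
proof -
  obtain W f y w v where h: "Z = sig W" "F = cls C I f" "G = cls C I (eta W \<cdot> y)" "H = cls C I v"
    "X \<in> T \<inter> U" "Y \<in> T \<inter> U" "W \<in> U" "mor C f X Y" "cf y w (push f (sg X))" "mor C y Y W"
    using assms(1) by (rule modelsE)
  note s = sg_ext[OF h(5)] su_U[OF h(5)] eta_mor[OF h(7)] sig_ob[OF h(7)]
  obtain k where k: "mor C k Y B" "K = cls C I k" and B: "B \<in> T \<inter> U" using assms(2) D_mor by blast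
  note s' = s Zc_ob[OF B]
  have "cls C I (Zero C X B) = cls C I (k \<cdot> f)" using assms(3) h(2,8) k by (simp add: quotient_comp)
  then have "push (Zero C X B) (sg X) = push (k \<cdot> f) (sg X)"
    by (intro push_cls) (use s' h(8) in simp_all)
  then have "push (Zero C Y B) (push f (sg X)) = push k (push f (sg X))"
    using push_comp[of "sg X" f k] push_comp[of "sg X" f "Zero C Y B"] h(8) k(1) s by simp
  then obtain m where "mor C m W B" "Zero C Y B \<boxplus> (m \<cdot> y) = k"
    using push_eq[OF h(9), of "Zero C Y B" k] k(1) h(10) by auto
  then have m: "mor C m W B" "m \<cdot> y = k" using h(10) by simp_all
  obtain q where q: "mor C q (sig W) B" "q \<cdot> eta W = m"
    by (rule sig_extend[OF h(7) m(1)]; (rule that)?) (use s' in simp_all)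
  have "K = cls C I q \<cdot>\<^bsub>D\<^esub> G" unfolding h(3) k(2)
    using q(1) s h(10) m by (simp add: quotient_comp comp_reassoc[OF q(2)])
  moreover have "mor D (cls C I q) Z B" using q(1) s' B unfolding h(1) by simp
  ultimately show ?thesis by blast
qed

text \<open>The outer vertices have to be moved into \<Z> without losing the conflation. A pushout
  along the unit of \<open>A\<close> replaces \<open>A\<close> by \<open>sig A\<close>, and
  composing with the unit of the new middle term \<open>E\<close> replaces \<open>E\<close> by
  \<open>sig E\<close>. Both moves change the remaining terms only by inflations with cokernel in
  \<S>, which the reflection inverts. The result has a standard triangle, and that triangle is
  compared with the given one.\<close>

lemma conflation_triangle:
  assumes cf: "cf p q e" and A: "A \<in> U" and G: "G \<in> U" and m: "mor C p A B" "mor C q B G"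
    and P: "mor C P (sig A) (sig B)" "cls C I (P \<cdot> eta A) = cls C I (eta B \<cdot> p)"
    and Q: "mor C K (sig B) (sig G)" "cls C I (K \<cdot> eta B) = cls C I (eta G \<cdot> q)"
    and c: "mor C c G (su (sig A))" "pull c (sg (sig A)) = push (eta A) e"
    and H: "mor C H (sig G) (sig (su (sig A)))" "cls C I (H \<cdot> eta G) = cls C I (eta (su (sig A)) \<cdot> c)"
  shows "(sig A, sig B, sig G, cls C I P, cls C I K, cls C I H) \<in> dist"
proof -
  have B: "B \<in> U" using extension_closed(3)[OF cf] m A G by simp
  note e = cf_wf[OF cf]
  note s = eta_mor[OF A] eta_mor[OF B] eta_mor[OF G] sig_ob[OF A] sig_ob[OF B] sig_ob[OF G]
    su_U[OF sig_Zc[OF A]] sg_ext[OF sig_Zc[OF A]]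
  note s' = s eta_mor[of "su (sig A)"] sig_ob[of "su (sig A)"]
  obtain s1 d1 where S1: "cf (eta A) s1 d1" "tgt C s1 \<in> S" using A by (elim sigE)
  \<comment> \<open>\<open>E\<close> is the pushout of \<open>p\<close> and \<open>eta A\<close>;
    the inflation \<open>d\<close> of \<open>B\<close> into it has the cokernel of
    \<open>eta A\<close>, an object of \<S>.\<close>
  obtain x y d r where po: "cf x y (push (eta A) e)" "cf d r (push p d1)" "tgt C d = tgt C x"
     "x \<cdot> eta A = d \<cdot> p" "y \<cdot> d = q" "r \<cdot> x = s1"
    using pushout[OF S1(1) cf] m s by auto
  define E where "E = tgt C x"
  have m2: "mor C x (sig A) E" "mor C y E G" "mor C d B E" "tgt C r \<in> S"
    using cf_wf[OF po(1)] cf_wf[OF po(2)] cf_wf[OF S1(1)] po(3,6) S1(2) m s e unfolding E_def by auto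
  have E: "E \<in> U" using extension_closed(3)[OF po(1)] m2 s G by simp
  note sE = eta_mor[OF E] sig_ob[OF E]
  obtain s2 d2 where S2: "cf (eta E) s2 d2" "tgt C s2 \<in> S" using E by (elim sigE)
  \<comment> \<open>The composite \<open>eta E \<cdot> x\<close> is an inflation between objects of
    \<Z>. Its cokernel \<open>F\<close> contains \<open>G\<close> through \<open>p2\<close>, with
    quotient the cokernel of \<open>eta E\<close>, again in \<S>.\<close>
  obtain h e3 p2 q2 where ic: "cf (eta E \<cdot> x) h e3" "cf p2 q2 (push y d2)" "tgt C p2 = tgt C h"
      "p2 \<cdot> y = h \<cdot> eta E" "q2 \<cdot> h = s2" "pull p2 e3 = push (eta A) e"
    using inflation_comp[OF po(1) S2(1)] m2 sE by auto
  define F where "F = tgt C h"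
  have m3: "mor C h (sig E) F" "mor C p2 G F" "tgt C q2 \<in> S"
    using cf_wf[OF ic(1)] cf_wf[OF ic(2)] cf_wf[OF S2(1)] ic(3,5) S2(2) m2 sE unfolding F_def by auto
  have F: "F \<in> U" using extension_closed(3)[OF ic(2)] m3 G S_U ic(3) unfolding F_def by simp
  note sF = eta_mor[OF F] sig_ob[OF F]
  obtain c' v where st: "mor C c' F (su (sig A))" "pull c' (sg (sig A)) = e3" "mor C v (sig F) (sig (su (sig A)))"
    "v \<cdot> eta F = eta (su (sig A)) \<cdot> c'"
    "(sig A, sig E, sig F, cls C I (eta E \<cdot> x), cls C I (eta F \<cdot> h), cls C I v) \<in> std"
    by (rule std_exists[OF ic(1) _ _ sig_Zc[OF A] sig_Zc[OF E] F]; (rule that)?) (use m2 m3 sE in simp_all)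
  obtain t1 where t1: "mor C t1 (sig B) (sig E)" "t1 \<cdot> eta B = eta E \<cdot> d"
    by (rule sig_arrow_exists[OF B E m2(3)])
  obtain t2 where t2: "mor C t2 (sig G) (sig F)" "t2 \<cdot> eta G = eta F \<cdot> p2"
    by (rule sig_arrow_exists[OF G F m3(2)])
  have i1: "iso_in D (sig B) (sig E) (cls C I t1)"
    by (rule sig_iso_S_cone[OF po(2) m2(4) m2(3) B E t1(1)]) (simp add: t1(2))
  have i2: "iso_in D (sig G) (sig F) (cls C I t2)"
    by (rule sig_iso_S_cone[OF ic(2) m3(3) m3(2) G F t2(1)]) (simp add: t2(2))
  have "cls C I ((t1 \<cdot> P) \<cdot> eta A) = cls C I ((t1 \<cdot> eta B) \<cdot> p)"
    using cong_left[OF P(2), of t1] t1(1) P(1) s m by simp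
  also have "\<dots> = cls C I ((eta E \<cdot> x) \<cdot> eta A)" unfolding t1(2) using m m2 sE s po(4) by simp
  finally have 1: "cls C I (t1 \<cdot> P) = cls C I (eta E \<cdot> x)"
    by (rule sig_cancel[where Y = "sig E", OF A, rotated 3]) (use t1(1) P(1) m2 sE in simp_all)
  have "cls C I ((t2 \<cdot> K) \<cdot> eta B) = cls C I ((t2 \<cdot> eta G) \<cdot> q)"
    using cong_left[OF Q(2), of t2] t2(1) Q(1) s m by simp
  also have "(t2 \<cdot> eta G) \<cdot> q = eta F \<cdot> (p2 \<cdot> (y \<cdot> d))" unfolding t2(2) po(5) using m m3 sF by simp
  also have "\<dots> = eta F \<cdot> ((p2 \<cdot> y) \<cdot> d)" using m2 m3 sF by simp
  also have "\<dots> = eta F \<cdot> (h \<cdot> (eta E \<cdot> d))" unfolding ic(4) using m2 m3 sF sE by simp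
  also have "\<dots> = ((eta F \<cdot> h) \<cdot> t1) \<cdot> eta B" unfolding t1(2)[symmetric] using m2 m3 sF sE t1(1) s by simp
  finally have 2: "cls C I (t2 \<cdot> K) = cls C I ((eta F \<cdot> h) \<cdot> t1)"
    by (rule sig_cancel[where Y = "sig F", OF B, rotated 3]) (use t1(1) t2(1) Q(1) m3 sF in simp_all)
  \<comment> \<open>Both morphisms classify \<open>push (eta A) e\<close>, so the connecting maps
    agree after restriction to \<open>G\<close>.\<close>
  have cp: "cls C I (c' \<cdot> p2) = cls C I c"
    by (rule su_arrow_unique[OF sig_Zc[OF A], of _ G])
       (use st(1,2) m3 c ic(6) s pull_comp[of "sg (sig A)" c' p2] in simp_all)
  have "(v \<cdot> t2) \<cdot> eta G = (v \<cdot> eta F) \<cdot> p2" using t2 st(3) s sF m3 by simp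
  also have "\<dots> = eta (su (sig A)) \<cdot> (c' \<cdot> p2)" unfolding st(4) using st(1) s' m3 by simp
  also have "cls C I \<dots> = cls C I (eta (su (sig A)) \<cdot> c)"
    by (rule cong_left[OF cp]) (use st(1) s' m3 in simp_all)
  also have "\<dots> = cls C I (H \<cdot> eta G)" using H(2) by simp
  finally have 3: "cls C I (v \<cdot> t2) = cls C I H"
    by (rule sig_cancel[where Y = "sig (su (sig A))", OF G, rotated 3]) (use t2(1) st(3) H(1) s' in simp_all)
  have w: "right_triangle D Sg (sig A, sig B, sig G, cls C I P, cls C I K, cls C I H)"
    unfolding D.right_triangle_iff using P(1) Q(1) H(1) s' Sg_ob[OF sig_Zc[OF A]] by simp
  note w2 = std_wf[OF st(5)]
  have "tri_mor D Sg (sig A, sig B, sig G, cls C I P, cls C I K, cls C I H)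
     (sig A, sig E, sig F, cls C I (eta E \<cdot> x), cls C I (eta F \<cdot> h), cls C I v)
     (cls C I (Id C (sig A))) (cls C I t1) (cls C I t2)"
    unfolding D.tri_mor_iff[OF w w2]
    using s' sE sF t1(1) t2(1) P(1) Q(1) H(1) m2 m3 st(3) 1 2 3 Sg_hom[OF susp_id[OF sig_Zc[OF A]]]
    by (simp add: quotient_comp)
  then have "tri_iso D Sg (sig A, sig B, sig G, cls C I P, cls C I K, cls C I H)
     (sig A, sig E, sig F, cls C I (eta E \<cdot> x), cls C I (eta F \<cdot> h), cls C I v)"
    by (rule D.tri_isoI) (use i1 i2 D.iso_in_id[of "sig A"] sig_Zc[OF A] in simp_all)
  then show ?thesis using dist_iso[OF std_dist[OF st(5)] w] D.tri_iso_sym w w2 by blast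
qed

text \<open>The conflation \<open>Y \<rightarrow> W \<rightarrow> su X\<close> behind the model has
  all its terms in \<U>, so its reflection is distinguished. It ends in \<open>w\<close>, whereas
  the model ends in minus \<open>w\<close>; comparing them through minus the identity of the
  suspension moves this sign to the suspended first map.\<close>

lemma models_rotate:
  assumes "(X, Y, Z, F, G, H) \<in> models"
  shows "(Y, Z, on_ob Sg X, G, H, mn D (on_hom Sg F)) \<in> dist"
proof -
  obtain W f y w v where h: "Z = sig W" "F = cls C I f" "G = cls C I (eta W \<cdot> y)" "H = cls C I v"
    "X \<in> T \<inter> U" "Y \<in> T \<inter> U" "W \<in> U" "mor C f X Y" "cf y w (push f (sg X))" "mor C y Y W" "mor C w W (su X)"
    "mor C v (sig W) (sig (su X))" "cls C I (v \<cdot> eta W) = cls C I (eta (su X) \<cdot> mn C w)"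
    using assms by (rule modelsE)
  note XY = Zc_ob[OF h(5)] Zc_ob[OF h(6)]
  have YU: "Y \<in> U" and XU: "su X \<in> U" using XY su_U[OF h(5)] by auto
  note s = sg_ext[OF h(5)] su_U[OF h(5)] eta_mor[OF h(7)] sig_ob[OF h(7)] eta_mor[OF YU] sig_ob[OF YU]
    eta_mor[OF XU] sig_ob[OF XU] su_U[OF sig_Zc[OF YU]]
  obtain P where P: "mor C P (sig Y) (sig W)" "P \<cdot> eta Y = eta W \<cdot> y"
    by (rule sig_arrow_exists[OF YU h(7,10)])
  obtain u v' where u: "mor C u (su X) (su (sig Y))" "pull u (sg (sig Y)) = push (eta Y \<cdot> f) (sg X)"
    "mor C v' (sig (su X)) (sig (su (sig Y)))" "v' \<cdot> eta (su X) = eta (su (sig Y)) \<cdot> u" "susp (eta Y \<cdot> f) v'"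
    by (rule susp_exists[OF h(5) sig_Zc[OF YU], of "eta Y \<cdot> f"]; (rule that)?) (use s h(8) in simp_all)
  have "cls C I (mn C v \<cdot> eta W) = cls C I (mn C (v \<cdot> eta W))" using s h(12) by simp
  also have "\<dots> = cls C I (mn C (eta (su X) \<cdot> mn C w))"
    by (rule cong_mn[OF h(13)]) (use s h(11,12) in simp_all)
  also have "\<dots> = cls C I (eta (su X) \<cdot> w)" using s h(11) by simp
  finally have vw: "cls C I (mn C v \<cdot> eta W) = cls C I (eta (su X) \<cdot> w)" .
  have t: "(sig Y, sig W, sig (su X), cls C I P, cls C I (mn C v), cls C I v') \<in> dist"
    by (rule conflation_triangle[OF h(9) YU XU h(10,11) P(1) _ _ vw u(1) _ u(3)])
       (use P(2) u(2,4) h(12) s h(8) push_comp[of "sg X" f "eta Y"] in simp_all)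
  have wf: "right_triangle D Sg (Y, sig W, on_ob Sg X, cls C I (eta W \<cdot> y), cls C I v, mn D (on_hom Sg (cls C I f)))"
    unfolding D.right_triangle_iff using h(8,10,12) s XY Sg_ob[OF h(5)] Sg_ob[OF h(6)] su_U[OF h(6)] sig_ob[of "su Y"]
    by simp
  note w2 = dist_wf[OF t]
  have f: "on_hom Sg (cls C I (eta Y)) \<cdot>\<^bsub>D\<^esub> on_hom Sg (cls C I f) = cls C I v'"
  proof -
    have "on_hom Sg (cls C I (eta Y \<cdot> f)) = on_hom Sg (cls C I (eta Y) \<cdot>\<^bsub>D\<^esub> cls C I f)"
      using s h(8) by (simp add: quotient_comp)
    also have "\<dots> = on_hom Sg (cls C I (eta Y)) \<cdot>\<^bsub>D\<^esub> on_hom Sg (cls C I f)"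
      by (rule D.Sg_simps) (use s h(8) XY in simp_all)
    finally show ?thesis using Sg_hom[OF u(5)] by simp
  qed
  obtain u0 v0 where v0: "mor C v0 (sig (su X)) (sig (su Y))" "susp f v0"
    by (rule susp_exists[OF h(5,6,8)])
  obtain u1 v1 where v1: "mor C v1 (sig (su Y)) (sig (su (sig Y)))" "susp (eta Y) v1"
    by (rule susp_exists[OF h(6) sig_Zc[OF YU], of "eta Y"]; (rule that; assumption)?) (use s in simp_all)
  note sY = su_U[OF h(6)] sig_ob[of "su Y"]
  have f': "cls C I (v1 \<cdot> mn C v0) = cls C I (v' \<cdot> mn C (Id C (sig (su X))))"
  proof -
    have e: "cls C I (v1 \<cdot> v0) = cls C I v'"
      using f v0(1) v1(1) Sg_hom[OF v0(2)] Sg_hom[OF v1(2)] by (simp add: quotient_comp)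
    show ?thesis using cong_mn[OF e] v0(1) v1(1) u(3) s by simp
  qed
  \<comment> \<open>The first component is the unit of \<open>Y\<close>, which is invertible in the
    quotient as \<open>Y\<close> is in \<Z>; the third is minus the identity.\<close>
  have "tri_mor D Sg (Y, sig W, on_ob Sg X, cls C I (eta W \<cdot> y), cls C I v, mn D (on_hom Sg (cls C I f)))
     (sig Y, sig W, sig (su X), cls C I P, cls C I (mn C v), cls C I v')
     (cls C I (eta Y)) (cls C I (Id C (sig W))) (cls C I (mn C (Id C (sig (su X)))))"
    unfolding D.tri_mor_iff[OF wf w2]
    using XY s h(10,12) P u(3) v0(1) v1(1) sY Sg_hom[OF v0(2)] Sg_hom[OF v1(2)] Sg_ob[OF h(5)] f'
    by (simp add: quotient_comp D_mn)
  moreover have "iso_in D (sig (su X)) (sig (su X)) (cls C I (mn C (Id C (sig (su X)))))"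
    by (rule D_iso[of _ _ _ "mn C (Id C (sig (su X)))"]) (use s sig_Zc[OF XU] in simp_all)
  ultimately have "tri_iso D Sg (Y, sig W, on_ob Sg X, cls C I (eta W \<cdot> y), cls C I v, mn D (on_hom Sg (cls C I f)))
     (sig Y, sig W, sig (su X), cls C I P, cls C I (mn C v), cls C I v')"
    using eta_iso[OF h(6)] D.iso_in_id[of "sig W"] sig_Zc[OF h(7)] Sg_ob[OF h(5)] by (intro D.tri_isoI) simp_all
  then show ?thesis unfolding h(1-4) using dist_iso[OF t wf] D.tri_iso_sym wf w2 by blast
qed

text \<open>This is the replacement of \<open>f\<close> by a column with components \<open>f\<close>
  and the inflation \<open>X \<rightarrow> J\<close>. In place of the direct sum of \<open>Y\<close>
  and \<open>J\<close> it uses a pullback \<open>E\<close>, an extension of \<open>J\<close> by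
  \<open>Y\<close>, so that the cokernel \<open>W\<close> of the new morphism comes with it and is
  visibly in \<U>.\<close>

lemma conic_exists:
  assumes "X \<in> T \<inter> U" "Y \<in> T \<inter> U" "mor C f X Y"
  obtains Y' A f' a b m m' where "cf f' a b" "mor C f' X Y'" "mor C a Y' A" "A \<in> U" "Y' \<in> T \<inter> U"
    "mor C m Y Y'" "mor C m' Y' Y" "cls C I (m' \<cdot> m) = cls C I (Id C Y)" "cls C I (m \<cdot> m') = cls C I (Id C Y')"
    "cls C I (m \<cdot> f) = cls C I f'"
proof -
  obtain i p J where i: "cf i p (sg X)" "mor C i X J" "J \<in> I" "mor C p J (su X)" using assms(1) by (rule suE)
  note s = sg_ext[OF assms(1)] su_U[OF assms(1)] Zc_ob[OF assms(1)] Zc_ob[OF assms(2)] I_sub[OF i(3)]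
  obtain y w where yw: "cf y w (push f (sg X))" using cf_realize[of "push f (sg X)"] s assms(3) by auto
  define W where "W = tgt C y"
  have m: "mor C y Y W" "mor C w W (su X)" using cf_wf[OF yw] s assms(3) unfolding W_def by auto
  have W: "W \<in> U" using extension_closed(3)[OF yw] m s by simp
  \<comment> \<open>The pullback of \<open>Y \<rightarrow> W \<rightarrow> su X\<close> and
    \<open>X \<rightarrow> J \<rightarrow> su X\<close> over \<open>su X\<close>.\<close>
  obtain x z d e where pb: "cf z x (pull p (push f (sg X)))" "cf e d (pull w (sg X))" "src C d = src C x"
     "d \<cdot> z = y" "x \<cdot> e = i" "push e (sg X) = push (mn C z) (push f (sg X))"
    using pullback[OF i(1) yw] i(4) m by auto
  define E where "E = src C x"
  have m2: "mor C z Y E" "mor C x E J" "mor C e X E" "mor C d E W"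
    using cf_wf[OF pb(1)] cf_wf[OF pb(2)] pb(3) s i m assms(3) unfolding E_def by auto
  have E: "E \<in> T \<inter> U" using extension_closed(2)[OF pb(1)] extension_closed(3)[OF pb(1)] m2 s by simp
  obtain r where r: "mor C r E Y" "r \<cdot> z = Id C Y" "cls C I (z \<cdot> r) = cls C I (Id C E)"
    by (rule quotient_I_iso[OF pb(1), of Y E]; (rule that)?) (use m2 i s in simp_all)
  have "push e (sg X) = push (mn C z \<cdot> f) (sg X)"
    using pb(6) push_comp[of "sg X" f "mn C z"] s assms(3) m2 by simp
  \<comment> \<open>The sign rule of the pullback: the new morphism is \<open>f\<close> followed by
    minus the inflation \<open>z\<close>, so minus \<open>z\<close> is the comparison
    \<open>m\<close>.\<close>
  then have "cls C I e = cls C I (mn C z \<cdot> f)"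
    by (intro push_inj[OF i(1), of _ E]) (use i m2 assms(3) in simp_all)
  then show ?thesis
    by (intro that[of e d "pull w (sg X)" E W "mn C z" "mn C r"]) (use pb(2) m2 W E r in simp_all)
qed

text \<open>The triangle of the replacing inflation becomes one on \<open>F\<close> itself by
  composing its second map with the comparison \<open>m\<close>.\<close>

lemma dist_complete:
  assumes "mor D F X Y"
  shows "\<exists>Z G H. (X, Y, Z, F, G, H) \<in> dist"
proof -
  obtain f where f: "mor C f X Y" "F = cls C I f" "X \<in> T \<inter> U" "Y \<in> T \<inter> U" using assms D_mor by blast
  obtain Y' A f' a b m m' where h: "cf f' a b" "mor C f' X Y'" "mor C a Y' A" "A \<in> U" "Y' \<in> T \<inter> U"
    "mor C m Y Y'" "mor C m' Y' Y" "cls C I (m' \<cdot> m) = cls C I (Id C Y)" "cls C I (m \<cdot> m') = cls C I (Id C Y')"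
    "cls C I (m \<cdot> f) = cls C I f'"
    using f(3,4,1) by (rule conic_exists)
  obtain c v where v: "mor C v (sig A) (sig (su X))" 
    and st: "(X, Y', sig A, cls C I f', cls C I (eta A \<cdot> a), cls C I v) \<in> std"
    by (rule std_exists[OF h(1-3) f(3) h(5,4)])
  note s = Zc_ob[OF f(3)] Zc_ob[OF f(4)] Zc_ob[OF h(5)] sig_ob[OF h(4)] eta_mor[OF h(4)] su_U[OF f(3)]
  note s' = s sig_ob[of "su X"]
  have w: "right_triangle D Sg (X, Y, sig A, F, cls C I ((eta A \<cdot> a) \<cdot> m), cls C I v)"
    unfolding D.right_triangle_iff f(2) using s' f(1) h(2,3,6) v Sg_ob[OF f(3)] by simp
  note w2 = std_wf[OF st]
  have "tri_mor D Sg (X, Y, sig A, F, cls C I ((eta A \<cdot> a) \<cdot> m), cls C I v)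
     (X, Y', sig A, cls C I f', cls C I (eta A \<cdot> a), cls C I v) (cls C I (Id C X)) (cls C I m) (cls C I (Id C (sig A)))"
    unfolding D.tri_mor_iff[OF w w2]
    using s' f(1) h(2,3,6,10) v Sg_hom[OF susp_id[OF f(3)]] by (simp add: quotient_comp f(2))
  then have "tri_iso D Sg (X, Y, sig A, F, cls C I ((eta A \<cdot> a) \<cdot> m), cls C I v)
     (X, Y', sig A, cls C I f', cls C I (eta A \<cdot> a), cls C I v)"
    by (rule D.tri_isoI)
       (use D.iso_in_id[of X] D.iso_in_id[of "sig A"] f(3) sig_Zc[OF h(4)] D_iso[OF h(6,7) f(4) h(5,8,9)] in simp_all)
  then show ?thesis using dist_iso[OF std_dist[OF st] w] D.tri_iso_sym w w2 by blast
qed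

text \<open>After replacing both morphisms by inflations with cokernels in \<U>, the composite is
  again such an inflation, and the three cokernels form a conflation in \<U>. Its reflection is the
  fourth triangle, so only the compatibility of the connecting maps has to be checked.\<close>

lemma dist_octahedral:
  assumes "mor D F X Y" "mor D K Y W"
  shows "\<exists>Y' W' y w f' g' E F' G a b c d e h p q. iso_in D Y Y' y \<and> iso_in D W W' w \<and>
          f' = y \<cdot>\<^bsub>D\<^esub> F \<and> mor D g' Y' W' \<and> w \<cdot>\<^bsub>D\<^esub> K = g' \<cdot>\<^bsub>D\<^esub> y \<and>
          (X, Y', E, f', a, b) \<in> dist \<and> (Y', W', G, g', c, d) \<in> dist \<and> (X, W', F', g' \<cdot>\<^bsub>D\<^esub> f', e, h) \<in> dist \<and>
          (E, F', G, p, q, on_hom Sg a \<cdot>\<^bsub>D\<^esub> d) \<in> dist \<and>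
          tri_mor D Sg (X, Y', E, f', a, b) (X, W', F', g' \<cdot>\<^bsub>D\<^esub> f', e, h) (Id D X) g' p \<and>
          tri_mor D Sg (X, W', F', g' \<cdot>\<^bsub>D\<^esub> f', e, h) (Y', W', G, g', c, d) f' (Id D W') q"
proof -
  obtain f where f: "mor C f X Y" "F = cls C I f" "X \<in> T \<inter> U" "Y \<in> T \<inter> U" using assms(1) D_mor by blast
  obtain k where k: "mor C k Y W" "K = cls C I k" "W \<in> T \<inter> U" using assms(2) D_mor by blast
  obtain Y' E f' a b m m' where h: "cf f' a b" "mor C f' X Y'" "mor C a Y' E" "E \<in> U" "Y' \<in> T \<inter> U"
    "mor C m Y Y'" "mor C m' Y' Y" "cls C I (m' \<cdot> m) = cls C I (Id C Y)" "cls C I (m \<cdot> m') = cls C I (Id C Y')"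
    "cls C I (m \<cdot> f) = cls C I f'"
    using f(3,4,1) by (rule conic_exists)
  \<comment> \<open>The second morphism has to start at the replaced middle object
    \<open>Y'\<close>, so it is transported there before it is replaced in turn.\<close>
  have km: "mor C (k \<cdot> m') Y' W" using k(1) h(7) by simp
  obtain W' G g' c d n n' where h': "cf g' c d" "mor C g' Y' W'" "mor C c W' G" "G \<in> U" "W' \<in> T \<inter> U"
    "mor C n W W'" "mor C n' W' W" "cls C I (n' \<cdot> n) = cls C I (Id C W)" "cls C I (n \<cdot> n') = cls C I (Id C W')"
    "cls C I (n \<cdot> (k \<cdot> m')) = cls C I g'"
    using h(5) k(3) km by (rule conic_exists)
  obtain e e3 p q where ic: "cf (g' \<cdot> f') e e3" "cf p q (push a d)" "tgt C p = tgt C e"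
     "p \<cdot> a = e \<cdot> g'" "q \<cdot> e = c" "pull p e3 = b" "pull q d = push f' e3"
    using inflation_comp[OF h(1) h'(1)] h(2) h'(2) by auto
  define B where "B = tgt C e"
  note cd = cf_wf[OF h(1)] cf_wf[OF h'(1)] cf_wf[OF ic(1)] cf_wf[OF ic(2)]
  have m: "mor C e W' B" "mor C p E B" "mor C q B G" "mor C (g' \<cdot> f') X W'"
    using cd ic(3,5) h(2,3) h'(2,3) unfolding B_def by auto
  have B: "B \<in> U" using extension_closed(3)[OF ic(2)] m h(4) h'(4) by simp
  note X = f(3) note Y' = h(5) note W' = h'(5) note E = h(4) note G = h'(4)
  note s = Zc_ob[OF X] Zc_ob[OF f(4)] Zc_ob[OF k(3)] Zc_ob[OF Y'] Zc_ob[OF W'] eta_mor[OF E] eta_mor[OF G] eta_mor[OF B]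
    sig_ob[OF E] sig_ob[OF G] sig_ob[OF B] su_U[OF X] su_U[OF Y'] su_U[OF sig_Zc[OF E]] sg_ext[OF X] sg_ext[OF Y']
    sg_ext[OF sig_Zc[OF E]]
  note s' = s eta_mor[of "su X"] sig_ob[of "su X"] eta_mor[of "su Y'"] sig_ob[of "su Y'"]
    eta_mor[of "su (sig E)"] sig_ob[of "su (sig E)"]
  obtain c1 v1 where t1: "mor C c1 E (su X)" "pull c1 (sg X) = b" "mor C v1 (sig E) (sig (su X))"
    "v1 \<cdot> eta E = eta (su X) \<cdot> c1" "(X, Y', sig E, cls C I f', cls C I (eta E \<cdot> a), cls C I v1) \<in> std"
    by (rule std_exists[OF h(1-3) X Y' E])
  obtain c2 v2 where t2: "mor C c2 G (su Y')" "pull c2 (sg Y') = d" "mor C v2 (sig G) (sig (su Y'))"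
    "v2 \<cdot> eta G = eta (su Y') \<cdot> c2" "(Y', W', sig G, cls C I g', cls C I (eta G \<cdot> c), cls C I v2) \<in> std"
    by (rule std_exists[OF h'(1-3) Y' W' G])
  obtain c3 v3 where t3: "mor C c3 B (su X)" "pull c3 (sg X) = e3" "mor C v3 (sig B) (sig (su X))"
    "v3 \<cdot> eta B = eta (su X) \<cdot> c3" "(X, W', sig B, cls C I (g' \<cdot> f'), cls C I (eta B \<cdot> e), cls C I v3) \<in> std"
    by (rule std_exists[OF ic(1) m(4,1) X W' B])
  obtain P where P: "mor C P (sig E) (sig B)" "P \<cdot> eta E = eta B \<cdot> p" by (rule sig_arrow_exists[OF E B m(2)])
  obtain N where N: "mor C N (sig B) (sig G)" "N \<cdot> eta B = eta G \<cdot> q" by (rule sig_arrow_exists[OF B G m(3)])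
  obtain u v where u: "mor C u (su Y') (su (sig E))" "pull u (sg (sig E)) = push (eta E \<cdot> a) (sg Y')"
    "mor C v (sig (su Y')) (sig (su (sig E)))" "v \<cdot> eta (su Y') = eta (su (sig E)) \<cdot> u" "susp (eta E \<cdot> a) v"
    by (rule susp_exists[OF Y' sig_Zc[OF E], of "eta E \<cdot> a"]; (rule that)?) (use s h(3) in simp_all)
  obtain u4 v4 where u4: "mor C u4 (su X) (su Y')" "pull u4 (sg Y') = push f' (sg X)"
    "mor C v4 (sig (su X)) (sig (su Y'))" "v4 \<cdot> eta (su X) = eta (su Y') \<cdot> u4" "susp f' v4"
    by (rule susp_exists[OF X Y' h(2)])
  have "pull (u \<cdot> c2) (sg (sig E)) = pull c2 (push (eta E \<cdot> a) (sg Y'))"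
    using pull_comp[of "sg (sig E)" u c2] u(1,2) t2(1) s by simp
  also have "\<dots> = push (eta E \<cdot> a) d"
    using push_pull[of "sg Y'" "eta E \<cdot> a" c2] t2(1,2) s h(3) by simp
  also have "\<dots> = push (eta E) (push a d)" using push_comp[of d a "eta E"] cd h(3) h'(2) s by simp
  finally have uc: "pull (u \<cdot> c2) (sg (sig E)) = push (eta E) (push a d)" .
  have "(v \<cdot> v2) \<cdot> eta G = v \<cdot> (eta (su Y') \<cdot> c2)" using u(3) t2(3,4) s by simp
  also have "\<dots> = eta (su (sig E)) \<cdot> (u \<cdot> c2)" using u(1,3) t2(1) s' by (simp add: comp_reassoc[OF u(4)])
  finally have vv: "(v \<cdot> v2) \<cdot> eta G = eta (su (sig E)) \<cdot> (u \<cdot> c2)" .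
  \<comment> \<open>The extension of \<open>G\<close> by \<open>E\<close> is
    \<open>push a d\<close>. Its connecting map is therefore the one of the second triangle followed
    by the suspension of the second map of the first, as the axiom demands.\<close>
  have d4: "(sig E, sig B, sig G, cls C I P, cls C I N, cls C I (v \<cdot> v2)) \<in> dist"
    by (rule conflation_triangle[OF ic(2) E G m(2,3) P(1) _ N(1) _ _ uc])
       (use P(2) N(2) vv u(1,3) t2(1,3) s in simp_all)
  have e1: "P \<cdot> (eta E \<cdot> a) = (eta B \<cdot> e) \<cdot> g'"
    using P m h(3) h'(2) s ic(4) by (simp add: comp_reassoc[OF P(2)])
  have e2: "N \<cdot> (eta B \<cdot> e) = eta G \<cdot> c"
    using N m s ic(5) by (simp add: comp_reassoc[OF N(2)])
  \<comment> \<open>The triangles over \<open>f'\<close> and \<open>g' \<cdot> f'\<close> have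
    matching connecting maps because the extension \<open>e3\<close> restricts along
    \<open>p\<close> to \<open>b\<close>.\<close>
  have "cls C I (c3 \<cdot> p) = cls C I c1"
    by (rule su_arrow_unique[OF X, of _ E]) (use t1(1,2) t3(1,2) m s ic(6) pull_comp[of "sg X" c3 p] in simp_all)
  then have "cls C I (eta (su X) \<cdot> (c3 \<cdot> p)) = cls C I (eta (su X) \<cdot> c1)"
    by (rule cong_left) (use t3(1) m s' in simp_all)
  moreover have "(v3 \<cdot> P) \<cdot> eta E = eta (su X) \<cdot> (c3 \<cdot> p)"
    using t3 P m s' by (simp add: comp_reassoc[OF t3(4)])
  ultimately have "cls C I ((v3 \<cdot> P) \<cdot> eta E) = cls C I (v1 \<cdot> eta E)" using t1(4) by simp
  then have e3: "cls C I (v3 \<cdot> P) = cls C I v1"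
    by (rule sig_cancel[where Y = "sig (su X)", OF E, rotated 3]) (use t1(3) t3(3) P(1) s' in simp_all)
  \<comment> \<open>The other matching of connecting maps: pulling \<open>d\<close> along
    \<open>q\<close> is pushing \<open>e3\<close> along \<open>f'\<close>.\<close>
  have "pull (u4 \<cdot> c3) (sg Y') = pull c3 (push f' (sg X))"
    using pull_comp[of "sg Y'" u4 c3] u4(1,2) t3(1) s by simp
  also have "\<dots> = push f' e3" using push_pull[of "sg X" f' c3] t3(1,2) s h(2) by simp
  also have "\<dots> = pull (c2 \<cdot> q) (sg Y')" using ic(7) t2(1,2) pull_comp[of "sg Y'" c2 q] s m by simp
  finally have "cls C I (u4 \<cdot> c3) = cls C I (c2 \<cdot> q)"
    by (intro su_arrow_unique[OF Y', of _ B]) (use u4(1) t3(1) t2(1) m in simp_all)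
  then have "cls C I (eta (su Y') \<cdot> (u4 \<cdot> c3)) = cls C I (eta (su Y') \<cdot> (c2 \<cdot> q))"
    by (rule cong_left) (use u4(1) t3(1) s' in simp_all)
  moreover have "(v4 \<cdot> v3) \<cdot> eta B = eta (su Y') \<cdot> (u4 \<cdot> c3)"
    using u4 t3 s' by (simp add: comp_reassoc[OF u4(4)])
  moreover have "(v2 \<cdot> N) \<cdot> eta B = eta (su Y') \<cdot> (c2 \<cdot> q)"
    using t2 N m s' by (simp add: comp_reassoc[OF t2(4)])
  ultimately have "cls C I ((v4 \<cdot> v3) \<cdot> eta B) = cls C I ((v2 \<cdot> N) \<cdot> eta B)" by simp
  then have e4: "cls C I (v4 \<cdot> v3) = cls C I (v2 \<cdot> N)"
    by (rule sig_cancel[where Y = "sig (su Y')", OF B, rotated 3]) (use u4(3) t3(3) t2(3) N(1) s' in simp_all)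
  note w = std_wf[OF t1(5)] std_wf[OF t2(5)] std_wf[OF t3(5)]
  have T1: "tri_mor D Sg (X, Y', sig E, cls C I f', cls C I (eta E \<cdot> a), cls C I v1)
      (X, W', sig B, cls C I (g' \<cdot> f'), cls C I (eta B \<cdot> e), cls C I v3) (cls C I (Id C X)) (cls C I g') (cls C I P)"
    unfolding D.tri_mor_iff[OF w(1,3)]
    using s' h(2,3) h'(2) m P(1) t1(3) t3(3) e1 e3 Sg_hom[OF susp_id[OF X]] by (simp add: quotient_comp)
  have T2: "tri_mor D Sg (X, W', sig B, cls C I (g' \<cdot> f'), cls C I (eta B \<cdot> e), cls C I v3)
      (Y', W', sig G, cls C I g', cls C I (eta G \<cdot> c), cls C I v2) (cls C I f') (cls C I (Id C W')) (cls C I N)"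
    unfolding D.tri_mor_iff[OF w(3,2)]
    using s' h(2,3) h'(2,3) m N(1) t2(3) t3(3) u4(3) e2 e4 Sg_hom[OF u4(5)] by (simp add: quotient_comp)
  have nk: "cls C I (n \<cdot> k) = cls C I (g' \<cdot> m)"
  proof -
    have "cls C I (g' \<cdot> m) = cls C I ((n \<cdot> (k \<cdot> m')) \<cdot> m)"
      by (rule cong_right[OF h'(10)[symmetric]]) (use h(6) h'(2) in simp_all)
    also have "\<dots> = cls C I ((n \<cdot> k) \<cdot> (m' \<cdot> m))" using h(6,7) h'(6) k(1) by simp
    also have "\<dots> = cls C I ((n \<cdot> k) \<cdot> Id C Y)" by (rule cong_left[OF h(8)]) (use h(6,7) h'(6) k(1) in simp_all)
    finally show ?thesis using h'(6) k(1) by simp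
  qed
  have gf: "cls C I g' \<cdot>\<^bsub>D\<^esub> cls C I f' = cls C I (g' \<cdot> f')" using h(2) h'(2) by (simp add: quotient_comp)
  have sv: "on_hom Sg (cls C I (eta E \<cdot> a)) \<cdot>\<^bsub>D\<^esub> cls C I v2 = cls C I (v \<cdot> v2)"
    unfolding Sg_hom[OF u(5)] using u(3) t2(3) by (simp add: quotient_comp)
  show ?thesis
  proof (intro exI conjI)
    show "iso_in D Y Y' (cls C I m)" by (rule D_iso[OF h(6,7) f(4) h(5,8,9)])
    show "iso_in D W W' (cls C I n)" by (rule D_iso[OF h'(6,7) k(3) h'(5,8,9)])
    show "cls C I f' = cls C I m \<cdot>\<^bsub>D\<^esub> F" unfolding f(2) using h(6,10) f(1) by (simp add: quotient_comp)
    show "cls C I n \<cdot>\<^bsub>D\<^esub> K = cls C I g' \<cdot>\<^bsub>D\<^esub> cls C I m"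
      unfolding k(2) using nk h(6) h'(2,6) k(1) by (simp add: quotient_comp)
    show "(X, Y', sig E, cls C I f', cls C I (eta E \<cdot> a), cls C I v1) \<in> dist" by (rule std_dist[OF t1(5)])
    show "(Y', W', sig G, cls C I g', cls C I (eta G \<cdot> c), cls C I v2) \<in> dist" by (rule std_dist[OF t2(5)])
    show "(X, W', sig B, cls C I g' \<cdot>\<^bsub>D\<^esub> cls C I f', cls C I (eta B \<cdot> e), cls C I v3) \<in> dist"
      unfolding gf by (rule std_dist[OF t3(5)])
    show "(sig E, sig B, sig G, cls C I P, cls C I N, on_hom Sg (cls C I (eta E \<cdot> a)) \<cdot>\<^bsub>D\<^esub> cls C I v2) \<in> dist"
      unfolding sv by (rule d4)
    show "tri_mor D Sg (X, Y', sig E, cls C I f', cls C I (eta E \<cdot> a), cls C I v1)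
      (X, W', sig B, cls C I g' \<cdot>\<^bsub>D\<^esub> cls C I f', cls C I (eta B \<cdot> e), cls C I v3) (Id D X) (cls C I g') (cls C I P)"
      unfolding gf using T1 by simp
    show "tri_mor D Sg (X, W', sig B, cls C I g' \<cdot>\<^bsub>D\<^esub> cls C I f', cls C I (eta B \<cdot> e), cls C I v3)
      (Y', W', sig G, cls C I g', cls C I (eta G \<cdot> c), cls C I v2) (cls C I f') (Id D W') (cls C I N)"
      unfolding gf using T2 by simp
  qed (use h'(2) s in simp_all)
qed

theorem dist_right_triangulated: "right_triangulated_category D Sg dist"
proof -
  interpret model_triangulation D Sg dist models
  proof
    show "t \<in> dist \<Longrightarrow> right_triangle D Sg t" for t by (rule dist_wf)
    show "\<lbrakk>t \<in> dist; right_triangle D Sg t'; tri_iso D Sg t t'\<rbrakk> \<Longrightarrow> t' \<in> dist" for t t' by (rule dist_iso)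
    show "t \<in> models \<Longrightarrow> right_triangle D Sg t" for t by (rule models_wf)
    show "t \<in> dist \<Longrightarrow> \<exists>m\<in>models. tri_iso D Sg m t" for t by (rule dist_model)
  next
    fix X Y Z F G H assume M: "(X, Y, Z, F, G, H) \<in> models"
    show "\<exists>c. tri_mor D Sg (X, Y, Z, F, G, H) (A', B', X', f', g', h') a b c"
      if "(A', B', X', f', g', h') \<in> models" "mor D a X A'" "mor D b Y B'" "b \<cdot>\<^bsub>D\<^esub> F = f' \<cdot>\<^bsub>D\<^esub> a"
      for A' B' X' f' g' h' a b by (rule models_mor[OF M that])
    show "G \<cdot>\<^bsub>D\<^esub> F = Zero D X Z" by (rule models_zero[OF M])
    show "\<exists>K'. mor D K' Z B \<and> K = K' \<cdot>\<^bsub>D\<^esub> G" if "mor D K Y B" "K \<cdot>\<^bsub>D\<^esub> F = Zero D X B" for K B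
      by (rule models_cokernel[OF M that])
    show "(Y, Z, on_ob Sg X, G, H, mn D (on_hom Sg F)) \<in> dist" by (rule models_rotate[OF M])
  next
    show "\<exists>X g h. (A, B, X, f, g, h) \<in> dist" if "mor D f A B" for f A B by (rule dist_complete[OF that])
  next
    fix F K X Y W assume "mor D F X Y" "mor D K Y W"
    then show "\<exists>Y' W' y w f' g' E F' G a b c d e h p q. iso_in D Y Y' y \<and> iso_in D W W' w \<and>
          f' = y \<cdot>\<^bsub>D\<^esub> F \<and> mor D g' Y' W' \<and> w \<cdot>\<^bsub>D\<^esub> K = g' \<cdot>\<^bsub>D\<^esub> y \<and>
          (X, Y', E, f', a, b) \<in> dist \<and> (Y', W', G, g', c, d) \<in> dist \<and> (X, W', F', g' \<cdot>\<^bsub>D\<^esub> f', e, h) \<in> dist \<and>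
          (E, F', G, p, q, on_hom Sg a \<cdot>\<^bsub>D\<^esub> d) \<in> dist \<and>
          tri_mor D Sg (X, Y', E, f', a, b) (X, W', F', g' \<cdot>\<^bsub>D\<^esub> f', e, h) (Id D X) g' p \<and>
          tri_mor D Sg (X, W', F', g' \<cdot>\<^bsub>D\<^esub> f', e, h) (Y', W', G, g', c, d) f' (Id D W') q"
      by (rule dist_octahedral)
  qed
  show ?thesis by (rule right_triangulated)
qed

end

section \<open>Compatibility of the right and the left triangles\<close>

lemma op_additive_functor: "additive_functor (op_cat C) (op_cat D) F \<longleftrightarrow> additive_functor C D F"
  unfolding additive_functor_def by (simp, blast)

text \<open>The condition quantifies over \<open>\<delta>\<close> and uses its adjoint, instead of
  the other way round, so that both conditions apply \<open>phi\<close> in the forward direction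
  only.\<close>

definition compatible_right where
  "compatible_right D Sg Om phi t l = (case (t, l) of ((A, B, X, f, g, h), (A', B', X', f', g', h')) \<Rightarrow>
     (\<forall>\<delta> \<beta>. mor D \<delta> (on_ob Sg A) X' \<longrightarrow> mor D \<beta> B A' \<longrightarrow> \<beta> \<cdot>\<^bsub>D\<^esub> f = f' \<cdot>\<^bsub>D\<^esub> phi A X' \<delta> \<longrightarrow>
        (\<exists>\<gamma>. mor D \<gamma> X B' \<and> \<gamma> \<cdot>\<^bsub>D\<^esub> g = g' \<cdot>\<^bsub>D\<^esub> \<beta> \<and> h' \<cdot>\<^bsub>D\<^esub> \<gamma> = \<delta> \<cdot>\<^bsub>D\<^esub> h)))"

definition compatible_left where
  "compatible_left D Sg Om phi t l = (case (t, l) of ((A, B, X, f, g, h), (A', B', X', f', g', h')) \<Rightarrow>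
     (\<forall>\<delta> \<gamma>. mor D \<delta> (on_ob Sg A) X' \<longrightarrow> mor D \<gamma> X B' \<longrightarrow> h' \<cdot>\<^bsub>D\<^esub> \<gamma> = \<delta> \<cdot>\<^bsub>D\<^esub> h \<longrightarrow>
        (\<exists>\<beta>. mor D \<beta> B A' \<and> \<beta> \<cdot>\<^bsub>D\<^esub> f = f' \<cdot>\<^bsub>D\<^esub> phi A X' \<delta> \<and> g' \<cdot>\<^bsub>D\<^esub> \<beta> = \<gamma> \<cdot>\<^bsub>D\<^esub> g)))"

locale adjoint_pair = R: suspended_category C Sg + L: suspended_category C Om
  for C :: "('o, 'm, 'z) precategory_scheme" (structure) and Sg Om +
  fixes phi
  assumes adj: "adjunction C Sg Om phi"
begin

lemma phi_mor:
  assumes "A \<in> Ob C" "mor C x (on_ob Sg A) B"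
  shows "mor C (phi A B x) A (on_ob Om B)"
proof -
  have x: "x \<in> Hom C (on_ob Sg A) B" "B \<in> Ob C" using R.mor_hom[OF assms(2)] assms(2) by auto
  have "bij_betw (phi A B) (Hom C (on_ob Sg A) B) (Hom C A (on_ob Om B))"
    using adj assms(1) x(2) unfolding adjunction_def by blast
  then have "phi A B x \<in> Hom C A (on_ob Om B)" using x(1) by (rule bij_betwE[rule_format])
  then show ?thesis using R.hom_iff_mor[of A "on_ob Om B"] assms(1) x(2) by simp
qed

lemma phi_natural:
  assumes "A \<in> Ob C" "mor C x (on_ob Sg A) B" "mor C f A' A" "mor C k B B'"
  shows "phi A' B' (k \<cdot> (x \<cdot> on_hom Sg f)) = on_hom Om k \<cdot> (phi A B x \<cdot> f)"
proof -
  have "x \<in> Hom C (on_ob Sg A) B" "f \<in> Hom C A' A" "k \<in> Hom C B B'" "A' \<in> Ob C" "B \<in> Ob C" "B' \<in> Ob C"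
    using R.mor_hom[OF assms(2)] R.mor_hom[OF assms(3)] R.mor_hom[OF assms(4)] assms by auto
  then show ?thesis using adj assms(1) unfolding adjunction_def by blast
qed

lemma left_tri_isoE:
  assumes "left_tri_iso C Om (A0, B0, X0, f0, g0, h0) (A, B, X, f, g, h)"
  obtains a b c where "iso_in C A A0 a" "iso_in C B B0 b" "iso_in C X X0 c"
    "h0 \<cdot> b = c \<cdot> h" "g0 \<cdot> a = b \<cdot> g" "f0 \<cdot> on_hom Om c = a \<cdot> f"
proof -
  have "\<exists>c b a. iso_in C X X0 c \<and> iso_in C B B0 b \<and> iso_in C A A0 a \<and>
    h0 \<cdot> b = c \<cdot> h \<and> g0 \<cdot> a = b \<cdot> g \<and> f0 \<cdot> on_hom Om c = a \<cdot> f"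
    using assms unfolding left_tri_iso_def op_tri_def tri_iso_def tri_mor_def
    by (simp add: op_iso) blast
  then show ?thesis using that by blast
qed

lemma left_triangle_iff:
  "left_triangle C Om (A, B, X, f, g, h) \<longleftrightarrow> mor C h B X \<and> mor C g A B \<and> mor C f (on_ob Om X) A"
  unfolding left_triangle_def op_tri_def right_triangle_def
  using R.hom_iff_mor[of B X h] R.hom_iff_mor[of A B g] R.hom_iff_mor[of "on_ob Om X" A f] by auto

text \<open>The data of each condition are conjugated along the two isomorphisms of triangles.
  Naturality of \<open>phi\<close> matches the conjugate of \<open>\<delta>\<close> with the
  conjugate of its adjoint.\<close>

lemma compatible_iso:
  assumes w: "right_triangle C Sg (A0, B0, X0, f0, g0, h0)" "right_triangle C Sg (A, B, X, f, g, h)"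
      "left_triangle C Om (A0', B0', X0', f0', g0', h0')" "left_triangle C Om (A', B', X', f', g', h')"
    and t: "tri_iso C Sg (A0, B0, X0, f0, g0, h0) (A, B, X, f, g, h)"
    and l: "left_tri_iso C Om (A0', B0', X0', f0', g0', h0') (A', B', X', f', g', h')"
  shows "compatible_right C Sg Om phi (A0, B0, X0, f0, g0, h0) (A0', B0', X0', f0', g0', h0') \<Longrightarrow>
      compatible_right C Sg Om phi (A, B, X, f, g, h) (A', B', X', f', g', h')"
    and "compatible_left C Sg Om phi (A0, B0, X0, f0, g0, h0) (A0', B0', X0', f0', g0', h0') \<Longrightarrow>
      compatible_left C Sg Om phi (A, B, X, f, g, h) (A', B', X', f', g', h')"
proof -
  obtain a b c ai bi ci where
    m: "tri_mor C Sg (A0, B0, X0, f0, g0, h0) (A, B, X, f, g, h) a b c"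
      "tri_mor C Sg (A, B, X, f, g, h) (A0, B0, X0, f0, g0, h0) ai bi ci"
    and i: "mor C a A0 A" "mor C ai A A0" "ai \<cdot> a = Id C A0" "a \<cdot> ai = Id C A"
      "mor C b B0 B" "mor C bi B B0" "bi \<cdot> b = Id C B0" "b \<cdot> bi = Id C B"
      "mor C c X0 X" "mor C ci X X0" "ci \<cdot> c = Id C X0" "c \<cdot> ci = Id C X"
    using t w(1,2) by (rule R.tri_isoE)
  obtain a' b' c' where j: "iso_in C A' A0' a'" "iso_in C B' B0' b'" "iso_in C X' X0' c'"
    and e': "h0' \<cdot> b' = c' \<cdot> h'" "g0' \<cdot> a' = b' \<cdot> g'" "f0' \<cdot> on_hom Om c' = a' \<cdot> f'"
    using l by (rule left_tri_isoE)
  obtain ai' where a': "mor C a' A' A0'" "mor C ai' A0' A'" "ai' \<cdot> a' = Id C A'" "a' \<cdot> ai' = Id C A0'"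
    using j(1) by (rule R.iso_inE)
  obtain bi' where b': "mor C b' B' B0'" "mor C bi' B0' B'" "bi' \<cdot> b' = Id C B'" "b' \<cdot> bi' = Id C B0'"
    using j(2) by (rule R.iso_inE)
  obtain ci' where c': "mor C c' X' X0'" "mor C ci' X0' X'" "ci' \<cdot> c' = Id C X'" "c' \<cdot> ci' = Id C X0'"
    using j(3) by (rule R.iso_inE)
  note v = w(1,2)[unfolded R.right_triangle_iff] w(3,4)[unfolded left_triangle_iff]
  note e = m(1)[unfolded R.tri_mor_iff[OF w(1,2)]] m(2)[unfolded R.tri_mor_iff[OF w(2,1)]]
  show "compatible_right C Sg Om phi (A, B, X, f, g, h) (A', B', X', f', g', h')"
    if co: "compatible_right C Sg Om phi (A0, B0, X0, f0, g0, h0) (A0', B0', X0', f0', g0', h0')"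
    unfolding compatible_right_def prod.case
  proof (intro allI impI)
    fix \<delta> \<beta> assume d: "mor C \<delta> (on_ob Sg A) X'" "mor C \<beta> B A'" "\<beta> \<cdot> f = f' \<cdot> phi A X' \<delta>"
    have p: "mor C (phi A X' \<delta>) A (on_ob Om X')" using phi_mor v d(1) by blast
    \<comment> \<open>\<open>\<delta>\<close> conjugated by the suspended first component of the
      right isomorphism and the last component of the left one, the form to which naturality of
      \<open>phi\<close> applies.\<close>
    define \<delta>0 where "\<delta>0 = c' \<cdot> (\<delta> \<cdot> on_hom Sg a)"
    define \<beta>0 where "\<beta>0 = a' \<cdot> (\<beta> \<cdot> b)"
    have t0: "mor C \<delta>0 (on_ob Sg A0) X0'" "mor C \<beta>0 B0 A0'" unfolding \<delta>0_def \<beta>0_def using d i a' c' by simp_all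
    have ph: "phi A0 X0' \<delta>0 = on_hom Om c' \<cdot> (phi A X' \<delta> \<cdot> a)"
      unfolding \<delta>0_def by (rule phi_natural) (use d i c' v in auto)
    have "\<beta>0 \<cdot> f0 = a' \<cdot> (\<beta> \<cdot> (f \<cdot> a))" unfolding \<beta>0_def using e d(1,2) i a' v by simp
    also have "\<dots> = a' \<cdot> ((\<beta> \<cdot> f) \<cdot> a)" using d(1,2) i a' v by simp
    also have "\<dots> = (a' \<cdot> f') \<cdot> (phi A X' \<delta> \<cdot> a)" unfolding d(3) using p i a' v by simp
    also have "\<dots> = f0' \<cdot> (on_hom Om c' \<cdot> (phi A X' \<delta> \<cdot> a))" unfolding e'(3)[symmetric] using p i c' v by simp
    finally have "\<beta>0 \<cdot> f0 = f0' \<cdot> phi A0 X0' \<delta>0" unfolding ph .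
    then obtain \<gamma>0 where g: "mor C \<gamma>0 X0 B0'" "\<gamma>0 \<cdot> g0 = g0' \<cdot> \<beta>0" "h0' \<cdot> \<gamma>0 = \<delta>0 \<cdot> h0"
      using co[unfolded compatible_right_def prod.case] t0 by blast
    have 1: "(bi' \<cdot> (\<gamma>0 \<cdot> ci)) \<cdot> g = g' \<cdot> \<beta>"
    proof -
      have "(bi' \<cdot> (\<gamma>0 \<cdot> ci)) \<cdot> g = bi' \<cdot> (\<gamma>0 \<cdot> (g0 \<cdot> bi))" using e g(1) i b' v by simp
      also have "\<dots> = bi' \<cdot> ((\<gamma>0 \<cdot> g0) \<cdot> bi)" using g(1) i b' v by simp
      also have "\<dots> = bi' \<cdot> ((g0' \<cdot> a') \<cdot> (\<beta> \<cdot> (b \<cdot> bi)))" unfolding g(2) \<beta>0_def using d i(5,6) a' b' v by simp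
      also have "\<dots> = (bi' \<cdot> b') \<cdot> (g' \<cdot> \<beta>)" unfolding e'(2) using i d b'(1,2) v by simp
      finally show ?thesis using b' d v by simp
    qed
    have 2: "h' \<cdot> (bi' \<cdot> (\<gamma>0 \<cdot> ci)) = \<delta> \<cdot> h"
    proof -
      have "h' \<cdot> bi' = (ci' \<cdot> c') \<cdot> (h' \<cdot> bi')" using b' c' v by simp
      also have "\<dots> = ci' \<cdot> ((c' \<cdot> h') \<cdot> bi')" using b'(1,2) c'(1,2) v by simp
      also have "\<dots> = ci' \<cdot> (h0' \<cdot> (b' \<cdot> bi'))" unfolding e'(1)[symmetric] using b'(1,2) c'(1,2) v by simp
      finally have hb: "h' \<cdot> bi' = ci' \<cdot> h0'" using b' v by simp
      have "h' \<cdot> (bi' \<cdot> (\<gamma>0 \<cdot> ci)) = (h' \<cdot> bi') \<cdot> (\<gamma>0 \<cdot> ci)" using b' v g(1) i by simp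
      also have "\<dots> = ci' \<cdot> ((h0' \<cdot> \<gamma>0) \<cdot> ci)" unfolding hb using c' v g(1) i by simp
      also have "\<dots> = (ci' \<cdot> c') \<cdot> (\<delta> \<cdot> (on_hom Sg a \<cdot> (h0 \<cdot> ci)))" unfolding g(3) \<delta>0_def using c'(1,2) v d i(1,9,10) by simp
      also have "\<dots> = \<delta> \<cdot> ((on_hom Sg a \<cdot> h0) \<cdot> ci)" using c' v d i(1,9,10) by simp
      also have "\<dots> = \<delta> \<cdot> (h \<cdot> (c \<cdot> ci))" using e v d i(9,10) by simp
      finally show ?thesis using i v d by simp
    qed
    show "\<exists>\<gamma>. mor C \<gamma> X B' \<and> \<gamma> \<cdot> g = g' \<cdot> \<beta> \<and> h' \<cdot> \<gamma> = \<delta> \<cdot> h"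
      by (rule exI[of _ "bi' \<cdot> (\<gamma>0 \<cdot> ci)"]) (use 1 2 b' g(1) i in simp)
  qed
  show "compatible_left C Sg Om phi (A, B, X, f, g, h) (A', B', X', f', g', h')"
    if co: "compatible_left C Sg Om phi (A0, B0, X0, f0, g0, h0) (A0', B0', X0', f0', g0', h0')"
    unfolding compatible_left_def prod.case
  proof (intro allI impI)
    fix \<delta> \<gamma> assume d: "mor C \<delta> (on_ob Sg A) X'" "mor C \<gamma> X B'" "h' \<cdot> \<gamma> = \<delta> \<cdot> h"
    have p: "mor C (phi A X' \<delta>) A (on_ob Om X')" using phi_mor v d(1) by blast
    define \<delta>0 where "\<delta>0 = c' \<cdot> (\<delta> \<cdot> on_hom Sg a)"
    define \<gamma>0 where "\<gamma>0 = b' \<cdot> (\<gamma> \<cdot> c)"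
    have t0: "mor C \<delta>0 (on_ob Sg A0) X0'" "mor C \<gamma>0 X0 B0'" unfolding \<delta>0_def \<gamma>0_def using d i b' c' by simp_all
    have ph: "phi A0 X0' \<delta>0 = on_hom Om c' \<cdot> (phi A X' \<delta> \<cdot> a)"
      unfolding \<delta>0_def by (rule phi_natural) (use d i c' v in auto)
    have "h0' \<cdot> \<gamma>0 = (h0' \<cdot> b') \<cdot> (\<gamma> \<cdot> c)" unfolding \<gamma>0_def using d i b' v by simp
    also have "\<dots> = c' \<cdot> ((h' \<cdot> \<gamma>) \<cdot> c)" unfolding e'(1) using d(1,2) i c' v by simp
    also have "\<dots> = c' \<cdot> (\<delta> \<cdot> (h \<cdot> c))" unfolding d(3) using d(1,2) i c' v by simp
    also have "\<dots> = c' \<cdot> (\<delta> \<cdot> (on_hom Sg a \<cdot> h0))" using e by simp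
    also have "\<dots> = \<delta>0 \<cdot> h0" unfolding \<delta>0_def using d(1) i c' v by simp
    finally obtain \<beta>0 where g: "mor C \<beta>0 B0 A0'" "\<beta>0 \<cdot> f0 = f0' \<cdot> phi A0 X0' \<delta>0" "g0' \<cdot> \<beta>0 = \<gamma>0 \<cdot> g0"
      using co[unfolded compatible_left_def prod.case] t0 by blast
    have 1: "(ai' \<cdot> (\<beta>0 \<cdot> bi)) \<cdot> f = f' \<cdot> phi A X' \<delta>"
    proof -
      have "(ai' \<cdot> (\<beta>0 \<cdot> bi)) \<cdot> f = ai' \<cdot> (\<beta>0 \<cdot> (f0 \<cdot> ai))" using e g(1) i a' v by simp
      also have "\<dots> = ai' \<cdot> ((\<beta>0 \<cdot> f0) \<cdot> ai)" using g(1) i a' v by simp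
      also have "\<dots> = ai' \<cdot> ((f0' \<cdot> on_hom Om c') \<cdot> (phi A X' \<delta> \<cdot> (a \<cdot> ai)))"
        unfolding g(2) ph using p i(1,2) a' c' v by simp
      also have "\<dots> = (ai' \<cdot> a') \<cdot> (f' \<cdot> phi A X' \<delta>)" unfolding e'(3) using i p a'(1,2) v by simp
      finally show ?thesis using a' p v by simp
    qed
    have 2: "g' \<cdot> (ai' \<cdot> (\<beta>0 \<cdot> bi)) = \<gamma> \<cdot> g"
    proof -
      have "g' \<cdot> ai' = (bi' \<cdot> b') \<cdot> (g' \<cdot> ai')" using a' b' v by simp
      also have "\<dots> = bi' \<cdot> ((b' \<cdot> g') \<cdot> ai')" using a'(1,2) b'(1,2) v by simp
      also have "\<dots> = bi' \<cdot> (g0' \<cdot> (a' \<cdot> ai'))" unfolding e'(2)[symmetric] using a'(1,2) b'(1,2) v by simp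
      finally have hb: "g' \<cdot> ai' = bi' \<cdot> g0'" using a' v by simp
      have "g' \<cdot> (ai' \<cdot> (\<beta>0 \<cdot> bi)) = (g' \<cdot> ai') \<cdot> (\<beta>0 \<cdot> bi)" using a' v g(1) i by simp
      also have "\<dots> = bi' \<cdot> ((g0' \<cdot> \<beta>0) \<cdot> bi)" unfolding hb using b' v g(1) i by simp
      also have "\<dots> = (bi' \<cdot> b') \<cdot> (\<gamma> \<cdot> ((c \<cdot> g0) \<cdot> bi))" unfolding g(3) \<gamma>0_def using b'(1,2) v d(2) i(5,6,9,10) by simp
      also have "\<dots> = \<gamma> \<cdot> (g \<cdot> (b \<cdot> bi))" using e b' v d(2) i(5,6,9,10) by simp
      finally show ?thesis using i v d by simp
    qed
    show "\<exists>\<beta>. mor C \<beta> B A' \<and> \<beta> \<cdot> f = f' \<cdot> phi A X' \<delta> \<and> g' \<cdot> \<beta> = \<gamma> \<cdot> g"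
      by (rule exI[of _ "ai' \<cdot> (\<beta>0 \<cdot> bi)"]) (use 1 2 a' g(1) i in simp)
  qed
qed

end

text \<open>The left structure is the right structure of the opposite category, with classes in the
  order \<open>V\<close>, \<open>U\<close>, \<open>T\<close>, \<open>S\<close>. The bijection
  \<open>phi\<close> is described by matching two extensions of \<open>su X\<close> by
  \<open>de Y\<close>, with a minus on the side of \<open>d\<close>; this minus compensates the one
  in the models.\<close>

locale suspension_pair =
  R: suspension C EE eC eA push pull cf S T U V su sig sg eta Sg +
  L: suspension "op_cat C" EE eA eC pull push "\<lambda>f g e. cf g f e" V U T S de ome dg eps Om
  for C :: "('a, 'b, 'z) precategory_scheme" (structure) and EE :: "'d set" and eC eA push pull cf S T U V
    su sig sg eta Sg de ome dg eps Om +
  fixes phi :: "'a \<Rightarrow> 'a \<Rightarrow> 'b set \<Rightarrow> 'b set"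
  assumes phi: "\<lbrakk>X \<in> T \<inter> U; Y \<in> T \<inter> U; mor C d (sig (su X)) Y; mor C a X (ome (de Y));
      push (eps (de Y) \<cdot> a) (sg X) = pull (mn C (d \<cdot> eta (su X))) (dg Y)\<rbrakk>
    \<Longrightarrow> phi X Y (cls C (S \<inter> T) d) = cls C (S \<inter> T) a"
begin

abbreviation I where "I \<equiv> S \<inter> T"

lemma op_I: "cls (op_cat C) (V \<inter> U) f = cls C I f"
  using R.concentric op_cls[OF R.category_axioms] by (simp add: Int_commute)

lemma op_D: "ideal_quotient (op_cat C) (U \<inter> T) (V \<inter> U) = op_cat R.D"
  using R.concentric op_ideal_quotient[OF R.category_axioms] by (simp add: Int_commute)

lemma de_T: "Y \<in> T \<inter> U \<Longrightarrow> de Y \<in> T \<and> de Y \<in> Ob C"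
  using L.su_U[of Y] by auto

lemma deE:
  assumes "Y \<in> T \<inter> U"
  obtains j q J where "cf j q (dg Y)" "mor C q J Y" "J \<in> I" "mor C j (de Y) J"
proof -
  have Y: "Y \<in> U \<inter> T" using assms by blast
  show ?thesis using L.suE[OF Y] that R.concentric by (simp add: Int_commute) metis
qed

lemma dg_ext: "Y \<in> T \<inter> U \<Longrightarrow> dg Y \<in> EE \<and> eA (dg Y) = de Y \<and> eC (dg Y) = Y"
  using L.sg_ext[of Y] by auto

lemma eps_mor: "B \<in> T \<Longrightarrow> mor C (eps B) (ome B) B"
  using L.eta_mor[of B] by auto

lemma ome_ob: "B \<in> T \<Longrightarrow> ome B \<in> Ob C \<and> ome B \<in> T \<and> ome B \<in> U"
  using L.sig_ob[of B] by auto

lemma ome_Zc: "B \<in> T \<Longrightarrow> ome B \<in> T \<inter> U"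
  using ome_ob by blast

lemma ome_lift:
  assumes "B \<in> T" "mor C k Y B" "Y \<in> U"
  obtains G where "mor C G Y (ome B)" "eps B \<cdot> G = k"
proof -
  have k: "mor (op_cat C) k B Y" using assms(2) by auto
  show ?thesis using L.sig_extend[OF assms(1) k assms(3)] that by auto
qed

lemma ome_cancel:
  assumes "B \<in> T" "mor C G Y (ome B)" "mor C G' Y (ome B)" "Y \<in> U" "cls C I (eps B \<cdot> G) = cls C I (eps B \<cdot> G')"
  shows "cls C I G = cls C I G'"
  using L.sig_cancel[of B G Y G'] assms by (simp add: op_I)

lemma Om_ob: "Y \<in> T \<inter> U \<Longrightarrow> on_ob Om Y = ome (de Y)"
  using L.Sg_ob[of Y] by auto

text \<open>The extension attached to \<open>d\<close> is a push of \<open>sg X\<close> because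
  \<open>de Y\<close> is in \<T>, and the pushing morphism lifts along the counit because
  \<open>X\<close> is in \<U>.\<close>

lemma phi_exists:
  assumes "X \<in> T \<inter> U" "Y \<in> T \<inter> U" "mor C d (sig (su X)) Y"
  obtains a where "mor C a X (ome (de Y))" 
    "push (eps (de Y) \<cdot> a) (sg X) = pull (mn C (d \<cdot> eta (su X))) (dg Y)"
proof -
  note s = R.sg_ext[OF assms(1)] R.su_U[OF assms(1)] dg_ext[OF assms(2)] de_T[OF assms(2)]
    R.Zc_ob[OF assms(1)] R.Zc_ob[OF assms(2)]
  note s' = s R.eta_mor[of "su X"] eps_mor[of "de Y"]
  obtain i p J where i: "cf i p (sg X)" "mor C i X J" "J \<in> I" "mor C p J (su X)" using assms(1) by (rule R.suE)
  obtain t where t: "mor C t X (de Y)" "push t (sg X) = pull (mn C (d \<cdot> eta (su X))) (dg Y)"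
    by (rule R.push_surj[OF i(1), of "pull (mn C (d \<cdot> eta (su X))) (dg Y)"]; (rule that)?) (use s' assms(3) i in simp_all)
  obtain a where a: "mor C a X (ome (de Y))" "eps (de Y) \<cdot> a = t"
    by (rule ome_lift[of "de Y" t X]; (rule that; assumption)?) (use s t in simp_all)
  show ?thesis by (rule that[OF a(1)]) (simp add: a(2) t(2))
qed

lemma phi_exists':
  assumes "X \<in> T \<inter> U" "Y \<in> T \<inter> U" "mor C a X (ome (de Y))"
  obtains d where "mor C d (sig (su X)) Y" 
    "push (eps (de Y) \<cdot> a) (sg X) = pull (mn C (d \<cdot> eta (su X))) (dg Y)"
proof -
  note s = R.sg_ext[OF assms(1)] R.su_U[OF assms(1)] dg_ext[OF assms(2)] de_T[OF assms(2)]
    R.Zc_ob[OF assms(1)] R.Zc_ob[OF assms(2)]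
  note s' = s R.eta_mor[of "su X"] eps_mor[of "de Y"]
  obtain j q J where j: "cf j q (dg Y)" "mor C q J Y" "J \<in> I" "mor C j (de Y) J" using assms(2) by (rule deE)
  obtain u where u: "mor C u (su X) Y" "pull u (dg Y) = push (eps (de Y) \<cdot> a) (sg X)"
    by (rule R.pull_surj[OF j(1), of "push (eps (de Y) \<cdot> a) (sg X)"]; (rule that)?) (use s' assms(3) j in simp_all)
  obtain d where d: "mor C d (sig (su X)) Y" "d \<cdot> eta (su X) = mn C u"
    by (rule R.sig_extend[of "su X" "mn C u" Y]; (rule that; assumption)?) (use s u in simp_all)
  show ?thesis by (rule that[OF d(1)]) (use d(2) u in simp)
qed

text \<open>Either class determines the common extension, and that extension determines the other
  class. One equivalence thus gives both well-definedness and injectivity of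
  \<open>phi\<close>.\<close>

lemma phi_unique:
  assumes "X \<in> T \<inter> U" "Y \<in> T \<inter> U" "mor C d (sig (su X)) Y" "mor C a X (ome (de Y))"
    "push (eps (de Y) \<cdot> a) (sg X) = pull (mn C (d \<cdot> eta (su X))) (dg Y)"
    "mor C d' (sig (su X)) Y" "mor C a' X (ome (de Y))"
    "push (eps (de Y) \<cdot> a') (sg X) = pull (mn C (d' \<cdot> eta (su X))) (dg Y)"
  shows "cls C I d = cls C I d' \<longleftrightarrow> cls C I a = cls C I a'"
proof -
  note s = R.sg_ext[OF assms(1)] R.su_U[OF assms(1)] dg_ext[OF assms(2)] de_T[OF assms(2)]
    R.Zc_ob[OF assms(1)] R.Zc_ob[OF assms(2)]
  note s' = s R.eta_mor[of "su X"] eps_mor[of "de Y"]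
  show ?thesis
  proof
    assume e: "cls C I d = cls C I d'"
    have "cls C I (mn C (d \<cdot> eta (su X))) = cls C I (mn C (d' \<cdot> eta (su X)))"
      by (rule R.cong_mn[OF R.cong_right[OF e]]) (use s' assms(3,6) in simp_all)
    then have "pull (mn C (d \<cdot> eta (su X))) (dg Y) = pull (mn C (d' \<cdot> eta (su X))) (dg Y)"
      by (intro R.pull_cls) (use s' assms(3) in simp_all)
    then have p: "push (eps (de Y) \<cdot> a) (sg X) = push (eps (de Y) \<cdot> a') (sg X)" using assms(5,8) by simp
    obtain i p J where i: "cf i p (sg X)" "mor C i X J" "J \<in> I" "mor C p J (su X)" using assms(1) by (rule R.suE)
    have "cls C I (eps (de Y) \<cdot> a) = cls C I (eps (de Y) \<cdot> a')"
      by (rule R.push_inj[OF i(1), of _ "de Y"]) (use i p s' assms(4,7) in simp_all)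
    then show "cls C I a = cls C I a'"
      by (intro ome_cancel[of "de Y" a X a']) (use s assms(4,7) in simp_all)
  next
    assume e: "cls C I a = cls C I a'"
    have "cls C I (eps (de Y) \<cdot> a) = cls C I (eps (de Y) \<cdot> a')"
      by (rule R.cong_left[OF e]) (use s' assms(4,7) in simp_all)
    then have "push (eps (de Y) \<cdot> a) (sg X) = push (eps (de Y) \<cdot> a') (sg X)"
      by (intro R.push_cls) (use s' assms(4) in simp_all)
    then have p: "pull (mn C (d \<cdot> eta (su X))) (dg Y) = pull (mn C (d' \<cdot> eta (su X))) (dg Y)" using assms(5,8) by simp
    obtain j q J where j: "cf j q (dg Y)" "mor C q J Y" "J \<in> I" "mor C j (de Y) J" using assms(2) by (rule deE)
    have m: "cls C I (mn C (d \<cdot> eta (su X))) = cls C I (mn C (d' \<cdot> eta (su X)))"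
      by (rule R.pull_inj[OF j(1), of _ "su X"]) (use j p s' assms(3,6) in simp_all)
    have "cls C I (d \<cdot> eta (su X)) = cls C I (d' \<cdot> eta (su X))"
      using R.cong_mn[OF m] s' assms(3,6) by simp
    then show "cls C I d = cls C I d'"
      by (intro R.sig_cancel[of "su X" d Y d']) (use s assms(3,6) in simp_all)
  qed
qed

lemma D_homE:
  assumes "A \<in> T \<inter> U" "B \<in> T \<inter> U" "F \<in> Hom R.D A B"
  obtains f where "mor C f A B" "F = cls C I f"
proof -
  have "mor R.D F A B" using R.D.hom_iff_mor[of A B F] assms by simp
  then show ?thesis using R.D_mor that by blast
qed

lemma D_homI: "\<lbrakk>mor C f A B; A \<in> T \<inter> U; B \<in> T \<inter> U\<rbrakk> \<Longrightarrow> cls C I f \<in> Hom R.D A B"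
  by (rule R.D.mor_hom) simp

lemma susp_op:
  assumes "X \<in> T \<inter> U" "Y \<in> T \<inter> U" "mor C z X Y"
  obtains t v where "mor C t (de X) (de Y)" "push t (dg X) = pull z (dg Y)"
    "mor C v (ome (de X)) (ome (de Y))" "eps (de Y) \<cdot> v = t \<cdot> eps (de X)" "on_hom Om (cls C I z) = cls C I v"
proof -
  have z: "Y \<in> U \<inter> T" "X \<in> U \<inter> T" "mor (op_cat C) z Y X" using assms by auto
  obtain t v where h: "mor (op_cat C) t (de Y) (de X)" "push t (dg X) = pull z (dg Y)"
    "mor (op_cat C) v (ome (de Y)) (ome (de X))" "v \<cdot>\<^bsub>op_cat C\<^esub> eps (de Y) = eps (de X) \<cdot>\<^bsub>op_cat C\<^esub> t" "L.susp z v"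
    using z by (rule L.susp_exists)
  show ?thesis by (rule that[of t v]) (use h L.Sg_hom[OF h(5)] in \<open>simp_all add: op_I\<close>)
qed

text \<open>Bijectivity is existence in both directions together with the uniqueness above. For
  naturality, the morphisms on both sides are moved across the extension that relates
  \<open>d\<close> and \<open>a\<close>.\<close>

lemma adjunction: "adjunction R.D Sg Om phi"
  unfolding adjunction_def
proof (intro conjI ballI)
  fix X Y assume "X \<in> Ob R.D" "Y \<in> Ob R.D"
  then have XY: "X \<in> T \<inter> U" "Y \<in> T \<inter> U" by auto
  have Z: "sig (su X) \<in> T \<inter> U" "ome (de Y) \<in> T \<inter> U" using R.sig_Zc R.su_U[OF XY(1)] ome_Zc de_T[OF XY(2)] by auto
  show "bij_betw (phi X Y) (Hom R.D (on_ob Sg X) Y) (Hom R.D X (on_ob Om Y))"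
    unfolding R.Sg_ob[OF XY(1)] Om_ob[OF XY(2)]
  proof (rule bij_betwI')
    fix F F' assume h: "F \<in> Hom R.D (sig (su X)) Y" "F' \<in> Hom R.D (sig (su X)) Y"
    obtain d where d: "mor C d (sig (su X)) Y" "F = cls C I d" using Z(1) XY(2) h(1) by (rule D_homE)
    obtain d' where d': "mor C d' (sig (su X)) Y" "F' = cls C I d'" using Z(1) XY(2) h(2) by (rule D_homE)
    obtain a where a: "mor C a X (ome (de Y))" "push (eps (de Y) \<cdot> a) (sg X) = pull (mn C (d \<cdot> eta (su X))) (dg Y)"
      using XY d(1) by (rule phi_exists)
    obtain a' where a': "mor C a' X (ome (de Y))" "push (eps (de Y) \<cdot> a') (sg X) = pull (mn C (d' \<cdot> eta (su X))) (dg Y)"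
      using XY d'(1) by (rule phi_exists)
    show "(phi X Y F = phi X Y F') = (F = F')"
      unfolding d(2) d'(2) phi[OF XY d(1) a] phi[OF XY d'(1) a'] using phi_unique[OF XY d(1) a d'(1) a'] by simp
  next
    fix F assume h: "F \<in> Hom R.D (sig (su X)) Y"
    obtain d where d: "mor C d (sig (su X)) Y" "F = cls C I d" using Z(1) XY(2) h by (rule D_homE)
    obtain a where a: "mor C a X (ome (de Y))" "push (eps (de Y) \<cdot> a) (sg X) = pull (mn C (d \<cdot> eta (su X))) (dg Y)"
      using XY d(1) by (rule phi_exists)
    show "phi X Y F \<in> Hom R.D X (ome (de Y))" unfolding d(2) phi[OF XY d(1) a] by (rule D_homI[OF a(1) XY(1) Z(2)])
  next
    fix G assume h: "G \<in> Hom R.D X (ome (de Y))"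
    obtain a where a: "mor C a X (ome (de Y))" "G = cls C I a" using XY(1) Z(2) h by (rule D_homE)
    obtain d where d: "mor C d (sig (su X)) Y" "push (eps (de Y) \<cdot> a) (sg X) = pull (mn C (d \<cdot> eta (su X))) (dg Y)"
      using XY a(1) by (rule phi_exists')
    show "\<exists>F\<in>Hom R.D (sig (su X)) Y. G = phi X Y F"
      by (rule bexI[of _ "cls C I d"]) (use phi[OF XY d(1) a(1) d(2)] a(2) D_homI[OF d(1) Z(1) XY(2)] in simp_all)
  qed
next
  fix X Y X' Y' F G K assume "X \<in> Ob R.D" "Y \<in> Ob R.D" "X' \<in> Ob R.D" "Y' \<in> Ob R.D"
    and h: "F \<in> Hom R.D (on_ob Sg X) Y" "G \<in> Hom R.D X' X" "K \<in> Hom R.D Y Y'"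
  then have XY: "X \<in> T \<inter> U" "Y \<in> T \<inter> U" "X' \<in> T \<inter> U" "Y' \<in> T \<inter> U" by auto
  have Z: "sig (su X) \<in> T \<inter> U" using R.sig_Zc R.su_U[OF XY(1)] by auto
  obtain d where d: "mor C d (sig (su X)) Y" "F = cls C I d"
    using Z XY(2) h(1)[unfolded R.Sg_ob[OF XY(1)]] by (rule D_homE)
  obtain g where g: "mor C g X' X" "G = cls C I g" using XY(3,1) h(2) by (rule D_homE)
  obtain k where k: "mor C k Y Y'" "K = cls C I k" using XY(2,4) h(3) by (rule D_homE)
  obtain a where a: "mor C a X (ome (de Y))" "push (eps (de Y) \<cdot> a) (sg X) = pull (mn C (d \<cdot> eta (su X))) (dg Y)"
    using XY(1,2) d(1) by (rule phi_exists)
  obtain w v where w: "mor C w (su X') (su X)" "pull w (sg X) = push g (sg X')"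
    "mor C v (sig (su X')) (sig (su X))" "v \<cdot> eta (su X') = eta (su X) \<cdot> w" "R.susp g v"
    using XY(3,1) g(1) by (rule R.susp_exists)
  obtain t q where t: "mor C t (de Y) (de Y')" "push t (dg Y) = pull k (dg Y')"
    "mor C q (ome (de Y)) (ome (de Y'))" "eps (de Y') \<cdot> q = t \<cdot> eps (de Y)" "on_hom Om (cls C I k) = cls C I q"
    using XY(2,4) k(1) by (rule susp_op)
  note s = R.sg_ext[OF XY(1)] R.su_U[OF XY(1)] R.sg_ext[OF XY(3)] R.su_U[OF XY(3)]
    dg_ext[OF XY(2)] de_T[OF XY(2)] dg_ext[OF XY(4)] de_T[OF XY(4)]
  note s' = s R.eta_mor[of "su X"] eps_mor[of "de Y"] R.eta_mor[of "su X'"] eps_mor[of "de Y'"]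
  \<comment> \<open>Precomposition with \<open>g\<close> becomes a pull along its suspension
    \<open>w\<close>, and postcomposition with \<open>k\<close> becomes a push along
    \<open>t\<close>; pushes and pulls commute.\<close>
  have "push (eps (de Y') \<cdot> (q \<cdot> (a \<cdot> g))) (sg X') = push ((t \<cdot> (eps (de Y) \<cdot> a)) \<cdot> g) (sg X')"
    using t a(1) g(1) s' by (simp add: R.comp_reassoc[OF t(4)])
  also have "\<dots> = push (t \<cdot> (eps (de Y) \<cdot> a)) (pull w (sg X))"
    using R.push_comp[of "sg X'" g "t \<cdot> (eps (de Y) \<cdot> a)"] w(2) t(1) a(1) g(1) s' by simp
  also have "\<dots> = pull w (push (t \<cdot> (eps (de Y) \<cdot> a)) (sg X))"
    by (rule R.push_pull) (use w(1) t(1) a(1) s' in simp_all)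
  also have "\<dots> = pull w (push t (pull (mn C (d \<cdot> eta (su X))) (dg Y)))"
    using R.push_comp[of "sg X" "eps (de Y) \<cdot> a" t] a t(1) s' by simp
  also have "\<dots> = pull w (pull (mn C (d \<cdot> eta (su X))) (pull k (dg Y')))"
    using R.push_pull[of "dg Y" t "mn C (d \<cdot> eta (su X))"] t(1,2) d(1) s' by simp
  also have "\<dots> = pull (k \<cdot> (mn C (d \<cdot> eta (su X)) \<cdot> w)) (dg Y')"
    using R.pull_comp[of "dg Y'" k "mn C (d \<cdot> eta (su X))"] R.pull_comp[of "dg Y'" "k \<cdot> mn C (d \<cdot> eta (su X))" w]
      k(1) d(1) w(1) s' by simp
  also have "k \<cdot> (mn C (d \<cdot> eta (su X)) \<cdot> w) = mn C ((k \<cdot> (d \<cdot> v)) \<cdot> eta (su X'))"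
    using k(1) d(1) w s' by simp
  finally have p: "push (eps (de Y') \<cdot> (q \<cdot> (a \<cdot> g))) (sg X') = pull (mn C ((k \<cdot> (d \<cdot> v)) \<cdot> eta (su X'))) (dg Y')" .
  have "phi X' Y' (cls C I (k \<cdot> (d \<cdot> v))) = cls C I (q \<cdot> (a \<cdot> g))"
    by (rule phi[OF XY(3,4) _ _ p]) (use k(1) d(1) w(3) t(3) a(1) g(1) in simp_all)
  then show "phi X' Y' (K \<cdot>\<^bsub>R.D\<^esub> F \<cdot>\<^bsub>R.D\<^esub> on_hom Sg G) = on_hom Om K \<cdot>\<^bsub>R.D\<^esub> phi X Y F \<cdot>\<^bsub>R.D\<^esub> G"
    unfolding d(2) g(2) k(2) R.Sg_hom[OF w(5)] t(5) phi[OF XY(1,2) d(1) a]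
    using k(1) d(1) w(3) t(3) a(1) g(1) by (simp add: R.quotient_comp)
qed

section \<open>The left triangulation, and compatibility on representatives\<close>

lemma Om_additive: "additive_functor R.D R.D Om"
  using L.Sg_additive unfolding op_D op_additive_functor .

definition ldist where "ldist = {l. op_tri l \<in> L.dist}"

lemma op_tri_op_tri [simp]: "op_tri (op_tri t) = t"
  by (cases t) (simp add: op_tri_def)

text \<open>Reversal of triangles is an involution, so the reversed left triangles are exactly the
  distinguished triangles of the opposite category.\<close>

lemma ldist_left_triangulated: "left_triangulated_category R.D Om ldist"
proof -
  have "op_tri ` ldist = L.dist"
    unfolding ldist_def by (auto intro!: image_eqI[of _ op_tri "op_tri _"])
  then show ?thesis using L.dist_right_triangulated unfolding left_triangulated_category_def op_D by simp
qed

sublocale AP: adjoint_pair R.D Sg Om phi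
proof -
  interpret L': suspended_category R.D Om by unfold_locales (rule Om_additive)
  show "adjoint_pair R.D Sg Om phi" by unfold_locales (rule adjunction)
qed

lemma lstdE:
  assumes "t \<in> L.std"
  obtains T0 Z P l m b n N where "op_tri t = (ome T0, Z, P, cls C I N, cls C I (l \<cdot> eps T0), cls C I m)"
    "P \<in> T \<inter> U" "Z \<in> T \<inter> U" "T0 \<in> T" "cf l m b" "mor C l T0 Z" "mor C m Z P"
    "mor C n (de P) T0" "push n (dg P) = b" "mor C N (ome (de P)) (ome T0)"
    "cls C I (eps T0 \<cdot> N) = cls C I (n \<cdot> eps (de P))"
proof -
  obtain P Z T0 m l b n N where h: "t = (P, Z, ome T0, cls C I m, cls C I (l \<cdot> eps T0), cls C I N)"
    "P \<in> U \<inter> T" "Z \<in> U \<inter> T" "T0 \<in> T" "cf l m b" "mor (op_cat C) m P Z" "mor (op_cat C) l Z T0"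
    "mor (op_cat C) n T0 (de P)" "push n (dg P) = b" "mor (op_cat C) N (ome T0) (ome (de P))"
    "cls C I (eps T0 \<cdot> N) = cls C I (n \<cdot> eps (de P))"
    using assms unfolding L.std_def op_I by auto
  show ?thesis
    by (rule that[of T0 Z P N l m b n]) (use h in \<open>simp_all add: op_tri_def\<close>)
qed

lemma lmodelsE:
  assumes "t \<in> L.models"
  obtains W Z P m y w N where "op_tri t = (ome W, Z, P, cls C I N, cls C I (y \<cdot> eps W), cls C I m)"
    "P \<in> T \<inter> U" "Z \<in> T \<inter> U" "W \<in> T" "mor C m Z P" "cf w y (pull m (dg P))" "mor C y W Z" "mor C w (de P) W"
    "mor C N (ome (de P)) (ome W)" "cls C I (eps W \<cdot> N) = cls C I (mn C w \<cdot> eps (de P))"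
proof -
  obtain P Z E M G N where t: "t = (P, Z, E, M, G, N)" by (cases t)
  obtain W m y w v where h: "E = ome W" "M = cls (op_cat C) (V \<inter> U) m" "G = cls (op_cat C) (V \<inter> U) (eps W \<cdot>\<^bsub>op_cat C\<^esub> y)"
    "N = cls (op_cat C) (V \<inter> U) v" "P \<in> U \<inter> T" "Z \<in> U \<inter> T" "W \<in> T" "mor (op_cat C) m P Z" "cf w y (pull m (dg P))"
    "mor (op_cat C) y Z W" "mor (op_cat C) w W (de P)"
    "mor (op_cat C) v (ome W) (ome (de P))"
    "cls (op_cat C) (V \<inter> U) (v \<cdot>\<^bsub>op_cat C\<^esub> eps W) = cls (op_cat C) (V \<inter> U) (eps (de P) \<cdot>\<^bsub>op_cat C\<^esub> mn (op_cat C) w)"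
    using assms unfolding t by (rule L.modelsE)
  show ?thesis
    by (rule that[of W Z P v y m w]) (use h in \<open>simp_all add: op_tri_def op_I t\<close>)
qed

text \<open>For the first condition the right triangle is a model: its extension
  \<open>push f (sg X)\<close> absorbs the failure of the given square to commute strictly. The data
  then form a morphism to the extension behind the left standard triangle, and its completion,
  extended along the unit of \<open>W\<close>, is the answer.\<close>

lemma compatible1:
  assumes M: "(X, Y, Z, F, G, H) \<in> R.models" and t: "t \<in> L.std" and ot: "op_tri t = (A', B', P, f', g', h')"
    and d: "mor R.D \<delta> (on_ob Sg X) P" and b: "mor R.D \<beta> Y A'"
    and e: "\<beta> \<cdot>\<^bsub>R.D\<^esub> F = f' \<cdot>\<^bsub>R.D\<^esub> phi X P \<delta>"
  shows "\<exists>\<gamma>. mor R.D \<gamma> Z B' \<and> \<gamma> \<cdot>\<^bsub>R.D\<^esub> G = g' \<cdot>\<^bsub>R.D\<^esub> \<beta> \<and> h' \<cdot>\<^bsub>R.D\<^esub> \<gamma> = \<delta> \<cdot>\<^bsub>R.D\<^esub> H"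
proof -
  obtain W f y w v where h: "Z = sig W" "F = cls C I f" "G = cls C I (eta W \<cdot> y)" "H = cls C I v"
    "X \<in> T \<inter> U" "Y \<in> T \<inter> U" "W \<in> U" "mor C f X Y" "cf y w (push f (sg X))" "mor C y Y W" "mor C w W (su X)"
    "mor C v (sig W) (sig (su X))" "cls C I (v \<cdot> eta W) = cls C I (eta (su X) \<cdot> mn C w)"
    using M by (rule R.modelsE)
  obtain T0 l m k n N where l: "A' = ome T0" "f' = cls C I N" "g' = cls C I (l \<cdot> eps T0)" "h' = cls C I m"
    "P \<in> T \<inter> U" "B' \<in> T \<inter> U" "T0 \<in> T" "cf l m k" "mor C l T0 B'" "mor C m B' P"
    "mor C n (de P) T0" "push n (dg P) = k" "mor C N (ome (de P)) (ome T0)"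
    "cls C I (eps T0 \<cdot> N) = cls C I (n \<cdot> eps (de P))"
    using t by (rule lstdE) (use ot in auto)
  obtain d0 where d0: "mor C d0 (sig (su X)) P" "\<delta> = cls C I d0" using d R.D_mor R.Sg_ob[OF h(5)] by auto
  obtain b0 where b0: "mor C b0 Y (ome T0)" "\<beta> = cls C I b0" using b R.D_mor l(1) by auto
  obtain a where a: "mor C a X (ome (de P))" "push (eps (de P) \<cdot> a) (sg X) = pull (mn C (d0 \<cdot> eta (su X))) (dg P)"
    using h(5) l(5) d0(1) by (rule phi_exists)
  have ph: "phi X P \<delta> = cls C I a" unfolding d0(2) by (rule phi[OF h(5) l(5) d0(1) a])
  note s = R.sg_ext[OF h(5)] R.su_U[OF h(5)] dg_ext[OF l(5)] de_T[OF l(5)] R.eta_mor[OF h(7)] R.sig_ob[OF h(7)]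
    eps_mor[OF l(7)] ome_ob[OF l(7)]
  note s' = s R.eta_mor[of "su X"] R.sig_ob[of "su X"] eps_mor[of "de P"] ome_ob[of "de P"]
  have "cls C I (b0 \<cdot> f) = cls C I (N \<cdot> a)" using e h(2,8) b0 l(2,13) a(1) ph by (simp add: R.quotient_comp)
  then have "cls C I (eps T0 \<cdot> (b0 \<cdot> f)) = cls C I (eps T0 \<cdot> (N \<cdot> a))"
    by (rule R.cong_left) (use b0 h(8) s in simp_all)
  also have "\<dots> = cls C I ((eps T0 \<cdot> N) \<cdot> a)" using s l(13) a(1) by simp
  also have "\<dots> = cls C I ((n \<cdot> eps (de P)) \<cdot> a)" by (rule R.cong_right[OF l(14)]) (use s l(13) a(1) in simp_all)
  finally have bf: "cls C I ((eps T0 \<cdot> b0) \<cdot> f) = cls C I (n \<cdot> (eps (de P) \<cdot> a))"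
    using s' b0(1) h(8) l(11) a(1) by simp
  have "push (eps T0 \<cdot> b0) (push f (sg X)) = push ((eps T0 \<cdot> b0) \<cdot> f) (sg X)"
    by (rule R.push_comp[symmetric]) (use s b0(1) h(8) in simp_all)
  also have "\<dots> = push (n \<cdot> (eps (de P) \<cdot> a)) (sg X)" by (rule R.push_cls[OF _ _ _ _ bf]) (use s b0(1) h(8) in simp_all)
  also have "\<dots> = push n (pull (mn C (d0 \<cdot> eta (su X))) (dg P))"
    using R.push_comp[of "sg X" "eps (de P) \<cdot> a" n] a s' l(11) by simp
  also have "\<dots> = pull (mn C (d0 \<cdot> eta (su X))) k"
    using R.push_pull[of "dg P" n "mn C (d0 \<cdot> eta (su X))"] s' d0(1) l(11,12) by simp
  finally obtain g where g: "mor C g W B'" "g \<cdot> y = l \<cdot> (eps T0 \<cdot> b0)" "mn C (d0 \<cdot> eta (su X)) \<cdot> w = m \<cdot> g"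
    using R.cf_mor[OF h(9) l(8), of "eps T0 \<cdot> b0" "mn C (d0 \<cdot> eta (su X))"] s' h(10,11) l(9,10) b0(1) d0(1) by auto
  obtain c where c: "mor C c (sig W) B'" "c \<cdot> eta W = g"
    by (rule R.sig_extend[OF h(7) g(1)]; (rule that)?) (use R.Zc_ob[OF l(6)] in simp_all)
  have 1: "c \<cdot> (eta W \<cdot> y) = (l \<cdot> eps T0) \<cdot> b0"
    using c g(1,2) s h(10) l(9) b0(1) by (simp add: R.comp_reassoc[OF c(2)])
  have "cls C I ((d0 \<cdot> v) \<cdot> eta W) = cls C I (d0 \<cdot> (eta (su X) \<cdot> mn C w))"
    using R.cong_left[OF h(13), of d0] s' d0(1) h(12) by simp
  \<comment> \<open>The minus on the third map of the model meets the minus in the description of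
    \<open>phi\<close>.\<close>
  also have "d0 \<cdot> (eta (su X) \<cdot> mn C w) = mn C (d0 \<cdot> eta (su X)) \<cdot> w" using s' d0(1) h(11) by simp
  also have "\<dots> = (m \<cdot> c) \<cdot> eta W" unfolding g(3) using c l(10) s by simp
  finally have 2: "cls C I (m \<cdot> c) = cls C I (d0 \<cdot> v)"
    by (intro R.sig_cancel[of W "m \<cdot> c" P "d0 \<cdot> v"]) (use c(1) l(10) d0(1) h(7,12) R.Zc_ob[OF l(5)] in simp_all)
  show ?thesis
    by (rule exI[of _ "cls C I c"])
       (use c(1) s h(10,12) l(9,10) b0(1) d0(1) 1 2 R.Zc_ob[OF l(6)] in
         \<open>simp add: h(1-4) l(1-4) d0(2) b0(2) R.quotient_comp\<close>)
qed

text \<open>For the second condition the left triangle is a model: its extension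
  \<open>pull m (dg P)\<close> absorbs the failure of strict commutativity, now on the side of
  \<open>m\<close>. The completion of the resulting morphism of extensions is lifted along the
  counit of \<open>W\<close>.\<close>

lemma compatible2:
  assumes st: "(X, Y, Z, F, G, H) \<in> R.std" and t: "t \<in> L.models" and ot: "op_tri t = (A', B', P, f', g', h')"
    and d: "mor R.D \<delta> (on_ob Sg X) P" and c: "mor R.D \<gamma> Z B'"
    and e: "h' \<cdot>\<^bsub>R.D\<^esub> \<gamma> = \<delta> \<cdot>\<^bsub>R.D\<^esub> H"
  shows "\<exists>\<beta>. mor R.D \<beta> Y A' \<and> \<beta> \<cdot>\<^bsub>R.D\<^esub> F = f' \<cdot>\<^bsub>R.D\<^esub> phi X P \<delta> \<and> g' \<cdot>\<^bsub>R.D\<^esub> \<beta> = \<gamma> \<cdot>\<^bsub>R.D\<^esub> G"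
proof -
  obtain A f a b c v where h: "Z = sig A" "F = cls C I f" "G = cls C I (eta A \<cdot> a)" "H = cls C I v"
     "X \<in> T \<inter> U" "Y \<in> T \<inter> U" "A \<in> U" "cf f a b" "mor C f X Y" "mor C a Y A"
     "mor C c A (su X)" "pull c (sg X) = b"
     "mor C v (sig A) (sig (su X))" "cls C I (v \<cdot> eta A) = cls C I (eta (su X) \<cdot> c)"
    using st unfolding R.std_def by blast
  obtain W m y w N where l: "A' = ome W" "f' = cls C I N" "g' = cls C I (y \<cdot> eps W)" "h' = cls C I m"
    "P \<in> T \<inter> U" "B' \<in> T \<inter> U" "W \<in> T" "mor C m B' P" "cf w y (pull m (dg P))" "mor C y W B'" "mor C w (de P) W"
    "mor C N (ome (de P)) (ome W)" "cls C I (eps W \<cdot> N) = cls C I (mn C w \<cdot> eps (de P))"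
    using t by (rule lmodelsE) (use ot in auto)
  obtain d0 where d0: "mor C d0 (sig (su X)) P" "\<delta> = cls C I d0" using d R.D_mor R.Sg_ob[OF h(5)] by auto
  obtain c0 where c0: "mor C c0 (sig A) B'" "\<gamma> = cls C I c0" using assms(5) R.D_mor h(1) by auto
  obtain k where k: "mor C k X (ome (de P))" "push (eps (de P) \<cdot> k) (sg X) = pull (mn C (d0 \<cdot> eta (su X))) (dg P)"
    using h(5) l(5) d0(1) by (rule phi_exists)
  have ph: "phi X P \<delta> = cls C I k" unfolding d0(2) by (rule phi[OF h(5) l(5) d0(1) k])
  note s = R.sg_ext[OF h(5)] R.su_U[OF h(5)] dg_ext[OF l(5)] de_T[OF l(5)] R.eta_mor[OF h(7)] R.sig_ob[OF h(7)]
    eps_mor[OF l(7)] ome_ob[OF l(7)]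
  note s' = s R.eta_mor[of "su X"] R.sig_ob[of "su X"] eps_mor[of "de P"] ome_ob[of "de P"]
  have "cls C I (m \<cdot> c0) = cls C I (d0 \<cdot> v)" using e h(4,13) c0 l(4,8) d0 by (simp add: R.quotient_comp)
  then have "cls C I ((m \<cdot> c0) \<cdot> eta A) = cls C I ((d0 \<cdot> v) \<cdot> eta A)"
    by (rule R.cong_right) (use s c0 l(8) in simp_all)
  also have "\<dots> = cls C I (d0 \<cdot> (eta (su X) \<cdot> c))" using R.cong_left[OF h(14), of d0] s h(13) d0(1) by simp
  finally have mc: "cls C I (m \<cdot> (c0 \<cdot> eta A)) = cls C I ((d0 \<cdot> eta (su X)) \<cdot> c)"
    using s' d0(1) h(11) c0(1) l(8) by simp
  \<comment> \<open>The sign in the description of \<open>phi\<close> is moved to the pushing side,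
    so that the extension of the right standard triangle can be mapped.\<close>
  have neg: "push (mn C (eps (de P) \<cdot> k)) (sg X) = pull (d0 \<cdot> eta (su X)) (dg P)"
    using R.ext_neg[of "dg P" "sg X" "eps (de P) \<cdot> k" "mn C (d0 \<cdot> eta (su X))"] k s' d0(1) by simp
  have "push (mn C (eps (de P) \<cdot> k)) b = pull c (push (mn C (eps (de P) \<cdot> k)) (sg X))"
    unfolding h(12)[symmetric] by (rule R.push_pull) (use s' k(1) h(11) in simp_all)
  also have "\<dots> = pull ((d0 \<cdot> eta (su X)) \<cdot> c) (dg P)"
    unfolding neg by (rule R.pull_comp[symmetric]) (use s' d0(1) h(11) in simp_all)
  also have "\<dots> = pull (m \<cdot> (c0 \<cdot> eta A)) (dg P)"
    by (rule R.pull_cls[OF _ _ _ _ mc[symmetric]]) (use s' d0(1) h(11) in simp_all)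
  also have "\<dots> = pull (c0 \<cdot> eta A) (pull m (dg P))"
    by (rule R.pull_comp) (use s' c0(1) l(8) in simp_all)
  finally obtain b0 where b0: "mor C b0 Y W" "b0 \<cdot> f = w \<cdot> mn C (eps (de P) \<cdot> k)" "(c0 \<cdot> eta A) \<cdot> a = y \<cdot> b0"
    using R.cf_mor[OF h(8) l(9), of "mn C (eps (de P) \<cdot> k)" "c0 \<cdot> eta A"] s' h(9,10) l(10,11) c0(1) k(1) by auto
  obtain B where B: "mor C B Y (ome W)" "eps W \<cdot> B = b0"
    by (rule ome_lift[OF l(7) b0(1)]; (rule that)?) (use R.Zc_ob[OF h(6)] in simp_all)
  \<comment> \<open>The minus in the left model matches the one with which \<open>k\<close> enters
    the morphism of extensions.\<close>
  have "cls C I (eps W \<cdot> (N \<cdot> k)) = cls C I ((mn C w \<cdot> eps (de P)) \<cdot> k)"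
    using R.cong_right[OF l(13), of k] s k(1) l(12) by simp
  also have "(mn C w \<cdot> eps (de P)) \<cdot> k = w \<cdot> mn C (eps (de P) \<cdot> k)" using s' k(1) l(11) by simp
  also have "\<dots> = eps W \<cdot> (B \<cdot> f)" unfolding b0(2)[symmetric] B(2)[symmetric] using s B(1) h(9) by simp
  finally have 1: "cls C I (B \<cdot> f) = cls C I (N \<cdot> k)"
    by (intro ome_cancel[of W "B \<cdot> f" X "N \<cdot> k"]) (use B(1) h(9) k(1) l(7,12) R.Zc_ob[OF h(5)] in simp_all)
  have 2: "(y \<cdot> eps W) \<cdot> B = c0 \<cdot> (eta A \<cdot> a)"
    using b0(3) B s l(10) c0(1) h(10) by simp
  show ?thesis
    by (rule exI[of _ "cls C I B"])
       (use B(1) s h(9,10) k(1) l(10,12) c0(1) 1 2 R.Zc_ob[OF h(6)] in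
         \<open>simp add: h(1-4) l(1-4) c0(2) ph R.quotient_comp\<close>)
qed

lemma left_triangle_op: "left_triangle R.D Om l \<longleftrightarrow> right_triangle L.D Om (op_tri l)"
  unfolding left_triangle_def op_D ..

lemma left_tri_iso_op: "left_tri_iso R.D Om l l' \<longleftrightarrow> tri_iso L.D Om (op_tri l) (op_tri l')"
  unfolding left_tri_iso_def op_D ..

lemma ldist_wf: "l \<in> ldist \<Longrightarrow> left_triangle R.D Om l"
  unfolding ldist_def left_triangle_op using L.dist_wf by blast

text \<open>Each condition is known for one pairing of a model with a standard triangle, and every
  distinguished triangle is isomorphic to triangles of both kinds.\<close>

lemma dist_compatible:
  assumes t: "(A, B, X, f, g, h) \<in> R.dist" and l: "(A', B', X', f', g', h') \<in> ldist"
  shows "compatible_right R.D Sg Om phi (A, B, X, f, g, h) (A', B', X', f', g', h')"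
    and "compatible_left R.D Sg Om phi (A, B, X, f, g, h) (A', B', X', f', g', h')"
proof -
  note w = R.dist_wf[OF t] ldist_wf[OF l]
  obtain m where m: "m \<in> R.models" "tri_iso R.D Sg m (A, B, X, f, g, h)" using R.dist_model[OF t] by blast
  obtain s where s: "s \<in> R.std" "tri_iso R.D Sg s (A, B, X, f, g, h)" using t unfolding R.dist_def by blast
  have l': "op_tri (A', B', X', f', g', h') \<in> L.dist" using l unfolding ldist_def by blast
  obtain m' where m': "m' \<in> L.models" "tri_iso L.D Om m' (op_tri (A', B', X', f', g', h'))"
    using L.dist_model[OF l'] by blast
  obtain s' where s': "s' \<in> L.std" "tri_iso L.D Om s' (op_tri (A', B', X', f', g', h'))"
    using l' unfolding L.dist_def by blast
  show "compatible_right R.D Sg Om phi (A, B, X, f, g, h) (A', B', X', f', g', h')"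
  proof -
    obtain A0 B0 X0 f0 g0 h0 where e: "m = (A0, B0, X0, f0, g0, h0)" by (cases m)
    obtain A1 B1 X1 f1 g1 h1 where e': "op_tri s' = (A1, B1, X1, f1, g1, h1)" by (cases "op_tri s'")
    have "left_triangle R.D Om (A1, B1, X1, f1, g1, h1)"
      "left_tri_iso R.D Om (A1, B1, X1, f1, g1, h1) (A', B', X', f', g', h')"
      unfolding left_triangle_op left_tri_iso_op e'[symmetric] using L.std_wf[OF s'(1)] s'(2) by simp_all
    moreover have "compatible_right R.D Sg Om phi (A0, B0, X0, f0, g0, h0) (A1, B1, X1, f1, g1, h1)"
      unfolding compatible_right_def prod.case using compatible1[OF m(1)[unfolded e] s'(1) e'] by blast
    ultimately show ?thesis
      using AP.compatible_iso(1)[OF R.models_wf[OF m(1), unfolded e] w(1) _ w(2) m(2)[unfolded e]] by blast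
  qed
  show "compatible_left R.D Sg Om phi (A, B, X, f, g, h) (A', B', X', f', g', h')"
  proof -
    obtain A0 B0 X0 f0 g0 h0 where e: "s = (A0, B0, X0, f0, g0, h0)" by (cases s)
    obtain A1 B1 X1 f1 g1 h1 where e': "op_tri m' = (A1, B1, X1, f1, g1, h1)" by (cases "op_tri m'")
    have "left_triangle R.D Om (A1, B1, X1, f1, g1, h1)"
      "left_tri_iso R.D Om (A1, B1, X1, f1, g1, h1) (A', B', X', f', g', h')"
      unfolding left_triangle_op left_tri_iso_op e'[symmetric] using L.models_wf[OF m'(1)] m'(2) by simp_all
    moreover have "compatible_left R.D Sg Om phi (A0, B0, X0, f0, g0, h0) (A1, B1, X1, f1, g1, h1)"
      unfolding compatible_left_def prod.case using compatible2[OF s(1)[unfolded e] m'(1) e'] by blast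
    ultimately show ?thesis
      using AP.compatible_iso(2)[OF R.std_wf[OF s(1), unfolded e] w(1) _ w(2) s(2)[unfolded e]] by blast
  qed
qed

theorem pretriangulated: "pretriangulated_category R.D Sg R.dist Om ldist phi"
  unfolding pretriangulated_category_def
proof (intro conjI allI impI ballI)
  show "right_triangulated_category R.D Sg R.dist" by (rule R.dist_right_triangulated)
  show "left_triangulated_category R.D Om ldist" by (rule ldist_left_triangulated)
  show "adjunction R.D Sg Om phi" by (rule adjunction)
next
  fix A B X f g h A' B' X' f' g' h'
  assume t: "(A, B, X, f, g, h) \<in> R.dist" and l: "(A', B', X', f', g', h') \<in> ldist"
  note c = dist_compatible[OF t l, unfolded compatible_right_def compatible_left_def prod.case]
  note w = R.dist_wf[OF t, unfolded R.D.right_triangle_iff] ldist_wf[OF l, unfolded AP.left_triangle_iff]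
  have ob: "A \<in> Ob R.D" "B \<in> Ob R.D" "X \<in> Ob R.D" "on_ob Sg A \<in> Ob R.D" "A' \<in> Ob R.D" "B' \<in> Ob R.D" "X' \<in> Ob R.D"
    using w by blast+
  have bij: "bij_betw (phi A X') (Hom R.D (on_ob Sg A) X') (Hom R.D A (on_ob Om X'))"
    using adjunction ob unfolding adjunction_def by blast
  show "\<exists>\<gamma>\<in>Hom R.D X B'. \<gamma> \<cdot>\<^bsub>R.D\<^esub> g = g' \<cdot>\<^bsub>R.D\<^esub> \<beta> \<and>
      h' \<cdot>\<^bsub>R.D\<^esub> \<gamma> = inv_into (Hom R.D (on_ob Sg A) X') (phi A X') \<alpha> \<cdot>\<^bsub>R.D\<^esub> h"
    if \<alpha>: "\<alpha> \<in> Hom R.D A (on_ob Om X')" and \<beta>: "\<beta> \<in> Hom R.D B A'" and e: "\<beta> \<cdot>\<^bsub>R.D\<^esub> f = f' \<cdot>\<^bsub>R.D\<^esub> \<alpha>" for \<alpha> \<beta>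
  proof -
    \<comment> \<open>Passing from \<open>\<alpha>\<close> to its adjoint reduces the condition to
      the forward form.\<close>
    define \<delta> where "\<delta> = inv_into (Hom R.D (on_ob Sg A) X') (phi A X') \<alpha>"
    have d: "\<delta> \<in> Hom R.D (on_ob Sg A) X'" "phi A X' \<delta> = \<alpha>"
      unfolding \<delta>_def using bij \<alpha> by (auto simp: bij_betw_def inv_into_into f_inv_into_f)
    have "mor R.D \<delta> (on_ob Sg A) X'" "mor R.D \<beta> B A'"
      using d(1) \<beta> R.D.hom_iff_mor[OF ob(4,7)] R.D.hom_iff_mor[OF ob(2,5)] by blast+
    then obtain \<gamma> where "mor R.D \<gamma> X B'" "\<gamma> \<cdot>\<^bsub>R.D\<^esub> g = g' \<cdot>\<^bsub>R.D\<^esub> \<beta>" "h' \<cdot>\<^bsub>R.D\<^esub> \<gamma> = \<delta> \<cdot>\<^bsub>R.D\<^esub> h"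
      using c(1) e d(2) by metis
    then show ?thesis unfolding \<delta>_def[symmetric] using R.D.mor_hom by blast
  qed
  show "\<exists>\<beta>\<in>Hom R.D B A'. \<beta> \<cdot>\<^bsub>R.D\<^esub> f = f' \<cdot>\<^bsub>R.D\<^esub> phi A X' \<delta> \<and> g' \<cdot>\<^bsub>R.D\<^esub> \<beta> = \<gamma> \<cdot>\<^bsub>R.D\<^esub> g"
    if \<gamma>: "\<gamma> \<in> Hom R.D X B'" and \<delta>: "\<delta> \<in> Hom R.D (on_ob Sg A) X'" and e: "h' \<cdot>\<^bsub>R.D\<^esub> \<gamma> = \<delta> \<cdot>\<^bsub>R.D\<^esub> h" for \<gamma> \<delta>
  proof -
    have "mor R.D \<delta> (on_ob Sg A) X'" "mor R.D \<gamma> X B'"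
      using \<delta> \<gamma> R.D.hom_iff_mor[OF ob(4,7)] R.D.hom_iff_mor[OF ob(3,6)] by blast+
    then obtain \<beta> where "mor R.D \<beta> B A'" "\<beta> \<cdot>\<^bsub>R.D\<^esub> f = f' \<cdot>\<^bsub>R.D\<^esub> phi A X' \<delta>" "g' \<cdot>\<^bsub>R.D\<^esub> \<beta> = \<gamma> \<cdot>\<^bsub>R.D\<^esub> g"
      using c(2) e by metis
    then show ?thesis using R.D.mor_hom by blast
  qed
qed

end

section \<open>Triangulated categories as extension categories\<close>

locale triangulated =
  fixes C :: "('o, 'm, 'z) tricategory_scheme" (structure)
  assumes triangulated: "triangulated_category C"
begin

sublocale suspended_category C "Shift C"
proof -
  interpret rt: right_triangulated_category C "Shift C" "Tri C"
    using triangulated unfolding triangulated_category_def by blast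
  show "suspended_category C (Shift C)" by unfold_locales (rule rt.suspension_additive)
qed

sublocale rt: right_triangulated_category C "Shift C" "Tri C"
  using triangulated unfolding triangulated_category_def by blast

lemma mn_inject [simp]:
  assumes "f \<in> arrs C" "g \<in> arrs C"
  shows "mn C f = mn C g \<longleftrightarrow> f = g"
proof
  assume "mn C f = mn C g"
  then have "mn C (mn C f) = mn C (mn C g)" by simp
  then show "f = g" using assms by simp
qed simp

lemma mn_eq_zero [simp]:
  assumes "f \<in> arrs C" "A \<in> Ob C" "B \<in> Ob C"
  shows "mn C f = Zero C A B \<longleftrightarrow> f = Zero C A B"
  using mn_inject[of f "Zero C A B"] assms by simp

section \<open>Rotating triangles back and forth, and descending along the shift\<close>

abbreviation F where "F \<equiv> on_hom (Shift C)"
abbreviation Fo where "Fo \<equiv> on_ob (Shift C)"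

lemma tri_wf: "(A, B, X, f, g, h) \<in> Tri C \<Longrightarrow> mor C f A B \<and> mor C g B X \<and> mor C h X (Fo A)"
  using rt.dist_wf right_triangle_iff by blast

lemma rotate: "(A, B, X, f, g, h) \<in> Tri C \<Longrightarrow> (B, X, Fo A, g, h, mn C (F f)) \<in> Tri C"
proof -
  assume t: "(A, B, X, f, g, h) \<in> Tri C"
  have "neg C (Fo A) (Fo B) (F f) = mn C (F f)" by (rule neg_mn) (use tri_wf[OF t] in simp)
  then show ?thesis using rt.dist_rotate[OF t] by simp
qed

lemma unrotate:
  assumes "(B, X, Fo A, g, h, mn C (F f)) \<in> Tri C" "mor C f A B"
  shows "(A, B, X, f, g, h) \<in> Tri C"
proof -
  have "neg C (Fo A) (Fo B) (F f) = mn C (F f)" by (rule neg_mn) (use assms(2) in simp)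
  moreover have "right_triangle C (Shift C) (A, B, X, f, g, h)"
    unfolding right_triangle_iff using tri_wf[OF assms(1)] assms(2) by simp
  ultimately show ?thesis using triangulated assms(1) unfolding triangulated_category_def by auto
qed

lemma shift_full:
  assumes "mor C g (Fo A) (Fo B)" "A \<in> Ob C" "B \<in> Ob C"
  obtains f where "mor C f A B" "F f = g"
proof -
  have "bij_betw F (Hom C A B) (Hom C (Fo A) (Fo B))"
    using triangulated assms(2,3) unfolding triangulated_category_def autoequivalence_def by blast
  moreover have "g \<in> Hom C (Fo A) (Fo B)" using assms(1) by (rule mor_hom)
  ultimately have "g \<in> F ` Hom C A B" unfolding bij_betw_def by simp
  then obtain f where "f \<in> Hom C A B" "F f = g" by blast
  then show ?thesis using that hom_iff_mor[OF assms(2,3)] by blast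
qed

lemma shift_faithful:
  assumes "F f = F f'" "mor C f A B" "mor C f' A B"
  shows "f = f'"
proof -
  have "bij_betw F (Hom C A B) (Hom C (Fo A) (Fo B))"
    using triangulated assms(2) unfolding triangulated_category_def autoequivalence_def by blast
  then show ?thesis using assms(1) mor_hom[OF assms(2)] mor_hom[OF assms(3)] unfolding bij_betw_def inj_on_def by blast
qed

lemma shift_surj:
  assumes "B \<in> Ob C"
  obtains A r s where "A \<in> Ob C" "mor C r (Fo A) B" "mor C s B (Fo A)" "s \<cdot> r = Id C (Fo A)" "r \<cdot> s = Id C B"
proof -
  obtain A r where "A \<in> Ob C" "iso_in C (Fo A) B r"
    using triangulated assms unfolding triangulated_category_def autoequivalence_def by blast
  then show ?thesis using that by (elim iso_inE) blast
qed

lemma tri_replace: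
  assumes t: "(A, B, X, f, g, h) \<in> Tri C"
    and b: "mor C b B B'" "mor C b' B' B" "b' \<cdot> b = Id C B" "b \<cdot> b' = Id C B'"
    and c: "mor C c X X'" "mor C c' X' X" "c' \<cdot> c = Id C X" "c \<cdot> c' = Id C X'"
  shows "(A, B', X', b \<cdot> f, (c \<cdot> g) \<cdot> b', h \<cdot> c') \<in> Tri C"
proof -
  note w = tri_wf[OF t]
  have w1: "right_triangle C (Shift C) (A, B, X, f, g, h)" by (rule rt.dist_wf[OF t])
  have w2: "right_triangle C (Shift C) (A, B', X', b \<cdot> f, (c \<cdot> g) \<cdot> b', h \<cdot> c')"
    unfolding right_triangle_iff using w b c by simp
  have "tri_mor C (Shift C) (A, B, X, f, g, h) (A, B', X', b \<cdot> f, (c \<cdot> g) \<cdot> b', h \<cdot> c') (Id C A) b c"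
    unfolding tri_mor_iff[OF w1 w2] using w b c by simp
  then have "tri_iso C (Shift C) (A, B, X, f, g, h) (A, B', X', b \<cdot> f, (c \<cdot> g) \<cdot> b', h \<cdot> c')"
    by (rule tri_isoI) (use iso_in_id w iso_inI[OF b] iso_inI[OF c] in auto)
  then show ?thesis using rt.dist_iso[OF t w2] by blast
qed

text \<open>Conjugation by minus the identity at the middle vertex: signs may be changed in
  pairs.\<close>

lemma flip_fg: "(A, B, X, f, g, h) \<in> Tri C \<Longrightarrow> (A, B, X, mn C f, mn C g, h) \<in> Tri C"
  using tri_replace[of A B X f g h "mn C (Id C B)" B "mn C (Id C B)" "Id C X" X "Id C X"] tri_wf[of A B X f g h] by simp

lemma flip_gh: "(A, B, X, f, g, h) \<in> Tri C \<Longrightarrow> (A, B, X, f, mn C g, mn C h) \<in> Tri C"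
  using tri_replace[of A B X f g h "Id C B" B "Id C B" "mn C (Id C X)" X "mn C (Id C X)"] tri_wf[of A B X f g h] by simp

lemma rotate2:
  assumes "(A, B, X, f, g, h) \<in> Tri C"
  shows "(X, Fo A, Fo B, h, mn C (F f), mn C (F g)) \<in> Tri C"
  using rotate[OF rotate[OF assms]] .

text \<open>Three rotations produce three signs, of which two can be removed as a pair.\<close>

lemma rotate3:
  assumes "(A, B, X, f, g, h) \<in> Tri C"
  shows "(Fo A, Fo B, Fo X, F f, F g, mn C (F h)) \<in> Tri C"
proof -
  have "(Fo A, Fo B, Fo X, mn C (F f), mn C (F g), mn C (F h)) \<in> Tri C"
    using rotate[OF rotate2[OF assms]] .
  from flip_fg[OF this] show ?thesis using tri_wf[OF assms] by simp
qed

lemma unrotate2: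
  assumes "(X, Fo A, Fo B, h, mn C (F f), mn C (F g)) \<in> Tri C" "mor C f A B" "mor C g B X"
  shows "(A, B, X, f, g, h) \<in> Tri C"
  using unrotate[OF unrotate[OF assms(1,3)] assms(2)] .

lemma unrotate3:
  assumes "(Fo A, Fo B, Fo X, F f, F g, mn C (F h)) \<in> Tri C" "mor C f A B" "mor C g B X" "mor C h X (Fo A)"
  shows "(A, B, X, f, g, h) \<in> Tri C"
proof -
  have "(Fo A, Fo B, Fo X, mn C (F f), mn C (F g), mn C (F h)) \<in> Tri C"
    using flip_fg[OF assms(1)] .
  then show ?thesis using unrotate2[OF unrotate] assms(2-4) by blast
qed

text \<open>The shift of a zero object is again zero, because its identity is the image of a zero
  morphism.\<close>

lemma zero_obE:
  obtains N where "N \<in> Ob C" "zero_object C N" "zero_object C (Fo N)"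
    "\<And>X f. mor C f N X \<Longrightarrow> f = Zero C N X" "Id C N = Zero C N N" "Id C (Fo N) = Zero C (Fo N) (Fo N)"
proof -
  obtain N where N: "zero_object C N" using ex_zero_object by blast
  then have o: "N \<in> Ob C" unfolding zero_object_def by blast
  have u: "f = Zero C N X" if "mor C f N X" for X f
    using N mor_hom[OF that] that unfolding zero_object_def by blast
  have i: "Id C N = Zero C N N" using u[of "Id C N" N] o by simp
  have i': "Id C (Fo N) = Zero C (Fo N) (Fo N)" using arg_cong[OF i, of F] o by simp
  have l: "f = Zero C (Fo N) X" if "mor C f (Fo N) X" for X f
  proof -
    have "f = f \<cdot> Id C (Fo N)" using that by simp
    then show ?thesis unfolding i' using that by simp
  qed
  have r: "f = Zero C X (Fo N)" if "mor C f X (Fo N)" for X f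
  proof -
    have "f = Id C (Fo N) \<cdot> f" using that by simp
    then show ?thesis unfolding i' using that by simp
  qed
  have "zero_object C (Fo N)" unfolding zero_object_def
  proof (intro conjI ballI)
    fix X assume X: "X \<in> Ob C"
    show "Hom C (Fo N) X = {Zero C (Fo N) X}"
      using l[of _ X] hom_iff_mor[of "Fo N" X] X o by auto
    show "Hom C X (Fo N) = {Zero C X (Fo N)}"
      using r[of _ X] hom_iff_mor[of X "Fo N"] X o by auto
  qed (use o in simp)
  then show ?thesis using that[OF o N _ u i i'] by blast
qed

text \<open>Comparison with the triangle on the identity of \<open>A\<close> factors
  \<open>g \<cdot> f\<close> through a zero object.\<close>

lemma tri_zero:
  assumes t: "(A, B, X, f, g, h) \<in> Tri C"
  shows "g \<cdot> f = Zero C A X"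
proof -
  note w = tri_wf[OF t]
  obtain N where N: "N \<in> Ob C" "zero_object C N" by (rule zero_obE)
  have i: "(A, A, N, Id C A, Zero C A N, Zero C N (Fo A)) \<in> Tri C" using rt.dist_id[of A N] w N by blast
  obtain c where c: "tri_mor C (Shift C) (A, A, N, Id C A, Zero C A N, Zero C N (Fo A)) (A, B, X, f, g, h) (Id C A) f c"
    using rt.dist_mor[OF i t, of "Id C A" f] mor_hom[of f A B] mor_hom[of "Id C A" A A] w by auto
  show ?thesis using c[unfolded tri_mor_iff[OF rt.dist_wf[OF i] rt.dist_wf[OF t]]] w N by auto
qed

lemma tri_mor_exists:
  assumes t: "(A, B, X, f, g, h) \<in> Tri C" and t': "(A', B', X', f', g', h') \<in> Tri C"
    and m: "mor C a A A'" "mor C b B B'" "b \<cdot> f = f' \<cdot> a"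
  obtains c where "mor C c X X'" "c \<cdot> g = g' \<cdot> b" "F a \<cdot> h = h' \<cdot> c"
proof -
  obtain c where c: "tri_mor C (Shift C) (A, B, X, f, g, h) (A', B', X', f', g', h') a b c"
    using rt.dist_mor[OF t t' mor_hom[OF m(1)] mor_hom[OF m(2)] m(3)] by blast
  show ?thesis using c[unfolded tri_mor_iff[OF rt.dist_wf[OF t] rt.dist_wf[OF t']]] that by blast
qed

text \<open>The triangle is mapped to \<open>0 \<rightarrow> K \<rightarrow> K\<close>, obtained by
  rotating back the triangle on the identity of \<open>K\<close>. Rotating back needs a zero object
  of the form \<open>Fo N\<close>.\<close>

lemma tri_cokernel:
  assumes t: "(A, B, X, f, g, h) \<in> Tri C" and k: "mor C k B K" "k \<cdot> f = Zero C A K"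
  obtains m where "mor C m X K" "m \<cdot> g = k"
proof -
  note w = tri_wf[OF t]
  obtain N where N: "N \<in> Ob C" "zero_object C (Fo N)" by (rule zero_obE)
  have K: "K \<in> Ob C" using k by blast
  have z: "(K, K, Fo N, Id C K, Zero C K (Fo N), Zero C (Fo N) (Fo K)) \<in> Tri C" using rt.dist_id[OF K N(2)] .
  have i: "(N, K, K, Zero C N K, Id C K, Zero C K (Fo N)) \<in> Tri C"
    by (rule unrotate) (use z N(1) K in simp_all)
  obtain c where "mor C c X K" "c \<cdot> g = Id C K \<cdot> k"
    by (rule tri_mor_exists[OF t i, of "Zero C A N" k]; (rule that; assumption)?) (use k w N(1) in simp_all)
  then show ?thesis using that[of c] k by simp
qed

text \<open>Comparing \<open>K \<rightarrow> 0 \<rightarrow> Fo K\<close> with the rotated triangle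
  gives the factorization after a shift; fullness and faithfulness remove the shift.\<close>

lemma tri_kernel:
  assumes t: "(A, B, X, f, g, h) \<in> Tri C" and k: "mor C k K B" "g \<cdot> k = Zero C K X"
  obtains m where "mor C m K A" "f \<cdot> m = k"
proof -
  note w = tri_wf[OF t]
  obtain N where N: "N \<in> Ob C" "zero_object C N" by (rule zero_obE)
  have K: "K \<in> Ob C" using k by blast
  have i: "(K, N, Fo K, Zero C K N, Zero C N (Fo K), mn C (F (Id C K))) \<in> Tri C"
    using rotate[OF rt.dist_id[OF K N(2)]] .
  obtain c where c: "mor C c (Fo K) (Fo A)" "F k \<cdot> mn C (F (Id C K)) = mn C (F f) \<cdot> c"
    by (rule tri_mor_exists[OF i rotate[OF t], of k "Zero C N X"]; (rule that; assumption)?) (use k w N(1) in simp_all)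
  obtain m where m: "mor C m K A" "F m = c" by (rule shift_full[OF c(1)]) (use K w in auto)
  have "F k = F (f \<cdot> m)" using c m k w K by simp
  then have "k = f \<cdot> m" by (rule shift_faithful[of _ _ K B]) (use k m w in simp_all)
  then show ?thesis using that[OF m(1)] by simp
qed

text \<open>The axiom completes third components. Two rotations put the missing middle component in
  third place, and the result descends along the shift.\<close>

lemma tri_third:
  assumes t: "(A, B, X, f, g, h) \<in> Tri C" and t': "(A', B', X', f', g', h') \<in> Tri C"
    and m: "mor C a A A'" "mor C c X X'" "F a \<cdot> h = h' \<cdot> c"
  obtains b where "mor C b B B'" "b \<cdot> f = f' \<cdot> a" "c \<cdot> g = g' \<cdot> b"
proof -
  note w = tri_wf[OF t] tri_wf[OF t']
  obtain b' where b': "mor C b' (Fo B) (Fo B')" "b' \<cdot> mn C (F f) = mn C (F f') \<cdot> F a" "F c \<cdot> mn C (F g) = mn C (F g') \<cdot> b'"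
    by (rule tri_mor_exists[OF rotate2[OF t] rotate2[OF t'], of c "F a"]; (rule that; assumption)?) (use m w in simp_all)
  obtain b where b: "mor C b B B'" "F b = b'" by (rule shift_full[OF b'(1)]) (use w in auto)
  have "F (b \<cdot> f) = F (f' \<cdot> a)" using b'(2) b'(1) b m(1) w by simp
  then have 1: "b \<cdot> f = f' \<cdot> a" by (rule shift_faithful[of _ _ A B']) (use b(1) m w in simp_all)
  have "F (c \<cdot> g) = F (g' \<cdot> b)" using b'(3) b'(1) b m(2) w by simp
  then have 2: "c \<cdot> g = g' \<cdot> b" by (rule shift_faithful[of _ _ B X']) (use b(1) m w in simp_all)
  show ?thesis by (rule that[OF b(1) 1 2])
qed

lemma octahedral:
  assumes t1: "(X, Y, E, f, a, b) \<in> Tri C" and t2: "(Y, W, G, g, c, d) \<in> Tri C" and t3: "(X, W, H, g \<cdot> f, e, h) \<in> Tri C"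
  obtains p q where "(E, H, G, p, q, F a \<cdot> d) \<in> Tri C" "mor C p E H" "mor C q H G"
    "p \<cdot> a = e \<cdot> g" "h \<cdot> p = b" "q \<cdot> e = c" "d \<cdot> q = F f \<cdot> h"
proof -
  note w = rt.dist_wf[OF t1] rt.dist_wf[OF t2] rt.dist_wf[OF t3]
  note v = w[unfolded right_triangle_iff]
  obtain p q where h: "(E, H, G, p, q, F a \<cdot> d) \<in> Tri C"
    "tri_mor C (Shift C) (X, Y, E, f, a, b) (X, W, H, g \<cdot> f, e, h) (Id C X) g p"
    "tri_mor C (Shift C) (X, W, H, g \<cdot> f, e, h) (Y, W, G, g, c, d) f (Id C W) q"
    using rt.dist_octahedral[OF t1 t2 t3] by blast
  show ?thesis
    by (rule that[OF h(1)]) (use h(2)[unfolded tri_mor_iff[OF w(1,3)]] h(3)[unfolded tri_mor_iff[OF w(3,2)]] v in auto)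
qed

text \<open>The third vertex of a triangle on \<open>d\<close> is isomorphic to a shift by essential
  surjectivity; after this replacement two rotations can be undone.\<close>

lemma cocone:
  assumes "mor C d X (Fo A)" "A \<in> Ob C"
  obtains B f g where "(A, B, X, f, g, d) \<in> Tri C"
proof -
  obtain Y u v where t: "(X, Fo A, Y, d, u, v) \<in> Tri C"
    using rt.dist_complete[OF _ _ mor_hom[OF assms(1)]] assms(1) by blast
  note w = tri_wf[OF t]
  obtain B r s where B: "B \<in> Ob C" "mor C r (Fo B) Y" "mor C s Y (Fo B)" "s \<cdot> r = Id C (Fo B)" "r \<cdot> s = Id C Y"
    by (rule shift_surj[of Y]) (use w in blast)
  have "(X, Fo A, Fo B, Id C (Fo A) \<cdot> d, (s \<cdot> u) \<cdot> Id C (Fo A), v \<cdot> r) \<in> Tri C"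
    by (rule tri_replace[OF t _ _ _ _ B(3,2,5,4)]) (use w in simp_all)
  then have t': "(X, Fo A, Fo B, d, s \<cdot> u, v \<cdot> r) \<in> Tri C" using w B by simp
  obtain f where f: "mor C f A B" "F f = mn C (s \<cdot> u)" by (rule shift_full[of "mn C (s \<cdot> u)" A B]) (use w B assms in simp_all)
  obtain g where g: "mor C g B X" "F g = mn C (v \<cdot> r)" by (rule shift_full[of "mn C (v \<cdot> r)" B X]) (use w B assms in simp_all)
  have "(A, B, X, f, g, d) \<in> Tri C" by (rule unrotate2[OF _ f(1) g(1)]) (use t' f g w B in simp)
  then show ?thesis by (rule that)
qed

lemma fibre:
  assumes "mor C m B X"
  obtains A f d where "(A, B, X, f, m, d) \<in> Tri C"
proof -
  obtain Y u v where t: "(B, X, Y, m, u, v) \<in> Tri C"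
    using rt.dist_complete[OF _ _ mor_hom[OF assms(1)]] assms(1) by blast
  note w = tri_wf[OF t]
  obtain A r s where A: "A \<in> Ob C" "mor C r (Fo A) Y" "mor C s Y (Fo A)" "s \<cdot> r = Id C (Fo A)" "r \<cdot> s = Id C Y"
    by (rule shift_surj[of Y]) (use w in blast)
  have "(B, X, Fo A, Id C X \<cdot> m, (s \<cdot> u) \<cdot> Id C X, v \<cdot> r) \<in> Tri C"
    by (rule tri_replace[OF t _ _ _ _ A(3,2,5,4)]) (use w in simp_all)
  then have t': "(B, X, Fo A, m, s \<cdot> u, v \<cdot> r) \<in> Tri C" using w A by simp
  obtain f where f: "mor C f A B" "F f = mn C (v \<cdot> r)" by (rule shift_full[of "mn C (v \<cdot> r)" A B]) (use w A in simp_all)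
  have "(A, B, X, f, m, s \<cdot> u) \<in> Tri C" by (rule unrotate[OF _ f(1)]) (use t' f w A in simp)
  then show ?thesis by (rule that)
qed

text \<open>The octahedron of the composite of \<open>d2\<close> and \<open>F f1\<close>, with all
  three triangles rotated into position. Its fourth triangle is the shift of the second conflation
  through \<open>D\<close>.\<close>

lemma tri_pushout:
  assumes t1: "(X, B1, C1, f1, g1, d1) \<in> Tri C" and t2: "(X, B2, C2, f2, g2, d2) \<in> Tri C"
  obtains D x y d e where "(B1, D, C2, x, y, F f1 \<cdot> d2) \<in> Tri C" "(B2, D, C1, d, e, F f2 \<cdot> d1) \<in> Tri C"
    "x \<cdot> f1 = d \<cdot> f2" "y \<cdot> d = g2" "e \<cdot> x = g1" "d1 \<cdot> e = d2 \<cdot> mn C y"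
proof -
  note w = tri_wf[OF t1] tri_wf[OF t2]
  obtain D x y where t3: "(B1, D, C2, x, y, F f1 \<cdot> d2) \<in> Tri C"
    by (rule cocone[of "F f1 \<cdot> d2" C2 B1]) (use w in simp_all)
  note w3 = tri_wf[OF t3]
  obtain p q where o: "(Fo B2, Fo D, Fo C1, p, q, F (mn C (F f2)) \<cdot> mn C (F d1)) \<in> Tri C"
    "mor C p (Fo B2) (Fo D)" "mor C q (Fo D) (Fo C1)"
    "p \<cdot> mn C (F f2) = mn C (F x) \<cdot> F f1" "mn C (F y) \<cdot> p = mn C (F g2)" "q \<cdot> mn C (F x) = F g1"
    "mn C (F d1) \<cdot> q = F d2 \<cdot> mn C (F y)"
    by (rule octahedral[OF rotate2[OF t2] rotate3[OF t1] rotate2[OF t3]])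
  obtain d where d: "mor C d B2 D" "F d = p" by (rule shift_full[OF o(2)]) (use w w3 in auto)
  \<comment> \<open>The sign is dictated by \<open>q \<cdot> mn C (F x) = F g1\<close>: it makes
    \<open>e \<cdot> x = g1\<close> hold and leaves a minus at \<open>y\<close> in the relation of
    the connecting maps.\<close>
  obtain e where e: "mor C e D C1" "F e = mn C q" by (rule shift_full[of "mn C q" D C1]) (use o(3) w w3 in simp_all)
  have q: "q = mn C (F e)" using e o(3) by simp
  have "F (x \<cdot> f1) = F (d \<cdot> f2)" using o(4) o(2,3) d w w3 by simp
  then have 1: "x \<cdot> f1 = d \<cdot> f2" by (rule shift_faithful[of _ _ X D]) (use d(1) w w3 in simp_all)
  have "F (y \<cdot> d) = F g2" using o(5) o(2,3) d w w3 by simp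
  then have 2: "y \<cdot> d = g2" by (rule shift_faithful[of _ _ B2 C2]) (use d(1) w w3 in simp_all)
  have "F (e \<cdot> x) = F g1" using o(6) o(2,3) e(1) q w w3 by simp
  then have 3: "e \<cdot> x = g1" by (rule shift_faithful[of _ _ B1 C1]) (use e(1) w w3 in simp_all)
  have "F (d1 \<cdot> e) = F (d2 \<cdot> mn C y)" using o(7) o(2,3) e(1) q w w3 by simp
  then have 4: "d1 \<cdot> e = d2 \<cdot> mn C y" by (rule shift_faithful[of _ _ D "Fo X"]) (use e(1) w w3 in simp_all)
  have "(Fo B2, Fo D, Fo C1, F d, mn C (F e), F (F f2 \<cdot> d1)) \<in> Tri C" using o(1) o(2,3) d q w w3 by simp
  then have "(Fo B2, Fo D, Fo C1, F d, F e, mn C (F (F f2 \<cdot> d1))) \<in> Tri C"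
    using flip_gh[of _ _ _ "F d" "mn C (F e)"] e(1) by fastforce
  then have "(B2, D, C1, d, e, F f2 \<cdot> d1) \<in> Tri C"
    by (rule unrotate3) (use d(1) e(1) w in simp_all)
  then show ?thesis by (rule that[OF t3 _ 1 2 3 4])
qed

text \<open>The octahedron of the composite of \<open>f1\<close> and \<open>d2\<close>, again read
  through rotations; the minus at \<open>y\<close> comes from rotating the triangle that defines
  \<open>D\<close>.\<close>

lemma tri_pullback:
  assumes t1: "(A1, B1, Z, g1, f1, d1) \<in> Tri C" and t2: "(A2, B2, Z, g2, f2, d2) \<in> Tri C"
  obtains D x y d e where "(A2, D, B1, y, x, d2 \<cdot> f1) \<in> Tri C" "(A1, D, B2, e, d, d1 \<cdot> f2) \<in> Tri C"
    "f1 \<cdot> x = f2 \<cdot> d" "d \<cdot> y = g2" "x \<cdot> e = g1" "F e \<cdot> d1 = F (mn C y) \<cdot> d2"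
proof -
  note w = tri_wf[OF t1] tri_wf[OF t2]
  obtain D x y where t3: "(A2, D, B1, y, x, d2 \<cdot> f1) \<in> Tri C"
    by (rule cocone[of "d2 \<cdot> f1" B1 A2]) (use w in simp_all)
  note w3 = tri_wf[OF t3]
  obtain p q where o: "(Fo A1, Fo D, Fo B2, p, q, F d1 \<cdot> mn C (F f2)) \<in> Tri C"
    "mor C p (Fo A1) (Fo D)" "mor C q (Fo D) (Fo B2)"
    "p \<cdot> d1 = mn C (F y) \<cdot> d2" "mn C (F x) \<cdot> p = mn C (F g1)" "q \<cdot> mn C (F y) = mn C (F g2)"
    "mn C (F f2) \<cdot> q = F f1 \<cdot> mn C (F x)"
    by (rule octahedral[OF rotate[OF t1] rotate2[OF t2] rotate2[OF t3]])
  obtain e where e: "mor C e A1 D" "F e = p" by (rule shift_full[OF o(2)]) (use w w3 in auto)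
  obtain d where d: "mor C d D B2" "F d = q" by (rule shift_full[OF o(3)]) (use w w3 in auto)
  have "F (f1 \<cdot> x) = F (f2 \<cdot> d)" using o(7) o(2,3) d w w3 by simp
  then have 1: "f1 \<cdot> x = f2 \<cdot> d" by (rule shift_faithful[of _ _ D Z]) (use d(1) w w3 in simp_all)
  have "F (d \<cdot> y) = F g2" using o(6) o(2,3) d w w3 by simp
  then have 2: "d \<cdot> y = g2" by (rule shift_faithful[of _ _ A2 B2]) (use d(1) w w3 in simp_all)
  have "F (x \<cdot> e) = F g1" using o(5) o(2,3) e w w3 by simp
  then have 3: "x \<cdot> e = g1" by (rule shift_faithful[of _ _ A1 B1]) (use e(1) w w3 in simp_all)
  have 4: "F e \<cdot> d1 = F (mn C y) \<cdot> d2" using o(4) o(2,3) e w3 by simp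
  have "(Fo A1, Fo D, Fo B2, F e, F d, mn C (F (d1 \<cdot> f2))) \<in> Tri C" using o(1) o(2,3) d e w by simp
  then have "(A1, D, B2, e, d, d1 \<cdot> f2) \<in> Tri C"
    by (rule unrotate3) (use d(1) e(1) w in simp_all)
  then show ?thesis by (rule that[OF t3 _ 1 2 3 4])
qed

text \<open>The octahedral axiom for composites of second maps: the three triangles are rotated
  once, so that these maps come first, and the result is rotated back.\<close>

lemma octahedral_op:
  assumes t1: "(K, B, Z, a, f, d2) \<in> Tri C" and t2: "(D, A, B, c, g, d1) \<in> Tri C"
  obtains E h d3 p q where "(E, A, Z, h, f \<cdot> g, d3) \<in> Tri C" "(D, E, K, q, p, d1 \<cdot> a) \<in> Tri C"
    "a \<cdot> p = g \<cdot> h" "h \<cdot> q = c" "F p \<cdot> d3 = d2" "F q \<cdot> d1 = d3 \<cdot> f"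
proof -
  note w = tri_wf[OF t1] tri_wf[OF t2]
  obtain E h d3 where t3: "(E, A, Z, h, f \<cdot> g, d3) \<in> Tri C"
    by (rule fibre[of "f \<cdot> g" A Z]) (use w in simp_all)
  note w3 = tri_wf[OF t3]
  obtain p' q' where o: "(Fo D, Fo E, Fo K, p', q', F d1 \<cdot> mn C (F a)) \<in> Tri C"
    "mor C p' (Fo D) (Fo E)" "mor C q' (Fo E) (Fo K)"
    "p' \<cdot> d1 = d3 \<cdot> f" "mn C (F h) \<cdot> p' = mn C (F c)" "q' \<cdot> d3 = d2" "mn C (F a) \<cdot> q' = F g \<cdot> mn C (F h)"
    by (rule octahedral[OF rotate[OF t2] rotate[OF t1] rotate[OF t3]])
  obtain q where q: "mor C q D E" "F q = p'" by (rule shift_full[OF o(2)]) (use w w3 in auto)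
  obtain p where p: "mor C p E K" "F p = q'" by (rule shift_full[OF o(3)]) (use w w3 in auto)
  have "F (a \<cdot> p) = F (g \<cdot> h)" using o(7) o(2,3) p w w3 by simp
  then have 1: "a \<cdot> p = g \<cdot> h" by (rule shift_faithful[of _ _ E B]) (use p(1) w w3 in simp_all)
  have "F (h \<cdot> q) = F c" using o(5) o(2,3) q w w3 by simp
  then have 2: "h \<cdot> q = c" by (rule shift_faithful[of _ _ D A]) (use q(1) w w3 in simp_all)
  have "(Fo D, Fo E, Fo K, F q, F p, mn C (F (d1 \<cdot> a))) \<in> Tri C" using o(1) o(2,3) p q w by simp
  then have "(D, E, K, q, p, d1 \<cdot> a) \<in> Tri C"
    by (rule unrotate3) (use p(1) q(1) w in simp_all)
  then show ?thesis by (rule that[OF t3 _ 1 2]) (use o(4,6) p q in simp_all)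
qed

text \<open>The object \<open>X\<close> has to be recorded with \<open>d\<close>, because the shift
  need not be injective on objects and \<open>X\<close> cannot be read off from the target.\<close>

definition EE :: "('o \<times> 'o \<times> 'm) set" where
  "EE = {(Z, X, d). X \<in> Ob C \<and> mor C d Z (Fo X)}"

definition eC :: "'o \<times> 'o \<times> 'm \<Rightarrow> 'o" where "eC e = fst e"
definition eA :: "'o \<times> 'o \<times> 'm \<Rightarrow> 'o" where "eA e = fst (snd e)"

definition push :: "'m \<Rightarrow> 'o \<times> 'o \<times> 'm \<Rightarrow> 'o \<times> 'o \<times> 'm" where
  "push a e = (case e of (Z, X, d) \<Rightarrow> (Z, tgt C a, F a \<cdot> d))"

definition pull :: "'m \<Rightarrow> 'o \<times> 'o \<times> 'm \<Rightarrow> 'o \<times> 'o \<times> 'm" where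
  "pull c e = (case e of (Z, X, d) \<Rightarrow> (src C c, X, d \<cdot> c))"

definition cf :: "'m \<Rightarrow> 'm \<Rightarrow> 'o \<times> 'o \<times> 'm \<Rightarrow> bool" where
  "cf f g e = (case e of (Z, X, d) \<Rightarrow> (X, tgt C f, Z, f, g, d) \<in> Tri C)"

lemma ext_simps [simp]:
  "(Z, X, d) \<in> EE \<longleftrightarrow> X \<in> Ob C \<and> mor C d Z (Fo X)"
  "eC (Z, X, d) = Z" "eA (Z, X, d) = X"
  "push a (Z, X, d) = (Z, tgt C a, F a \<cdot> d)"
  "pull c (Z, X, d) = (src C c, X, d \<cdot> c)"
  by (auto simp: EE_def eC_def eA_def push_def pull_def)

lemma cf_iff: "cf f g (Z, X, d) \<longleftrightarrow> (X, tgt C f, Z, f, g, d) \<in> Tri C"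
  by (simp add: cf_def)

lemma cfI: "(X, B, Z, f, g, d) \<in> Tri C \<Longrightarrow> cf f g (Z, X, d)"
  using tri_wf[of X B Z f g d] by (simp add: cf_iff)

lemma cfE:
  assumes "cf f g e"
  obtains X B Z d where "e = (Z, X, d)" "(X, B, Z, f, g, d) \<in> Tri C" "mor C f X B" "mor C g B Z" "mor C d Z (Fo X)"
proof -
  obtain Z X d where e: "e = (Z, X, d)" by (cases e)
  have t: "(X, tgt C f, Z, f, g, d) \<in> Tri C" using assms unfolding e cf_iff .
  show ?thesis by (rule that[OF e t]) (use tri_wf[OF t] in auto)
qed

lemma triv_iff:
  assumes "A \<in> Ob C" "X \<in> Ob C"
  shows "triv EE eC eA A X \<longleftrightarrow> (\<forall>x. mor C x A (Fo X) \<longrightarrow> x = Zero C A (Fo X))"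
proof
  assume t: "triv EE eC eA A X"
  show "\<forall>x. mor C x A (Fo X) \<longrightarrow> x = Zero C A (Fo X)"
  proof (intro allI impI)
    fix x assume "mor C x A (Fo X)"
    then have "(A, X, x) = (A, X, Zero C A (Fo X))"
      using t[unfolded triv_def, rule_format, of "(A, X, x)" "(A, X, Zero C A (Fo X))"] assms by simp
    then show "x = Zero C A (Fo X)" by simp
  qed
next
  assume h: "\<forall>x. mor C x A (Fo X) \<longrightarrow> x = Zero C A (Fo X)"
  show "triv EE eC eA A X" unfolding triv_def
  proof (intro ballI impI)
    fix e e' assume "e \<in> EE" "e' \<in> EE" "eC e = A" "eC e' = A" "eA e = X" "eA e' = X"
    then show "e = e'" using h by (cases e; cases e') auto
  qed
qed

lemma extension_category: "extension_category C EE eC eA push pull cf"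
proof (unfold_locales, goal_cases)
  case (1 e) then show ?case by (cases e) auto
next case (2 e a) then show ?case by (cases e) simp
next case (3 e c) then show ?case by (cases e) simp
next case (4 e) then show ?case by (cases e) simp
next case (5 e) then show ?case by (cases e) simp
next case (6 e a b) then show ?case by (cases e) simp
next case (7 e a b) then show ?case by (cases e) simp
next case (8 e a c) then show ?case by (cases e) simp
next case (9 e e' z z' u u') then show ?case by (cases e; cases e') simp
next case (10 e e' z u) then show ?case by (cases e; cases e') simp
next case (11 f g e) then show ?case by (elim cfE) (use tri_zero in simp)
next
  case (12 e)
  obtain Z X d where e: "e = (Z, X, d)" by (cases e)
  obtain B f g where "(X, B, Z, f, g, d) \<in> Tri C" by (rule cocone[of d Z X]) (use 12 e in simp_all)
  then show ?case unfolding e using cfI by blast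
next
  case (13 f g e f' g' e' a c)
  obtain X B Z d where h: "e = (Z, X, d)" "(X, B, Z, f, g, d) \<in> Tri C" "mor C f X B" "mor C g B Z" "mor C d Z (Fo X)"
    using 13(1) by (rule cfE)
  obtain X' B' Z' d' where h': "e' = (Z', X', d')" "(X', B', Z', f', g', d') \<in> Tri C" "mor C f' X' B'" "mor C g' B' Z'" "mor C d' Z' (Fo X')"
    using 13(2) by (rule cfE)
  obtain b where "mor C b B B'" "b \<cdot> f = f' \<cdot> a" "c \<cdot> g = g' \<cdot> b"
    by (rule tri_third[OF h(2) h'(2), of a c]) (use 13 h h' in simp_all)
  then show ?case using h h' by (intro exI[of _ b]) simp
next
  case (14 f g e k k')
  obtain X B Z d where h: "e = (Z, X, d)" "(X, B, Z, f, g, d) \<in> Tri C" "mor C f X B" "mor C g B Z" "mor C d Z (Fo X)"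
    using 14(1) by (rule cfE)
  define K where "K = tgt C k"
  have k: "mor C k X K" "mor C k' X K" using 14 h unfolding K_def by simp_all
  have "mn C (F f) \<cdot> d = Zero C Z (Fo B)" by (rule tri_zero[OF rotate2[OF h(2)]])
  then have fd: "F f \<cdot> d = Zero C Z (Fo B)" using h by simp
  show ?case
  proof
    assume "push k e = push k' e"
    then have p: "F k \<cdot> d = F k' \<cdot> d" unfolding h(1) by simp
    obtain j where j: "mor C j X K" "k' = k \<boxplus> j" by (rule difference[OF k])
    have "(F k \<cdot> d) \<boxplus> (F j \<cdot> d) = (F k \<cdot> d) \<boxplus> Zero C Z (Fo K)" using p j k(1) h by simp
    then have jd: "F j \<cdot> d = Zero C Z (Fo K)" by (rule add_left_cancel) (use j(1) k(1) h in simp_all)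
    \<comment> \<open>The difference \<open>j\<close> of the two morphisms satisfies
      \<open>F j \<cdot> d = 0\<close>, so after the shift it factors through \<open>F f\<close>,
      the next map of the rotated triangle up to sign.\<close>
    obtain m' where m': "mor C m' (Fo B) (Fo K)" "m' \<cdot> mn C (F f) = F j"
      by (rule tri_cokernel[OF rotate2[OF h(2)], of "F j" "Fo K"]; (rule that; assumption)?) (use j(1) jd in simp_all)
    obtain m where m: "mor C m B K" "F m = mn C m'" by (rule shift_full[of "mn C m'" B K]) (use m' h k in simp_all)
    have "F (m \<cdot> f) = F j" using m m' h by simp
    then have "m \<cdot> f = j" by (rule shift_faithful[of _ _ X K]) (use m(1) j(1) h in simp_all)
    then show "\<exists>m. m \<in> arrs C \<and> src C m = tgt C f \<and> tgt C m = tgt C k \<and> k \<boxplus> (m \<cdot> f) = k'"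
      using m(1) j(2) k(1) h by (intro exI[of _ m]) simp
  next
    assume "\<exists>m. m \<in> arrs C \<and> src C m = tgt C f \<and> tgt C m = tgt C k \<and> k \<boxplus> (m \<cdot> f) = k'"
    then obtain m where m: "mor C m B K" "k' = k \<boxplus> (m \<cdot> f)" using h k by auto
    have "F k' \<cdot> d = F k \<cdot> d" unfolding m(2) using m(1) k(1) h fd by simp
    then show "push k e = push k' e" unfolding h(1) using k by simp
  qed
next
  case (15 g f e k k')
  obtain X B Z d where h: "e = (Z, X, d)" "(X, B, Z, g, f, d) \<in> Tri C" "mor C g X B" "mor C f B Z" "mor C d Z (Fo X)"
    using 15(1) by (rule cfE)
  define K where "K = src C k"
  have k: "mor C k K Z" "mor C k' K Z" using 15 h unfolding K_def by simp_all
  have df: "d \<cdot> f = Zero C B (Fo X)" by (rule tri_zero[OF rotate[OF h(2)]])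
  show ?case
  proof
    assume "pull k e = pull k' e"
    then have p: "d \<cdot> k = d \<cdot> k'" unfolding h(1) by simp
    obtain j where j: "mor C j K Z" "k' = k \<boxplus> j" by (rule difference[OF k])
    have "(d \<cdot> k) \<boxplus> (d \<cdot> j) = (d \<cdot> k) \<boxplus> Zero C K (Fo X)" using p j k(1) h by simp
    then have dj: "d \<cdot> j = Zero C K (Fo X)" by (rule add_left_cancel) (use j(1) k(1) h in simp_all)
    obtain m where m: "mor C m K B" "f \<cdot> m = j"
      by (rule tri_kernel[OF rotate[OF h(2)], of j K]; (rule that; assumption)?) (use j(1) dj in simp_all)
    then show "\<exists>m. m \<in> arrs C \<and> tgt C m = src C f \<and> src C m = src C k \<and> k \<boxplus> (f \<cdot> m) = k'"
      using j(2) k(1) h by (intro exI[of _ m]) simp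
  next
    assume "\<exists>m. m \<in> arrs C \<and> tgt C m = src C f \<and> src C m = src C k \<and> k \<boxplus> (f \<cdot> m) = k'"
    then obtain m where m: "mor C m K B" "k' = k \<boxplus> (f \<cdot> m)" using h k by auto
    have "d \<cdot> k' = d \<cdot> k" unfolding m(2) using m(1) k(1) h df by (simp add: comp_reassoc[OF df])
    then show "pull k e = pull k' e" unfolding h(1) using k by simp
  qed
next
  case (16 f g e k)
  obtain X B Z d where h: "e = (Z, X, d)" "(X, B, Z, f, g, d) \<in> Tri C" "mor C f X B" "mor C g B Z"
    using 16(1) by (rule cfE)
  obtain m where "mor C m Z (tgt C k)" "m \<cdot> g = k"
    by (rule tri_cokernel[OF h(2), of k "tgt C k"]) (use 16 h in simp_all)
  then show ?case using h by (intro exI[of _ m]) simp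
next
  case (17 g f e k)
  obtain X B Z d where h: "e = (Z, X, d)" "(X, B, Z, g, f, d) \<in> Tri C" "mor C g X B" "mor C f B Z"
    using 17(1) by (rule cfE)
  obtain m where "mor C m (src C k) X" "g \<cdot> m = k"
    by (rule tri_kernel[OF h(2), of k "src C k"]) (use 17 h in simp_all)
  then show ?case using h by (intro exI[of _ m]) simp
next
  case (18 f g e x)
  obtain X B Z d where h: "e = (Z, X, d)" "(X, B, Z, f, g, d) \<in> Tri C" "mor C f X B" "mor C g B Z" "mor C d Z (Fo X)"
    using 18(1) by (rule cfE)
  obtain Y d' where x: "x = (Y, X, d')" "mor C d' Y (Fo X)" using 18(2,3) h by (cases x) auto
  have "F f \<cdot> d' = Zero C Y (Fo B)" using 18(4) h x by simp
  then obtain c where "mor C c Y Z" "d \<cdot> c = d'"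
    using tri_kernel[OF rotate2[OF h(2)], of d' Y] h x by auto
  then show ?case using h x by (intro exI[of _ c]) simp
next
  case (19 g f e x)
  obtain X B Z d where h: "e = (Z, X, d)" "(X, B, Z, g, f, d) \<in> Tri C" "mor C g X B" "mor C f B Z" "mor C d Z (Fo X)"
    using 19(1) by (rule cfE)
  obtain Y d' where x: "x = (Z, Y, d')" "mor C d' Z (Fo Y)" "Y \<in> Ob C" using 19(2,3) h by (cases x) auto
  have "d' \<cdot> f = Zero C B (Fo Y)" using 19(4) h x by simp
  \<comment> \<open>The factorization is a morphism between shifts; fullness turns it into one to
    push along.\<close>
  then obtain m where m: "mor C m (Fo X) (Fo Y)" "m \<cdot> d = d'"
    by (elim tri_cokernel[OF rotate[OF h(2)], of d' "Fo Y", rotated]) (use h x in simp_all)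
  obtain c where "mor C c X Y" "F c = m" by (rule shift_full[OF m(1)]) (use h x in auto)
  then show ?case using h x m by (intro exI[of _ c]) simp
next
  case (20 f g e Y)
  obtain X B Z d where h: "e = (Z, X, d)" "(X, B, Z, f, g, d) \<in> Tri C" "mor C f X B" "mor C g B Z"
    using 20(1) by (rule cfE)
  have z: "\<And>x. mor C x X (Fo Y) \<Longrightarrow> x = Zero C X (Fo Y)" "\<And>x. mor C x Z (Fo Y) \<Longrightarrow> x = Zero C Z (Fo Y)"
    using 20 h by (simp_all add: triv_iff)
  have "x = Zero C B (Fo Y)" if x: "mor C x B (Fo Y)" for x
  proof -
    have "x \<cdot> f = Zero C X (Fo Y)" using z(1)[of "x \<cdot> f"] h x by simp
    then obtain m where m: "mor C m Z (Fo Y)" "m \<cdot> g = x"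
      by (elim tri_cokernel[OF h(2) x])
    then show ?thesis using z(2)[of m] h by auto
  qed
  then show ?case using 20(2) h by (simp add: triv_iff)
next
  case (21 g f e Y)
  obtain X B Z d where h: "e = (Z, X, d)" "(X, B, Z, g, f, d) \<in> Tri C" "mor C g X B" "mor C f B Z"
    using 21(1) by (rule cfE)
  have z: "\<And>x. mor C x Y (Fo X) \<Longrightarrow> x = Zero C Y (Fo X)" "\<And>x. mor C x Y (Fo Z) \<Longrightarrow> x = Zero C Y (Fo Z)"
    using 21 h by (simp_all add: triv_iff)
  have "x = Zero C Y (Fo B)" if x: "mor C x Y (Fo B)" for x
  proof -
    \<comment> \<open>Exactness in the second variable is needed for shifted targets, hence the
      triangle rotated three times.\<close>
    have "F f \<cdot> x = Zero C Y (Fo Z)" using z(2)[of "F f \<cdot> x"] h x by simp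
    then obtain m where m: "mor C m Y (Fo X)" "F g \<cdot> m = x"
      by (elim tri_kernel[OF rotate3[OF h(2)] x])
    then show ?thesis using z(1)[of m] h by auto
  qed
  then show ?case using 21(2) h by (simp add: triv_iff)
next
  case (22 f a e1 g c e2)
  obtain X B Z d where h: "e1 = (Z, X, d)" "(X, B, Z, f, a, d) \<in> Tri C" "mor C f X B" "mor C a B Z" "mor C d Z (Fo X)"
    using 22(1) by (rule cfE)
  obtain X' B' Z' d' where h': "e2 = (Z', X', d')" "(X', B', Z', g, c, d') \<in> Tri C" "mor C g X' B'" "mor C c B' Z'" "mor C d' Z' (Fo X')"
    using 22(2) by (rule cfE)
  have e: "X' = B" using 22(3) h h' by simp
  have "g \<cdot> f \<in> Hom C X B'" by (rule mor_hom) (use h h' e in simp)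
  then obtain H k d3 where t: "(X, B', H, g \<cdot> f, k, d3) \<in> Tri C" using rt.dist_complete[of X B' "g \<cdot> f"] h h' by blast
  note w = tri_wf[OF t]
  obtain p q where o: "(Z, H, Z', p, q, F a \<cdot> d') \<in> Tri C" "mor C p Z H" "mor C q H Z'"
    "p \<cdot> a = k \<cdot> g" "d3 \<cdot> p = d" "q \<cdot> k = c" "d' \<cdot> q = F f \<cdot> d3"
    by (rule octahedral[OF h(2) h'(2)[unfolded e] t])
  show ?case
    by (rule exI[of _ k], rule exI[of _ "(H, X, d3)"], rule exI[of _ p], rule exI[of _ q])
       (use cfI[OF t] cfI[OF o(1)] o h h' w e in simp)
next
  case (23 a f e1 c g e2)
  obtain X B Z d where h: "e1 = (Z, X, d)" "(X, B, Z, a, f, d) \<in> Tri C" "mor C a X B" "mor C f B Z" "mor C d Z (Fo X)"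
    using 23(1) by (rule cfE)
  obtain X' B' Z' d' where h': "e2 = (Z', X', d')" "(X', B', Z', c, g, d') \<in> Tri C" "mor C c X' B'" "mor C g B' Z'" "mor C d' Z' (Fo X')"
    using 23(2) by (rule cfE)
  have e: "Z' = B" using 23(3) h h' by simp
  obtain E k d3 p q where o: "(E, B', Z, k, f \<cdot> g, d3) \<in> Tri C" "(X', E, X, q, p, d' \<cdot> a) \<in> Tri C"
    "a \<cdot> p = g \<cdot> k" "k \<cdot> q = c" "F p \<cdot> d3 = d" "F q \<cdot> d' = d3 \<cdot> f"
    by (rule octahedral_op[OF h(2) h'(2)[unfolded e]])
  show ?case
    by (rule exI[of _ k], rule exI[of _ "(Z, E, d3)"], rule exI[of _ p], rule exI[of _ q])
       (use cfI[OF o(1)] cfI[OF o(2)] o h h' tri_wf[OF o(1)] tri_wf[OF o(2)] e in simp)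
next
  case (24 f1 g1 e1 f2 g2 e2)
  obtain X B Z d where h: "e1 = (Z, X, d)" "(X, B, Z, f1, g1, d) \<in> Tri C" "mor C f1 X B" "mor C g1 B Z" "mor C d Z (Fo X)"
    using 24(1) by (rule cfE)
  obtain X' B' Z' d' where h': "e2 = (Z', X', d')" "(X', B', Z', f2, g2, d') \<in> Tri C" "mor C f2 X' B'" "mor C g2 B' Z'" "mor C d' Z' (Fo X')"
    using 24(2) by (rule cfE)
  have e: "X' = X" using 24(3) h h' by simp
  obtain D x y r s where o: "(B, D, Z', x, y, F f1 \<cdot> d') \<in> Tri C" "(B', D, Z, r, s, F f2 \<cdot> d) \<in> Tri C"
    "x \<cdot> f1 = r \<cdot> f2" "y \<cdot> r = g2" "s \<cdot> x = g1" "d \<cdot> s = d' \<cdot> mn C y"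
    by (rule tri_pushout[OF h(2) h'(2)[unfolded e]])
  show ?case
    by (rule exI[of _ x], rule exI[of _ y], rule exI[of _ r], rule exI[of _ s])
       (use cfI[OF o(1)] cfI[OF o(2)] o h h' tri_wf[OF o(1)] tri_wf[OF o(2)] e in simp)
next
  case (25 g1 f1 e1 g2 f2 e2)
  obtain X B Z d where h: "e1 = (Z, X, d)" "(X, B, Z, g1, f1, d) \<in> Tri C" "mor C g1 X B" "mor C f1 B Z" "mor C d Z (Fo X)"
    using 25(1) by (rule cfE)
  obtain X' B' Z' d' where h': "e2 = (Z', X', d')" "(X', B', Z', g2, f2, d') \<in> Tri C" "mor C g2 X' B'" "mor C f2 B' Z'" "mor C d' Z' (Fo X')"
    using 25(2) by (rule cfE)
  have e: "Z' = Z" using 25(3) h h' by simp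
  obtain D x y r s where o: "(X', D, B, y, x, d' \<cdot> f1) \<in> Tri C" "(X, D, B', s, r, d \<cdot> f2) \<in> Tri C"
    "f1 \<cdot> x = f2 \<cdot> r" "r \<cdot> y = g2" "x \<cdot> s = g1" "F s \<cdot> d = F (mn C y) \<cdot> d'"
    by (rule tri_pullback[OF h(2) h'(2)[unfolded e]])
  show ?case
    by (rule exI[of _ x], rule exI[of _ y], rule exI[of _ r], rule exI[of _ s])
       (use cfI[OF o(1)] cfI[OF o(2)] o h h' tri_wf[OF o(1)] tri_wf[OF o(2)] e in simp)
qed

end

section \<open>The pretriangulated structure\<close>

context suspension_choice
begin

text \<open>This is the uniqueness needed by the definite description of the suspended morphism,
  which also quantifies over the end objects; equal classes force equal ends.\<close>

lemma su_arrow_cong: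
  assumes "X \<in> T \<inter> U" "Y \<in> T \<inter> U" "mor C z X Y" "mor C u (su X) (su Y)" "pull u (sg Y) = push z (sg X)"
    and "mor C z' X' Y'" "mor C u' (su X') (su Y')" "pull u' (sg Y') = push z' (sg X')" "cls C I z = cls C I z'"
  shows "cls C I u' = cls C I u"
proof -
  have "src C z' = src C z" "tgt C z' = tgt C z"
    using cls_mem[of z' z] cls_self[of z'] assms(3,6,9) by auto
  then have XY: "X' = X" "Y' = Y" using assms(3,6) by auto
  note s = su_U[OF assms(1)] sg_ext[OF assms(1)]
  have "push z (sg X) = push z' (sg X)" by (rule push_cls) (use s assms(3,9) in simp_all)
  then show ?thesis
    by (intro su_arrow_unique[OF assms(2), of u' "su X" u]) (use assms(4,5,7,8) XY in simp_all)
qed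

lemma sig_arrow_cong:
  assumes "A \<in> U" "B \<in> U" "mor C u A B" "mor C v (sig A) (sig B)" "cls C I (v \<cdot> eta A) = cls C I (eta B \<cdot> u)"
    and "mor C u' A' B'" "mor C v' (sig A') (sig B')" "cls C I (v' \<cdot> eta A') = cls C I (eta B' \<cdot> u')"
      "cls C I u = cls C I u'"
  shows "cls C I v' = cls C I v"
proof -
  have "src C u' = src C u" "tgt C u' = tgt C u"
    using cls_mem[of u' u] cls_self[of u'] assms(3,6,9) by auto
  then have AB: "A' = A" "B' = B" using assms(3,6) by auto
  note s = eta_mor[OF assms(2)] sig_ob[OF assms(2)]
  have "cls C I (eta B \<cdot> u) = cls C I (eta B \<cdot> u')" by (rule cong_left[OF assms(9)]) (use s assms(3) in simp_all)
  then show ?thesis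
    by (intro sig_cancel[OF assms(1), of v' "sig B" v]) (use assms(4,5,7,8) s AB in simp_all)
qed

end

section \<open>Triangles starting at a desuspension, and cotorsion pairs\<close>

context triangulated
begin

text \<open>One rotation brings the third vertex to \<open>Fo W\<close>, which is then replaced by
  \<open>Q\<close> along the inverse of \<open>\<kappa>\<close>.\<close>

lemma desusp_tri:
  assumes "desusp_triangle C W \<kappa> X Y Q k l m"
  shows "(X, Y, Q, l, m, neg C (Fo W) (Fo X) (F k) \<cdot> \<kappa>) \<in> Tri C"
proof -
  have h: "iso_in C Q (Fo W) \<kappa>" "m \<in> Hom C Y Q" "(W, X, Y, k, l, \<kappa> \<cdot> m) \<in> Tri C"
    using assms unfolding desusp_triangle_def by auto
  obtain r where r: "mor C \<kappa> Q (Fo W)" "mor C r (Fo W) Q" "r \<cdot> \<kappa> = Id C Q" "\<kappa> \<cdot> r = Id C (Fo W)"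
    using h(1) by (rule iso_inE)
  note w = tri_wf[OF h(3)]
  have m: "mor C m Y Q" using h(2) hom_iff_mor[of Y Q m] w r(1) by blast
  have "(X, Y, Q, Id C Y \<cdot> l, (r \<cdot> (\<kappa> \<cdot> m)) \<cdot> Id C Y, mn C (F k) \<cdot> \<kappa>) \<in> Tri C"
    by (rule tri_replace[OF rotate[OF h(3)] _ _ _ _ r(2,1,4,3)]) (use w in simp_all)
  moreover have "r \<cdot> (\<kappa> \<cdot> m) = m" using r m by (simp add: comp_reassoc[OF r(3)])
  moreover have "neg C (Fo W) (Fo X) (F k) = mn C (F k)" by (rule neg_mn) (use w in simp)
  ultimately show ?thesis using w m by simp
qed

text \<open>\<open>W\<close> and \<open>\<kappa>\<close> come from essential surjectivity of the
  shift at \<open>Q\<close>, and \<open>k\<close> from fullness; its sign is chosen so that rotation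
  returns \<open>d\<close>.\<close>

lemma tri_desusp:
  assumes "(X, Y, Q, l, m, d) \<in> Tri C"
  obtains W \<kappa> k where "desusp_triangle C W \<kappa> X Y Q k l m" "neg C (Fo W) (Fo X) (F k) \<cdot> \<kappa> = d"
proof -
  note w = tri_wf[OF assms]
  obtain W r \<kappa> where W: "W \<in> Ob C" "mor C r (Fo W) Q" "mor C \<kappa> Q (Fo W)" "\<kappa> \<cdot> r = Id C (Fo W)" "r \<cdot> \<kappa> = Id C Q"
    by (rule shift_surj[of Q]) (use w in blast)
  obtain k where k: "mor C k W X" "F k = mn C (d \<cdot> r)" by (rule shift_full[of "mn C (d \<cdot> r)" W X]) (use w W in simp_all)
  have "(X, Y, Fo W, Id C Y \<cdot> l, (\<kappa> \<cdot> m) \<cdot> Id C Y, d \<cdot> r) \<in> Tri C"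
    by (rule tri_replace[OF assms _ _ _ _ W(3,2,5,4)]) (use w in simp_all)
  then have "(X, Y, Fo W, l, \<kappa> \<cdot> m, mn C (F k)) \<in> Tri C" using w W k by simp
  then have t: "(W, X, Y, k, l, \<kappa> \<cdot> m) \<in> Tri C" using k(1) by (rule unrotate)
  have n: "neg C (Fo W) (Fo X) (F k) = mn C (F k)" by (rule neg_mn) (use k(1) in simp)
  show ?thesis
  proof (rule that)
    show "desusp_triangle C W \<kappa> X Y Q k l m"
      unfolding desusp_triangle_def using W t iso_inI[OF W(3,2,5,4)] w mor_hom[of m Y Q] by blast
    have "mn C (F k) \<cdot> \<kappa> = (d \<cdot> r) \<cdot> \<kappa>" using k w W by simp
    then show "neg C (Fo W) (Fo X) (F k) \<cdot> \<kappa> = d" unfolding n using w W by simp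
  qed
qed

lemma cotorsion_triv:
  assumes "ext1_vanishes C A B" "A \<subseteq> Ob C" "B \<subseteq> Ob C" "X \<in> A" "Y \<in> B"
  shows "triv EE eC eA X Y"
proof -
  have o: "X \<in> Ob C" "Y \<in> Ob C" using assms by auto
  have "x = Zero C X (Fo Y)" if "mor C x X (Fo Y)" for x
    using mor_hom[OF that] assms(1,4,5) unfolding ext1_vanishes_def by blast
  then show ?thesis unfolding triv_iff[OF o] by blast
qed

text \<open>The decomposition of \<open>X\<close> itself, rotated back once.\<close>

lemma cotorsion_left:
  assumes "cotorsion_pair C A B" "X \<in> Ob C"
  shows "\<exists>f g e. cf f g e \<and> tgt C g = X \<and> src C f \<in> B \<and> tgt C f \<in> A"
proof -
  have "X \<in> star C A (Fo ` B)" using assms unfolding cotorsion_pair_def by blast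
  then obtain A0 B0 f g h where t: "A0 \<in> A" "B0 \<in> B" "(A0, X, Fo B0, f, g, h) \<in> Tri C" unfolding star_def by blast
  note w = tri_wf[OF t(3)]
  have B: "B0 \<in> Ob C" using assms(1) t(2) unfolding cotorsion_pair_def additive_subcategory_def by blast
  obtain k where k: "mor C k B0 A0" "F k = mn C h" by (rule shift_full[of "mn C h" B0 A0]) (use w B in simp_all)
  have t': "(B0, A0, X, k, f, g) \<in> Tri C" by (rule unrotate[OF _ k(1)]) (use t(3) k(2) w in simp)
  show ?thesis
    by (rule exI[of _ k], rule exI[of _ f], rule exI[of _ "(X, B0, g)"]) (use cfI[OF t'] k w t in simp)
qed

text \<open>The decomposition of the shift of \<open>X\<close>, rotated back twice.\<close>

lemma cotorsion_right:
  assumes "cotorsion_pair C A B" "X \<in> Ob C"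
  shows "\<exists>f g e. cf f g e \<and> src C f = X \<and> tgt C f \<in> B \<and> tgt C g \<in> A"
proof -
  have "Ob C = star C A (Fo ` B)" using assms(1) unfolding cotorsion_pair_def by blast
  moreover have "Fo X \<in> Ob C" using assms(2) by simp
  ultimately have "Fo X \<in> star C A (Fo ` B)" by (rule subst)
  then obtain A0 B0 f g h where t: "A0 \<in> A" "B0 \<in> B" "(A0, Fo X, Fo B0, f, g, h) \<in> Tri C" unfolding star_def by blast
  note w = tri_wf[OF t(3)]
  have B: "B0 \<in> Ob C" using assms(1) t(2) unfolding cotorsion_pair_def additive_subcategory_def by blast
  obtain x where x: "mor C x X B0" "F x = mn C g" by (rule shift_full[of "mn C g" X B0]) (use w B assms(2) in simp_all)
  obtain y where y: "mor C y B0 A0" "F y = mn C h" by (rule shift_full[of "mn C h" B0 A0]) (use w B in simp_all)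
  have t': "(X, B0, A0, x, y, f) \<in> Tri C" by (rule unrotate2[OF _ x(1) y(1)]) (use t(3) x(2) y(2) w in simp)
  show ?thesis
    by (rule exI[of _ x], rule exI[of _ y], rule exI[of _ "(A0, X, f)"]) (use cfI[OF t'] x y w t in simp)
qed

end

locale concentric_choices = triangulated C
  for C :: "('o, 'm, 'z) tricategory_scheme" (structure) +
  fixes P :: "('o, 'm, 'y) tcp_choices_scheme"
  assumes concentric_P: "concentric_tcp C P"
    and choices: "valid_choices C P"
begin

abbreviation S where "S \<equiv> tcpS P"
abbreviation T where "T \<equiv> tcpT P"
abbreviation U where "U \<equiv> tcpU P"
abbreviation V where "V \<equiv> tcpV P"
abbreviation I where "I \<equiv> tcpS P \<inter> tcpT P"

definition sg where "sg X = (su P X, X, su_gamma P X)"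
definition dg where "dg Y = (Y, de P Y, de_gamma P Y)"

lemma concentric_C: "concentric C EE eC eA push pull cf S T U V"
proof -
  interpret extension_category C EE eC eA push pull cf by (rule extension_category)
  have cp: "cotorsion_pair C S T" "cotorsion_pair C U V" "ext1_vanishes C S V" "S \<inter> T = U \<inter> V"
    using concentric_P unfolding concentric_tcp_def twin_cotorsion_pair_def by auto
  have s: "additive_subcategory C S" "additive_subcategory C T" "additive_subcategory C U" "additive_subcategory C V"
    "ext1_vanishes C S T" "ext1_vanishes C U V"
    using cp(1,2) unfolding cotorsion_pair_def by auto
  then have o: "S \<subseteq> Ob C" "T \<subseteq> Ob C" "U \<subseteq> Ob C" "V \<subseteq> Ob C" unfolding additive_subcategory_def by auto
  show ?thesis
    by unfold_locales
      (use cp s cotorsion_triv[OF s(5) o(1,2)] cotorsion_triv[OF s(6) o(3,4)] cotorsion_triv[OF cp(3) o(1,4)]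
         cotorsion_left[OF cp(1)] cotorsion_right[OF cp(1)] cotorsion_left[OF cp(2)] cotorsion_right[OF cp(2)] in simp_all)
qed

lemma su_tri: "X \<in> T \<inter> U \<Longrightarrow> su_I P X \<in> I \<and> su P X \<in> U \<and>
    (X, su_I P X, su P X, su_iota P X, su_wp P X, su_gamma P X) \<in> Tri C"
  using choices unfolding valid_choices_def su_tri_def tcpZ_def tcpI_def by blast

lemma de_tri: "X \<in> T \<inter> U \<Longrightarrow> de_I P X \<in> I \<and> de P X \<in> T \<and>
    (de P X, de_I P X, X, de_iota P X, de_wp P X, de_gamma P X) \<in> Tri C"
  using choices unfolding valid_choices_def de_tri_def tcpZ_def tcpI_def by blast

lemma suspension_choice_C: "suspension_choice C EE eC eA push pull cf S T U V (su P) (sig P) sg (eta P)"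
proof -
  interpret c: concentric C EE eC eA push pull cf S T U V by (rule concentric_C)
  show ?thesis
  proof
    fix X assume X: "X \<in> T \<inter> U"
    note t = su_tri[OF X] 
    then have "cf (su_iota P X) (su_wp P X) (sg X)" unfolding sg_def using cfI by blast
    moreover have "src C (su_iota P X) = X" "tgt C (su_iota P X) = su_I P X" "tgt C (su_wp P X) = su P X"
      using t tri_wf[of X "su_I P X" "su P X" "su_iota P X" "su_wp P X" "su_gamma P X"] by auto
    ultimately show "su P X \<in> U \<and> (\<exists>i p. cf i p (sg X) \<and> src C i = X \<and> tgt C i \<in> S \<inter> T \<and> tgt C p = su P X)"
      using t by metis
  next
    fix A assume "A \<in> U"
    then obtain S0 W \<kappa> w s where h: "sig P A \<in> T" "S0 \<in> S" "desusp_triangle C W \<kappa> A (sig P A) S0 w (eta P A) s"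
      using choices unfolding valid_choices_def by blast
    note t = desusp_tri[OF h(3)]
    show "sig P A \<in> T \<and> (\<exists>s e. cf (eta P A) s e \<and> src C (eta P A) = A \<and> tgt C (eta P A) = sig P A \<and> tgt C s \<in> S)"
      using h(1,2) cfI[OF t] tri_wf[OF t] by auto
  qed
qed

lemma suspension_choice_op:
  "suspension_choice (op_cat C) EE eA eC pull push (\<lambda>f g e. cf g f e) V U T S (de P) (ome P) dg (eps P)"
proof -
  interpret c: concentric "op_cat C" EE eA eC pull push "\<lambda>f g e. cf g f e" V U T S
    by (rule concentric_op[OF concentric_C])
  \<comment> \<open>Concentricity identifies the ideal of the dual pair with the given one, so the
    same choices serve for both.\<close>
  have VU: "V \<inter> U = I" using concentric_P unfolding concentric_tcp_def by blast
  show ?thesis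
  proof
    fix X assume X: "X \<in> U \<inter> T"
    then have t: "de_I P X \<in> I" "de P X \<in> T" "(de P X, de_I P X, X, de_iota P X, de_wp P X, de_gamma P X) \<in> Tri C"
      using de_tri by auto
    note w = tri_wf[OF t(3)]
    have c: "cf (de_iota P X) (de_wp P X) (dg X)" unfolding dg_def using cfI[OF t(3)] .
    show "de P X \<in> T \<and> (\<exists>i p. cf p i (dg X) \<and> src (op_cat C) i = X \<and> tgt (op_cat C) i \<in> V \<inter> U \<and> tgt (op_cat C) p = de P X)"
      unfolding VU using t(1,2) c w by (intro conjI exI[of _ "de_wp P X"] exI[of _ "de_iota P X"]) auto
  next
    fix A assume "A \<in> T"
    then obtain V0 v w where h: "ome P A \<in> U" "V0 \<in> V" "(V0, ome P A, A, v, eps P A, w) \<in> Tri C"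
      using choices unfolding valid_choices_def by blast
    show "ome P A \<in> U \<and> (\<exists>s e. cf s (eps P A) e \<and> src (op_cat C) (eps P A) = A \<and> tgt (op_cat C) (eps P A) = ome P A \<and> tgt (op_cat C) s \<in> V)"
      using h(1,2) cfI[OF h(3)] tri_wf[OF h(3)] by auto
  qed
qed

sublocale R0: suspension_choice C EE eC eA push pull cf S T U V "su P" "sig P" sg "eta P"
  by (rule suspension_choice_C)

sublocale L0: suspension_choice "op_cat C" EE eA eC pull push "\<lambda>f g e. cf g f e" V U T S "de P" "ome P" dg "eps P"
  by (rule suspension_choice_op)

section \<open>Evaluating the functors and bijections given by definite descriptions\<close>

lemma op_I: "cls (op_cat C) (V \<inter> U) f = cls C I f"
  using R0.concentric op_cls[OF category_axioms] by (simp add: Int_commute)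

lemma quotient_homE:
  assumes "X \<subseteq> Ob C" "A \<in> X" "B \<in> X" "F' \<in> Hom (ideal_quotient C X I) A B"
  obtains f where "mor C f A B" "F' = cls C I f"
proof -
  obtain f where f: "f \<in> Hom C A B" "F' = cls C I f" using assms(4) by auto
  moreover have "A \<in> Ob C" "B \<in> Ob C" using assms by auto
  ultimately show ?thesis using that hom_iff_mor by blast
qed

lemma quotient_homI: "mor C f A B \<Longrightarrow> cls C I f \<in> Hom (ideal_quotient C X I) A B"
  using mor_hom by auto

lemma U_ob: "U \<subseteq> Ob C" and T_ob: "T \<subseteq> Ob C" using R0.sub_ob by auto

text \<open>A middle component can always be supplied, so only commutation with the connecting maps
  remains: morphisms of the chosen triangles are morphisms of extensions.\<close>

lemma su_tri_mor:
  assumes "A \<in> T \<inter> U" "B \<in> T \<inter> U"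
  shows "(\<exists>i. tri_mor C (Shift C) (su_tri P A) (su_tri P B) z i u) \<longleftrightarrow>
    mor C z A B \<and> mor C u (su P A) (su P B) \<and> pull u (sg B) = push z (sg A)"
proof -
  note t = conjunct2[OF conjunct2[OF su_tri[OF assms(1)]]] conjunct2[OF conjunct2[OF su_tri[OF assms(2)]]]
  note e = tri_mor_iff[OF rt.dist_wf[OF t(1)] rt.dist_wf[OF t(2)]]
  show ?thesis
  proof
    assume "\<exists>i. tri_mor C (Shift C) (su_tri P A) (su_tri P B) z i u"
    then have "mor C z A B" "mor C u (su P A) (su P B)" "F z \<cdot> su_gamma P A = su_gamma P B \<cdot> u"
      unfolding su_tri_def e by blast+
    moreover from this have "pull u (sg B) = push z (sg A)" unfolding sg_def by simp
    ultimately show "mor C z A B \<and> mor C u (su P A) (su P B) \<and> pull u (sg B) = push z (sg A)"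
      by blast
  next
    assume h: "mor C z A B \<and> mor C u (su P A) (su P B) \<and> pull u (sg B) = push z (sg A)"
    then have "pull u (sg B) = push z (sg A)" by blast
    then have "F z \<cdot> su_gamma P A = su_gamma P B \<cdot> u" unfolding sg_def by auto
    then obtain i where "mor C i (su_I P A) (su_I P B)" "i \<cdot> su_iota P A = su_iota P B \<cdot> z" "u \<cdot> su_wp P A = su_wp P B \<cdot> i"
      using tri_third[OF t, of z u] h by blast
    then show "\<exists>i. tri_mor C (Shift C) (su_tri P A) (su_tri P B) z i u"
      unfolding su_tri_def e using h \<open>F z \<cdot> su_gamma P A = su_gamma P B \<cdot> u\<close> by blast
  qed
qed

lemma de_tri_mor:
  assumes "A \<in> T \<inter> U" "B \<in> T \<inter> U"
  shows "(\<exists>i. tri_mor C (Shift C) (de_tri P A) (de_tri P B) t i z) \<longleftrightarrow>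
    mor C z A B \<and> mor C t (de P A) (de P B) \<and> pull z (dg B) = push t (dg A)"
proof -
  note t = conjunct2[OF conjunct2[OF de_tri[OF assms(1)]]] conjunct2[OF conjunct2[OF de_tri[OF assms(2)]]]
  note e = tri_mor_iff[OF rt.dist_wf[OF t(1)] rt.dist_wf[OF t(2)]]
  show ?thesis
  proof
    assume "\<exists>i. tri_mor C (Shift C) (de_tri P A) (de_tri P B) t i z"
    then show "mor C z A B \<and> mor C t (de P A) (de P B) \<and> pull z (dg B) = push t (dg A)"
      unfolding de_tri_def e dg_def by auto
  next
    assume h: "mor C z A B \<and> mor C t (de P A) (de P B) \<and> pull z (dg B) = push t (dg A)"
    then have g: "F t \<cdot> de_gamma P A = de_gamma P B \<cdot> z" unfolding dg_def by simp
    then obtain i where "mor C i (de_I P A) (de_I P B)" "i \<cdot> de_iota P A = de_iota P B \<cdot> t" "z \<cdot> de_wp P A = de_wp P B \<cdot> i"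
      using tri_third[OF t, of t z] h by blast
    then show "\<exists>i. tri_mor C (Shift C) (de_tri P A) (de_tri P B) t i z"
      unfolding de_tri_def e using h g by blast
  qed
qed

lemma su_de_tri_mor:
  assumes "A \<in> T \<inter> U" "B \<in> T \<inter> U"
  shows "(\<exists>i. tri_mor C (Shift C) (su_tri P A) (de_tri P B) t i u) \<longleftrightarrow>
    mor C t A (de P B) \<and> mor C u (su P A) B \<and> pull u (dg B) = push t (sg A)"
proof -
  note t = conjunct2[OF conjunct2[OF su_tri[OF assms(1)]]] conjunct2[OF conjunct2[OF de_tri[OF assms(2)]]]
  note e = tri_mor_iff[OF rt.dist_wf[OF t(1)] rt.dist_wf[OF t(2)]]
  show ?thesis
  proof
    assume "\<exists>i. tri_mor C (Shift C) (su_tri P A) (de_tri P B) t i u"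
    then show "mor C t A (de P B) \<and> mor C u (su P A) B \<and> pull u (dg B) = push t (sg A)"
      unfolding su_tri_def de_tri_def e sg_def dg_def by auto
  next
    assume h: "mor C t A (de P B) \<and> mor C u (su P A) B \<and> pull u (dg B) = push t (sg A)"
    then have g: "F t \<cdot> su_gamma P A = de_gamma P B \<cdot> u" unfolding sg_def dg_def by simp
    then obtain i where "mor C i (su_I P A) (de_I P B)" "i \<cdot> su_iota P A = de_iota P B \<cdot> t" "u \<cdot> su_wp P A = de_wp P B \<cdot> i"
      using tri_third[OF t, of t u] h by blast
    then show "\<exists>i. tri_mor C (Shift C) (su_tri P A) (de_tri P B) t i u"
      unfolding su_tri_def de_tri_def e using h g by blast
  qed
qed

text \<open>One completion shows existence. Any other one, even for another representative of the
  class, classifies the same extension and so has the same class.\<close>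

lemma shift1_hom:
  assumes "A \<in> T \<inter> U" "B \<in> T \<inter> U" "mor C z A B" "mor C u (su P A) (su P B)" "pull u (sg B) = push z (sg A)"
  shows "on_hom (shift1 C P) (cls C I z) = cls C I u"
  unfolding shift1_def tcpI_def tcpZ_def functor_data.simps
proof (rule the_equality)
  show "\<exists>A\<in>T \<inter> U. \<exists>B\<in>T \<inter> U. \<exists>z' i u'. tri_mor C (Shift C) (su_tri P A) (su_tri P B) z' i u' \<and>
      cls C I z = cls C I z' \<and> cls C I u = cls C I u'"
    using assms su_tri_mor[OF assms(1,2), of z u] by blast
next
  fix G assume "\<exists>A\<in>T \<inter> U. \<exists>B\<in>T \<inter> U. \<exists>z' i u'. tri_mor C (Shift C) (su_tri P A) (su_tri P B) z' i u' \<and>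
      cls C I z = cls C I z' \<and> G = cls C I u'"
  then obtain A' B' z' u' where "A' \<in> T \<inter> U" "B' \<in> T \<inter> U" "cls C I z = cls C I z'" "G = cls C I u'"
    "mor C z' A' B'" "mor C u' (su P A') (su P B')" "pull u' (sg B') = push z' (sg A')"
    using su_tri_mor by blast
  then show "G = cls C I u" using R0.su_arrow_cong[OF assms] by blast
qed

lemma shift_minus1_hom:
  assumes "A \<in> T \<inter> U" "B \<in> T \<inter> U" "mor C z A B" "mor C t (de P A) (de P B)" "pull z (dg B) = push t (dg A)"
  shows "on_hom (shift_minus1 C P) (cls C I z) = cls C I t"
  unfolding shift_minus1_def tcpI_def tcpZ_def functor_data.simps
proof (rule the_equality)
  show "\<exists>A\<in>T \<inter> U. \<exists>B\<in>T \<inter> U. \<exists>t' i z'. tri_mor C (Shift C) (de_tri P A) (de_tri P B) t' i z' \<and>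
      cls C I z = cls C I z' \<and> cls C I t = cls C I t'"
    using assms de_tri_mor[OF assms(1,2), of t z] by blast
next
  fix G assume "\<exists>A\<in>T \<inter> U. \<exists>B\<in>T \<inter> U. \<exists>t' i z'. tri_mor C (Shift C) (de_tri P A) (de_tri P B) t' i z' \<and>
      cls C I z = cls C I z' \<and> G = cls C I t'"
  then obtain A' B' z' t' where h: "A' \<in> T \<inter> U" "B' \<in> T \<inter> U" "cls C I z = cls C I z'" "G = cls C I t'"
    "mor C z' A' B'" "mor C t' (de P A') (de P B')" "pull z' (dg B') = push t' (dg A')"
    using de_tri_mor by blast
  show "G = cls C I t" unfolding h(4)
    using L0.su_arrow_cong[of B A z t z' B' A' t'] assms h by (simp add: op_I)
qed

text \<open>Uniqueness in the description is cancellation of the unit modulo \<I>.\<close>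

lemma sigma_hom:
  assumes "A \<in> U" "B \<in> U" "mor C u A B" "mor C v (sig P A) (sig P B)" "cls C I (v \<cdot> eta P A) = cls C I (eta P B \<cdot> u)"
  shows "on_hom (sigma C P) (cls C I u) = cls C I v"
  unfolding sigma_def UI_def ZI_def tcpI_def tcpZ_def functor_data.simps
proof (rule the_equality)
  have "cls C I v \<cdot>\<^bsub>ideal_quotient C U I\<^esub> cls C I (eta P A) = cls C I (eta P B) \<cdot>\<^bsub>ideal_quotient C U I\<^esub> cls C I u"
    using assms R0.eta_mor[OF assms(1)] R0.eta_mor[OF assms(2)] by (simp add: R0.quotient_comp)
  then show "\<exists>A\<in>U. \<exists>B\<in>U. cls C I u \<in> Hom (ideal_quotient C U I) A B \<and>
      cls C I v \<in> Hom (ideal_quotient C (T \<inter> U) I) (sig P A) (sig P B) \<and>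
      cls C I v \<cdot>\<^bsub>ideal_quotient C U I\<^esub> cls C I (eta P A) = cls C I (eta P B) \<cdot>\<^bsub>ideal_quotient C U I\<^esub> cls C I u"
    using assms(1,2) quotient_homI[OF assms(3)] quotient_homI[OF assms(4)] by blast
next
  fix G assume "\<exists>A\<in>U. \<exists>B\<in>U. cls C I u \<in> Hom (ideal_quotient C U I) A B \<and>
      G \<in> Hom (ideal_quotient C (T \<inter> U) I) (sig P A) (sig P B) \<and>
      G \<cdot>\<^bsub>ideal_quotient C U I\<^esub> cls C I (eta P A) = cls C I (eta P B) \<cdot>\<^bsub>ideal_quotient C U I\<^esub> cls C I u"
  then obtain A' B' where h: "A' \<in> U" "B' \<in> U" "cls C I u \<in> Hom (ideal_quotient C U I) A' B'"
      "G \<in> Hom (ideal_quotient C (T \<inter> U) I) (sig P A') (sig P B')"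
      "G \<cdot>\<^bsub>ideal_quotient C U I\<^esub> cls C I (eta P A') = cls C I (eta P B') \<cdot>\<^bsub>ideal_quotient C U I\<^esub> cls C I u"
    by blast
  obtain u' where u': "mor C u' A' B'" "cls C I u = cls C I u'" using U_ob h(1,2,3) by (rule quotient_homE)
  obtain g where g: "mor C g (sig P A') (sig P B')" "G = cls C I g"
    using R0.Z_ob R0.sig_Zc[OF h(1)] R0.sig_Zc[OF h(2)] h(4) by (rule quotient_homE)
  have "cls C I (g \<cdot> eta P A') = cls C I (eta P B' \<cdot> u')"
    using h(5) u' g R0.eta_mor[OF h(1)] R0.eta_mor[OF h(2)] by (simp add: R0.quotient_comp)
  then show "G = cls C I v" unfolding g(2) using R0.sig_arrow_cong[OF assms u'(1) g(1)] u'(2) by blast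
qed

lemma eps_mor: "B \<in> T \<Longrightarrow> mor C (eps P B) (ome P B) B"
  using L0.eta_mor[of B] by auto

lemma ome_Zc: "B \<in> T \<Longrightarrow> ome P B \<in> T \<inter> U"
  using L0.sig_Zc[of B] by auto

lemma omega_hom:
  assumes "A \<in> T" "B \<in> T" "mor C t A B" "mor C v (ome P A) (ome P B)" "cls C I (eps P B \<cdot> v) = cls C I (t \<cdot> eps P A)"
  shows "on_hom (omega C P) (cls C I t) = cls C I v"
  unfolding omega_def TI_def ZI_def tcpI_def tcpZ_def functor_data.simps
proof (rule the_equality)
  have "cls C I (eps P B) \<cdot>\<^bsub>ideal_quotient C T I\<^esub> cls C I v = cls C I t \<cdot>\<^bsub>ideal_quotient C T I\<^esub> cls C I (eps P A)"
    using assms eps_mor[OF assms(1)] eps_mor[OF assms(2)] by (simp add: R0.quotient_comp)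
  then show "\<exists>A\<in>T. \<exists>B\<in>T. cls C I t \<in> Hom (ideal_quotient C T I) A B \<and>
      cls C I v \<in> Hom (ideal_quotient C (T \<inter> U) I) (ome P A) (ome P B) \<and>
      cls C I (eps P B) \<cdot>\<^bsub>ideal_quotient C T I\<^esub> cls C I v = cls C I t \<cdot>\<^bsub>ideal_quotient C T I\<^esub> cls C I (eps P A)"
    using assms(1,2) quotient_homI[OF assms(3)] quotient_homI[OF assms(4)] by blast
next
  fix G assume "\<exists>A\<in>T. \<exists>B\<in>T. cls C I t \<in> Hom (ideal_quotient C T I) A B \<and>
      G \<in> Hom (ideal_quotient C (T \<inter> U) I) (ome P A) (ome P B) \<and>
      cls C I (eps P B) \<cdot>\<^bsub>ideal_quotient C T I\<^esub> G = cls C I t \<cdot>\<^bsub>ideal_quotient C T I\<^esub> cls C I (eps P A)"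
  then obtain A' B' where h: "A' \<in> T" "B' \<in> T" "cls C I t \<in> Hom (ideal_quotient C T I) A' B'"
      "G \<in> Hom (ideal_quotient C (T \<inter> U) I) (ome P A') (ome P B')"
      "cls C I (eps P B') \<cdot>\<^bsub>ideal_quotient C T I\<^esub> G = cls C I t \<cdot>\<^bsub>ideal_quotient C T I\<^esub> cls C I (eps P A')"
    by blast
  obtain t' where t': "mor C t' A' B'" "cls C I t = cls C I t'" using T_ob h(1,2,3) by (rule quotient_homE)
  obtain g where g: "mor C g (ome P A') (ome P B')" "G = cls C I g"
    using R0.Z_ob ome_Zc[OF h(1)] ome_Zc[OF h(2)] h(4) by (rule quotient_homE)
  have "cls C I (eps P B' \<cdot> g) = cls C I (t' \<cdot> eps P A')"
    using h(5) t' g eps_mor[OF h(1)] eps_mor[OF h(2)] by (simp add: R0.quotient_comp)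
  then show "G = cls C I v" unfolding g(2)
    using L0.sig_arrow_cong[of B A t v t' B' A' g] assms t' g(1) by (simp add: op_I)
qed

lemma Sigma_hom: "R0.susp z v \<Longrightarrow> on_hom (Sigma_Z C P) (cls C I z) = cls C I v"
proof -
  assume "R0.susp z v"
  then obtain X Y u where h: "X \<in> T \<inter> U" "Y \<in> T \<inter> U" "mor C z X Y" "mor C u (su P X) (su P Y)"
     "pull u (sg Y) = push z (sg X)" "mor C v (sig P (su P X)) (sig P (su P Y))"
     "cls C I (v \<cdot> eta P (su P X)) = cls C I (eta P (su P Y) \<cdot> u)"
    unfolding R0.susp_def by blast
  show ?thesis
    using shift1_hom[OF h(1-5)] sigma_hom[OF _ _ h(4,6,7)] R0.su_U[OF h(1)] R0.su_U[OF h(2)]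
    by (simp add: Sigma_Z_def functor_comp_def)
qed

lemma Omega_hom: "L0.susp z v \<Longrightarrow> on_hom (Omega_Z C P) (cls C I z) = cls C I v"
proof -
  assume "L0.susp z v"
  then obtain X Y t where h: "X \<in> U \<inter> T" "Y \<in> U \<inter> T" "mor (op_cat C) z X Y" "mor (op_cat C) t (de P X) (de P Y)"
     "push t (dg Y) = pull z (dg X)" "mor (op_cat C) v (ome P (de P X)) (ome P (de P Y))"
     "cls (op_cat C) (V \<inter> U) (v \<cdot>\<^bsub>op_cat C\<^esub> eps P (de P X)) = cls (op_cat C) (V \<inter> U) (eps P (de P Y) \<cdot>\<^bsub>op_cat C\<^esub> t)"
    unfolding L0.susp_def by blast
  have "on_hom (shift_minus1 C P) (cls C I z) = cls C I t"
    by (rule shift_minus1_hom[of Y X]) (use h in auto)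
  moreover have "on_hom (omega C P) (cls C I t) = cls C I v"
    by (rule omega_hom[of "de P Y" "de P X"]) (use h L0.su_U[OF h(1)] L0.su_U[OF h(2)] in \<open>auto simp: op_I\<close>)
  ultimately show ?thesis by (simp add: Omega_Z_def functor_comp_def)
qed

text \<open>The bijection \<open>adj\<close> sends the class of \<open>d\<close> to that of minus
  \<open>a\<close>: the minus in the hypothesis is carried through the middle bijection to the side
  of \<open>a\<close>. The negative in \<open>Sigma_Omega_adj\<close> cancels it.\<close>

lemma adj_hom:
  assumes "X \<in> T \<inter> U" "Y \<in> T \<inter> U" "mor C d (sig P (su P X)) Y" "mor C a X (ome P (de P Y))"
    "push (eps P (de P Y) \<cdot> a) (sg X) = pull (mn C (d \<cdot> eta P (su P X))) (dg Y)"
  shows "Sigma_Omega_adj C P X Y (cls C I d) = cls C I a"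
proof -
  note s = R0.su_U[OF assms(1)] R0.sg_ext[OF assms(1)] R0.Zc_ob[OF assms(1)] R0.Zc_ob[OF assms(2)]
  have dT: "de P Y \<in> T" "dg Y \<in> EE" "eA (dg Y) = de P Y" "eC (dg Y) = Y"
    using L0.su_U[of Y] L0.sg_ext[of Y] assms(2) by auto
  note s' = s dT R0.eta_mor[of "su P X"] eps_mor[OF dT(1)]
  define u where "u = d \<cdot> eta P (su P X)"
  define t where "t = mn C (eps P (de P Y) \<cdot> a)"
  have ut: "mor C u (su P X) Y" "mor C t X (de P Y)" unfolding u_def t_def using s' assms(3,4) by simp_all
  have e: "pull u (dg Y) = push t (sg X)"
    using R0.ext_neg[of "dg Y" "sg X" "eps P (de P Y) \<cdot> a" "mn C u"] s' assms(4,5) ut(1)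
    unfolding u_def t_def by simp
  have 1: "adj_sigma C P (su P X) (cls C I d) = cls C I u"
    unfolding adj_sigma_def UI_def tcpI_def u_def using s' assms(3) by (simp add: R0.quotient_comp)
  have 2: "adj_shift C P X Y (cls C I u) = cls C I t"
    unfolding adj_shift_def tcpI_def
  proof (rule the_equality)
    show "\<exists>t' i u'. tri_mor C (Shift C) (su_tri P X) (de_tri P Y) t' i u' \<and> cls C I u = cls C I u' \<and> cls C I t = cls C I t'"
      using su_de_tri_mor[OF assms(1,2), of t u] ut e by blast
  next
    fix G assume "\<exists>t' i u'. tri_mor C (Shift C) (su_tri P X) (de_tri P Y) t' i u' \<and> cls C I u = cls C I u' \<and> G = cls C I t'"
    then obtain t' u' where h: "cls C I u = cls C I u'" "G = cls C I t'" "mor C t' X (de P Y)" "mor C u' (su P X) Y"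
        "pull u' (dg Y) = push t' (sg X)"
      using su_de_tri_mor[OF assms(1,2)] by blast
    have p: "pull u (dg Y) = pull u' (dg Y)" by (rule R0.pull_cls) (use s' ut h(1) in simp_all)
    obtain i p J where i: "cf i p (sg X)" "mor C i X J" "J \<in> I" "mor C p J (su P X)" using assms(1) by (rule R0.suE)
    have "cls C I t' = cls C I t"
      by (rule R0.push_inj[OF i(1), of _ "de P Y"]) (use i e p h(3,5) ut(2) in simp_all)
    then show "G = cls C I t" using h(2) by simp
  qed
  have 3: "adj_omega C P X (de P Y) (cls C I t) = cls C I (mn C a)"
    unfolding adj_omega_def ZI_def TI_def tcpI_def tcpZ_def
  proof (rule the_equality)
    show "cls C I (mn C a) \<in> Hom (ideal_quotient C (T \<inter> U) I) X (ome P (de P Y)) \<and>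
       cls C I (eps P (de P Y)) \<cdot>\<^bsub>ideal_quotient C T I\<^esub> cls C I (mn C a) = cls C I t"
      using quotient_homI[of "mn C a" X "ome P (de P Y)"] s' assms(4) unfolding t_def by (simp add: R0.quotient_comp)
  next
    fix G assume h: "G \<in> Hom (ideal_quotient C (T \<inter> U) I) X (ome P (de P Y)) \<and>
       cls C I (eps P (de P Y)) \<cdot>\<^bsub>ideal_quotient C T I\<^esub> G = cls C I t"
    then obtain g where g: "mor C g X (ome P (de P Y))" "G = cls C I g"
      using quotient_homE[OF R0.Z_ob assms(1) ome_Zc[OF dT(1)]] by blast
    have "cls C I (eps P (de P Y) \<cdot> g) = cls C I (eps P (de P Y) \<cdot> mn C a)"
      using h g s' assms(4) unfolding t_def by (simp add: R0.quotient_comp)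
    then show "G = cls C I (mn C a)" unfolding g(2)
      using L0.sig_cancel[of "de P Y" g X "mn C a"] dT(1) s g(1) assms(4) by (simp add: op_I)
  qed
  have "neg R0.D X (ome P (de P Y)) (cls C I (mn C a)) = mn R0.D (cls C I (mn C a))"
    by (rule R0.D.neg_mn) (use assms(1,4) s ome_Zc[OF dT(1)] in simp)
  also have "\<dots> = cls C I (mn C (mn C a))"
    by (rule R0.D_mn) (use assms(1,4) ome_Zc[OF dT(1)] in simp_all)
  finally show ?thesis
    unfolding Sigma_Omega_adj_def adj_def 1 2 3 Omega_Z_def functor_comp_def omega_def shift_minus1_def ZI_def tcpI_def tcpZ_def
    using assms(4) by simp
qed

sublocale SP: suspension_pair C EE eC eA push pull cf S T U V "su P" "sig P" sg "eta P" "Sigma_Z C P"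
   "de P" "ome P" dg "eps P" "Omega_Z C P" "Sigma_Omega_adj C P"
proof -
  interpret R: suspension C EE eC eA push pull cf S T U V "su P" "sig P" sg "eta P" "Sigma_Z C P"
    by unfold_locales (use Sigma_hom in \<open>auto simp: Sigma_Z_def functor_comp_def sigma_def shift1_def\<close>)
  interpret L: suspension "op_cat C" EE eA eC pull push "\<lambda>f g e. cf g f e" V U T S "de P" "ome P" dg "eps P" "Omega_Z C P"
    by unfold_locales
      (use Omega_hom in \<open>auto simp: op_I Omega_Z_def functor_comp_def omega_def shift_minus1_def\<close>)
  show "suspension_pair C EE eC eA push pull cf S T U V (su P) (sig P) sg (eta P) (Sigma_Z C P)
     (de P) (ome P) dg (eps P) (Omega_Z C P) (Sigma_Omega_adj C P)"
    by unfold_locales (rule adj_hom)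
qed

section \<open>The two classes of distinguished triangles identified\<close>

lemma D_ZI: "R0.D = ZI C P"
  by (simp add: ZI_def tcpI_def tcpZ_def)

text \<open>A morphism of triangles over the identity of \<open>X\<close> is the same as a
  factorization of the connecting map through \<open>su_gamma P X\<close>.\<close>

lemma standard_right_std: "standard_right C P = SP.R.std"
proof (intro equalityI subsetI)
  fix s assume "s \<in> standard_right C P"
  then obtain X Y A f a b y c where h: "X \<in> T \<inter> U" "Y \<in> T \<inter> U" "A \<in> U" "(X, Y, A, f, a, b) \<in> Tri C"
      "tri_mor C (Shift C) (X, Y, A, f, a, b) (su_tri P X) (Id C X) y c"
    and s: "s = (X, Y, sig P A, cls C I f, cls C I (eta P A) \<cdot>\<^bsub>ideal_quotient C U I\<^esub> cls C I a, on_hom (sigma C P) (cls C I c))"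
    unfolding standard_right_def tcpZ_def tcpI_def UI_def by blast
  note t = conjunct2[OF conjunct2[OF su_tri[OF h(1)]]]
  note w = tri_wf[OF h(4)] tri_wf[OF t]
  have c: "mor C c A (su P X)" "b = su_gamma P X \<cdot> c"
    using h(5)[unfolded su_tri_def tri_mor_iff[OF rt.dist_wf[OF h(4)] rt.dist_wf[OF t]]] w by auto
  obtain v where v: "mor C v (sig P A) (sig P (su P X))" "v \<cdot> eta P A = eta P (su P X) \<cdot> c"
    by (rule R0.sig_arrow_exists[OF h(3) _ c(1)]) (use R0.su_U[OF h(1)] in auto)
  have "on_hom (sigma C P) (cls C I c) = cls C I v"
    by (rule sigma_hom[OF h(3) _ c(1) v(1)]) (use R0.su_U[OF h(1)] v(2) in simp_all)
  moreover have "cls C I (eta P A) \<cdot>\<^bsub>ideal_quotient C U I\<^esub> cls C I a = cls C I (eta P A \<cdot> a)"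
    using R0.eta_mor[OF h(3)] w by (simp add: R0.quotient_comp)
  ultimately have s': "s = (X, Y, sig P A, cls C I f, cls C I (eta P A \<cdot> a), cls C I v)" unfolding s by simp
  have "pull c (sg X) = (A, X, b)" using c w unfolding sg_def by simp
  moreover have "mor C f X Y" "mor C a Y A" using w by blast+
  ultimately show "s \<in> SP.R.std"
    unfolding SP.R.std_def using s' h(1-3) c(1) v(1) arg_cong[OF v(2), of "cls C I"] cfI[OF h(4)] by blast
next
  fix s assume "s \<in> SP.R.std"
  then obtain X Y A f a b c v where h: "X \<in> T \<inter> U" "Y \<in> T \<inter> U" "A \<in> U" "cf f a b" "mor C f X Y" "mor C a Y A"
     "mor C c A (su P X)" "pull c (sg X) = b" "mor C v (sig P A) (sig P (su P X))"
     "cls C I (v \<cdot> eta P A) = cls C I (eta P (su P X) \<cdot> c)"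
    and s: "s = (X, Y, sig P A, cls C I f, cls C I (eta P A \<cdot> a), cls C I v)"
    unfolding SP.R.std_def by blast
  note t = conjunct2[OF conjunct2[OF su_tri[OF h(1)]]]
  have b: "b = (A, X, su_gamma P X \<cdot> c)" using h(7,8) unfolding sg_def by simp
  have t': "(X, Y, A, f, a, su_gamma P X \<cdot> c) \<in> Tri C" using h(4,5) unfolding b cf_iff by simp
  note w = tri_wf[OF t'] tri_wf[OF t]
  \<comment> \<open>The middle component forgotten by the conflation form is recovered by
    completion.\<close>
  obtain y where y: "mor C y Y (su_I P X)" "y \<cdot> f = su_iota P X \<cdot> Id C X" "c \<cdot> a = su_wp P X \<cdot> y"
    by (rule tri_third[OF t' t, of "Id C X" c]; (rule that; assumption)?) (use w h(7) in simp_all)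
  have m: "tri_mor C (Shift C) (X, Y, A, f, a, su_gamma P X \<cdot> c) (su_tri P X) (Id C X) y c"
    unfolding su_tri_def tri_mor_iff[OF rt.dist_wf[OF t'] rt.dist_wf[OF t]] using y w h(7) by simp
  have "on_hom (sigma C P) (cls C I c) = cls C I v"
    by (rule sigma_hom[OF h(3) _ h(7,9,10)]) (use R0.su_U[OF h(1)] in simp)
  moreover have "cls C I (eta P A) \<cdot>\<^bsub>ideal_quotient C U I\<^esub> cls C I a = cls C I (eta P A \<cdot> a)"
    using R0.eta_mor[OF h(3)] w by (simp add: R0.quotient_comp)
  ultimately have "s = (X, Y, sig P A, cls C I f, cls C I (eta P A) \<cdot>\<^bsub>ideal_quotient C U I\<^esub> cls C I a, on_hom (sigma C P) (cls C I c))"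
    unfolding s by simp
  then show "s \<in> standard_right C P"
    unfolding standard_right_def tcpZ_def tcpI_def UI_def using h(1-3) t' m by blast
qed

text \<open>Besides the middle component, the desuspension of \<open>Q\<close> and its first map are
  forgotten in the conflation form and have to be restored, with the sign of the rotated
  map.\<close>

lemma standard_left_std: "standard_left C P = op_tri ` SP.L.std"
proof (intro equalityI subsetI)
  fix s assume "s \<in> standard_left C P"
  then obtain T0 Z Q W \<kappa> k l m n i where h: "T0 \<in> T" "Z \<in> T \<inter> U" "Q \<in> T \<inter> U" "desusp_triangle C W \<kappa> T0 Z Q k l m"
      "tri_mor C (Shift C) (de_tri P Q) (T0, Z, Q, l, m, neg C (Fo W) (Fo T0) (F k) \<cdot> \<kappa>) n i (Id C Q)"
    and s: "s = (ome P T0, Z, Q, on_hom (omega C P) (cls C I n), cls C I l \<cdot>\<^bsub>ideal_quotient C T I\<^esub> cls C I (eps P T0), cls C I m)"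
    unfolding standard_left_def tcpZ_def tcpI_def TI_def by blast
  define d where "d = neg C (Fo W) (Fo T0) (F k) \<cdot> \<kappa>"
  note t' = desusp_tri[OF h(4), folded d_def]
  note t = conjunct2[OF conjunct2[OF de_tri[OF h(3)]]]
  note w = tri_wf[OF t'] tri_wf[OF t]
  have n: "mor C n (de P Q) T0" "F n \<cdot> de_gamma P Q = d"
    using h(5)[folded d_def, unfolded de_tri_def tri_mor_iff[OF rt.dist_wf[OF t] rt.dist_wf[OF t']]] w by auto
  have dT: "de P Q \<in> T" using L0.su_U[of Q] h(3) by auto
  obtain v where v: "mor C v (ome P (de P Q)) (ome P T0)" "eps P T0 \<cdot> v = n \<cdot> eps P (de P Q)"
    using L0.sig_arrow_exists[of T0 "de P Q" n] h(1) dT n(1) by auto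
  have "on_hom (omega C P) (cls C I n) = cls C I v"
    by (rule omega_hom[OF dT h(1) n(1) v(1)]) (simp add: v(2))
  moreover have "cls C I l \<cdot>\<^bsub>ideal_quotient C T I\<^esub> cls C I (eps P T0) = cls C I (l \<cdot> eps P T0)"
    using eps_mor[OF h(1)] w by (simp add: R0.quotient_comp)
  ultimately have s': "op_tri s = (Q, Z, ome P T0, cls C I m, cls C I (l \<cdot> eps P T0), cls C I v)"
    unfolding s op_tri_def by simp
  have "push n (dg Q) = (Q, T0, d)" using n w unfolding dg_def by simp
  moreover have "mor (op_cat C) l Z T0" "mor (op_cat C) m Q Z" "mor (op_cat C) n T0 (de P Q)"
      "mor (op_cat C) v (ome P T0) (ome P (de P Q))" using w n(1) v(1) by simp_all
  moreover have "Q \<in> U \<inter> T" "Z \<in> U \<inter> T" using h(2,3) by blast+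
  ultimately have "op_tri s \<in> SP.L.std"
    unfolding SP.L.std_def op_I op_cat_simps using s' h(1) cfI[OF t'] arg_cong[OF v(2), of "cls C I"] by blast
  then show "s \<in> op_tri ` SP.L.std" by (intro image_eqI[of _ _ "op_tri s"]) simp_all
next
  fix s assume "s \<in> op_tri ` SP.L.std"
  then obtain q where q: "q \<in> SP.L.std" "s = op_tri q" by blast
  obtain T0 Z Q l m b n N where s: "op_tri q = (ome P T0, Z, Q, cls C I N, cls C I (l \<cdot> eps P T0), cls C I m)"
    and h: "Q \<in> T \<inter> U" "Z \<in> T \<inter> U" "T0 \<in> T" "cf l m b" "mor C l T0 Z" "mor C m Z Q"
    "mor C n (de P Q) T0" "push n (dg Q) = b" "mor C N (ome P (de P Q)) (ome P T0)"
    "cls C I (eps P T0 \<cdot> N) = cls C I (n \<cdot> eps P (de P Q))"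
    using q(1) by (rule SP.lstdE)
  have b: "b = (Q, T0, F n \<cdot> de_gamma P Q)" using h(7,8) unfolding dg_def by simp
  have t': "(T0, Z, Q, l, m, F n \<cdot> de_gamma P Q) \<in> Tri C" using h(4,5) unfolding b cf_iff by simp
  obtain W \<kappa> k where d: "desusp_triangle C W \<kappa> T0 Z Q k l m" "neg C (Fo W) (Fo T0) (F k) \<cdot> \<kappa> = F n \<cdot> de_gamma P Q"
    using t' by (rule tri_desusp)
  note t = conjunct2[OF conjunct2[OF de_tri[OF h(1)]]]
  note w = tri_wf[OF t'] tri_wf[OF t]
  obtain i where i: "mor C i (de_I P Q) Z" "i \<cdot> de_iota P Q = l \<cdot> n" "Id C Q \<cdot> de_wp P Q = m \<cdot> i"
    by (rule tri_third[OF t t', of n "Id C Q"]; (rule that; assumption)?) (use w h(7) in simp_all)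
  have tm: "tri_mor C (Shift C) (de_tri P Q) (T0, Z, Q, l, m, neg C (Fo W) (Fo T0) (F k) \<cdot> \<kappa>) n i (Id C Q)"
    unfolding de_tri_def d(2) tri_mor_iff[OF rt.dist_wf[OF t] rt.dist_wf[OF t']] using i w h(7) by simp
  have dT: "de P Q \<in> T" using L0.su_U[of Q] h(1) by auto
  have "on_hom (omega C P) (cls C I n) = cls C I N" by (rule omega_hom[OF dT h(3,7,9,10)])
  moreover have "cls C I l \<cdot>\<^bsub>ideal_quotient C T I\<^esub> cls C I (eps P T0) = cls C I (l \<cdot> eps P T0)"
    using eps_mor[OF h(3)] w by (simp add: R0.quotient_comp)
  ultimately have "s = (ome P T0, Z, Q, on_hom (omega C P) (cls C I n), cls C I l \<cdot>\<^bsub>ideal_quotient C T I\<^esub> cls C I (eps P T0), cls C I m)"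
    unfolding q(2) s by simp
  then show "s \<in> standard_left C P"
    unfolding standard_left_def tcpZ_def tcpI_def TI_def using h(1-3) d(1) tm by blast
qed

lemma distinguished_right_dist: "distinguished_right C P = SP.R.dist"
  unfolding distinguished_right_def SP.R.dist_def standard_right_std D_ZI ..

lemma distinguished_left_dist: "distinguished_left C P = SP.ldist"
  unfolding distinguished_left_def SP.ldist_def SP.L.dist_def standard_left_std left_triangle_def left_tri_iso_def
    SP.op_D D_ZI by auto

lemma pretriangulated_ZI: "pretriangulated_category (ZI C P) (Sigma_Z C P) (distinguished_right C P)
    (Omega_Z C P) (distinguished_left C P) (Sigma_Omega_adj C P)"
  using SP.pretriangulated unfolding distinguished_right_dist distinguished_left_dist D_ZI .

end

theorem theorem4p15:
  fixes C :: "('o, 'm) tricategory" and P :: "('o, 'm) tcp_choices"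
  assumes "triangulated_category C"
    and "concentric_tcp C P"
    and "valid_choices C P"
  shows "pretriangulated_category (ZI C P)
    (Sigma_Z C P) (distinguished_right C P)
    (Omega_Z C P) (distinguished_left C P)
    (Sigma_Omega_adj C P)"
proof -
  interpret concentric_choices C P using assms by unfold_locales
  show ?thesis by (rule pretriangulated_ZI)
qed

end
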